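(* Let $z\in\mathbb{C}^*$ and put $\ell_\pm=\pm\mathbb{R}_{>0}\cdot z$. For $t\in\mathbb{C}^*\setminus i\ell_\pm$ let $\Psi_\pm(t)$ be the unique automorphism of the extended quantum torus algebra $\widehat{\mathbb{C}_q[\mathbb{T}]}$ which acts trivially on the commutative subalgebra $\widehat{\mathbb{C}_q[\mathbb{T}]}_0=\mathcal{M}(\mathcal{H}\times\mathbb{C})\cdot 1$ and satisfies $$\Psi_\pm(t)(y_{\alpha^\vee})=\Lambda\Big(\pm\frac{z}{2\pi i t},\ \tfrac12\mp\big(\theta+\tfrac{\tau}{2}\big)\ \Big|\ 1\Big)^{\pm1}\cdot y_{\alpha^\vee}.$$ Define $\Phi_\pm(t)$ by $\Psi_\pm(t)=\Phi_\pm(t)\circ\epsilon_Z(t)$. Then $\Phi_\pm$ give a solution to the quantum Riemann–Hilbert problem for the doubled A$_1$ refined BPS structure, i.e. they are meromorphic maps $\Phi_\pm\colon\mathbb{C}^*\setminus i\ell_\pm\to\operatorname{Aut}\widehat{\mathbb{C}_q[\mathbb{T}]}$ satisfying: (qRH1) $\Phi_+(t)=\Phi_-(t)\circ\mathbb{S}_q(\ell_+)$ if $\operatorname{Re}(t/z)>0$, and $\Phi_+(t)=\Phi_-(t)\circ\mathbb{S}_q(\ell_-)^{-1}$ if $\operatorname{Re}(t/z)<0$; (qRH2) as $t\to0$ in $\mathbb{C}^*\setminus i\ell_\pm$, one has $\Phi_\pm(t)\circ\epsilon_Z(t)\to\operatorname{id}\in\operatorname{Aut}\widehat{\mathbb{C}_q[\mathbb{T}]}$;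 (qRH3) the map $\Phi_\pm(t)$ has bounded growth at infinity.
   Context: Extended quantum torus. $\mathcal{H}$ is the upper half-plane and $\mathcal{M}(\mathcal{H}\times\mathbb{C})$ is the field of meromorphic functions $f(\tau,\theta)$ on $\mathcal{H}\times\mathbb{C}$. Set $\widehat{\mathbb{C}_q[\mathbb{T}]}=\bigoplus_{n\in\mathbb{Z}}\mathcal{M}(\mathcal{H}\times\mathbb{C})\cdot y_{n\alpha^\vee}$ (the $y_{n\alpha^\vee}$ are formal symbols, $y_0=1$) with product $$(f_1(\tau,\theta)\,y_{n_1\alpha^\vee})*(f_2(\tau,\theta)\,y_{n_2\alpha^\vee})=f_1(\tau,\theta)\,f_2(\tau,\theta+n_1\tau)\,y_{(n_1+n_2)\alpha^\vee},$$ and $\widehat{\mathbb{C}_q[\mathbb{T}]}_0=\mathcal{M}(\mathcal{H}\times\mathbb{C})\cdot1$. For an invertible element $g$, $\operatorname{Ad}_g(a)=g*a*g^{-1}$. The doubled A$_1$ refined BPS structure: $\Gamma=\mathbb{Z}\alpha\oplus\mathbb{Z}\alpha^\vee$ with skew-symmetric form $\langle\alpha^\vee,\alpha\rangle=1$, the homomorphism $Z\colon\Gamma\to\mathbb{C}$ with $Z(\alpha)=z$, $Z(\alpha^\vee)=0$, and the only nonzero refined BPS invariants are $\Omega(\pm\alpha)=1$. Define automorphisms $$\epsilon_Z(t)\big(f(\tau,\theta)\,y_{n\alpha^\vee}\big)=f\big(\tau,\theta+\tfrac{z}{2\pi i t}\big)\,y_{n\alpha^\vee}.$$ Quantum dilogarithm: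 $\mathbb{E}_q(x)=\prod_{k\ge0}(1-q^kx)$ for $|q|<1$. Set $\mathrm{DT}_q(\ell_\pm)=\mathbb{E}_{e^{2\pi i\tau}}\big(-e^{\pi i\tau\pm2\pi i\theta}\big)^{-1}\cdot1\in\widehat{\mathbb{C}_q[\mathbb{T}]}_0$ and $\mathbb{S}_q(\ell_\pm)=\operatorname{Ad}_{\mathrm{DT}_q(\ell_\pm)}$. Modified gamma function: for $w\in\mathbb{C}^*\setminus\mathbb{R}_{<0}$, $\eta\in\mathbb{C}$, $$\Lambda(w,\eta\,|\,1)=\frac{\Gamma(w+\eta)\,e^{w}}{\sqrt{2\pi}\;w^{\,\eta+w-\frac12}}$$ with the principal branch of $\log w$. Maps into the algebra. Let $D\subset\mathbb{C}$ be a domain. A meromorphic map $f\colon D\to\widehat{\mathbb{C}_q[\mathbb{T}]}$ is a finite sum $f(t)=\sum_nf_n(\tau,\theta,t)\,y_{n\alpha^\vee}$ with each $f_n$ meromorphic on $\mathcal{H}\times\mathbb{C}\times D$. For $t_0\in\overline D$, $f(t)\to g=\sum_ng_n(\tau,\theta)y_{n\alpha^\vee}$ as $t\to t_0$ means that for each $n\in\mathbb{Z}$ and each $(\tau,\theta)\in\mathcal{H}\times\mathbb{C}$ one has $f_n(\tau,\theta,t)\to g_n(\tau,\theta)$ as $t\to t_0$. If $D$ is unbounded, $f$ has bounded growth at infinity if for all $(\tau,\theta)\in\mathcal{H}\times\mathbb{C}$ and all $n\in\mathbb{Z}$ there is $k>0$ with $|t|^{-k}<|f_n(\tau,\theta,t)|<|t|^k$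 as $|t|\to\infty$. A map $\phi\colon D\to\operatorname{Aut}\widehat{\mathbb{C}_q[\mathbb{T}]}$ is meromorphic, tends to an automorphism $\psi$ as $t\to t_0$, or has bounded growth at infinity, if for every $a\in\widehat{\mathbb{C}_q[\mathbb{T}]}$ the map $t\mapsto\phi(t)(a)$ has the corresponding property (with limit $\psi(a)$ in the second case).
   Formalization: (qRH2): t→0 is taken in closed subsectors of C*\iℓ± (poles of Λ off the ray accumulate at 0), with values in the Riemann sphere except at indeterminacy points; (qRH3): bounds are required only for n,(τ,θ) where f_n(τ,θ,t) is defined and nonzero for some t. *)

theory Defs
  imports "HOL-Complex_Analysis.Complex_Analysis"
begin

section \<open>Holomorphic and meromorphic functions of several complex variables\<close>

definition mv_holomorphic_on :: "(complex ^ 'n \<Rightarrow> complex) \<Rightarrow> (complex ^ 'n) set \<Rightarrow> bool" where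
  "mv_holomorphic_on f U \<longleftrightarrow>
     (\<forall>p\<in>U. \<exists>D. (f has_derivative D) (at p) \<and> (\<forall>c v. D (c *s v) = c * D v))"

text \<open>Equality on a dense open subset. Meromorphic functions are treated as functions modulo this
  relation, so that values on polar sets are irrelevant.\<close>

definition agree_on :: "(complex ^ 'n) set \<Rightarrow> (complex ^ 'n \<Rightarrow> complex) \<Rightarrow> (complex ^ 'n \<Rightarrow> complex) \<Rightarrow> bool" where
  "agree_on U f g \<longleftrightarrow> (\<exists>W. open W \<and> W \<subseteq> U \<and> U \<subseteq> closure W \<and> (\<forall>x\<in>W. f x = g x))"

text \<open>Locally a quotient of holomorphic functions, the denominator not vanishing identically on any
  nonempty open set.\<close>

definition mv_meromorphic_on :: "(complex ^ 'n \<Rightarrow> complex) \<Rightarrow> (complex ^ 'n) set \<Rightarrow> bool" where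
  "mv_meromorphic_on f U \<longleftrightarrow>
     (\<forall>p\<in>U. \<exists>V g h. open V \<and> p \<in> V \<and> V \<subseteq> U \<and> mv_holomorphic_on g V \<and> mv_holomorphic_on h V \<and>
        V \<subseteq> closure {x\<in>V. h x \<noteq> 0} \<and> agree_on V f (\<lambda>x. g x / h x))"

text \<open>\<open>regular_value f p v\<close>: the class of \<open>f\<close> is holomorphic near \<open>p\<close> and takes the value \<open>v\<close> there
  (\<open>f p\<close> itself plays no role).\<close>

definition regular_value :: "(complex ^ 'n \<Rightarrow> complex) \<Rightarrow> complex ^ 'n \<Rightarrow> complex \<Rightarrow> bool" where
  "regular_value f p v \<longleftrightarrow>
     (\<exists>V g. open V \<and> p \<in> V \<and> mv_holomorphic_on g V \<and> agree_on V f g \<and> g p = v)"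

lemma mv_holomorphic_on_subset: "mv_holomorphic_on f U \<Longrightarrow> V \<subseteq> U \<Longrightarrow> mv_holomorphic_on f V"
  unfolding mv_holomorphic_on_def by blast

lemma mv_holomorphic_on_const: "mv_holomorphic_on (\<lambda>x. c) U"
  unfolding mv_holomorphic_on_def by (auto intro!: exI[of _ "\<lambda>x. 0"])

lemma mv_holomorphic_on_add:
  assumes "mv_holomorphic_on f U" "mv_holomorphic_on g U"
  shows "mv_holomorphic_on (\<lambda>x. f x + g x) U"
  unfolding mv_holomorphic_on_def
proof
  fix p assume "p \<in> U"
  with assms obtain D E where D: "(f has_derivative D) (at p)" "\<And>c v. D (c *s v) = c * D v"
    and E: "(g has_derivative E) (at p)" "\<And>c v. E (c *s v) = c * E v"
    unfolding mv_holomorphic_on_def by meson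
  show "\<exists>D. ((\<lambda>x. f x + g x) has_derivative D) (at p) \<and> (\<forall>c v. D (c *s v) = c * D v)"
    by (rule exI[of _ "\<lambda>x. D x + E x"])
      (use D E in \<open>auto intro!: derivative_eq_intros simp: algebra_simps\<close>)
qed

lemma mv_holomorphic_on_mult:
  assumes "mv_holomorphic_on f U" "mv_holomorphic_on g U"
  shows "mv_holomorphic_on (\<lambda>x. f x * g x) U"
  unfolding mv_holomorphic_on_def
proof
  fix p assume "p \<in> U"
  with assms obtain D E where D: "(f has_derivative D) (at p)" "\<And>c v. D (c *s v) = c * D v"
    and E: "(g has_derivative E) (at p)" "\<And>c v. E (c *s v) = c * E v"
    unfolding mv_holomorphic_on_def by meson
  show "\<exists>D. ((\<lambda>x. f x * g x) has_derivative D) (at p) \<and> (\<forall>c v. D (c *s v) = c * D v)"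
    by (rule exI[of _ "\<lambda>x. f p * E x + D x * g p"])
      (use D E in \<open>auto intro!: derivative_eq_intros simp: algebra_simps\<close>)
qed

lemma mv_holomorphic_on_continuous: "mv_holomorphic_on f U \<Longrightarrow> continuous_on U f"
  unfolding mv_holomorphic_on_def continuous_on_eq_continuous_within
  using has_derivative_continuous continuous_at_imp_continuous_within by blast

lemma mv_holomorphic_on_open_nonzero:
  assumes "mv_holomorphic_on h V" "open V"
  shows "open {x\<in>V. h x \<noteq> 0}"
proof -
  have "{x\<in>V. h x \<noteq> 0} = V \<inter> h -` (- {0})" by auto
  thus ?thesis
    using continuous_open_preimage[OF mv_holomorphic_on_continuous[OF assms(1)] assms(2), of "- {0}"]
    by (simp add: open_Compl)
qed

lemma dense_open_Int:
  assumes "open W1" "W1 \<subseteq> V" "V \<subseteq> closure W1" "V \<subseteq> closure W2"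
  shows "V \<subseteq> closure (W1 \<inter> W2)"
proof -
  have "W1 \<subseteq> closure (W1 \<inter> W2)"
    using open_Int_closure_subset[OF assms(1), of W2] assms(2,4) by blast
  hence "closure W1 \<subseteq> closure (W1 \<inter> W2)" by (rule closure_minimal) simp
  with assms(3) show ?thesis by blast
qed

lemma agree_on_refl: "open U \<Longrightarrow> agree_on U f f"
  unfolding agree_on_def using closure_subset by blast

lemma agree_on_sym: "agree_on U f g \<Longrightarrow> agree_on U g f"
  unfolding agree_on_def by metis

lemma agree_on_combine:
  assumes "agree_on U f1 g1" "agree_on U f2 g2"
  shows "\<exists>W. open W \<and> W \<subseteq> U \<and> U \<subseteq> closure W \<and> (\<forall>x\<in>W. f1 x = g1 x \<and> f2 x = g2 x)"
proof -
  obtain W1 W2 where "open W1" "W1 \<subseteq> U" "U \<subseteq> closure W1" "\<forall>x\<in>W1. f1 x = g1 x"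
    "open W2" "W2 \<subseteq> U" "U \<subseteq> closure W2" "\<forall>x\<in>W2. f2 x = g2 x"
    using assms unfolding agree_on_def by blast
  thus ?thesis using dense_open_Int[of W1 U W2] by (intro exI[of _ "W1 \<inter> W2"]) auto
qed

lemma agree_on_trans: "agree_on U f g \<Longrightarrow> agree_on U g h \<Longrightarrow> agree_on U f h"
  using agree_on_combine[of U f g g h] unfolding agree_on_def by metis

lemma dense_subset_open:
  assumes "U \<subseteq> closure W" "open V" "V \<subseteq> U"
  shows "V \<subseteq> closure (V \<inter> W)"
  using open_Int_closure_subset[OF assms(2), of W] assms(1,3) by blast

lemma agree_on_subset:
  assumes "agree_on U f g" "open V" "V \<subseteq> U"
  shows "agree_on V f g"
proof -
  obtain W where W: "open W" "W \<subseteq> U" "U \<subseteq> closure W" "\<forall>x\<in>W. f x = g x"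
    using assms unfolding agree_on_def by blast
  thus ?thesis unfolding agree_on_def using dense_subset_open[OF W(3) assms(2,3)] assms(2)
    by (intro exI[of _ "V \<inter> W"]) auto
qed

lemma mv_meromorphic_onE:
  assumes "mv_meromorphic_on f U" "p \<in> U"
  obtains V g h where "open V" "p \<in> V" "V \<subseteq> U" "mv_holomorphic_on g V" "mv_holomorphic_on h V"
    "V \<subseteq> closure {x\<in>V. h x \<noteq> 0}" "agree_on V f (\<lambda>x. g x / h x)"
  using assms unfolding mv_meromorphic_on_def by meson

lemma mv_holomorphic_on_imp_meromorphic_on:
  assumes "mv_holomorphic_on f U" "open U"
  shows "mv_meromorphic_on f U"
  unfolding mv_meromorphic_on_def
  by (intro ballI exI[of _ U] exI[of _ f] exI[of _ "\<lambda>x. 1"])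
    (use assms closure_subset[of U] in \<open>auto intro: mv_holomorphic_on_const agree_on_refl\<close>)

lemma mv_meromorphic_on_cong:
  assumes "mv_meromorphic_on f U" "agree_on U f g"
  shows "mv_meromorphic_on g U"
  unfolding mv_meromorphic_on_def
proof
  fix p assume "p \<in> U"
  then obtain V a b where V: "open V" "p \<in> V" "V \<subseteq> U" "mv_holomorphic_on a V" "mv_holomorphic_on b V"
    "V \<subseteq> closure {x\<in>V. b x \<noteq> 0}" "agree_on V f (\<lambda>x. a x / b x)"
    using assms(1) by (elim mv_meromorphic_onE)
  moreover have "agree_on V g (\<lambda>x. a x / b x)"
    using agree_on_trans[OF agree_on_sym[OF agree_on_subset[OF assms(2) V(1,3)]] V(7)] .
  ultimately show "\<exists>V g' h. open V \<and> p \<in> V \<and> V \<subseteq> U \<and> mv_holomorphic_on g' V \<and>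
      mv_holomorphic_on h V \<and> V \<subseteq> closure {x\<in>V. h x \<noteq> 0} \<and> agree_on V g (\<lambda>x. g' x / h x)"
    by blast
qed

lemma mv_meromorphic_on_common:
  assumes "mv_meromorphic_on f1 U" "mv_meromorphic_on f2 U" "p \<in> U"
  obtains V g1 h1 g2 h2 W where "open V" "p \<in> V" "V \<subseteq> U"
    "mv_holomorphic_on g1 V" "mv_holomorphic_on h1 V" "mv_holomorphic_on g2 V" "mv_holomorphic_on h2 V"
    "V \<subseteq> closure {x\<in>V. h1 x * h2 x \<noteq> 0}"
    "open W" "W \<subseteq> V" "V \<subseteq> closure W"
    "\<forall>x\<in>W. h1 x \<noteq> 0 \<and> h2 x \<noteq> 0 \<and> f1 x = g1 x / h1 x \<and> f2 x = g2 x / h2 x"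
proof -
  obtain V1 g1 h1 where 1: "open V1" "p \<in> V1" "V1 \<subseteq> U" "mv_holomorphic_on g1 V1" "mv_holomorphic_on h1 V1"
    "V1 \<subseteq> closure {x\<in>V1. h1 x \<noteq> 0}" "agree_on V1 f1 (\<lambda>x. g1 x / h1 x)"
    using assms(1,3) by (rule mv_meromorphic_onE)
  obtain V2 g2 h2 where 2: "open V2" "p \<in> V2" "V2 \<subseteq> U" "mv_holomorphic_on g2 V2" "mv_holomorphic_on h2 V2"
    "V2 \<subseteq> closure {x\<in>V2. h2 x \<noteq> 0}" "agree_on V2 f2 (\<lambda>x. g2 x / h2 x)"
    using assms(2,3) by (rule mv_meromorphic_onE)
  define V where "V = V1 \<inter> V2"
  have V: "open V" "p \<in> V" "V \<subseteq> U" "V \<subseteq> V1" "V \<subseteq> V2" using 1 2 by (auto simp: V_def)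
  have hol: "mv_holomorphic_on g1 V" "mv_holomorphic_on h1 V" "mv_holomorphic_on g2 V" "mv_holomorphic_on h2 V"
    using mv_holomorphic_on_subset[OF 1(4) V(4)] mv_holomorphic_on_subset[OF 1(5) V(4)]
      mv_holomorphic_on_subset[OF 2(4) V(5)] mv_holomorphic_on_subset[OF 2(5) V(5)] by auto
  define Z1 where "Z1 = {x\<in>V. h1 x \<noteq> 0}"
  define Z2 where "Z2 = {x\<in>V. h2 x \<noteq> 0}"
  have Z: "open Z1" "open Z2" unfolding Z1_def Z2_def
    by (rule mv_holomorphic_on_open_nonzero[OF hol(2) V(1)], rule mv_holomorphic_on_open_nonzero[OF hol(4) V(1)])
  have "V \<inter> {x\<in>V1. h1 x \<noteq> 0} = Z1" "V \<inter> {x\<in>V2. h2 x \<noteq> 0} = Z2" using V by (auto simp: Z1_def Z2_def)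
  hence d: "V \<subseteq> closure Z1" "V \<subseteq> closure Z2"
    using dense_subset_open[OF 1(6) V(1,4)] dense_subset_open[OF 2(6) V(1,5)] by simp_all
  have sub: "Z1 \<subseteq> V" "Z2 \<subseteq> V" by (auto simp: Z1_def Z2_def)
  have d12: "V \<subseteq> closure (Z1 \<inter> Z2)" using dense_open_Int[OF Z(1) sub(1) d] .
  obtain W where W: "open W" "W \<subseteq> V" "V \<subseteq> closure W" "\<forall>x\<in>W. f1 x = g1 x / h1 x \<and> f2 x = g2 x / h2 x"
    using agree_on_combine[OF agree_on_subset[OF 1(7) V(1,4)] agree_on_subset[OF 2(7) V(1,5)]] by blast
  have "V \<subseteq> closure (W \<inter> (Z1 \<inter> Z2))" using dense_open_Int[OF W(1-3) d12] .
  moreover have "{x\<in>V. h1 x * h2 x \<noteq> 0} = Z1 \<inter> Z2" by (auto simp: Z1_def Z2_def)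
  moreover have "open (W \<inter> (Z1 \<inter> Z2))" "W \<inter> (Z1 \<inter> Z2) \<subseteq> V" using W Z by auto
  moreover have "\<forall>x\<in>W \<inter> (Z1 \<inter> Z2). h1 x \<noteq> 0 \<and> h2 x \<noteq> 0 \<and> f1 x = g1 x / h1 x \<and> f2 x = g2 x / h2 x"
    using W(4) by (auto simp: Z1_def Z2_def)
  ultimately show ?thesis
    using that[OF V(1-3) hol, of "W \<inter> (Z1 \<inter> Z2)"] d12 by simp
qed

lemma mv_meromorphic_on_add:
  assumes "mv_meromorphic_on f1 U" "mv_meromorphic_on f2 U"
  shows "mv_meromorphic_on (\<lambda>x. f1 x + f2 x) U"
  unfolding mv_meromorphic_on_def
proof
  fix p assume "p \<in> U"
  obtain V g1 h1 g2 h2 W where *: "open V" "p \<in> V" "V \<subseteq> U"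
    "mv_holomorphic_on g1 V" "mv_holomorphic_on h1 V" "mv_holomorphic_on g2 V" "mv_holomorphic_on h2 V"
    "V \<subseteq> closure {x\<in>V. h1 x * h2 x \<noteq> 0}" and W: "open W" "W \<subseteq> V" "V \<subseteq> closure W"
    "\<forall>x\<in>W. h1 x \<noteq> 0 \<and> h2 x \<noteq> 0 \<and> f1 x = g1 x / h1 x \<and> f2 x = g2 x / h2 x"
    by (rule mv_meromorphic_on_common[OF assms \<open>p \<in> U\<close>])
  have "agree_on V (\<lambda>x. f1 x + f2 x) (\<lambda>x. (g1 x * h2 x + g2 x * h1 x) / (h1 x * h2 x))"
    unfolding agree_on_def using W by (intro exI[of _ W]) (auto simp: add_frac_eq)
  thus "\<exists>V g h. open V \<and> p \<in> V \<and> V \<subseteq> U \<and> mv_holomorphic_on g V \<and> mv_holomorphic_on h V \<and>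
      V \<subseteq> closure {x\<in>V. h x \<noteq> 0} \<and> agree_on V (\<lambda>x. f1 x + f2 x) (\<lambda>x. g x / h x)"
    using * by (intro exI[of _ V] exI[of _ "\<lambda>x. g1 x * h2 x + g2 x * h1 x"] exI[of _ "\<lambda>x. h1 x * h2 x"])
      (auto intro!: mv_holomorphic_on_mult mv_holomorphic_on_add)
qed

lemma mv_meromorphic_on_mult:
  assumes "mv_meromorphic_on f1 U" "mv_meromorphic_on f2 U"
  shows "mv_meromorphic_on (\<lambda>x. f1 x * f2 x) U"
  unfolding mv_meromorphic_on_def
proof
  fix p assume "p \<in> U"
  obtain V g1 h1 g2 h2 W where *: "open V" "p \<in> V" "V \<subseteq> U"
    "mv_holomorphic_on g1 V" "mv_holomorphic_on h1 V" "mv_holomorphic_on g2 V" "mv_holomorphic_on h2 V"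
    "V \<subseteq> closure {x\<in>V. h1 x * h2 x \<noteq> 0}" and W: "open W" "W \<subseteq> V" "V \<subseteq> closure W"
    "\<forall>x\<in>W. h1 x \<noteq> 0 \<and> h2 x \<noteq> 0 \<and> f1 x = g1 x / h1 x \<and> f2 x = g2 x / h2 x"
    by (rule mv_meromorphic_on_common[OF assms \<open>p \<in> U\<close>])
  have "agree_on V (\<lambda>x. f1 x * f2 x) (\<lambda>x. (g1 x * g2 x) / (h1 x * h2 x))"
    unfolding agree_on_def using W by (intro exI[of _ W]) auto
  thus "\<exists>V g h. open V \<and> p \<in> V \<and> V \<subseteq> U \<and> mv_holomorphic_on g V \<and> mv_holomorphic_on h V \<and>
      V \<subseteq> closure {x\<in>V. h x \<noteq> 0} \<and> agree_on V (\<lambda>x. f1 x * f2 x) (\<lambda>x. g x / h x)"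
    using * by (intro exI[of _ V] exI[of _ "\<lambda>x. g1 x * g2 x"] exI[of _ "\<lambda>x. h1 x * h2 x"])
      (auto intro!: mv_holomorphic_on_mult)
qed

lemma mv_holomorphic_on_ball_eq_0:
  fixes g :: "complex ^ 'n \<Rightarrow> complex"
  assumes g: "mv_holomorphic_on g (ball p r)" and A: "open A" "a \<in> A" "a \<in> ball p r"
    and 0: "\<And>x. x \<in> A \<Longrightarrow> g x = 0" and x: "x \<in> ball p r"
  shows "g x = 0"
proof -
  define l where "l = (\<lambda>s::complex. a + s *s (x - a))"
  have l_eq: "l s = a + (Re s *\<^sub>R (x - a) + Im s *\<^sub>R (\<i> *s (x - a)))" for s
    unfolding l_def by (simp add: vec_eq_iff complex_eq_iff algebra_simps)
  have dl: "(l has_derivative (\<lambda>h. h *s (x - a))) (at s)" for s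
  proof -
    have eq: "(\<lambda>h. h *s (x - a)) = (\<lambda>h. Re h *\<^sub>R (x - a) + Im h *\<^sub>R (\<i> *s (x - a)))"
      by (rule ext) (simp add: vec_eq_iff complex_eq_iff algebra_simps)
    show ?thesis unfolding eq l_eq[abs_def]
      by (auto intro!: derivative_eq_intros bounded_linear_imp_has_derivative bounded_linear_Re bounded_linear_Im)
  qed
  have cl: "continuous_on UNIV l"
    using dl by (meson continuous_on_eq_continuous_at has_derivative_continuous open_UNIV)
  define S where "S = l -` ball p r"
  have oS: "open S" unfolding S_def using cl by (simp add: continuous_on_open_vimage)
  have conS: "connected S"
  proof (rule convex_connected, rule convexI)
    fix s t and u v :: real assume st: "s \<in> S" "t \<in> S" "0 \<le> u" "0 \<le> v" "u + v = 1"
    have "l (u *\<^sub>R s + v *\<^sub>R t) = u *\<^sub>R l s + v *\<^sub>R l t"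
    proof -
      have v: "v = 1 - u" using st by simp
      show ?thesis unfolding l_def v by (simp add: vec_eq_iff complex_eq_iff algebra_simps)
    qed
    thus "u *\<^sub>R s + v *\<^sub>R t \<in> S" using convexD[OF convex_ball[of p r]] st by (auto simp: S_def)
  qed
  have hol: "(g \<circ> l) holomorphic_on S"
  proof -
    have "(g \<circ> l) field_differentiable at s" if "s \<in> S" for s
    proof -
      from g that obtain D where D: "(g has_derivative D) (at (l s))" "\<And>c v. D (c *s v) = c * D v"
        unfolding mv_holomorphic_on_def S_def by blast
      have "((g \<circ> l) has_derivative (D \<circ> (\<lambda>h. h *s (x - a)))) (at s)"
        using diff_chain_at[OF dl D(1)] .
      moreover have "D \<circ> (\<lambda>h. h *s (x - a)) = (*) (D (x - a))" by (rule ext) (simp only: o_apply D(2) mult.commute)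
      ultimately show ?thesis
        unfolding field_differentiable_def has_field_derivative_def by auto
    qed
    thus ?thesis by (simp add: holomorphic_on_def field_differentiable_at_within)
  qed
  have l01: "l 0 = a" "l 1 = x" by (simp_all add: l_def)
  have oT: "open (S \<inter> l -` A)" using oS A(1) cl by (simp add: continuous_on_open_vimage open_Int)
  have 0: "0 \<in> S \<inter> l -` A" using A l01 by (auto simp: S_def)
  have "(g \<circ> l) 1 = 0"
  proof (rule analytic_continuation[OF hol oS conS, of "S \<inter> l -` A" 0])
    show "0 islimpt S \<inter> l -` A" using 0 interior_limit_point[of 0 "S \<inter> l -` A"] by (simp only: interior_open[OF oT])
  qed (use 0 x l01 assms(5) in \<open>auto simp: S_def\<close>)
  thus ?thesis by (simp add: l01)
qed

lemma mv_meromorphic_on_inverse: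
  fixes f :: "complex ^ 'n \<Rightarrow> complex"
  assumes f: "mv_meromorphic_on f U" and U: "open U" "connected U"
    and nz: "\<not> agree_on U f (\<lambda>x. 0)"
  shows "mv_meromorphic_on (\<lambda>x. inverse (f x)) U" and "agree_on U (\<lambda>x. f x * inverse (f x)) (\<lambda>x. 1)"
proof -
  define A where "A = {p\<in>U. \<exists>V. open V \<and> p \<in> V \<and> V \<subseteq> U \<and> agree_on V f (\<lambda>x. 0)}"
  have loc: "\<exists>r g h W. 0 < r \<and> ball p r \<subseteq> U \<and> mv_holomorphic_on g (ball p r) \<and>
      mv_holomorphic_on h (ball p r) \<and> ball p r \<subseteq> closure {x\<in>ball p r. h x \<noteq> 0} \<and>
      open W \<and> W \<subseteq> ball p r \<and> ball p r \<subseteq> closure W \<and> (\<forall>x\<in>W. h x \<noteq> 0 \<and> f x = g x / h x) \<and>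
      (p \<notin> A \<longrightarrow> ball p r \<subseteq> closure {x\<in>ball p r. g x \<noteq> 0} \<and> ball p r \<inter> A = {})" if p: "p \<in> U" for p
  proof -
    obtain V g h g2 h2 W where V: "open V" "p \<in> V" "V \<subseteq> U"
      "mv_holomorphic_on g V" "mv_holomorphic_on h V"
      "mv_holomorphic_on g2 V" "mv_holomorphic_on h2 V"
      "V \<subseteq> closure {x\<in>V. h x * h2 x \<noteq> 0}"
      "open W" "W \<subseteq> V" "V \<subseteq> closure W"
      "\<forall>x\<in>W. h x \<noteq> 0 \<and> h2 x \<noteq> 0 \<and> f x = g x / h x \<and> f x = g2 x / h2 x"
      by (rule mv_meromorphic_on_common[OF f f p])
    obtain r where r: "0 < r" "ball p r \<subseteq> V" using V(1,2) openE by blast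
    define B where "B = ball p r"
    have B: "open B" "B \<subseteq> V" using r by (auto simp: B_def)
    have gB: "mv_holomorphic_on g B" and hB: "mv_holomorphic_on h B"
      using V B mv_holomorphic_on_subset by blast+
    have d: "B \<subseteq> closure (B \<inter> W)" using dense_subset_open[OF V(11) B] .
    have dh: "B \<subseteq> closure {x\<in>B. h x \<noteq> 0}"
    proof -
      have "closure (B \<inter> W) \<subseteq> closure {x\<in>B. h x \<noteq> 0}" using V(12) by (intro closure_mono) auto
      thus ?thesis using d by blast
    qed
    have key: "p \<in> A" if "B' \<subseteq> B" "open B'" "b \<in> B'" "\<And>x. x \<in> B' \<Longrightarrow> g x = 0" for b B'
    proof -
      have "g x = 0" if "x \<in> B" for x
        by (rule mv_holomorphic_on_ball_eq_0[OF gB[unfolded B_def], of B' b])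
          (use \<open>B' \<subseteq> B\<close> \<open>open B'\<close> \<open>b \<in> B'\<close> \<open>\<And>x. x \<in> B' \<Longrightarrow> g x = 0\<close> that in \<open>auto simp: B_def\<close>)
      hence "agree_on B f (\<lambda>x. 0)" unfolding agree_on_def
        using d V(9,12) B(1) by (intro exI[of _ "B \<inter> W"]) auto
      moreover have "p \<in> B" "B \<subseteq> U" using B V(3) r(1) by (auto simp: B_def)
      ultimately show ?thesis unfolding A_def using p B(1) by blast
    qed
    have "B \<subseteq> closure {x\<in>B. g x \<noteq> 0}" if "p \<notin> A"
    proof
      fix b assume b: "b \<in> B"
      show "b \<in> closure {x\<in>B. g x \<noteq> 0}"
      proof (rule ccontr)
        assume n: "b \<notin> closure {x\<in>B. g x \<noteq> 0}"
        have "p \<in> A"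
          by (rule key[of "B - closure {x\<in>B. g x \<noteq> 0}" b])
            (use B(1) b n closure_subset[of "{x\<in>B. g x \<noteq> 0}"] in \<open>auto\<close>)
        thus False using that by simp
      qed
    qed
    moreover have "B \<inter> A = {}" if "p \<notin> A"
    proof (rule ccontr)
      assume "B \<inter> A \<noteq> {}"
      then obtain a V' where a: "a \<in> B" "open V'" "a \<in> V'" "V' \<subseteq> U" "agree_on V' f (\<lambda>x. 0)"
        unfolding A_def by blast
      have "agree_on (B \<inter> V') f (\<lambda>x. 0)" using a B by (intro agree_on_subset[OF a(5)]) auto
      then obtain W' where W': "open W'" "W' \<subseteq> B \<inter> V'" "B \<inter> V' \<subseteq> closure W'" "\<forall>x\<in>W'. f x = 0"
        unfolding agree_on_def by blast
      have "B \<inter> V' \<subseteq> closure (B \<inter> V' \<inter> W)" using B a by (intro dense_subset_open[OF V(11)]) auto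
      hence "B \<inter> V' \<subseteq> closure (W' \<inter> (B \<inter> V' \<inter> W))" by (intro dense_open_Int[OF W'(1-3)])
      moreover have "a \<in> B \<inter> V'" using a by simp
      ultimately have "W' \<inter> (B \<inter> V' \<inter> W) \<noteq> {}" by (metis closure_empty empty_iff subsetD)
      then obtain b where b: "b \<in> W' \<inter> (B \<inter> V' \<inter> W)" by blast
      have "p \<in> A"
      proof (rule key[OF _ _ b])
        show "open (W' \<inter> (B \<inter> V' \<inter> W))" using W'(1) B(1) a(2) V(9) by (intro open_Int)
        fix x assume "x \<in> W' \<inter> (B \<inter> V' \<inter> W)"
        hence "f x = 0" "h x \<noteq> 0 \<and> f x = g x / h x" using W'(4) V(12) by blast+
        thus "g x = 0" by simp
      qed blast
      thus False using that by simp
    qed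
    moreover have "open (B \<inter> W)" "B \<inter> W \<subseteq> B" "B \<subseteq> U" using B V(3,9) by auto
    moreover have "\<forall>x\<in>B \<inter> W. h x \<noteq> 0 \<and> f x = g x / h x" using V(12) by blast
    ultimately show ?thesis
      using r(1) gB hB d dh unfolding B_def by blast
  qed
  have oA: "open A"
    unfolding open_subopen[of A]
  proof
    fix x assume "x \<in> A"
    then obtain V where "open V" "x \<in> V" "V \<subseteq> U" "agree_on V f (\<lambda>x. 0)" by (auto simp: A_def)
    thus "\<exists>T. open T \<and> x \<in> T \<and> T \<subseteq> A" by (intro exI[of _ V]) (auto simp: A_def)
  qed
  have oUA: "open (U - A)"
    unfolding open_subopen[of "U - A"]
  proof
    fix x assume x: "x \<in> U - A"
    then obtain r where "0 < r" "ball x r \<subseteq> U" "ball x r \<inter> A = {}" using loc[of x] by blast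
    thus "\<exists>T. open T \<and> x \<in> T \<and> T \<subseteq> U - A" by (intro exI[of _ "ball x r"]) auto
  qed
  have "A \<noteq> U"
  proof
    assume AU: "A = U"
    define F where "F = {T. open T \<and> T \<subseteq> U \<and> (\<forall>x\<in>T. f x = 0)}"
    have "p \<in> closure (\<Union>F)" if "p \<in> U" for p
    proof -
      from that AU obtain V where V: "open V" "p \<in> V" "V \<subseteq> U" "agree_on V f (\<lambda>x. 0)" by (auto simp: A_def)
      then obtain T where "open T" "T \<subseteq> V" "V \<subseteq> closure T" "\<forall>x\<in>T. f x = 0" by (auto simp: agree_on_def)
      moreover from this have "T \<subseteq> \<Union>F" using V by (auto simp: F_def)
      ultimately show ?thesis using V closure_mono by blast
    qed
    hence "agree_on U f (\<lambda>x. 0)" unfolding agree_on_def by (intro exI[of _ "\<Union>F"]) (auto simp: F_def)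
    thus False using nz by simp
  qed
  hence A: "A = {}"
    using connectedD[OF U(2) oA oUA] unfolding A_def by blast
  show "mv_meromorphic_on (\<lambda>x. inverse (f x)) U"
    unfolding mv_meromorphic_on_def
  proof
    fix p assume "p \<in> U"
    then obtain r g h W where r: "0 < r" "ball p r \<subseteq> U" "mv_holomorphic_on g (ball p r)"
      "mv_holomorphic_on h (ball p r)" 
      "open W" "W \<subseteq> ball p r" "ball p r \<subseteq> closure W" "\<forall>x\<in>W. h x \<noteq> 0 \<and> f x = g x / h x"
      "ball p r \<subseteq> closure {x\<in>ball p r. g x \<noteq> 0}" using loc[of p] A by blast
    have "agree_on (ball p r) (\<lambda>x. inverse (f x)) (\<lambda>x. h x / g x)"
      unfolding agree_on_def using r(5-8) by (intro exI[of _ W]) simp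
    thus "\<exists>V g h. open V \<and> p \<in> V \<and> V \<subseteq> U \<and> mv_holomorphic_on g V \<and> mv_holomorphic_on h V \<and>
      V \<subseteq> closure {x\<in>V. h x \<noteq> 0} \<and> agree_on V (\<lambda>x. inverse (f x)) (\<lambda>x. g x / h x)"
      using r by (intro exI[of _ "ball p r"] exI[of _ h] exI[of _ g]) simp
  qed
  define F where "F = {T. open T \<and> T \<subseteq> U \<and> (\<forall>x\<in>T. f x \<noteq> 0)}"
  have "p \<in> closure (\<Union>F)" if "p \<in> U" for p
  proof -
    from that obtain r g h W where r: "0 < r" "ball p r \<subseteq> U" "mv_holomorphic_on g (ball p r)"
      "open W" "W \<subseteq> ball p r" "ball p r \<subseteq> closure W" "\<forall>x\<in>W. h x \<noteq> 0 \<and> f x = g x / h x"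
      "ball p r \<subseteq> closure {x\<in>ball p r. g x \<noteq> 0}" using loc[of p] A by blast
    have "ball p r \<subseteq> closure (W \<inter> {x\<in>ball p r. g x \<noteq> 0})" using dense_open_Int[OF r(4,5,6,8)] .
    moreover have "W \<inter> {x\<in>ball p r. g x \<noteq> 0} \<in> F" unfolding F_def
      using r mv_holomorphic_on_open_nonzero[OF r(3)] by (auto simp: open_Int)
    moreover have "p \<in> ball p r" using r by simp
    ultimately show ?thesis by (meson Union_upper closure_mono subsetD)
  qed
  thus "agree_on U (\<lambda>x. f x * inverse (f x)) (\<lambda>x. 1)"
    unfolding agree_on_def by (intro exI[of _ "\<Union>F"]) (auto simp: F_def)
qed


section \<open>The field of meromorphic functions on the product of the upper half-plane and the plane\<close>

text \<open>A point \<open>(\<tau>, \<theta>)\<close> is the vector with components \<open>p $ 1 = \<tau>\<close> and \<open>p $ 2 = \<theta>\<close>.\<close>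

definition HC :: "(complex ^ 2) set" where
  "HC = {p. 0 < Im (p $ 1)}"

lemma open_HC: "open HC"
  unfolding HC_def by (intro open_Collect_less continuous_intros)

lemma connected_HC: "connected HC"
proof (rule convex_connected, rule convexI)
  fix x y :: "complex ^ 2" and u v :: real
  assume "x \<in> HC" "y \<in> HC" "0 \<le> u" "0 \<le> v" "u + v = 1"
  thus "u *\<^sub>R x + v *\<^sub>R y \<in> HC"
    by (cases "u = 0") (auto simp: HC_def intro!: add_pos_nonneg)
qed

definition mero_rel :: "(complex ^ 2 \<Rightarrow> complex) \<Rightarrow> (complex ^ 2 \<Rightarrow> complex) \<Rightarrow> bool" where
  "mero_rel f g \<longleftrightarrow> mv_meromorphic_on f HC \<and> mv_meromorphic_on g HC \<and> agree_on HC f g"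

lemma mero_rel_I: "mv_meromorphic_on f HC \<Longrightarrow> agree_on HC f g \<Longrightarrow> mero_rel f g"
  by (simp add: mero_rel_def mv_meromorphic_on_cong)

lemma mero_rel_const: "mero_rel (\<lambda>p. c) (\<lambda>p. c)"
  by (intro mero_rel_I mv_holomorphic_on_imp_meromorphic_on mv_holomorphic_on_const agree_on_refl open_HC)

text \<open>\<open>abs_mero f\<close> is the class of \<open>f\<close>; it is meaningful only if \<open>mv_meromorphic_on f HC\<close>.\<close>

quotient_type mero = "complex ^ 2 \<Rightarrow> complex" / partial: mero_rel
proof (rule part_equivpI)
  show "\<exists>x. mero_rel x x" using mero_rel_const by blast
  show "symp mero_rel" by (simp add: symp_def mero_rel_def agree_on_sym)
  show "transp mero_rel" unfolding transp_def mero_rel_def by (meson agree_on_trans)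
qed

lemma mero_rel_op2:
  assumes "mero_rel f1 g1" "mero_rel f2 g2"
    "mv_meromorphic_on (\<lambda>p. F (f1 p) (f2 p)) HC"
  shows "mero_rel (\<lambda>p. F (f1 p) (f2 p)) (\<lambda>p. F (g1 p) (g2 p))"
proof (rule mero_rel_I[OF assms(3)])
  have "agree_on HC f1 g1" "agree_on HC f2 g2" using assms(1,2) by (simp_all add: mero_rel_def)
  then obtain W where "open W" "W \<subseteq> HC" "HC \<subseteq> closure W" "\<forall>x\<in>W. f1 x = g1 x \<and> f2 x = g2 x"
    using agree_on_combine[of HC f1 g1 f2 g2] by auto
  thus "agree_on HC (\<lambda>p. F (f1 p) (f2 p)) (\<lambda>p. F (g1 p) (g2 p))"
    unfolding agree_on_def by (intro exI[of _ W]) auto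
qed

instantiation mero :: field
begin

lift_definition zero_mero :: mero is "\<lambda>p. 0" by (rule mero_rel_const)
lift_definition one_mero :: mero is "\<lambda>p. 1" by (rule mero_rel_const)
lift_definition plus_mero :: "mero \<Rightarrow> mero \<Rightarrow> mero" is "\<lambda>f g p. f p + g p"
  by (rule mero_rel_op2) (auto intro: mv_meromorphic_on_add simp: mero_rel_def)
lift_definition times_mero :: "mero \<Rightarrow> mero \<Rightarrow> mero" is "\<lambda>f g p. f p * g p"
  by (rule mero_rel_op2) (auto intro: mv_meromorphic_on_mult simp: mero_rel_def)
lift_definition uminus_mero :: "mero \<Rightarrow> mero" is "\<lambda>f p. - f p"
  subgoal for f g
    using mero_rel_op2[OF mero_rel_const[of "- 1"], of f g "(*)"]
      mv_meromorphic_on_mult[of "\<lambda>p. - 1" HC f] mero_rel_const[of "- 1"]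
    by (simp add: mero_rel_def)
  done
lift_definition inverse_mero :: "mero \<Rightarrow> mero" is "\<lambda>f p. inverse (f p)"
proof -
  fix f g assume fg: "mero_rel f g"
  have "mv_meromorphic_on (\<lambda>p. inverse (f p)) HC"
  proof (cases "agree_on HC f (\<lambda>x. 0)")
    case True
    hence "agree_on HC (\<lambda>x. 0) (\<lambda>x. inverse (f x))" unfolding agree_on_def by force
    thus ?thesis using mv_meromorphic_on_cong[of "\<lambda>x. 0" HC] mero_rel_const[of 0] by (simp add: mero_rel_def)
  next
    case False
    thus ?thesis using fg mv_meromorphic_on_inverse(1)[of f HC] open_HC connected_HC by (simp add: mero_rel_def)
  qed
  thus "mero_rel (\<lambda>p. inverse (f p)) (\<lambda>p. inverse (g p))"
    by (rule mero_rel_op2[OF fg fg, of "\<lambda>x y. inverse x"])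
qed

definition minus_mero :: "mero \<Rightarrow> mero \<Rightarrow> mero" where "minus_mero f g = f + - g"
definition divide_mero :: "mero \<Rightarrow> mero \<Rightarrow> mero" where "divide_mero f g = f * inverse g"

lemma mero_rel_eqI:
  assumes "mv_meromorphic_on f HC" "\<And>p. f p = g p" shows "mero_rel f g"
proof -
  have "f = g" using assms(2) by auto
  thus ?thesis using assms(1) by (auto intro: mero_rel_I agree_on_refl open_HC)
qed

instance
proof
  fix a b c :: mero
  show "a + b + c = a + (b + c)"
    by transfer (rule mero_rel_eqI; auto intro!: mv_meromorphic_on_add simp: mero_rel_def)
  show "a + b = b + a"
    by transfer (rule mero_rel_eqI; auto intro!: mv_meromorphic_on_add simp: mero_rel_def)
  show "0 + a = a"
    by transfer (rule mero_rel_eqI; auto simp: mero_rel_def)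
  show "- a + a = 0"
    by transfer (use mero_rel_const[of 0] in simp)
  show "a - b = a + - b" by (rule minus_mero_def)
  show "a * b * c = a * (b * c)"
    by transfer (rule mero_rel_eqI; auto intro!: mv_meromorphic_on_mult simp: mero_rel_def)
  show "a * b = b * a"
    by transfer (rule mero_rel_eqI; auto intro!: mv_meromorphic_on_mult simp: mero_rel_def)
  show "1 * a = a"
    by transfer (rule mero_rel_eqI; auto simp: mero_rel_def)
  show "(a + b) * c = a * c + b * c"
    by transfer (rule mero_rel_eqI; auto intro!: mv_meromorphic_on_mult mv_meromorphic_on_add
        simp: mero_rel_def algebra_simps)
  show "(0::mero) \<noteq> 1"
  proof transfer
    show "\<not> mero_rel (\<lambda>p. 0) (\<lambda>p. 1)"
    proof
      assume "mero_rel (\<lambda>p. 0) (\<lambda>p. 1)"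
      then obtain W where "HC \<subseteq> closure W" "W = {}" unfolding mero_rel_def agree_on_def by force
      moreover have "vector [\<i>, 0] \<in> HC" by (simp add: HC_def)
      ultimately show False by auto
    qed
  qed
  show "a \<noteq> 0 \<Longrightarrow> inverse a * a = 1"
  proof transfer
    fix f assume f: "mero_rel f f" "\<not> mero_rel f (\<lambda>p. 0)"
    hence "\<not> agree_on HC f (\<lambda>p. 0)" unfolding mero_rel_def
      using mero_rel_const[of 0] mero_rel_def by blast
    moreover have "mv_meromorphic_on f HC" using f by (simp add: mero_rel_def)
    ultimately have "agree_on HC (\<lambda>x. f x * inverse (f x)) (\<lambda>x. 1)"
      using mv_meromorphic_on_inverse(2) open_HC connected_HC by blast
    hence "agree_on HC (\<lambda>x. 1) (\<lambda>x. inverse (f x) * f x)" by (simp add: agree_on_sym mult.commute)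
    hence "mero_rel (\<lambda>x. 1) (\<lambda>x. inverse (f x) * f x)"
      using mero_rel_const[of 1] by (intro mero_rel_I) (auto simp: mero_rel_def)
    thus "mero_rel (\<lambda>x. inverse (f x) * f x) (\<lambda>x. 1)"
      by (simp add: mero_rel_def agree_on_sym)
  qed
  show "a div b = a * inverse b" by (rule divide_mero_def)
  show "inverse (0::mero) = 0" by transfer (use mero_rel_const[of 0] in simp)
qed

end

lift_definition mero_const :: "complex \<Rightarrow> mero" is "\<lambda>c p. c" by (rule mero_rel_const)

lemma regular_value_mero_rel:
  assumes fg: "mero_rel f g" and p: "p \<in> HC"
  shows "regular_value f p v \<longleftrightarrow> regular_value g p v"
proof -
  have *: "regular_value g p v" if fg: "mero_rel f g" and f: "regular_value f p v" for f g
  proof -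
    obtain V a where V: "open V" "p \<in> V" "mv_holomorphic_on a V" "agree_on V f a" "a p = v"
      using f unfolding regular_value_def by blast
    have o: "open (V \<inter> HC)" using V open_HC by blast
    have "agree_on (V \<inter> HC) g f" using fg o unfolding mero_rel_def
      by (meson agree_on_subset agree_on_sym inf_le2)
    moreover have "agree_on (V \<inter> HC) f a" using agree_on_subset[OF V(4) o] by blast
    ultimately have "agree_on (V \<inter> HC) g a" by (rule agree_on_trans)
    moreover have "mv_holomorphic_on a (V \<inter> HC)" using mv_holomorphic_on_subset[OF V(3)] by blast
    ultimately show ?thesis unfolding regular_value_def using o V(2,5) p by blast
  qed
  have "mero_rel g f" using fg unfolding mero_rel_def by (simp add: agree_on_sym)
  thus ?thesis using * fg by blast
qed

text \<open>\<open>mero_value f \<tau> \<theta> v\<close>: \<open>f\<close> is holomorphic near \<open>(\<tau>, \<theta>)\<close>, with value \<open>v\<close> there.\<close>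

lift_definition mero_value :: "mero \<Rightarrow> complex \<Rightarrow> complex \<Rightarrow> complex \<Rightarrow> bool" is
  "\<lambda>f \<tau> \<theta> v. vector [\<tau>, \<theta>] \<in> HC \<and> regular_value f (vector [\<tau>, \<theta>]) v"
  using regular_value_mero_rel by (auto simp: fun_eq_iff)

definition shear :: "complex \<Rightarrow> complex \<Rightarrow> complex ^ 2 \<Rightarrow> complex ^ 2" where
  "shear c d p = vector [p $ 1, p $ 2 + c * p $ 1 + d]"

lemma shear_shear: "shear c d (shear c' d' p) = shear (c + c') (d + d') p"
  by (simp add: shear_def algebra_simps)

lemma shear_0: "shear 0 0 p = p"
  by (simp add: shear_def vec_eq_iff forall_2)

lemma shear_HC: "shear c d p \<in> HC \<longleftrightarrow> p \<in> HC"
  by (simp add: shear_def HC_def)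

lemma has_derivative_shear: "(shear c d has_derivative shear c 0) (at p)"
proof -
  have "linear (shear c 0)"
    by (rule linearI) (simp_all add: shear_def vec_eq_iff forall_2 algebra_simps)
  hence "(shear c 0 has_derivative shear c 0) (at p)"
    by (simp add: linear_conv_bounded_linear bounded_linear_imp_has_derivative)
  hence "((\<lambda>p. shear c 0 p + vector [0, d]) has_derivative shear c 0) (at p)"
    by (rule has_derivative_add_const)
  moreover have "(\<lambda>p. shear c 0 p + vector [0, d]) = shear c d"
    by (rule ext) (simp add: shear_def vec_eq_iff forall_2)
  ultimately show ?thesis by simp
qed

lemma continuous_on_shear: "continuous_on S (shear c d)"
  using has_derivative_shear by (meson continuous_at_imp_continuous_on has_derivative_continuous)

lemma mv_holomorphic_on_shear:
  assumes "mv_holomorphic_on f U"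
  shows "mv_holomorphic_on (\<lambda>p. f (shear c d p)) (shear c d -` U)"
  unfolding mv_holomorphic_on_def
proof
  fix p assume "p \<in> shear c d -` U"
  then obtain D where D: "(f has_derivative D) (at (shear c d p))" "\<And>c v. D (c *s v) = c * D v"
    using assms unfolding mv_holomorphic_on_def by auto
  have "((\<lambda>p. f (shear c d p)) has_derivative (\<lambda>v. D (shear c 0 v))) (at p)"
    using diff_chain_at[OF has_derivative_shear D(1)] by (simp add: o_def)
  moreover have "shear c 0 (k *s v) = k *s shear c 0 v" for k v
    by (simp add: shear_def vec_eq_iff forall_2 algebra_simps)
  ultimately show "\<exists>D. ((\<lambda>p. f (shear c d p)) has_derivative D) (at p) \<and> (\<forall>c v. D (c *s v) = c * D v)"
    using D(2) by auto
qed

lemma open_shear: "open W \<Longrightarrow> open (shear c d -` W)"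
  using continuous_on_shear[of UNIV c d] by (simp add: continuous_on_open_vimage)

lemma closure_shear: "shear c d -` closure W \<subseteq> closure (shear c d -` W)"
proof
  fix x assume "x \<in> shear c d -` closure W"
  hence "shear c d x \<in> closure W" by simp
  moreover have "shear (- c) (- d) ` closure W \<subseteq> closure (shear c d -` W)"
  proof (rule image_closure_subset[OF continuous_on_shear])
    show "shear (- c) (- d) ` W \<subseteq> closure (shear c d -` W)"
      using closure_subset by (fastforce simp: shear_shear shear_0)
  qed simp
  moreover have "shear (- c) (- d) (shear c d x) = x" by (simp add: shear_shear shear_0)
  ultimately show "x \<in> closure (shear c d -` W)" by (metis image_subset_iff)
qed

lemma agree_on_shear:
  assumes "agree_on U f g"
  shows "agree_on (shear c d -` U) (\<lambda>p. f (shear c d p)) (\<lambda>p. g (shear c d p))"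
proof -
  obtain W where "open W" "W \<subseteq> U" "U \<subseteq> closure W" "\<forall>x\<in>W. f x = g x"
    using assms unfolding agree_on_def by blast
  thus ?thesis unfolding agree_on_def using closure_shear[of c d W] open_shear[of W c d]
    by (intro exI[of _ "shear c d -` W"]) blast
qed

lemma mv_meromorphic_on_shear:
  assumes "mv_meromorphic_on f U"
  shows "mv_meromorphic_on (\<lambda>p. f (shear c d p)) (shear c d -` U)"
  unfolding mv_meromorphic_on_def
proof
  fix p assume "p \<in> shear c d -` U"
  hence "shear c d p \<in> U" by simp
  then obtain V g h where V: "open V" "shear c d p \<in> V" "V \<subseteq> U" "mv_holomorphic_on g V"
    "mv_holomorphic_on h V" "V \<subseteq> closure {x\<in>V. h x \<noteq> 0}" "agree_on V f (\<lambda>x. g x / h x)"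
    by (rule mv_meromorphic_onE[OF assms])
  have "shear c d -` V \<subseteq> closure {x \<in> shear c d -` V. h (shear c d x) \<noteq> 0}"
    using closure_shear[of c d "{x\<in>V. h x \<noteq> 0}"] V(6) by (auto simp: vimage_def)
  thus "\<exists>V g h. open V \<and> p \<in> V \<and> V \<subseteq> shear c d -` U \<and> mv_holomorphic_on g V \<and> mv_holomorphic_on h V \<and>
      V \<subseteq> closure {x\<in>V. h x \<noteq> 0} \<and> agree_on V (\<lambda>p. f (shear c d p)) (\<lambda>x. g x / h x)"
    using V open_shear[OF V(1)] mv_holomorphic_on_shear[OF V(4)] mv_holomorphic_on_shear[OF V(5)]
      agree_on_shear[OF V(7)]
    by (intro exI[of _ "shear c d -` V"] exI[of _ "\<lambda>p. g (shear c d p)"] exI[of _ "\<lambda>p. h (shear c d p)"])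
      auto
qed

text \<open>The substitution \<open>f(\<tau>, \<theta>) \<mapsto> f(\<tau>, \<theta> + c \<tau> + d)\<close>.\<close>

lift_definition shift :: "complex \<Rightarrow> complex \<Rightarrow> mero \<Rightarrow> mero" is
  "\<lambda>c d f p. f (shear c d p)"
proof -
  have *: "shear c d -` HC = HC" for c d by (auto simp: shear_HC)
  show "mero_rel (\<lambda>p. f (shear c d p)) (\<lambda>p. g (shear c d p))" if "mero_rel f g" for c d f g
    using that mv_meromorphic_on_shear[of f HC c d] agree_on_shear[of HC f g c d]
    by (intro mero_rel_I) (auto simp: mero_rel_def *)
qed

lemma mero_rel_shearI: "mero_rel f f \<Longrightarrow> mero_rel (\<lambda>p. f (shear c d p)) (\<lambda>p. f (shear c d p))"
  using shift.rsp by (auto simp: rel_fun_def)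

lemma mv_meromorphic_on_HC_shear: "mero_rel f f \<Longrightarrow> mv_meromorphic_on (\<lambda>p. f (shear c d p)) HC"
  using mero_rel_shearI unfolding mero_rel_def by blast

lemma shift_add: "shift c d (f + g) = shift c d f + shift c d g"
  by transfer (rule mero_rel_eqI, rule mv_meromorphic_on_add, (erule mv_meromorphic_on_HC_shear)+, rule refl)

lemma shift_mult: "shift c d (f * g) = shift c d f * shift c d g"
  by transfer (rule mero_rel_eqI, rule mv_meromorphic_on_mult, (erule mv_meromorphic_on_HC_shear)+, rule refl)

lemma shift_const [simp]: "shift c d (mero_const k) = mero_const k"
  by transfer (rule mero_rel_const)

lemma shift_zero [simp]: "shift c d 0 = 0"
  by transfer (rule mero_rel_const)

lemma shift_one [simp]: "shift c d 1 = 1"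
  by transfer (rule mero_rel_const)

lemma shift_shift: "shift c d (shift c' d' f) = shift (c + c') (d + d') f"
  by transfer (use mero_rel_shearI in \<open>force simp: shear_shear add.commute\<close>)

lemma shift_0 [simp]: "shift 0 0 f = f"
  by transfer (simp add: shear_0)

lemma shift_sum: "shift c d (sum f A) = (\<Sum>x\<in>A. shift c d (f x))"
  by (induction A rule: infinite_finite_induct) (simp_all add: shift_add)


lifting_forget mero.lifting


section \<open>The extended quantum torus\<close>

typedef qtorus = "{a :: int \<Rightarrow> mero. finite {n. a n \<noteq> 0}}"
  morphisms qcoeff Abs_qtorus
  by (rule exI[of _ "\<lambda>n. 0"]) simp

setup_lifting type_definition_qtorus

lemma finite_support: "finite {n. qcoeff a n \<noteq> 0}"
  using qcoeff by simp

lemma qtorus_eqI: "(\<And>n. qcoeff a n = qcoeff b n) \<Longrightarrow> a = b"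
  by (simp add: qcoeff_inject[symmetric] fun_eq_iff)

text \<open>\<open>qmon f n\<close> is the element \<open>f(\<tau>, \<theta>) y\<close> where \<open>y\<close> is the basis symbol indexed by \<open>n \<alpha>\<^sup>\<or>\<close>.\<close>

lift_definition qmon :: "mero \<Rightarrow> int \<Rightarrow> qtorus" is "\<lambda>f n k. if k = n then f else 0"
  by (rule finite_subset[of _ "{n}" for n]) auto

instantiation qtorus :: ring_1
begin

lift_definition zero_qtorus :: qtorus is "\<lambda>n. 0" by simp
lift_definition one_qtorus :: qtorus is "\<lambda>n. if n = 0 then 1 else 0" by simp
lift_definition plus_qtorus :: "qtorus \<Rightarrow> qtorus \<Rightarrow> qtorus" is "\<lambda>a b n. a n + b n"
  subgoal for a b by (rule finite_subset[of _ "{n. a n \<noteq> 0} \<union> {n. b n \<noteq> 0}"]) auto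
  done
lift_definition uminus_qtorus :: "qtorus \<Rightarrow> qtorus" is "\<lambda>a n. - a n" by simp
lift_definition minus_qtorus :: "qtorus \<Rightarrow> qtorus \<Rightarrow> qtorus" is "\<lambda>a b n. a n - b n"
  subgoal for a b by (rule finite_subset[of _ "{n. a n \<noteq> 0} \<union> {n. b n \<noteq> 0}"]) auto
  done
lift_definition times_qtorus :: "qtorus \<Rightarrow> qtorus \<Rightarrow> qtorus" is
  "\<lambda>a b n. \<Sum>k | a k \<noteq> 0. a k * shift (of_int k) 0 (b (n - k))"
proof -
  fix a b :: "int \<Rightarrow> mero" assume ab: "finite {n. a n \<noteq> 0}" "finite {n. b n \<noteq> 0}"
  have "n \<in> (\<lambda>(k, j). k + j) ` ({n. a n \<noteq> 0} \<times> {n. b n \<noteq> 0})"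
    if n: "(\<Sum>k | a k \<noteq> 0. a k * shift (of_int k) 0 (b (n - k))) \<noteq> 0" for n
  proof -
    obtain k where "a k \<noteq> 0" "a k * shift (of_int k) 0 (b (n - k)) \<noteq> 0"
      by (rule sum.not_neutral_contains_not_neutral[OF n]) auto
    thus ?thesis by (intro image_eqI[of _ _ "(k, n - k)"]) auto
  qed
  thus "finite {n. (\<Sum>k | a k \<noteq> 0. a k * shift (of_int k) 0 (b (n - k))) \<noteq> 0}"
    by (intro finite_subset[OF _ finite_imageI[OF finite_cartesian_product[OF ab]]]) blast
qed

lemma qcoeff_times:
  assumes "finite K" "\<And>k. qcoeff a k \<noteq> 0 \<Longrightarrow> k \<in> K"
  shows "qcoeff (a * b) n = (\<Sum>k\<in>K. qcoeff a k * shift (of_int k) 0 (qcoeff b (n - k)))"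
  unfolding times_qtorus.rep_eq using assms by (intro sum.mono_neutral_left) auto

instance
proof
  fix a b c :: qtorus
  show "a + b + c = a + (b + c)" by (rule qtorus_eqI) (simp add: plus_qtorus.rep_eq)
  show "a + b = b + a" by (rule qtorus_eqI) (simp add: plus_qtorus.rep_eq)
  show "0 + a = a" by (rule qtorus_eqI) (simp add: plus_qtorus.rep_eq zero_qtorus.rep_eq)
  show "- a + a = 0" by (rule qtorus_eqI) (simp add: plus_qtorus.rep_eq zero_qtorus.rep_eq uminus_qtorus.rep_eq)
  show "a - b = a + - b"
    by (rule qtorus_eqI) (simp add: plus_qtorus.rep_eq minus_qtorus.rep_eq uminus_qtorus.rep_eq)
  show "(0::qtorus) \<noteq> 1"
  proof
    assume "(0::qtorus) = 1"
    hence "qcoeff 0 0 = qcoeff 1 0" by simp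
    thus False by (simp add: zero_qtorus.rep_eq one_qtorus.rep_eq)
  qed
  show "1 * a = a"
    by (rule qtorus_eqI, subst qcoeff_times[of "{0}"]) (auto simp: one_qtorus.rep_eq split: if_splits)
  show "a * 1 = a"
  proof (rule qtorus_eqI)
    fix n
    let ?K = "insert n {n. qcoeff a n \<noteq> 0}"
    have "qcoeff (a * 1) n = (\<Sum>k\<in>?K. qcoeff a k * shift (of_int k) 0 (qcoeff 1 (n - k)))"
      using finite_support by (intro qcoeff_times) auto
    also have "\<dots> = (\<Sum>k\<in>?K. if k = n then qcoeff a k else 0)"
      by (intro sum.cong) (auto simp: one_qtorus.rep_eq)
    also have "\<dots> = qcoeff a n" using finite_support[of a] by (subst sum.delta) auto
    finally show "qcoeff (a * 1) n = qcoeff a n" .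
  qed
  show "(a + b) * c = a * c + b * c"
  proof (rule qtorus_eqI)
    fix n
    let ?K = "{n. qcoeff a n \<noteq> 0} \<union> {n. qcoeff b n \<noteq> 0}"
    have K: "finite ?K" using finite_support by simp
    show "qcoeff ((a + b) * c) n = qcoeff (a * c + b * c) n"
      unfolding plus_qtorus.rep_eq
      by (subst (1 2 3) qcoeff_times[OF K]) (auto simp: plus_qtorus.rep_eq distrib_right sum.distrib)
  qed
  show "a * (b + c) = a * b + a * c"
    by (rule qtorus_eqI)
      (simp add: plus_qtorus.rep_eq times_qtorus.rep_eq shift_add distrib_left sum.distrib)
  show "a * b * c = a * (b * c)"
  proof (rule qtorus_eqI)
    fix n
    define A where "A = {n. qcoeff a n \<noteq> 0}"
    define B where "B = {n. qcoeff b n \<noteq> 0}"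
    define M where "M = (\<lambda>(k, j). k + j) ` (A \<times> B)"
    have fin: "finite A" "finite B" "finite M" using finite_support by (auto simp: A_def B_def M_def)
    have 1: "qcoeff (a * b) m = (\<Sum>k\<in>A. qcoeff a k * shift (of_int k) 0 (qcoeff b (m - k)))" for m
      using fin by (intro qcoeff_times) (auto simp: A_def)
    have M: "m \<in> M" if m: "qcoeff (a * b) m \<noteq> 0" for m
    proof -
      obtain k where "k \<in> A" "qcoeff a k * shift (of_int k) 0 (qcoeff b (m - k)) \<noteq> 0"
        by (rule sum.not_neutral_contains_not_neutral[OF m[unfolded 1]]) auto
      thus ?thesis unfolding M_def by (intro image_eqI[of _ _ "(k, m - k)"]) (auto simp: B_def)
    qed
    have "qcoeff (a * b * c) n = (\<Sum>m\<in>M. qcoeff (a * b) m * shift (of_int m) 0 (qcoeff c (n - m)))"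
      using fin M by (intro qcoeff_times) auto
    also have "\<dots> = (\<Sum>k\<in>A. \<Sum>m\<in>M. qcoeff a k * shift (of_int k) 0 (qcoeff b (m - k)) *
        shift (of_int m) 0 (qcoeff c (n - m)))"
      unfolding 1 sum_distrib_right by (rule sum.swap)
    also have "\<dots> = (\<Sum>k\<in>A. \<Sum>j\<in>B. qcoeff a k * shift (of_int k) 0 (qcoeff b j) *
        shift (of_int (k + j)) 0 (qcoeff c (n - (k + j))))"
    proof (rule sum.cong[OF refl])
      fix k assume k: "k \<in> A"
      have "(\<Sum>j\<in>B. qcoeff a k * shift (of_int k) 0 (qcoeff b j) *
          shift (of_int (k + j)) 0 (qcoeff c (n - (k + j)))) =
        (\<Sum>m\<in>(+) k ` B. qcoeff a k * shift (of_int k) 0 (qcoeff b (m - k)) *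
          shift (of_int m) 0 (qcoeff c (n - m)))"
        by (subst sum.reindex) (auto simp: inj_on_def)
      also have "\<dots> = (\<Sum>m\<in>M. qcoeff a k * shift (of_int k) 0 (qcoeff b (m - k)) *
          shift (of_int m) 0 (qcoeff c (n - m)))"
      proof (rule sum.mono_neutral_left[OF fin(3)])
        show "(+) k ` B \<subseteq> M" using k by (auto simp: M_def)
        show "\<forall>m\<in>M - (+) k ` B. qcoeff a k * shift (of_int k) 0 (qcoeff b (m - k)) *
          shift (of_int m) 0 (qcoeff c (n - m)) = 0"
        proof
          fix m assume "m \<in> M - (+) k ` B"
          hence "m - k \<notin> B" by (metis DiffE add_diff_cancel_left' diff_add_cancel add.commute image_eqI)
          thus "qcoeff a k * shift (of_int k) 0 (qcoeff b (m - k)) *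
            shift (of_int m) 0 (qcoeff c (n - m)) = 0" by (simp add: B_def)
        qed
      qed
      finally show "(\<Sum>m\<in>M. qcoeff a k * shift (of_int k) 0 (qcoeff b (m - k)) *
          shift (of_int m) 0 (qcoeff c (n - m))) =
        (\<Sum>j\<in>B. qcoeff a k * shift (of_int k) 0 (qcoeff b j) *
          shift (of_int (k + j)) 0 (qcoeff c (n - (k + j))))" by simp
    qed
    also have "\<dots> = (\<Sum>k\<in>A. qcoeff a k * shift (of_int k) 0 (qcoeff (b * c) (n - k)))"
    proof (rule sum.cong[OF refl])
      fix k assume "k \<in> A"
      have "qcoeff (b * c) (n - k) = (\<Sum>j\<in>B. qcoeff b j * shift (of_int j) 0 (qcoeff c (n - k - j)))"
        using fin by (intro qcoeff_times) (auto simp: B_def)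
      thus "(\<Sum>j\<in>B. qcoeff a k * shift (of_int k) 0 (qcoeff b j) *
          shift (of_int (k + j)) 0 (qcoeff c (n - (k + j)))) =
        qcoeff a k * shift (of_int k) 0 (qcoeff (b * c) (n - k))"
        by (simp add: shift_sum shift_mult shift_shift sum_distrib_left mult.assoc algebra_simps)
    qed
    also have "\<dots> = qcoeff (a * (b * c)) n"
      using fin by (intro qcoeff_times[symmetric]) (auto simp: A_def)
    finally show "qcoeff (a * b * c) n = qcoeff (a * (b * c)) n" .
  qed
qed

end

lemma qmon_times_qmon: "qmon f m * qmon g n = qmon (f * shift (of_int m) 0 g) (m + n)"
  by (rule qtorus_eqI, subst qcoeff_times[of "{m}"]) (auto simp: qmon.rep_eq split: if_splits)

lemma qmon_one: "qmon 1 0 = 1"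
  by (rule qtorus_eqI) (simp add: qmon.rep_eq one_qtorus.rep_eq)

text \<open>Automorphisms are automorphisms of unital \<open>\<complex>\<close>-algebras.\<close>

definition is_aut :: "(qtorus \<Rightarrow> qtorus) \<Rightarrow> bool" where
  "is_aut \<phi> \<longleftrightarrow> bij \<phi> \<and> \<phi> 1 = 1 \<and> (\<forall>a b. \<phi> (a + b) = \<phi> a + \<phi> b) \<and> (\<forall>a b. \<phi> (a * b) = \<phi> a * \<phi> b) \<and>
     (\<forall>c a. \<phi> (qmon (mero_const c) 0 * a) = qmon (mero_const c) 0 * \<phi> a)"

definition qinverse :: "qtorus \<Rightarrow> qtorus" where
  "qinverse g = (THE h. g * h = 1 \<and> h * g = 1)"

definition Ad :: "qtorus \<Rightarrow> qtorus \<Rightarrow> qtorus" where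
  "Ad g a = g * a * qinverse g"

lift_definition eps_Z :: "complex \<Rightarrow> complex \<Rightarrow> qtorus \<Rightarrow> qtorus" is
  "\<lambda>z t a n. shift 0 (z / (2 * of_real pi * \<i> * t)) (a n)"
  by (rule finite_subset[rotated], assumption) auto

lemma bij_eps_Z: "bij (eps_Z z t)"
proof (rule o_bij)
  show "eps_Z (- z) t \<circ> eps_Z z t = id" "eps_Z z t \<circ> eps_Z (- z) t = id"
    by (auto simp: fun_eq_iff eps_Z.rep_eq shift_shift intro!: qtorus_eqI)
qed


lifting_update mero.lifting


section \<open>Meromorphic maps into the algebra\<close>

text \<open>The slice of a meromorphic function \<open>F(\<tau>, \<theta>, t)\<close> at a fixed \<open>t\<close>, which must not lie in its
  polar set.\<close>

definition is_slice :: "(complex ^ 3 \<Rightarrow> complex) \<Rightarrow> complex \<Rightarrow> mero \<Rightarrow> bool" where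
  "is_slice F t f \<longleftrightarrow>
     (\<exists>\<tau> \<theta> v. 0 < Im \<tau> \<and> regular_value F (vector [\<tau>, \<theta>, t]) v) \<and>
     (\<forall>\<tau> \<theta> v. 0 < Im \<tau> \<and> regular_value F (vector [\<tau>, \<theta>, t]) v \<longrightarrow> mero_value f \<tau> \<theta> v)"

definition meromorphic_map :: "complex set \<Rightarrow> (complex \<Rightarrow> qtorus) \<Rightarrow> bool" where
  "meromorphic_map D f \<longleftrightarrow>
     (\<exists>N F. finite N \<and>
        (\<forall>n\<in>N. mv_meromorphic_on (F n) {p. 0 < Im (p $ 1) \<and> p $ 3 \<in> D}) \<and>
        (\<forall>t\<in>D. (\<forall>n\<in>N. is_slice (F n) t (qcoeff (f t) n)) \<and> (\<forall>n. n \<notin> N \<longrightarrow> qcoeff (f t) n = 0)))"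

text \<open>Pointwise convergence is convergence of values in the Riemann sphere: at a point where the limit
  is holomorphic the values converge, at a pole of the limit the values of the inverses do. At
  points of indeterminacy the limit has no value.\<close>

definition mero_tends_at ::
    "complex filter \<Rightarrow> (complex \<Rightarrow> mero) \<Rightarrow> mero \<Rightarrow> complex \<Rightarrow> complex \<Rightarrow> bool" where
  "mero_tends_at G f g \<tau> \<theta> \<longleftrightarrow>
     (\<forall>v. mero_value g \<tau> \<theta> v \<longrightarrow>
        (\<exists>w. eventually (\<lambda>t. mero_value (f t) \<tau> \<theta> (w t)) G \<and> (w \<longlongrightarrow> v) G))"

definition qtorus_tends :: "complex filter \<Rightarrow> (complex \<Rightarrow> qtorus) \<Rightarrow> qtorus \<Rightarrow> bool" where
  "qtorus_tends G f g \<longleftrightarrow>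
     (\<forall>n \<tau> \<theta>. 0 < Im \<tau> \<longrightarrow>
        mero_tends_at G (\<lambda>t. qcoeff (f t) n) (qcoeff g n) \<tau> \<theta> \<and>
        (qcoeff g n \<noteq> 0 \<longrightarrow>
           mero_tends_at G (\<lambda>t. inverse (qcoeff (f t) n)) (inverse (qcoeff g n)) \<tau> \<theta>))"

text \<open>A two-sided power bound only makes sense if \<open>t \<mapsto> f\<^sub>n(\<tau>, \<theta>, t)\<close> is defined and not identically
  zero. This excludes for instance the coefficients with \<open>f\<^sub>n = 0\<close>, and the points with
  \<open>\<tau> = \<tau>\<^sub>0\<close> for the element \<open>(\<tau> - \<tau>\<^sub>0) \<cdot> 1\<close>.\<close>

definition bounded_growth :: "complex set \<Rightarrow> (complex \<Rightarrow> qtorus) \<Rightarrow> bool" where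
  "bounded_growth D f \<longleftrightarrow>
     (\<forall>n \<tau> \<theta>. 0 < Im \<tau> \<longrightarrow> (\<exists>t\<in>D. \<exists>v. v \<noteq> 0 \<and> mero_value (qcoeff (f t) n) \<tau> \<theta> v) \<longrightarrow>
        (\<exists>k::real. 0 < k \<and>
           (\<forall>\<^sub>F t in inf at_infinity (principal D). \<exists>v. mero_value (qcoeff (f t) n) \<tau> \<theta> v \<and>
              norm t powr (- k) < norm v \<and> norm v < norm t powr k)))"

definition meromorphic_aut_map :: "complex set \<Rightarrow> (complex \<Rightarrow> qtorus \<Rightarrow> qtorus) \<Rightarrow> bool" where
  "meromorphic_aut_map D \<phi> \<longleftrightarrow> (\<forall>t\<in>D. is_aut (\<phi> t)) \<and> (\<forall>a. meromorphic_map D (\<lambda>t. \<phi> t a))"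

definition aut_tends ::
    "complex filter \<Rightarrow> (complex \<Rightarrow> qtorus \<Rightarrow> qtorus) \<Rightarrow> (qtorus \<Rightarrow> qtorus) \<Rightarrow> bool" where
  "aut_tends G \<phi> \<psi> \<longleftrightarrow> (\<forall>a. qtorus_tends G (\<lambda>t. \<phi> t a) (\<psi> a))"

definition aut_bounded_growth :: "complex set \<Rightarrow> (complex \<Rightarrow> qtorus \<Rightarrow> qtorus) \<Rightarrow> bool" where
  "aut_bounded_growth D \<phi> \<longleftrightarrow> (\<forall>a. bounded_growth D (\<lambda>t. \<phi> t a))"


section \<open>The quantum Riemann--Hilbert problem for the doubled \<open>A\<^sub>1\<close> structure\<close>

text \<open>In this section the integer \<open>s = \<plusminus>1\<close> stands for the sign in \<open>\<ell>\<^sub>\<plusminus>\<close>, \<open>\<Phi>\<^sub>\<plusminus>\<close>, etc.\<close>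

definition ray :: "complex \<Rightarrow> int \<Rightarrow> complex set" where
  "ray z s = {of_int s * of_real r * z | r :: real. 0 < r}"

definition slit_plane :: "complex \<Rightarrow> int \<Rightarrow> complex set" where
  "slit_plane z s = {t. t \<noteq> 0 \<and> t \<notin> (\<lambda>u. \<i> * u) ` ray z s}"

definition q_dilog :: "complex \<Rightarrow> complex \<Rightarrow> complex" where
  "q_dilog q x = prodinf (\<lambda>k. 1 - q ^ k * x)"

definition DT_q :: "int \<Rightarrow> qtorus" where
  "DT_q s = qmon (inverse (abs_mero (\<lambda>p. q_dilog (exp (2 * of_real pi * \<i> * p $ 1))
     (- exp (of_real pi * \<i> * p $ 1 + of_int s * (2 * of_real pi * \<i> * p $ 2)))))) 0"

definition S_q :: "int \<Rightarrow> qtorus \<Rightarrow> qtorus" where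
  "S_q s = Ad (DT_q s)"

definition Lambda :: "complex \<Rightarrow> complex \<Rightarrow> complex" where
  "Lambda w \<eta> = Gamma (w + \<eta>) * exp w / (of_real (sqrt (2 * pi)) * w powr (\<eta> + w - 1 / 2))"

definition is_Psi :: "complex \<Rightarrow> int \<Rightarrow> complex \<Rightarrow> (qtorus \<Rightarrow> qtorus) \<Rightarrow> bool" where
  "is_Psi z s t \<psi> \<longleftrightarrow> is_aut \<psi> \<and> (\<forall>f. \<psi> (qmon f 0) = qmon f 0) \<and>
     \<psi> (qmon 1 1) =
       qmon (abs_mero (\<lambda>p. Lambda (of_int s * (z / (2 * of_real pi * \<i> * t)))
                                  (1 / 2 - of_int s * (p $ 2 + p $ 1 / 2))) powi s) 1"

definition Psi :: "complex \<Rightarrow> int \<Rightarrow> complex \<Rightarrow> qtorus \<Rightarrow> qtorus" where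
  "Psi z s t = (THE \<psi>. is_Psi z s t \<psi>)"

definition Phi :: "complex \<Rightarrow> int \<Rightarrow> complex \<Rightarrow> qtorus \<Rightarrow> qtorus" where
  "Phi z s t = Psi z s t \<circ> inv (eps_Z z t)"

lemma Psi_eq_iff: "Psi z s t = \<phi> \<circ> eps_Z z t \<longleftrightarrow> \<phi> = Phi z s t"
  using bij_eps_Z[of z t]
  by (auto simp: Phi_def fun_eq_iff bij_is_inj bij_is_surj surj_f_inv_f inv_f_f)

definition closed_cone :: "complex set \<Rightarrow> bool" where
  "closed_cone K \<longleftrightarrow> closed K \<and> (\<forall>t\<in>K. \<forall>r::real. 0 < r \<longrightarrow> of_real r * t \<in> K)"

definition qRH1 :: "complex \<Rightarrow> (int \<Rightarrow> complex \<Rightarrow> qtorus \<Rightarrow> qtorus) \<Rightarrow> bool" where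
  "qRH1 z \<Phi> \<longleftrightarrow>
     (\<forall>t. t \<noteq> 0 \<longrightarrow>
        (0 < Re (t / z) \<longrightarrow> \<Phi> 1 t = \<Phi> (- 1) t \<circ> S_q 1) \<and>
        (Re (t / z) < 0 \<longrightarrow> \<Phi> 1 t = \<Phi> (- 1) t \<circ> inv (S_q (- 1))))"

text \<open>As usual for asymptotic statements, \<open>t \<rightarrow> 0\<close> in a slit plane means \<open>t \<rightarrow> 0\<close> in every closed
  subsector: the solution has infinitely many poles accumulating at \<open>0\<close> tangentially to the slit.\<close>

definition qRH2 :: "complex \<Rightarrow> (int \<Rightarrow> complex \<Rightarrow> qtorus \<Rightarrow> qtorus) \<Rightarrow> bool" where
  "qRH2 z \<Phi> \<longleftrightarrow>
     (\<forall>s\<in>{1, - 1}. \<forall>K. closed_cone K \<and> K - {0} \<subseteq> slit_plane z s \<longrightarrow>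
        aut_tends (at 0 within K) (\<lambda>t. \<Phi> s t \<circ> eps_Z z t) id)"

definition qRH3 :: "complex \<Rightarrow> (int \<Rightarrow> complex \<Rightarrow> qtorus \<Rightarrow> qtorus) \<Rightarrow> bool" where
  "qRH3 z \<Phi> \<longleftrightarrow> (\<forall>s\<in>{1, - 1}. aut_bounded_growth (slit_plane z s) (\<Phi> s))"

definition solves_qRH :: "complex \<Rightarrow> (int \<Rightarrow> complex \<Rightarrow> qtorus \<Rightarrow> qtorus) \<Rightarrow> bool" where
  "solves_qRH z \<Phi> \<longleftrightarrow>
     (\<forall>s\<in>{1, - 1}. meromorphic_aut_map (slit_plane z s) (\<Phi> s)) \<and> qRH1 z \<Phi> \<and> qRH2 z \<Phi> \<and> qRH3 z \<Phi>"

end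

theory Submission
  imports Defs
begin

text \<open>
  An automorphism that is trivial in degree \<open>0\<close> is a diagonal map \<open>f y\<^sub>n \<mapsto> f c\<^sub>n y\<^sub>n\<close> for a cocycle
  \<open>c\<close> of meromorphic functions under \<open>\<theta> \<mapsto> \<theta> + n \<tau>\<close>, and \<open>c\<close> is determined by \<open>c\<^sub>1\<close>. This yields
  \<open>\<Psi>\<^sub>\<plusminus>(t)\<close>, and it reduces the jump condition to one identity of functions: the reflection formula for
  \<open>\<Gamma>\<close> turns \<open>\<Lambda>(w, 1/2 - x) \<Lambda>(- w, 1/2 + x)\<close> into \<open>1 / (1 + exp (2 \<pi> i (x - w)))\<close>, and by the functional
  equation of the quantum dilogarithm this factor is also the cocycle of \<open>Ad\<close> at \<open>1\<close>. The limit at \<open>t = 0\<close> is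
  Stirling's asymptotics in closed sectors avoiding the negative real axis. For the growth at infinity the
  factors \<open>\<Lambda>(w, \<eta>)\<close> are bounded above and below by powers of \<open>|w|\<close> as \<open>w \<rightarrow> 0\<close>, and the remaining factor
  \<open>f(\<tau>, \<theta> - w)\<close> is bounded in this way once \<open>f\<close> has neither a pole nor a zero along the whole fibre over
  \<open>\<tau>\<close>. The latter follows from the existence of a single regular nonzero value on the fibre, because the
  order of \<open>f\<close> along the connected fibre is constant.
\<close>

text \<open>A class of functions modulo agreement on dense open sets has no restriction to a
  hypersurface, yet a slice at fixed t and the growth at fixed \<tau> are such restrictions. This
  shapes the middle of the proof: \<open>fib_mero i T\<close> records local quotients g / h that are
  valid and nonzero on a set dense in the relevant fibres. Fixed t means i = 3 and T = UNIV; a fibre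
  over \<tau> = c means i = 1 and T = {c}; T = {} asks for density in the whole space, as available
  for an arbitrary nonzero coefficient. \<Lambda> is good along all these fibres, because its gamma
  argument moves with \<theta>. An arbitrary coefficient is good over \<tau> = c only after
  multiplication by a power of \<tau> - c, and the exponent gives its order. Extracting it requires
  division by \<tau> - c in two variables, hence the Cauchy estimates and parameter integrals. Total
  functions take the value 0 at poles of the gamma function, so a nonzero value of \<Lambda>
  certifies regularity. Lower bounds accompany upper bounds, since the cocycle also contains
  inverses of \<Lambda>.\<close>

no_notation fps_nth (infixl \<open>$\<close> 75)

section \<open>Holomorphic functions of several variables\<close>

lemma mv_holomorphic_on_coord: "mv_holomorphic_on (\<lambda>p. p $ i) U"
  unfolding mv_holomorphic_on_def
  by (intro ballI exI[of _ "\<lambda>p. p $ i"])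
    (auto intro: bounded_linear_imp_has_derivative bounded_linear_vec_nth)

lemma mv_holomorphic_on_compose_field:
  assumes "mv_holomorphic_on f U" "\<And>p. p \<in> U \<Longrightarrow> \<phi> field_differentiable at (f p)"
  shows "mv_holomorphic_on (\<lambda>p. \<phi> (f p)) U"
  unfolding mv_holomorphic_on_def
proof
  fix p assume p: "p \<in> U"
  then obtain D d where D: "(f has_derivative D) (at p)" "\<And>c v. D (c *s v) = c * D v"
    and d: "(\<phi> has_derivative (*) d) (at (f p))"
    using assms unfolding mv_holomorphic_on_def field_differentiable_def has_field_derivative_def by meson
  have "((\<lambda>p. \<phi> (f p)) has_derivative (\<lambda>v. d * D v)) (at p)"
    using diff_chain_at[OF D(1) d] by (simp add: o_def)
  thus "\<exists>D. ((\<lambda>p. \<phi> (f p)) has_derivative D) (at p) \<and> (\<forall>c v. D (c *s v) = c * D v)"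
    using D(2) by (intro exI[of _ "\<lambda>v. d * D v"]) simp
qed

lemma mv_holomorphic_on_uminus: "mv_holomorphic_on f U \<Longrightarrow> mv_holomorphic_on (\<lambda>p. - f p) U"
  using mv_holomorphic_on_mult[OF mv_holomorphic_on_const[of "-1" U]] by simp

lemma mv_holomorphic_on_diff:
  "mv_holomorphic_on f U \<Longrightarrow> mv_holomorphic_on g U \<Longrightarrow> mv_holomorphic_on (\<lambda>p. f p - g p) U"
  using mv_holomorphic_on_add[OF _ mv_holomorphic_on_uminus, of f U g] by simp

lemma mv_holomorphic_on_divide:
  assumes "mv_holomorphic_on f U" "mv_holomorphic_on g U" "\<And>p. p \<in> U \<Longrightarrow> g p \<noteq> 0"
  shows "mv_holomorphic_on (\<lambda>p. f p / g p) U"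
  unfolding divide_inverse
  by (rule mv_holomorphic_on_mult[OF assms(1) mv_holomorphic_on_compose_field[OF assms(2), of inverse]])
    (simp add: field_differentiable_inverse assms(3))

lemma mv_holomorphic_on_exp: "mv_holomorphic_on f U \<Longrightarrow> mv_holomorphic_on (\<lambda>p. exp (f p)) U"
  by (erule mv_holomorphic_on_compose_field[where \<phi> = exp]) (rule field_differentiable_within_exp)

lemma mv_holomorphic_on_power: "mv_holomorphic_on f U \<Longrightarrow> mv_holomorphic_on (\<lambda>p. f p ^ n) U"
  by (induction n) (simp_all add: mv_holomorphic_on_const mv_holomorphic_on_mult)

lemma mv_holomorphic_on_sum:
  "(\<And>i. i \<in> I \<Longrightarrow> mv_holomorphic_on (f i) U) \<Longrightarrow> mv_holomorphic_on (\<lambda>p. \<Sum>i\<in>I. f i p) U"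
  by (induction I rule: infinite_finite_induct) (simp_all add: mv_holomorphic_on_const mv_holomorphic_on_add)

lemma mv_holomorphic_on_prod:
  "(\<And>i. i \<in> I \<Longrightarrow> mv_holomorphic_on (f i) U) \<Longrightarrow> mv_holomorphic_on (\<lambda>p. \<Prod>i\<in>I. f i p) U"
  by (induction I rule: infinite_finite_induct) (simp_all add: mv_holomorphic_on_const mv_holomorphic_on_mult)

lemma field_differentiable_rGamma: "rGamma field_differentiable at (z::complex)"
  using has_field_derivative_rGamma field_differentiable_def by blast

lemmas mv_hol_intros = mv_holomorphic_on_const mv_holomorphic_on_coord mv_holomorphic_on_add
  mv_holomorphic_on_diff mv_holomorphic_on_uminus mv_holomorphic_on_mult mv_holomorphic_on_exp
  mv_holomorphic_on_power mv_holomorphic_on_sum mv_holomorphic_on_prod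

lemma mv_holomorphic_on_cong:
  assumes "mv_holomorphic_on f U" "open U" "\<And>x. x \<in> U \<Longrightarrow> f x = g x"
  shows "mv_holomorphic_on g U"
  unfolding mv_holomorphic_on_def
proof
  fix p assume p: "p \<in> U"
  then obtain D where D: "(f has_derivative D) (at p)" "\<forall>c v. D (c *s v) = c * D v"
    using assms(1) unfolding mv_holomorphic_on_def by blast
  have "(g has_derivative D) (at p)"
    by (rule has_derivative_transform_within_open[OF D(1) assms(2) p]) (use assms(3) in auto)
  thus "\<exists>D. (g has_derivative D) (at p) \<and> (\<forall>c v. D (c *s v) = c * D v)" using D(2) by blast
qed

lemma mv_holomorphic_on_open_cover:
  "(\<And>p. p \<in> U \<Longrightarrow> \<exists>V. p \<in> V \<and> mv_holomorphic_on f V) \<Longrightarrow> mv_holomorphic_on f U"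
  unfolding mv_holomorphic_on_def by blast

text \<open>Componentwise holomorphy suffices: the derivative of the map is reassembled from the
  components in the standard basis and inherits their complex linearity.\<close>

lemma mv_holomorphic_on_compose_map:
  fixes F :: "complex ^ 'n \<Rightarrow> complex ^ 'm"
  assumes F: "\<And>i. mv_holomorphic_on (\<lambda>p. F p $ i) U" and h: "mv_holomorphic_on h V"
    and sub: "\<And>p. p \<in> U \<Longrightarrow> F p \<in> V"
  shows "mv_holomorphic_on (\<lambda>p. h (F p)) U"
  unfolding mv_holomorphic_on_def
proof
  fix p assume p: "p \<in> U"
  have "\<forall>i. \<exists>D. ((\<lambda>p. F p $ i) has_derivative D) (at p) \<and> (\<forall>c v. D (c *s v) = c * D v)"
    using F p unfolding mv_holomorphic_on_def by blast
  then obtain D where D: "\<And>i. ((\<lambda>p. F p $ i) has_derivative D i) (at p)" "\<And>i c v. D i (c *s v) = c * D i v"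
    by metis
  obtain E where E: "(h has_derivative E) (at (F p))" "\<And>c v. E (c *s v) = c * E v"
    using h sub[OF p] unfolding mv_holomorphic_on_def by blast
  have bl: "bounded_linear (\<lambda>x::complex. x *s (axis i 1 :: complex ^ 'm))" for i
    using linearI[of "\<lambda>x::complex. x *s (axis i 1 :: complex ^ 'm)"]
    by (simp add: linear_conv_bounded_linear vec_eq_iff algebra_simps)
  have "((\<lambda>p. \<Sum>i\<in>UNIV. F p $ i *s axis i 1) has_derivative (\<lambda>v. \<Sum>i\<in>UNIV. D i v *s axis i 1)) (at p)"
    by (intro has_derivative_sum bounded_linear.has_derivative[OF bl] D)
  moreover have "(\<lambda>p. \<Sum>i\<in>UNIV. F p $ i *s axis i 1) = F"
    by (simp add: basis_expansion fun_eq_iff)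
  moreover define G where "G = (\<lambda>v. \<Sum>i\<in>UNIV. D i v *s (axis i 1 :: complex ^ 'm))"
  ultimately have G: "(F has_derivative G) (at p)" by simp
  have "G (c *s v) = c *s G v" for c v
    unfolding G_def by (simp add: D(2) vec_eq_iff sum_distrib_left mult.assoc)
  moreover have "((\<lambda>p. h (F p)) has_derivative (\<lambda>v. E (G v))) (at p)"
    using diff_chain_at[OF G E(1)] by (simp add: o_def)
  ultimately show "\<exists>D. ((\<lambda>p. h (F p)) has_derivative D) (at p) \<and> (\<forall>c v. D (c *s v) = c * D v)"
    using E(2) by (intro exI[of _ "\<lambda>v. E (G v)"]) simp
qed

section \<open>Complex lines, Cauchy estimates and locally uniform limits\<close>

lemma norm_vector_scalar_mult: "norm (s *s v) = norm s * norm (v :: complex ^ 'n)"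
  by (simp add: norm_vec_def norm_mult L2_set_right_distrib)

lemma has_derivative_line: "((\<lambda>s::complex. a + s *s v) has_derivative (\<lambda>h. h *s v)) (at s)"
proof -
  have "linear (\<lambda>s::complex. s *s v)" by (rule linearI) (simp_all add: vec_eq_iff algebra_simps)
  hence "((\<lambda>s::complex. s *s v) has_derivative (\<lambda>h. h *s v)) (at s)"
    by (simp add: linear_conv_bounded_linear bounded_linear_imp_has_derivative)
  thus ?thesis by (auto intro!: derivative_eq_intros)
qed

lemma has_field_derivative_line:
  fixes g :: "complex ^ 'n \<Rightarrow> complex"
  assumes "(g has_derivative D) (at (a + s *s v))" "\<And>c v. D (c *s v) = c * D v"
  shows "((\<lambda>s. g (a + s *s v)) has_field_derivative D v) (at s)"
proof -
  have "((\<lambda>s. g (a + s *s v)) has_derivative (\<lambda>h. D (h *s v))) (at s)"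
    using diff_chain_at[OF has_derivative_line assms(1)] by (simp add: o_def)
  moreover have "(\<lambda>h. D (h *s v)) = (*) (D v)" by (rule ext) (simp add: assms(2) mult.commute)
  ultimately show ?thesis unfolding has_field_derivative_def by simp
qed

lemma mv_holomorphic_on_line:
  fixes g :: "complex ^ 'n \<Rightarrow> complex"
  assumes "mv_holomorphic_on g U"
  shows "(\<lambda>s. g (a + s *s v)) holomorphic_on {s. a + s *s v \<in> U}"
  unfolding holomorphic_on_def
proof
  fix s assume "s \<in> {s. a + s *s v \<in> U}"
  then obtain D where "(g has_derivative D) (at (a + s *s v))" "\<And>c v. D (c *s v) = c * D v"
    using assms unfolding mv_holomorphic_on_def by blast
  from has_field_derivative_line[OF this]
  show "(\<lambda>s. g (a + s *s v)) field_differentiable at s within {s. a + s *s v \<in> U}"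
    using field_differentiable_at_within field_differentiable_def by blast
qed

text \<open>One-variable Cauchy inequality on the complex line through \<open>x\<close> in direction
  \<open>v\<close>; \<open>\<rho> / norm v\<close> is the largest radius for which the disc stays in
  the ball.\<close>

lemma mv_Cauchy_estimate:
  fixes g :: "complex ^ 'n \<Rightarrow> complex"
  assumes g: "mv_holomorphic_on g U" and sub: "cball x \<rho> \<subseteq> U" and \<rho>: "0 < \<rho>"
    and D: "(g has_derivative D) (at x)" "\<And>c v. D (c *s v) = c * D v"
    and B: "\<And>y. y \<in> cball x \<rho> \<Longrightarrow> norm (g y) \<le> B"
  shows "norm (D v) \<le> B / \<rho> * norm v"
proof (cases "v = 0")
  case True
  have "D (0 *s v) = 0 * D v" by (rule D(2))
  thus ?thesis using True by simp
next
  case False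
  define R where "R = \<rho> / norm v"
  have R: "R > 0" using False \<rho> by (simp add: R_def)
  have in_ball: "x + s *s v \<in> cball x \<rho>" if "norm s \<le> R" for s
    using that False by (simp add: dist_norm norm_vector_scalar_mult R_def field_simps)
  have hol: "(\<lambda>s. g (x + s *s v)) holomorphic_on cball 0 R"
    by (rule holomorphic_on_subset[OF mv_holomorphic_on_line[OF g]]) (use in_ball sub in auto)
  have "norm ((deriv ^^ 1) (\<lambda>s. g (x + s *s v)) 0) \<le> fact 1 * B / R ^ 1"
  proof (rule Cauchy_inequality)
    show "(\<lambda>s. g (x + s *s v)) holomorphic_on ball 0 R"
      by (rule holomorphic_on_subset[OF hol]) auto
    show "norm (g (x + s *s v)) \<le> B" if "norm (0 - s) = R" for s
      using that by (intro B in_ball) simp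
  qed (use R hol holomorphic_on_imp_continuous_on in auto)
  moreover have "deriv (\<lambda>s. g (x + s *s v)) 0 = D v"
    by (rule DERIV_imp_deriv, rule has_field_derivative_line) (use D in auto)
  ultimately show ?thesis using False \<rho> by (simp add: R_def field_simps)
qed

text \<open>Weierstrass's theorem in several variables. The Cauchy estimate turns uniform
  convergence on a ball into a uniform Cauchy condition for the derivatives on a smaller one, so the
  total derivatives converge to that of the limit, and complex linearity survives.\<close>

lemma mv_holomorphic_on_uniform_limit:
  fixes g :: "complex ^ 'n \<Rightarrow> complex"
  assumes f: "\<And>n. mv_holomorphic_on (f n) U"
    and lim: "\<And>p. p \<in> U \<Longrightarrow> \<exists>r>0. cball p r \<subseteq> U \<and> uniform_limit (cball p r) f g sequentially"
  shows "mv_holomorphic_on g U"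
  unfolding mv_holomorphic_on_def
proof
  fix p assume p: "p \<in> U"
  obtain r where r: "r > 0" "cball p r \<subseteq> U" "uniform_limit (cball p r) f g sequentially"
    using lim[OF p] by blast
  define S where "S = ball p (r / 2)"
  have cb: "cball x (r / 2) \<subseteq> cball p r" if "x \<in> S" for x
  proof
    fix y assume "y \<in> cball x (r / 2)"
    thus "y \<in> cball p r" using that dist_triangle[of p y x] by (simp add: S_def)
  qed
  have SU: "S \<subseteq> U" using r unfolding S_def by auto
  have "\<forall>n. \<forall>x\<in>S. \<exists>D. (f n has_derivative D) (at x) \<and> (\<forall>c v. D (c *s v) = c * D v)"
    using f SU unfolding mv_holomorphic_on_def by blast
  then obtain D where D: "\<And>n x. x \<in> S \<Longrightarrow> (f n has_derivative D n x) (at x)"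
    "\<And>n x c v. x \<in> S \<Longrightarrow> D n x (c *s v) = c * D n x v" by metis
  have cauchy: "\<exists>N. \<forall>m\<ge>N. \<forall>n\<ge>N. \<forall>x\<in>S. \<forall>h. norm (D n x h - D m x h) \<le> e * norm h" if e: "e > 0" for e
  proof -
    \<comment> \<open>Two errors of \<open>e * r / 4\<close> bound the difference of the functions
      by \<open>e * r / 2\<close>; the Cauchy estimate at radius \<open>r / 2\<close> turns this
      into \<open>e\<close>.\<close>
    have "e * r / 4 > 0" using e r by simp
    then obtain N where N: "\<And>n x. n \<ge> N \<Longrightarrow> x \<in> cball p r \<Longrightarrow> dist (f n x) (g x) < e * r / 4"
      using r(3) unfolding uniform_limit_iff eventually_sequentially by meson
    have "norm (D n x h - D m x h) \<le> e * norm h" if "m \<ge> N" "n \<ge> N" "x \<in> S" for m n x h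
    proof -
      have "norm (D n x h - D m x h) \<le> (e * r / 2) / (r / 2) * norm h"
      proof (rule mv_Cauchy_estimate[where g = "\<lambda>y. f n y - f m y" and x = x and U = U])
        show "mv_holomorphic_on (\<lambda>y. f n y - f m y) U" by (intro mv_hol_intros f)
        show "cball x (r / 2) \<subseteq> U" using cb[OF \<open>x \<in> S\<close>] r(2) by blast
        show "((\<lambda>y. f n y - f m y) has_derivative (\<lambda>h. D n x h - D m x h)) (at x)"
          by (intro has_derivative_diff D that)
        show "D n x (c *s v) - D m x (c *s v) = c * (D n x v - D m x v)" for c v
          by (simp add: D(2) \<open>x \<in> S\<close> algebra_simps)
        fix y assume "y \<in> cball x (r / 2)"
        hence y: "y \<in> cball p r" using cb \<open>x \<in> S\<close> by blast
        have "dist (f n y) (f m y) \<le> dist (f n y) (g y) + dist (f m y) (g y)"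
          by (metis dist_commute dist_triangle)
        also have "\<dots> \<le> e * r / 4 + e * r / 4" using N[OF _ y] that by (intro add_mono) (auto intro: less_imp_le)
        finally show "norm (f n y - f m y) \<le> e * r / 2" by (simp add: dist_norm)
      qed (use r in auto)
      thus ?thesis using r by simp
    qed
    thus ?thesis by blast
  qed
  define G where "G = (\<lambda>x h. lim (\<lambda>n. D n x h))"
  have lim_G: "(\<lambda>n. D n x h) \<longlonglongrightarrow> G x h" if x: "x \<in> S" for x h
  proof -
    have "Cauchy (\<lambda>n. D n x h)"
    proof (rule metric_CauchyI)
      fix e :: real assume "e > 0"
      hence "e / (norm h + 1) > 0" by (simp add: add_nonneg_pos)
      from cauchy[OF this] obtain N where
        N: "\<And>m n. m \<ge> N \<Longrightarrow> n \<ge> N \<Longrightarrow> norm (D n x h - D m x h) \<le> e / (norm h + 1) * norm h"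
        using x by blast
      have "e * norm h < e * (norm h + 1)" using \<open>e > 0\<close> by simp
      hence "e / (norm h + 1) * norm h < e" by (simp add: pos_divide_less_eq add_nonneg_pos)
      thus "\<exists>M. \<forall>m\<ge>M. \<forall>n\<ge>M. dist (D m x h) (D n x h) < e"
        using N by (intro exI[of _ N] allI impI, unfold dist_norm) (rule le_less_trans)
    qed
    thus ?thesis unfolding G_def by (simp add: Cauchy_convergent_iff convergent_LIMSEQ_iff)
  qed
  have S: "convex S" "p \<in> S" "open S" using r by (auto simp: S_def)
  have fg: "(\<lambda>n. f n x) \<longlonglongrightarrow> g x" if "x \<in> S" for x
  proof -
    have "x \<in> cball p r" using that r(1) by (auto simp: S_def)
    thus ?thesis by (rule tendsto_uniform_limitI[OF r(3)])
  qed
  obtain g2 where g2: "\<forall>x\<in>S. (\<lambda>n. f n x) \<longlonglongrightarrow> g2 x \<and> (g2 has_derivative G x) (at x within S)"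
  proof -
    have "\<exists>g. \<forall>x\<in>S. (\<lambda>n. f n x) \<longlonglongrightarrow> g x \<and> (g has_derivative G x) (at x within S)"
    proof (rule has_derivative_sequence[where f = f and f' = D and ?x0.0 = p and l = "g p"])
      show "(f n has_derivative D n x) (at x within S)" if "x \<in> S" for n x
        using D(1)[OF that] by (rule has_derivative_at_withinI)
      fix e :: real assume "e > 0"
      then obtain N where N: "\<And>m n x h. m \<ge> N \<Longrightarrow> n \<ge> N \<Longrightarrow> x \<in> S \<Longrightarrow> norm (D n x h - D m x h) \<le> e * norm h"
        using cauchy by blast
      have "norm (D n x h - G x h) \<le> e * norm h" if "n \<ge> N" "x \<in> S" for n x h
      proof (rule tendsto_upperbound)
        show "(\<lambda>m. norm (D n x h - D m x h)) \<longlonglongrightarrow> norm (D n x h - G x h)"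
          by (intro tendsto_intros lim_G that)
        show "\<forall>\<^sub>F m in sequentially. norm (D n x h - D m x h) \<le> e * norm h"
          unfolding eventually_sequentially using N that by blast
      qed simp
      thus "\<forall>\<^sub>F n in sequentially. \<forall>x\<in>S. \<forall>h. norm (D n x h - G x h) \<le> e * norm h"
        unfolding eventually_sequentially by blast
    qed (use S fg in auto)
    thus ?thesis by (rule exE) (rule that)
  qed
  have "(g2 has_derivative G p) (at p)" 
    using conjunct2[OF bspec[OF g2 S(2)]] unfolding at_within_open[OF S(2,3)] .
  from this S(3,2) have "(g has_derivative G p) (at p)"
  proof (rule has_derivative_transform_within_open)
    fix x assume "x \<in> S"
    then show "g2 x = g x"

      using LIMSEQ_unique[OF conjunct1[OF bspec[OF g2]] fg] by blast
  qed
  moreover have "G p (c *s v) = c * G p v" for c v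
  proof (rule LIMSEQ_unique[OF lim_G[OF S(2)]])
    show "(\<lambda>n. D n p (c *s v)) \<longlonglongrightarrow> c * G p v"
      unfolding D(2)[OF S(2)] by (intro tendsto_intros lim_G S(2))
  qed
  ultimately show "\<exists>D. (g has_derivative D) (at p) \<and> (\<forall>c v. D (c *s v) = c * D v)" by (intro exI[of _ "G p"] conjI allI)
qed

section \<open>The modified gamma function in sectors\<close>

lemma Lambda_eq:
  assumes "w \<noteq> 0"
  shows "Lambda w \<eta> = Gamma (w + \<eta>) * exp w / (of_real (sqrt (2 * pi)) * exp ((\<eta> + w - 1/2) * Ln w))"
  using assms by (simp add: Lambda_def powr_def)

lemma sqrt_2pi_sq: "complex_of_real (sqrt (2 * pi)) * complex_of_real (sqrt (2 * pi)) = 2 * of_real pi"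
proof -
  have "sqrt (2 * pi) * sqrt (2 * pi) = 2 * pi" by simp
  thus ?thesis by (metis of_real_mult of_real_numeral)
qed

text \<open>In the lower half-plane the principal branches satisfy Ln (- w) = Ln w + \<pi> \<i>, so
  the two powers of w cancel up to exp u. Euler's reflection formula contributes \<pi> / cos (\<pi>
  (x - w)), and together they form the factor that the quantum dilogarithm produces under
  translation.\<close>

lemma Lambda_reflection:
  assumes "Im w < 0"
  shows "Lambda w (1/2 - x) * Lambda (- w) (1/2 + x) = 1 / (1 + exp (2 * of_real pi * \<i> * (x - w)))"
proof -
  have w: "w \<noteq> 0" using assms by auto
  define u where "u = of_real pi * \<i> * (x - w)"
  have Ln: "Ln (- w) = Ln w + of_real pi * \<i>"
    using Ln_minus[OF w] assms by (simp add: not_le mult.commute)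
  have "Gamma (w + (1/2 - x)) * Gamma (- w + (1/2 + x)) = of_real pi / sin (of_real pi * (w + (1/2 - x)))"
    using Gamma_reflection_complex[of "w + (1/2 - x)"] by (simp add: algebra_simps)
  also have "sin (of_real pi * (w + (1/2 - x))) = cos (of_real pi * (x - w))"
    by (simp add: cos_sin_eq algebra_simps)
  also have "\<dots> = (exp u + exp (- u)) / 2"
    by (simp add: cos_exp_eq u_def mult_ac)
  finally have G: "Gamma (w + (1/2 - x)) * Gamma (- w + (1/2 + x)) = of_real pi / ((exp u + exp (- u)) / 2)" .
  have E: "exp ((1/2 - x + w - 1/2) * Ln w) * exp ((1/2 + x + - w - 1/2) * Ln (- w)) = exp u"
    unfolding Ln exp_add[symmetric] by (simp add: u_def algebra_simps)
  have "Lambda w (1/2 - x) * Lambda (- w) (1/2 + x) =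
      (Gamma (w + (1/2 - x)) * Gamma (- w + (1/2 + x))) * (exp w * exp (- w)) /
      ((of_real (sqrt (2 * pi)) * of_real (sqrt (2 * pi))) *
        (exp ((1/2 - x + w - 1/2) * Ln w) * exp ((1/2 + x + - w - 1/2) * Ln (- w))))"
    using w by (simp add: Lambda_eq mult_ac)
  also have "\<dots> = 1 / ((exp u + exp (- u)) * exp u)"
    unfolding G E sqrt_2pi_sq by (simp add: exp_minus)
  also have "(exp u + exp (- u)) * exp u = 1 + exp (2 * u)"
    by (simp add: distrib_right flip: exp_add)
  finally show ?thesis by (simp add: u_def mult_ac)
qed

text \<open>The general term of Gudermann's series for Binet's function: a logarithm of the ratio of
  \<open>Lambda u 0\<close> to \<open>Lambda (u + 1) 0\<close>. Two separate logarithms, rather than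
  Ln (1 + 1/u), make this an algebraic identity under exp.\<close>

definition stirling_gap :: "complex \<Rightarrow> complex" where
  "stirling_gap u = (u + 1/2) * (Ln (u + 1) - Ln u) - 1"

section \<open>Logarithms of quotients and the Stirling series\<close>

lemma Ln_diff_eq:
  assumes "u \<noteq> 0" "v \<noteq> 0" "\<bar>Im (Ln u) - Im (Ln v)\<bar> < pi"
  shows "Ln u - Ln v = Ln (u / v)"
  by (rule Ln_unique[symmetric]) (use assms in \<open>auto simp: exp_diff\<close>)

text \<open>Points on the same side of the cut have arguments less than \<pi> apart, so no multiple
  of 2 \<pi> \<i> enters.\<close>

lemma Ln_diff_same_sign:
  assumes "Im u > 0 \<and> Im v > 0 \<or> Im u < 0 \<and> Im v < 0 \<or> Im u = 0 \<and> Im v = 0 \<and> Re u > 0 \<and> Re v > 0"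
  shows "Ln u - Ln v = Ln (u / v)"
proof (rule Ln_diff_eq)
  show uv: "u \<noteq> 0" "v \<noteq> 0" using assms by auto
  show "\<bar>Im (Ln u) - Im (Ln v)\<bar> < pi"
    using assms
  proof (elim disjE)
    assume "Im u > 0 \<and> Im v > 0"
    hence "0 < Im (Ln u) \<and> Im (Ln u) < pi" "0 < Im (Ln v) \<and> Im (Ln v) < pi"
      by (simp_all add: Im_Ln_pos_lt_imp)
    thus ?thesis by linarith
  next
    assume "Im u < 0 \<and> Im v < 0"
    hence "Im (Ln u) < 0" "Im (Ln v) < 0"
      using Im_Ln_pos_le[OF uv(1)] Im_Ln_pos_le[OF uv(2)] Im_Ln_le_pi[OF uv(1)] Im_Ln_le_pi[OF uv(2)]
      by (simp_all add: not_le[symmetric])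
    thus ?thesis using mpi_less_Im_Ln[OF uv(1)] mpi_less_Im_Ln[OF uv(2)] by linarith
  next
    assume "Im u = 0 \<and> Im v = 0 \<and> Re u > 0 \<and> Re v > 0"
    thus ?thesis using Im_Ln_eq_0[OF uv(1)] Im_Ln_eq_0[OF uv(2)] by simp
  qed
qed

text \<open>Mean value bound: the remainder vanishes at 0 and has derivative y^2 / (1 + y), where 1
  + y has modulus at least 1/2 on the disc.\<close>

lemma norm_Ln_approx:
  assumes "norm x \<le> 1/2"
  shows "norm (Ln (1 + x) - (x - x\<^sup>2 / 2)) \<le> 2 * norm x ^ 3"
proof -
  let ?k = "\<lambda>x::complex. Ln (1 + x) - (x - x\<^sup>2 / 2)"
  have "norm (?k x - ?k 0) \<le> (2 * norm x ^ 2) * norm (x - 0)"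
  proof (rule field_differentiable_bound[where S = "cball 0 (norm x)" and f' = "\<lambda>x. x\<^sup>2 / (1 + x)"])
    fix y :: complex assume y: "y \<in> cball 0 (norm x)"
    have "norm (- y) \<le> 1/2" using y assms by simp
    hence re: "Re (1 + y) \<ge> 1/2" using complex_Re_le_cmod[of "- y"] by simp
    hence n: "norm (1 + y) \<ge> 1/2" using complex_Re_le_cmod[of "1 + y"] by linarith
    have nz: "1 + y \<noteq> 0" "1 + y \<notin> \<real>\<^sub>\<le>\<^sub>0" using n re by (force, auto simp: complex_nonpos_Reals_iff)
    have "(?k has_field_derivative (1 / (1 + y) - (1 - y))) (at y within cball 0 (norm x))"
      using nz by (auto intro!: derivative_eq_intros simp: inverse_eq_divide)
    moreover have "1 / (1 + y) - (1 - y) = y\<^sup>2 / (1 + y)"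
      using nz by (simp add: field_simps power2_eq_square)
    ultimately show "(?k has_field_derivative y\<^sup>2 / (1 + y)) (at y within cball 0 (norm x))" by simp
    have "norm (y\<^sup>2 / (1 + y)) \<le> norm x ^ 2 / (1/2)"
      unfolding norm_divide norm_power using y n by (intro frac_le power_mono) auto
    thus "norm (y\<^sup>2 / (1 + y)) \<le> 2 * norm x ^ 2" by simp
  qed auto
  thus ?thesis by (simp add: power2_eq_square power3_eq_cube)
qed

text \<open>With x = 1/u, the product (1/x + 1/2) (x - x^2/2) equals 1 - x^2/4: the weight u + 1/2
  is what cancels the first-order term. The constant 3 leaves room for 1/4 + 2 + 1/2.\<close>

lemma norm_stirling_gap:
  assumes "norm u \<ge> 2" "u \<notin> \<real>\<^sub>\<le>\<^sub>0"
  shows "norm (stirling_gap u) \<le> 3 / norm u ^ 2"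
proof -
  define x where "x = 1 / u"
  have u: "u \<noteq> 0" "u = 1 / x" "x \<noteq> 0" using assms(1) by (auto simp: x_def)
  have nx: "norm x \<le> 1/2" using assms(1) by (auto simp: x_def norm_divide divide_simps)
  have "Ln (u + 1) - Ln u = Ln ((u + 1) / u)"
    by (rule Ln_diff_same_sign) (use assms(2) in \<open>auto simp: complex_nonpos_Reals_iff\<close>)
  also have "(u + 1) / u = 1 + x" using u(1) by (simp add: x_def field_simps)
  finally have L: "Ln (u + 1) - Ln u = Ln (1 + x)" .
  define k where "k = Ln (1 + x) - (x - x\<^sup>2 / 2)"
  have k: "norm k \<le> 2 * norm x ^ 3" using norm_Ln_approx[OF nx] by (simp add: k_def)
  have "stirling_gap u = (1 / x + 1/2) * (x - x\<^sup>2 / 2 + k) - 1"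
    unfolding stirling_gap_def L by (simp add: k_def u(2))
  also have "\<dots> = - x\<^sup>2 / 4 + (1 / x + 1/2) * k"
    using u(3) by (simp add: field_simps power2_eq_square)
  finally have "norm (stirling_gap u) \<le> norm (x\<^sup>2 / 4) + norm ((1 / x + 1/2) * k)"
    using norm_triangle_ineq[of "- x\<^sup>2 / 4" "(1 / x + 1/2) * k"] by simp
  also have "norm ((1 / x + 1/2) * k) \<le> (1 / norm x + 1/2) * (2 * norm x ^ 3)"
    unfolding norm_mult using k norm_triangle_ineq[of "1 / x" "1/2"]
    by (intro mult_mono) (auto simp: norm_divide)
  also have "\<dots> = 2 * norm x ^ 2 + norm x * norm x ^ 2"
    using u(3) by (simp add: field_simps power2_eq_square power3_eq_cube)
  also have "\<dots> \<le> 2 * norm x ^ 2 + 1/2 * norm x ^ 2"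
    using nx by (intro add_left_mono mult_right_mono) auto
  also have "norm (x\<^sup>2 / 4) + (2 * norm x ^ 2 + 1/2 * norm x ^ 2) \<le> 3 * norm x ^ 2"
    by (simp add: norm_power norm_divide)
  finally have "norm (stirling_gap u) \<le> 3 * norm x ^ 2" by simp
  thus ?thesis by (simp add: x_def norm_divide power_divide)
qed

lemma Lambda_0_step:
  assumes "w \<notin> \<real>\<^sub>\<le>\<^sub>0"
  shows "Lambda w 0 = Lambda (w + 1) 0 * exp (stirling_gap w)"
proof -
  have w: "w \<noteq> 0" "w \<notin> \<int>\<^sub>\<le>\<^sub>0" "w + 1 \<noteq> 0"
    using assms nonpos_Ints_subset_nonpos_Reals by (auto simp: complex_nonpos_Reals_iff complex_eq_iff)
  have "Lambda (w + 1) 0 * exp (stirling_gap w) =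
      w * Gamma w * exp (w + 1 + stirling_gap w) / (of_real (sqrt (2 * pi)) * exp ((w + 1 - 1/2) * Ln (w + 1)))"
    using w by (simp add: Lambda_eq Gamma_plus1 exp_add)
  also have "\<dots> = Gamma w / of_real (sqrt (2 * pi)) *
      (exp (Ln w) * exp (w + 1 + stirling_gap w) / exp ((w + 1 - 1/2) * Ln (w + 1)))"
    using w by simp
  also have "exp (Ln w) * exp (w + 1 + stirling_gap w) / exp ((w + 1 - 1/2) * Ln (w + 1)) =
      exp w / exp ((w - 1/2) * Ln w)"
    unfolding exp_add[symmetric] exp_diff[symmetric] by (simp add: stirling_gap_def algebra_simps)
  finally show ?thesis using w by (simp add: Lambda_eq)
qed

lemma nonpos_Reals_add_of_nat: "w \<notin> \<real>\<^sub>\<le>\<^sub>0 \<Longrightarrow> w + of_nat n \<notin> (\<real>\<^sub>\<le>\<^sub>0 :: complex set)"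
  by (auto simp: complex_nonpos_Reals_iff)

lemma Lambda_0_steps:
  assumes "w \<notin> \<real>\<^sub>\<le>\<^sub>0"
  shows "Lambda w 0 = Lambda (w + of_nat N) 0 * exp (\<Sum>n<N. stirling_gap (w + of_nat n))"
proof (induction N)
  case (Suc N)
  show ?case
    using Suc Lambda_0_step[OF nonpos_Reals_add_of_nat[OF assms, of N]]
    by (simp add: exp_add mult_ac add_ac)
qed simp

text \<open>The sectors about the negative real axis are parametrised by \<open>c\<close> in the form in which they enter the
  estimate of the Stirling series.\<close>

definition stirling_cone :: "real \<Rightarrow> complex set" where
  "stirling_cone c = {w. \<forall>x\<ge>0. c * (norm w + x) \<le> norm (w + of_real x)}"

lemma stirling_coneD: "w \<in> stirling_cone c \<Longrightarrow> 0 \<le> x \<Longrightarrow> c * (norm w + x) \<le> norm (w + of_real x)"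
  by (auto simp: stirling_cone_def)

lemma stirling_cone_nonpos_Reals:
  assumes "w \<in> stirling_cone c" "c > 0" "w \<noteq> 0"
  shows "w \<notin> \<real>\<^sub>\<le>\<^sub>0"
proof
  assume "w \<in> \<real>\<^sub>\<le>\<^sub>0"
  then obtain r where r: "w = of_real r" "r \<le> 0" by (auto elim: nonpos_Reals_cases)
  \<comment> \<open>The inequality of the sector is tested at x = - r, where w + x vanishes.\<close>
  have "c * (norm w + (- r)) \<le> norm (w + of_real (- r))" using r by (intro stirling_coneD[OF assms(1)]) auto
  hence "c * (- r) \<le> 0" using r by simp
    thus False using assms(2,3) r mult_pos_pos[of c "- r"] by auto
qed

text \<open>Telescoping; the factor 2 compares a (a + 1) with a^2 for a \<ge> 1.\<close>

lemma sum_inverse_squares_le: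
  fixes R :: real
  assumes "R \<ge> 1"
  shows "(\<Sum>n<N. 1 / (R + of_nat n) ^ 2) \<le> 2 * (1 / R - 1 / (R + of_nat N))"
proof (induction N)
  case (Suc N)
  define a where "a = R + of_nat N"
  have a: "a \<ge> 1" using assms by (simp add: a_def)
  have "1 / a ^ 2 \<le> 2 * (1 / a - 1 / (a + 1))"
    using a by (simp add: divide_simps power2_eq_square)
  thus ?case using Suc by (simp add: a_def add_ac)
qed simp

text \<open>The sector gives |w + n| \<ge> c (|w| + n), so the quadratic decay of the terms sums to
  a multiple of 1/|w|. The bound is independent of N, which permits the passage to the limit in
  N.\<close>

lemma sum_stirling_gap_le:
  assumes "w \<in> stirling_cone c" "0 < c" "norm w \<ge> 2 / c" "norm w \<ge> 1"
  shows "norm (\<Sum>n<N. stirling_gap (w + of_nat n)) \<le> 6 / c\<^sup>2 / norm w"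
proof -
  have "norm (\<Sum>n<N. stirling_gap (w + of_nat n)) \<le> (\<Sum>n<N. 3 / c\<^sup>2 * (1 / (norm w + of_nat n) ^ 2))"
  proof (rule order_trans[OF norm_sum sum_mono])
    fix n
    have le: "c * (norm w + real n) \<le> norm (w + of_nat n)"
      using stirling_coneD[OF assms(1), of "real n"] by simp
    have "2 = c * (2 / c)" using assms by simp
    also have "\<dots> \<le> c * (norm w + real n)" using assms by (intro mult_left_mono) auto
    finally have 2: "2 \<le> c * (norm w + real n)" .
    have "w \<notin> \<real>\<^sub>\<le>\<^sub>0" using stirling_cone_nonpos_Reals[OF assms(1,2)] assms(4) by force
    hence "norm (stirling_gap (w + of_nat n)) \<le> 3 / norm (w + of_nat n) ^ 2"
      using 2 le by (intro norm_stirling_gap nonpos_Reals_add_of_nat) auto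
    also have "\<dots> \<le> 3 / (c * (norm w + real n)) ^ 2"
    proof (rule divide_left_mono)
      show "(c * (norm w + real n)) ^ 2 \<le> norm (w + of_nat n) ^ 2" using le 2 by (intro power_mono) auto
      have "norm (w + of_nat n) > 0" "c * (norm w + real n) > 0" using 2 le by linarith+
      thus "0 < norm (w + of_nat n) ^ 2 * (c * (norm w + real n)) ^ 2"
        by (metis mult_pos_pos zero_less_power)
    qed auto
    finally show "norm (stirling_gap (w + of_nat n)) \<le> 3 / c\<^sup>2 * (1 / (norm w + of_nat n) ^ 2)"
      by (simp add: power_mult_distrib)
  qed
  also have "\<dots> = 3 / c\<^sup>2 * (\<Sum>n<N. 1 / (norm w + of_nat n) ^ 2)" by (simp only: sum_distrib_left)
  also have "\<dots> \<le> 3 / c\<^sup>2 * (2 * (1 / norm w - 1 / (norm w + of_nat N)))"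
    using assms by (intro mult_left_mono sum_inverse_squares_le) auto
  also have "\<dots> \<le> 3 / c\<^sup>2 * (2 * (1 / norm w))"
    using assms by (intro mult_left_mono) auto
  finally show ?thesis by simp
qed

section \<open>Limits at infinity inside a sector\<close>

abbreviation at_inf_in :: "complex set \<Rightarrow> complex filter" where
  "at_inf_in K \<equiv> inf at_infinity (principal K)"

lemma eventually_at_inf_in:
  "eventually P (at_inf_in K) \<longleftrightarrow> (\<exists>b. \<forall>w\<in>K. norm w \<ge> b \<longrightarrow> P w)"
  unfolding eventually_inf_principal eventually_at_infinity by blast

lemma filterlim_at_inf_in: "filterlim (\<lambda>w. w) at_infinity (at_inf_in K)"
  by (simp add: filterlim_def)

text \<open>The only danger is that adding \<eta> crosses the cut. For Re w \<ge> 0 the arguments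
  are too small for this; for Re w < 0 the sector forces |Im w| > |Im \<eta>|, so both points stay
  on one side.\<close>

lemma Ln_add_eventually:
  assumes c: "c > 0"
  shows "eventually (\<lambda>w. Ln (w + \<eta>) - Ln w = Ln (1 + \<eta> / w)) (at_inf_in (stirling_cone c))"
  unfolding eventually_at_inf_in
\<comment> \<open>The threshold secures both \<open>2 * (norm \<eta> + 1) \<le> norm w\<close>,
  which makes \<eta>/w small, and \<open>norm \<eta> + 1 \<le> c * norm w\<close>, which keeps w
  away from the cut.\<close>
proof (rule exI[of _ "(norm \<eta> + 1) * (2 + 1 / c)"], intro ballI impI)
  fix w assume w: "w \<in> stirling_cone c" "(norm \<eta> + 1) * (2 + 1 / c) \<le> norm w"
  have "2 * (norm \<eta> + 1) + (norm \<eta> + 1) / c \<le> norm w" using w(2) by (simp add: algebra_simps add_divide_distrib)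
  moreover have "(norm \<eta> + 1) / c \<ge> 0" using c by simp
  ultimately have e: "(norm \<eta> + 1) / c \<le> norm w" "2 * (norm \<eta> + 1) \<le> norm w"
    using norm_ge_zero[of \<eta>] by (smt (verit))+
  have w0: "w \<noteq> 0" and small: "norm (\<eta> / w) < 1"
  proof -
    have w: "norm \<eta> < norm w" "norm w > 0" using e(2) norm_ge_zero[of \<eta>] by (smt (verit))+
    thus "w \<noteq> 0" by auto
    show "norm (\<eta> / w) < 1" using w by (auto simp: norm_divide divide_less_eq)
  qed
  have w1: "w + \<eta> = w * (1 + \<eta> / w)" using w0 by (simp add: field_simps)
  show "Ln (w + \<eta>) - Ln w = Ln (1 + \<eta> / w)"
  proof (cases "Re w \<ge> 0")
    case True
    have re: "Re (1 + \<eta> / w) > 0" using small complex_Re_le_cmod[of "- (\<eta> / w)"] by simp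
    hence nz: "1 + \<eta> / w \<noteq> 0" by (metis less_irrefl zero_complex.sel(1))
    have "\<bar>Im (Ln (1 + \<eta> / w))\<bar> < pi / 2" using Re_Ln_pos_lt[OF nz] re by simp
    moreover have "\<bar>Im (Ln w)\<bar> \<le> pi / 2" using Re_Ln_pos_le[OF w0] True by simp
    ultimately have "Ln (w * (1 + \<eta> / w)) = Ln w + Ln (1 + \<eta> / w)"
      using w0 nz by (intro Ln_times_simple) auto
    thus ?thesis by (simp add: w1)
  next
    case False
    \<comment> \<open>The choice x = - Re w moves w onto the imaginary axis, where the modulus is
      |Im w|.\<close>
    have "c * (norm w + (- Re w)) \<le> norm (w + of_real (- Re w))"
      using False by (intro stirling_coneD[OF w(1)]) auto
    also have "w + of_real (- Re w) = \<i> * of_real (Im w)" by (simp add: complex_eq_iff)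
    finally have "c * norm w \<le> \<bar>Im w\<bar>"
      using False c by (simp add: norm_mult algebra_simps) (smt (verit) mult_pos_neg)
    moreover have "norm \<eta> + 1 \<le> c * norm w" using e(1) c by (simp add: field_simps)
    ultimately have "\<bar>Im \<eta>\<bar> < \<bar>Im w\<bar>" using abs_Im_le_cmod[of \<eta>] by linarith
    hence "Im (w + \<eta>) > 0 \<and> Im w > 0 \<or> Im (w + \<eta>) < 0 \<and> Im w < 0" by auto
    hence "Ln (w + \<eta>) - Ln w = Ln ((w + \<eta>) / w)" by (intro Ln_diff_same_sign) auto
    thus ?thesis using w0 by (simp add: field_simps)
  qed
qed

text \<open>Both sides contain the same value of Gamma, at w + \<eta>; only elementary factors
  differ. This reduces the asymptotics to \<eta> = 0.\<close>

lemma Lambda_shift_ratio: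
  assumes "w \<noteq> 0" "w + \<eta> \<noteq> 0"
  shows "Lambda w \<eta> = Lambda (w + \<eta>) 0 * exp ((w + \<eta> - 1/2) * (Ln (w + \<eta>) - Ln w) - \<eta>)"
proof -
  have "Lambda (w + \<eta>) 0 * exp ((w + \<eta> - 1/2) * (Ln (w + \<eta>) - Ln w) - \<eta>) =
     Gamma (w + \<eta>) / of_real (sqrt (2 * pi)) * (exp (w + \<eta>) *
       exp ((w + \<eta> - 1/2) * (Ln (w + \<eta>) - Ln w) - \<eta>) / exp ((w + \<eta> - 1/2) * Ln (w + \<eta>)))"
    using assms by (simp add: Lambda_eq)
  also have "exp (w + \<eta>) *
       exp ((w + \<eta> - 1/2) * (Ln (w + \<eta>) - Ln w) - \<eta>) / exp ((w + \<eta> - 1/2) * Ln (w + \<eta>)) =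
       exp w / exp ((w + \<eta> - 1/2) * Ln w)"
    unfolding exp_add[symmetric] exp_diff[symmetric] by (simp add: algebra_simps)
  finally show ?thesis using assms by (simp add: Lambda_eq add_ac)
qed

text \<open>With s = 1/w, the expression w Ln (1 + \<eta>/w) is the difference quotient of Ln (1 +
  \<eta> s) at 0 and tends to \<eta>, so the exponent tends to \<eta> - \<eta> = 0.\<close>

lemma tendsto_stirling_ratio:
  assumes c: "c > 0"
  shows "((\<lambda>w. exp ((w + \<eta> - 1/2) * (Ln (w + \<eta>) - Ln w) - \<eta>)) \<longlongrightarrow> 1) (at_inf_in (stirling_cone c))"
    (is "(_ \<longlongrightarrow> _) ?F")
proof -
  have inv: "filterlim (\<lambda>w. inverse w) (at 0) ?F"
    using filterlim_at_inf_in[of "stirling_cone c"]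
    unfolding filterlim_inverse_at_iff[symmetric, where g = "\<lambda>w. w"] .
  have inv0: "((\<lambda>w. inverse w) \<longlongrightarrow> 0) ?F" using inv by (simp add: filterlim_at)
  have "((\<lambda>s. Ln (1 + \<eta> * s)) has_field_derivative \<eta>) (at 0)"
    by (auto intro!: derivative_eq_intros)
  hence "((\<lambda>s. Ln (1 + \<eta> * s) / s) \<longlongrightarrow> \<eta>) (at 0)"
    by (simp add: has_field_derivative_iff)
  from filterlim_compose[OF this inv]
  have 1: "((\<lambda>w. w * Ln (1 + \<eta> / w)) \<longlongrightarrow> \<eta>) ?F" by (simp add: divide_inverse mult_ac)
  have "((\<lambda>w. Ln (1 + \<eta> * inverse w)) \<longlongrightarrow> Ln (1 + \<eta> * 0)) ?F"
    by (intro tendsto_intros inv0) auto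
  hence 2: "((\<lambda>w. (\<eta> - 1/2) * Ln (1 + \<eta> / w)) \<longlongrightarrow> (\<eta> - 1/2) * 0) ?F"
    by (intro tendsto_mult tendsto_const) (simp add: divide_inverse)
  have "((\<lambda>w. exp (w * Ln (1 + \<eta> / w) + (\<eta> - 1/2) * Ln (1 + \<eta> / w) - \<eta>)) \<longlongrightarrow> exp (\<eta> + (\<eta> - 1/2) * 0 - \<eta>)) ?F"
    by (intro tendsto_intros 1 2)
  moreover have "\<forall>\<^sub>F w in ?F. exp (w * Ln (1 + \<eta> / w) + (\<eta> - 1/2) * Ln (1 + \<eta> / w) - \<eta>) =
      exp ((w + \<eta> - 1/2) * (Ln (w + \<eta>) - Ln w) - \<eta>)"
    using Ln_add_eventually[OF c, of \<eta>] by eventually_elim (simp add: algebra_simps)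
  ultimately have "((\<lambda>w. exp ((w + \<eta> - 1/2) * (Ln (w + \<eta>) - Ln w) - \<eta>)) \<longlongrightarrow> exp (\<eta> + (\<eta> - 1/2) * 0 - \<eta>)) ?F"
    by (rule Lim_transform_eventually)
  thus ?thesis by simp
qed

section \<open>The limit along the integers and its transfer to sectors\<close>

lemma stirling_cone_of_nat: "of_nat n \<in> stirling_cone 1"
  unfolding stirling_cone_def
proof (intro CollectI allI impI)
  fix x :: real assume "x \<ge> 0"
  have "of_nat n + of_real x = complex_of_real (real n + x)" by simp
  thus "1 * (norm (of_nat n :: complex) + x) \<le> norm (of_nat n + complex_of_real x)"
    using \<open>x \<ge> 0\<close> by (simp only: norm_of_real norm_of_nat) simp
qed

lemma filterlim_of_nat_at_inf_in: "filterlim of_nat (at_inf_in (stirling_cone 1)) sequentially"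
proof -
  have "filterlim (of_nat :: nat \<Rightarrow> complex) at_infinity sequentially"
    by (rule tendsto_of_nat)
  thus ?thesis unfolding filterlim_inf filterlim_principal by (simp add: stirling_cone_of_nat)
qed

text \<open>\<open>Lambda_0_steps\<close> at w = 1 expresses the values at integers by partial sums
  of the gaps, which are summable by their quadratic decay. This gives existence of the limit only;
  its value comes from the reflection formula.\<close>

lemma Lambda_0_nat_convergent: "\<exists>C. (\<lambda>N. Lambda (of_nat N) 0) \<longlonglongrightarrow> C"
proof -
  have "summable (\<lambda>n. stirling_gap (1 + of_nat n))"
  proof (rule summable_comparison_test_ev)
    show "summable (\<lambda>n. 3 * inverse (of_nat (Suc n) ^ 2) :: real)"
      by (intro summable_mult, subst summable_Suc_iff) (rule inverse_power_summable, simp)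
    show "\<forall>\<^sub>F n in sequentially. norm (stirling_gap (1 + of_nat n)) \<le> 3 * inverse (of_nat (Suc n) ^ 2)"
      using eventually_ge_at_top[of "1::nat"]
    proof eventually_elim
      case (elim n)
      have "norm (of_nat (Suc n) :: complex) \<ge> 2" unfolding norm_of_nat using elim by simp
      hence "norm (stirling_gap (of_nat (Suc n))) \<le> 3 / norm (of_nat (Suc n) :: complex) ^ 2"
        by (intro norm_stirling_gap) (auto simp: complex_nonpos_Reals_iff)
      thus ?case unfolding norm_of_nat by (simp add: divide_inverse)
    qed
  qed
  hence "(\<lambda>N. \<Sum>n<N. stirling_gap (1 + of_nat n)) \<longlonglongrightarrow> (\<Sum>n. stirling_gap (1 + of_nat n))"
    by (rule summable_LIMSEQ)
  hence "(\<lambda>N. Lambda 1 0 * exp (- (\<Sum>n<N. stirling_gap (1 + of_nat n)))) \<longlonglongrightarrow>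
      Lambda 1 0 * exp (- (\<Sum>n. stirling_gap (1 + of_nat n)))"
    by (intro tendsto_intros)
  moreover have "Lambda 1 0 * exp (- (\<Sum>n<N. stirling_gap (1 + of_nat n))) = Lambda (of_nat (Suc N)) 0" for N
    using Lambda_0_steps[of 1 N] by (simp add: exp_minus)
  ultimately have "(\<lambda>N. Lambda (of_nat (Suc N)) 0) \<longlonglongrightarrow> Lambda 1 0 * exp (- (\<Sum>n. stirling_gap (1 + of_nat n)))"
    by simp
  thus ?thesis by (intro exI) (rule LIMSEQ_imp_Suc)
qed

text \<open>Gauss's product says that Gamma (N + w) is asymptotic to Gamma (N) N^w, so
  \<open>Lambda N w\<close> has the same limit as \<open>Lambda N 0\<close>;
  \<open>Lambda_shift_ratio\<close> converts this into a statement about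
  \<open>Lambda (w + N) 0\<close>.\<close>

lemma Lambda_0_add_nat_tendsto:
  assumes C: "(\<lambda>N. Lambda (of_nat N) 0) \<longlonglongrightarrow> C" and w: "w \<notin> \<real>\<^sub>\<le>\<^sub>0"
  shows "(\<lambda>N. Lambda (w + of_nat N) 0) \<longlonglongrightarrow> C"
proof -
  have wi: "w \<notin> \<int>\<^sub>\<le>\<^sub>0" using w nonpos_Ints_subset_nonpos_Reals by auto
  let ?R = "\<lambda>u. exp ((u + w - 1/2) * (Ln (u + w) - Ln u) - w)"
  have R: "(\<lambda>N. ?R (of_nat N)) \<longlonglongrightarrow> 1"
    by (rule filterlim_compose[OF tendsto_stirling_ratio filterlim_of_nat_at_inf_in]) simp
  have "(\<lambda>N. Lambda (of_nat N) 0 * (Gamma w / Gamma_series' w N) / ?R (of_nat N)) \<longlonglongrightarrow> C * (Gamma w / Gamma w) / 1"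
    using wi by (intro tendsto_intros C R Gamma_series'_LIMSEQ) (auto simp: Gamma_eq_zero_iff)
  moreover have "\<forall>\<^sub>F N in sequentially. Lambda (of_nat N) 0 * (Gamma w / Gamma_series' w N) / ?R (of_nat N) =
      Lambda (w + of_nat N) 0"
    using eventually_gt_at_top[of 0]
  proof eventually_elim
    case (elim N)
    have N: "(of_nat N :: complex) \<noteq> 0" "of_nat N + w \<noteq> 0"
      using elim nonpos_Reals_add_of_nat[OF w, of N] by (auto simp: add.commute)
    have lnN: "Ln (of_nat N) = of_real (ln (of_nat N))"
      using Ln_of_real[of "real N"] elim by simp
    have p: "pochhammer w N \<noteq> 0" using wi pochhammer_eq_0_imp_nonpos_Int by blast
    have "fact (N - 1) = (Gamma (of_nat N) :: complex)"
      using elim Gamma_fact[of "N - 1", where ?'a = complex] by (simp add: of_nat_diff)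
    moreover have "Gamma w \<noteq> 0" using wi by (simp add: Gamma_eq_zero_iff)
    ultimately have "Gamma w / Gamma_series' w N = Gamma (of_nat N + w) / (Gamma (of_nat N) * exp (w * Ln (of_nat N)))"
      using pochhammer_Gamma[OF wi, of N] elim wi p
      by (simp add: Gamma_series'_def lnN add.commute)
    moreover have "Gamma (of_nat N :: complex) \<noteq> 0" using elim Gamma_complex_of_real[of "real N"] Gamma_real_pos[of "real N"] by (metis less_irrefl of_nat_0_less_iff of_real_eq_0_iff of_real_of_nat_eq)
    ultimately have "Lambda (of_nat N) 0 * (Gamma w / Gamma_series' w N) = Lambda (of_nat N) w"
      using N by (simp add: Lambda_eq exp_add[symmetric] algebra_simps)
    thus ?case using Lambda_shift_ratio[OF N] by (simp add: add.commute)
  qed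
  ultimately have "(\<lambda>N. Lambda (w + of_nat N) 0) \<longlonglongrightarrow> C * (Gamma w / Gamma w) / 1"
    by (rule Lim_transform_eventually)
  thus ?thesis using wi by (simp add: Gamma_eq_zero_iff)
qed

lemma norm_exp_minus_1_le:
  assumes "norm (x::complex) \<le> 1"
  shows "norm (exp x - 1) \<le> 3 * norm x"
proof -
  have "norm (exp x - (\<Sum>k\<le>0. x ^ k / fact k)) \<le> exp \<bar>Re x\<bar> * norm x ^ Suc 0 / fact 0"
    by (rule Taylor_exp)
  hence "norm (exp x - 1) \<le> exp \<bar>Re x\<bar> * norm x" by simp
  also have "exp \<bar>Re x\<bar> \<le> exp 1" using abs_Re_le_cmod[of x] assms by simp
  hence "exp \<bar>Re x\<bar> \<le> 3" using exp_le by linarith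
  hence "exp \<bar>Re x\<bar> * norm x \<le> 3 * norm x" by (intro mult_right_mono) auto
  finally show ?thesis .
qed

text \<open>For fixed w, N tends to infinity in a comparison of \<open>Lambda w 0\<close> with
  \<open>Lambda (w + N) 0\<close> that is uniform in N. Every sector therefore inherits the limit C
  along the integers, with error of order 1/|w|.\<close>

lemma Lambda_0_cone_tendsto_aux:
  assumes C: "(\<lambda>N. Lambda (of_nat N) 0) \<longlonglongrightarrow> C" and c: "c > 0"
  shows "((\<lambda>w. Lambda w 0) \<longlongrightarrow> C) (at_inf_in (stirling_cone c))"
proof -
  have "\<forall>\<^sub>F w in at_inf_in (stirling_cone c). norm (Lambda w 0 - C) \<le> norm C * (3 * (6 / c\<^sup>2)) / norm w"
    unfolding eventually_at_inf_in
  \<comment> \<open>The terms 2/c and 1 meet the conditions of \<open>sum_stirling_gap_le\<close>;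
    6/c^2 makes the exponent at most 1 in modulus, so that exp S - 1 is bounded linearly.\<close>
  proof (rule exI[of _ "2 / c + 1 + 6 / c\<^sup>2"], intro ballI impI)
    fix w assume w: "w \<in> stirling_cone c" "2 / c + 1 + 6 / c\<^sup>2 \<le> norm w"
    have n: "norm w \<ge> 2 / c" "norm w \<ge> 1" "norm w \<ge> 6 / c\<^sup>2"
      using w(2) divide_pos_pos[of 2 c] divide_pos_pos[of 6 "c\<^sup>2"] c zero_less_power[OF c, of 2] by linarith+
    have w0: "w \<notin> \<real>\<^sub>\<le>\<^sub>0" using stirling_cone_nonpos_Reals[OF w(1) c] n(2) by force
    have bd: "norm (Lambda w 0 - Lambda (w + of_nat N) 0) \<le>
        norm (Lambda (w + of_nat N) 0) * (3 * (6 / c\<^sup>2 / norm w))" for N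
    proof -
      define S where "S = (\<Sum>n<N. stirling_gap (w + of_nat n))"
      have S: "norm S \<le> 6 / c\<^sup>2 / norm w" unfolding S_def by (rule sum_stirling_gap_le) fact+
      also have "\<dots> \<le> 1" using n by (subst pos_divide_le_eq) auto
      finally have "norm (exp S - 1) \<le> 3 * norm S" by (rule norm_exp_minus_1_le)
      also have "\<dots> \<le> 3 * (6 / c\<^sup>2 / norm w)" using S by simp
      finally have E: "norm (exp S - 1) \<le> 3 * (6 / c\<^sup>2 / norm w)" .
      have "Lambda w 0 - Lambda (w + of_nat N) 0 = Lambda (w + of_nat N) 0 * (exp S - 1)"
        using Lambda_0_steps[OF w0, of N] by (simp add: S_def algebra_simps)
      thus ?thesis using mult_left_mono[OF E norm_ge_zero] by (simp add: norm_mult)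
    qed
    have "norm (Lambda w 0 - C) \<le> norm C * (3 * (6 / c\<^sup>2 / norm w))"
    proof (rule tendsto_le[OF _ _ _ always_eventually])
      show "(\<lambda>N. norm (Lambda (w + of_nat N) 0) * (3 * (6 / c\<^sup>2 / norm w))) \<longlonglongrightarrow> norm C * (3 * (6 / c\<^sup>2 / norm w))"
        by (intro tendsto_intros Lambda_0_add_nat_tendsto[OF C w0])
      show "(\<lambda>N. norm (Lambda w 0 - Lambda (w + of_nat N) 0)) \<longlonglongrightarrow> norm (Lambda w 0 - C)"
        by (intro tendsto_intros Lambda_0_add_nat_tendsto[OF C w0])
    qed (use bd in auto)
    thus "norm (Lambda w 0 - C) \<le> norm C * (3 * (6 / c\<^sup>2)) / norm w" by simp
  qed
  moreover have "((\<lambda>w. norm C * (3 * (6 / c\<^sup>2)) / norm w) \<longlongrightarrow> 0) (at_inf_in (stirling_cone c))"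
    by (rule real_tendsto_divide_at_top[OF tendsto_const])
      (rule filterlim_compose[OF filterlim_norm_at_top filterlim_at_inf_in])
  ultimately have "((\<lambda>w. Lambda w 0 - C) \<longlongrightarrow> 0) (at_inf_in (stirling_cone c))"
    by (rule Lim_null_comparison)
  thus ?thesis by (rule LIM_zero_cancel)
qed

text \<open>The reflection formula at x = 1/2 pairs \<eta> = 0 with \<eta> = 1; this turns the pair
  into two values at \<eta> = 0.\<close>

lemma Lambda_1_eq:
  assumes "v \<notin> \<real>\<^sub>\<le>\<^sub>0"
  shows "Lambda v 1 = Lambda v 0"
proof -
  have v: "v \<noteq> 0" "v \<notin> \<int>\<^sub>\<le>\<^sub>0" using assms nonpos_Ints_subset_nonpos_Reals by auto
  have "(1 + v - 1/2) * Ln v = Ln v + (0 + v - 1/2) * Ln v" by (simp add: algebra_simps)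
  hence "exp ((1 + v - 1/2) * Ln v) = exp (Ln v) * exp ((0 + v - 1/2) * Ln v)" by (simp only: exp_add)
  thus ?thesis using v by (simp add: Lambda_eq Gamma_plus1)
qed

lemma imaginary_in_stirling_cone: "\<i> * of_real y \<in> stirling_cone (1/2)"
  unfolding stirling_cone_def
proof (intro CollectI allI impI)
  fix x :: real assume x: "x \<ge> 0"
  let ?n = "norm (\<i> * of_real y + of_real x)"
  have "x \<le> ?n" using abs_Re_le_cmod[of "\<i> * of_real y + of_real x"] x by simp
  moreover have "\<bar>y\<bar> \<le> ?n" using abs_Im_le_cmod[of "\<i> * of_real y + of_real x"] by simp
  ultimately show "1 / 2 * (norm (\<i> * of_real y) + x) \<le> ?n" by (simp add: norm_mult)
qed

text \<open>The limit is found by letting \<open>w \<rightarrow> \<infinity>\<close> along both imaginary half-axes in the reflection formula.\<close>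

lemma Lambda_0_nat_tendsto_1: "(\<lambda>N. Lambda (of_nat N) 0) \<longlonglongrightarrow> 1"
proof -
  obtain C where C: "(\<lambda>N. Lambda (of_nat N) 0) \<longlonglongrightarrow> C" using Lambda_0_nat_convergent by blast
  have lim: "filterlim (\<lambda>N. \<i> * of_real (a * real N)) (at_inf_in (stirling_cone (1/2))) sequentially"
    if "a \<noteq> 0" for a
  proof -
    have "filterlim (\<lambda>N. (\<i> * of_real a) * (of_nat N :: complex)) at_infinity sequentially"
      using that by (intro tendsto_mult_filterlim_at_infinity[OF tendsto_const]) (auto intro: tendsto_of_nat)
    moreover have "(\<i> * of_real a) * of_nat N = \<i> * of_real (a * real N)" for N by simp
    ultimately show ?thesis
      unfolding filterlim_inf filterlim_principal by (simp only: imaginary_in_stirling_cone simp_thms eventually_True)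
  qed
  have L1: "(\<lambda>N. Lambda (\<i> * of_real (-1 * real N)) 0 * Lambda (\<i> * of_real (1 * real N)) 0) \<longlonglongrightarrow> C * C"
    by (intro tendsto_mult filterlim_compose[OF Lambda_0_cone_tendsto_aux[OF C] lim]) auto
  have EV: "\<forall>\<^sub>F N in sequentially. Lambda (\<i> * of_real (-1 * real N)) 0 * Lambda (\<i> * of_real (1 * real N)) 0 =
      1 / (1 - of_real (exp (- 2 * pi * real N)))"
    using eventually_gt_at_top[of 0]
  proof eventually_elim
    case (elim N)
    define w where "w = \<i> * of_real (-1 * real N)"
    have w: "Im w < 0" "- w = \<i> * of_real (1 * real N)" using elim by (simp_all add: w_def)
    have "Lambda w 0 * Lambda (- w) 0 = Lambda w 0 * Lambda (- w) 1"
      using w(1) elim unfolding w(2) by (subst Lambda_1_eq) (auto simp: complex_nonpos_Reals_iff)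
    also have "\<dots> = 1 / (1 + exp (2 * of_real pi * \<i> * (1/2 - w)))"
      using Lambda_reflection[OF w(1), of "1/2"] by simp
    also have "2 * of_real pi * \<i> * (1/2 - w) = of_real pi * \<i> + of_real (- 2 * pi * real N)"
      by (simp add: w_def algebra_simps)
    finally show ?case unfolding w(2)[symmetric] w_def[symmetric]
      unfolding exp_add exp_of_real by simp
  qed
  have L2: "(\<lambda>N. 1 / (1 - complex_of_real (exp (- 2 * pi * real N)))) \<longlonglongrightarrow> 1 / (1 - of_real 0)"
  proof (intro tendsto_intros)
    show "(\<lambda>N. exp (- 2 * pi * real N)) \<longlonglongrightarrow> 0"
    proof (rule filterlim_compose[OF exp_at_bot])
      show "filterlim (\<lambda>N. - 2 * pi * real N) at_bot sequentially"
        by (rule filterlim_tendsto_neg_mult_at_bot[OF tendsto_const])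
          (auto intro: filterlim_real_sequentially)
    qed
  qed auto
  have "C * C = 1 / (1 - of_real 0)"
    by (rule LIMSEQ_unique[OF Lim_transform_eventually[OF L1 EV] L2])
  hence "C * C = 1" by simp
  \<comment> \<open>C = 1 and C = -1 are left; positivity of Gamma on the positive reals
    decides.\<close>
  moreover have "Re C \<ge> 0"
  proof (rule tendsto_lowerbound)
    show "(\<lambda>N. Re (Lambda (of_nat N) 0)) \<longlonglongrightarrow> Re C" by (intro tendsto_intros C)
    show "\<forall>\<^sub>F N in sequentially. 0 \<le> Re (Lambda (of_nat N) 0)"
      using eventually_gt_at_top[of 0]
    proof eventually_elim
      case (elim N)
      have "Lambda (of_nat N) 0 = of_real (Gamma (real N) * exp (real N) / (sqrt (2 * pi) * exp ((real N - 1/2) * ln (real N))))"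
        using elim Ln_of_real[of "real N"] Gamma_complex_of_real[of "real N"]
        by (simp add: Lambda_eq exp_of_real[symmetric])
      thus ?case using elim Gamma_real_pos[of "real N"] by simp
    qed
  qed simp
  ultimately have "C = 1" by (metis square_eq_1_iff mult.commute one_complex.sel(1) uminus_complex.sel(1) neg_0_le_iff_le not_one_le_zero)
  thus ?thesis using C by simp
qed

text \<open>Far out, a fixed translation is absorbed by halving the constant, that is, by passing to
  a wider sector.\<close>

lemma add_in_stirling_cone:
  assumes "w \<in> stirling_cone c" "c > 0" "norm \<eta> * (1 + c / 2) \<le> c / 2 * norm w"
  shows "w + \<eta> \<in> stirling_cone (c / 2)"
  unfolding stirling_cone_def
proof (intro CollectI allI impI)
  fix x :: real assume x: "x \<ge> 0"
  have "c / 2 * (norm (w + \<eta>) + x) \<le> c / 2 * (norm w + norm \<eta> + x)"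
    using assms(2) norm_triangle_ineq[of w \<eta>] by (intro mult_left_mono) auto
  also have "\<dots> \<le> c * (norm w + x) - norm \<eta>"
  proof -
    have "c * x \<ge> 0" using assms(2) x by simp
    thus ?thesis using assms(3) by (simp add: field_simps)
  qed
  also have "\<dots> \<le> norm (w + of_real x) - norm \<eta>" using stirling_coneD[OF assms(1) x] by simp
  also have "\<dots> \<le> norm (w + \<eta> + of_real x)"
    using norm_triangle_ineq4[of "w + \<eta> + of_real x" \<eta>] by (simp add: algebra_simps)
  finally show "c / 2 * (norm (w + \<eta>) + x) \<le> norm (w + \<eta> + of_real x)" .
qed

theorem Lambda_stirling_cone:
  assumes c: "c > 0"
  shows "((\<lambda>w. Lambda w \<eta>) \<longlongrightarrow> 1) (at_inf_in (stirling_cone c))"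
proof -
  let ?F = "at_inf_in (stirling_cone c)"
  have big: "\<forall>\<^sub>F w in ?F. b \<le> norm w" for b
    unfolding eventually_at_inf_in by blast
  have mem: "\<forall>\<^sub>F w in ?F. w \<in> stirling_cone c"
    unfolding eventually_at_inf_in by blast
  have "filterlim (\<lambda>w. w + \<eta>) at_infinity ?F"
    by (rule tendsto_add_filterlim_at_infinity'[OF filterlim_at_inf_in tendsto_const])
  moreover have "\<forall>\<^sub>F w in ?F. w + \<eta> \<in> stirling_cone (c / 2)"
    using mem big[of "2 / c * (norm \<eta> * (1 + c / 2))"]
    by eventually_elim (use c in \<open>auto intro!: add_in_stirling_cone simp: field_simps\<close>)
  ultimately have "filterlim (\<lambda>w. w + \<eta>) (at_inf_in (stirling_cone (c / 2))) ?F"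
    by (simp add: filterlim_inf filterlim_principal)
  hence "((\<lambda>w. Lambda (w + \<eta>) 0) \<longlongrightarrow> 1) ?F"
    using c by (intro filterlim_compose[OF Lambda_0_cone_tendsto_aux[OF Lambda_0_nat_tendsto_1]]) auto
  hence "((\<lambda>w. Lambda (w + \<eta>) 0 * exp ((w + \<eta> - 1/2) * (Ln (w + \<eta>) - Ln w) - \<eta>)) \<longlongrightarrow> 1 * 1) ?F"
    by (intro tendsto_mult tendsto_stirling_ratio c)
  moreover have "\<forall>\<^sub>F w in ?F. Lambda (w + \<eta>) 0 * exp ((w + \<eta> - 1/2) * (Ln (w + \<eta>) - Ln w) - \<eta>) = Lambda w \<eta>"
    using big[of "norm \<eta> + 1"]
  proof eventually_elim
    case (elim w)
    have "w \<noteq> 0" using elim norm_ge_zero[of \<eta>] by (intro notI) simp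
    moreover have "w + \<eta> \<noteq> 0"
    proof
      assume "w + \<eta> = 0"
      hence "\<eta> = - w" by (simp add: add_eq_0_iff)
      thus False using elim by simp
    qed
    ultimately
    show ?case by (rule Lambda_shift_ratio[symmetric])
  qed
  ultimately have "((\<lambda>w. Lambda w \<eta>) \<longlongrightarrow> 1 * 1) ?F" by (rule Lim_transform_eventually)
  thus ?thesis by simp
qed


text \<open>Compactness: the pairs (w, x) with w in K, x \<ge> 0 and |w| + x = 1 form a compact set
  on which w + x has no zero, since K avoids the negative axis. The minimum of |w + x| there is c,
  and homogeneity extends the bound to all of K.\<close>

lemma closed_cone_subset_stirling_cone:
  assumes K: "closed_cone K" and neg: "\<And>w. w \<in> K \<Longrightarrow> w \<noteq> 0 \<Longrightarrow> w \<notin> \<real>\<^sub>\<le>\<^sub>0"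
  obtains c where "c > 0" "K \<subseteq> stirling_cone c"
proof (cases "K = {}")
  case True
  thus ?thesis using that[of 1] by simp
next
  case False
  define S :: "(complex \<times> real) set" where "S = {p. fst p \<in> K \<and> snd p \<ge> 0 \<and> norm (fst p) + snd p = 1}"
  have clK: "closed K" and scale: "\<And>r t. t \<in> K \<Longrightarrow> 0 < r \<Longrightarrow> of_real r * t \<in> K"
    using K unfolding closed_cone_def by simp_all
  have inS: "(of_real (1 / (norm w + x)) * w, x / (norm w + x)) \<in> S" if "w \<in> K" "x \<ge> 0" "norm w + x > 0" for w x

  proof -
    have "norm (of_real (1 / (norm w + x)) * w) = norm w / (norm w + x)"
      using that by (simp add: norm_mult del: of_real_divide of_real_add)
    moreover have "norm w / (norm w + x) + x / (norm w + x) = 1"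
      using that(3) by (simp add: add_divide_distrib[symmetric])
    moreover have "of_real (1 / (norm w + x)) * w \<in> K" using that by (intro scale) auto
    ultimately show ?thesis using that unfolding S_def mem_Collect_eq fst_conv snd_conv by simp
  qed
  have "closed S"
  proof -
    have "S = fst -` K \<inter> {p. 0 \<le> snd p} \<inter> {p. norm (fst p) + snd p = 1}" by (auto simp: S_def)
    moreover have "closed (fst -` K :: (complex \<times> real) set)" by (intro closed_vimage clK continuous_intros)
    moreover have "closed {p::complex \<times> real. 0 \<le> snd p}" "closed {p::complex \<times> real. norm (fst p) + snd p = 1}"
      by (intro closed_Collect_le closed_Collect_eq continuous_intros)+
    ultimately show ?thesis by (simp add: closed_Int)
  qed
  moreover have "S \<subseteq> cball 0 1 \<times> {0..1}"
  proof
    fix p assume "p \<in> S"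
    hence "norm (fst p) \<le> 1" "0 \<le> snd p" "snd p \<le> 1"
      using norm_ge_zero[of "fst p"] unfolding S_def mem_Collect_eq by linarith+
    thus "p \<in> cball 0 1 \<times> {0..1}" by (cases p) auto
  qed
    hence "bounded S" by (rule bounded_subset[OF bounded_Times[OF bounded_cball bounded_closed_interval]])
  ultimately have "compact S" by (simp add: compact_eq_bounded_closed)
  moreover have "S \<noteq> {}"
  proof -
    obtain w where "w \<in> K" using False by blast
    hence "(of_real (1 / (norm w + 1)) * w, 1 / (norm w + 1)) \<in> S" using norm_ge_zero[of w] by (intro inS) (auto simp: add_nonneg_pos)
    thus ?thesis by blast
  qed
  moreover have "continuous_on S (\<lambda>p. norm (fst p + of_real (snd p)))" by (intro continuous_intros)
  ultimately obtain m where m: "m \<in> S" "\<And>p. p \<in> S \<Longrightarrow> norm (fst m + of_real (snd m)) \<le> norm (fst p + of_real (snd p))"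
    using continuous_attains_inf[of S "\<lambda>p. norm (fst p + of_real (snd p))"] by auto
  define c where "c = norm (fst m + of_real (snd m))"
  have "fst m + of_real (snd m) \<noteq> 0"
  proof
    assume "fst m + of_real (snd m) = 0"
    hence e: "fst m = of_real (- snd m)" by (simp add: eq_neg_iff_add_eq_0)
    have "fst m = 0"
    proof (rule ccontr)
      assume "fst m \<noteq> 0"
      with m(1) have "fst m \<notin> \<real>\<^sub>\<le>\<^sub>0" by (intro neg) (auto simp: S_def)
      thus False using m(1) by (auto simp: e S_def complex_nonpos_Reals_iff)
    qed
    thus False using m(1) e by (auto simp: S_def)
  qed
  hence "c > 0" by (simp add: c_def)
  moreover have "K \<subseteq> stirling_cone c"
  proof
    fix w assume w: "w \<in> K"
    show "w \<in> stirling_cone c" unfolding stirling_cone_def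
    proof (intro CollectI allI impI)
      fix x :: real assume x: "x \<ge> 0"
      show "c * (norm w + x) \<le> norm (w + of_real x)"
      proof (cases "norm w + x > 0")
        case True
        have "c \<le> norm (of_real (1 / (norm w + x)) * w + of_real (x / (norm w + x)))"
          using m(2)[OF inS[OF w x True]] by (simp add: c_def)
        also have "of_real (1 / (norm w + x)) * w + of_real (x / (norm w + x)) = (w + of_real x) / of_real (norm w + x)"
          by (simp add: add_divide_distrib del: of_real_add)
        also have "norm \<dots> = norm (w + of_real x) / (norm w + x)"
          using True by (simp add: norm_divide del: of_real_add)
        finally show ?thesis using True by (simp add: field_simps)
      next
        case False
        hence "norm w + x = 0" using x norm_ge_zero[of w] by linarith
        thus ?thesis by simp
      qed
    qed
  qed
  ultimately show ?thesis by (rule that)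
qed

section \<open>Meromorphic functions along fibres\<close>

text \<open>Junk values make pointwise identities of meromorphic functions available only on a dense open set \<open>W\<close>. To
  restrict such an identity to the fibre \<open>{x. x $ i = c}\<close> one needs \<open>W\<close> to be dense in the fibre as well.\<close>

definition fibre_dense :: "'n \<Rightarrow> complex set \<Rightarrow> (complex ^ 'n) set \<Rightarrow> (complex ^ 'n) set \<Rightarrow> bool" where
  "fibre_dense i T V W \<longleftrightarrow> V \<subseteq> closure W \<and> (\<forall>q\<in>V. q $ i \<in> T \<longrightarrow> q \<in> closure {x\<in>W. x $ i = q $ i})"

lemma fibre_dense_dense: "fibre_dense i T V W \<Longrightarrow> V \<subseteq> closure W"
  by (simp add: fibre_dense_def)

lemma fibre_denseD: "fibre_dense i T V W \<Longrightarrow> q \<in> V \<Longrightarrow> q $ i \<in> T \<Longrightarrow> q \<in> closure {x\<in>W. x $ i = q $ i}"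
  by (simp add: fibre_dense_def)

lemma fibre_dense_refl: "fibre_dense i T V V"
  unfolding fibre_dense_def
  using closure_subset[of V] closure_subset[of "{x \<in> V. x $ i = q $ i}" for q] by auto

text \<open>The usual argument for dense open sets, run inside each fibre: a point of W1 is a limit
  of points of W2 in its own fibre, and openness of W1 keeps them in W1.\<close>

lemma fibre_dense_Int:
  assumes W1: "open W1" "W1 \<subseteq> V" "fibre_dense i T V W1" and W2: "fibre_dense i T V W2"
  shows "fibre_dense i T V (W1 \<inter> W2)"
  unfolding fibre_dense_def
proof (intro conjI ballI impI)
  show "V \<subseteq> closure (W1 \<inter> W2)"
    using dense_open_Int[OF W1(1,2)] fibre_dense_dense[OF W1(3)] fibre_dense_dense[OF W2] by blast
  fix q assume q: "q \<in> V" "q $ i \<in> T"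
  let ?G = "{x \<in> W1 \<inter> W2. x $ i = q $ i}"
  have "{x \<in> W1. x $ i = q $ i} \<subseteq> closure ?G"
  proof
    fix x assume x: "x \<in> {x \<in> W1. x $ i = q $ i}"
    hence "x \<in> closure {y \<in> W2. y $ i = x $ i}" using W1(2) q by (intro fibre_denseD[OF W2]) auto
    hence "x \<in> closure (W1 \<inter> {y \<in> W2. y $ i = x $ i})"
      using open_Int_closure_subset[OF W1(1)] x by blast
    moreover have "W1 \<inter> {y \<in> W2. y $ i = x $ i} = ?G" using x by auto
    ultimately show "x \<in> closure ?G" by simp
  qed
  hence "closure {x \<in> W1. x $ i = q $ i} \<subseteq> closure ?G" by (intro closure_minimal) auto
  thus "q \<in> closure ?G" using fibre_denseD[OF W1(3) q] by blast
qed

lemma fibre_dense_restrict: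
  assumes "fibre_dense i T V W" "open V'" "V' \<subseteq> V"
  shows "fibre_dense i T V' (V' \<inter> W)"
  unfolding fibre_dense_def
proof (intro conjI ballI impI)
  show "V' \<subseteq> closure (V' \<inter> W)" using dense_subset_open[OF fibre_dense_dense[OF assms(1)] assms(2,3)] .
  fix q assume q: "q \<in> V'" "q $ i \<in> T"
  have "q \<in> V' \<inter> closure {x\<in>W. x $ i = q $ i}" using fibre_denseD[OF assms(1)] q assms(3) by blast
  hence "q \<in> closure (V' \<inter> {x\<in>W. x $ i = q $ i})" using open_Int_closure_subset[OF assms(2)] by blast
  moreover have "V' \<inter> {x\<in>W. x $ i = q $ i} = {x \<in> V' \<inter> W. x $ i = q $ i}" by auto
  ultimately show "q \<in> closure {x \<in> V' \<inter> W. x $ i = q $ i}" by simp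
qed

text \<open>A meromorphic function that vanishes identically on no open set and neither vanishes nor has a pole
  identically along the fibres \<open>{x. x $ i = c}\<close> for \<open>c \<in> T\<close>.\<close>

definition fib_mero :: "'n \<Rightarrow> complex set \<Rightarrow> (complex ^ 'n \<Rightarrow> complex) \<Rightarrow> (complex ^ 'n) set \<Rightarrow> bool" where
  "fib_mero i T F U \<longleftrightarrow>
     (\<forall>q\<in>U. \<exists>V g h W. open V \<and> q \<in> V \<and> V \<subseteq> U \<and> mv_holomorphic_on g V \<and> mv_holomorphic_on h V \<and>
        open W \<and> W \<subseteq> V \<and> fibre_dense i T V W \<and> (\<forall>x\<in>W. g x \<noteq> 0 \<and> h x \<noteq> 0 \<and> F x = g x / h x))"

lemma fib_meroE:
  assumes "fib_mero i T F U" "q \<in> U"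
  obtains V g h W where "open V" "q \<in> V" "V \<subseteq> U" "mv_holomorphic_on g V" "mv_holomorphic_on h V"
    "open W" "W \<subseteq> V" "fibre_dense i T V W" "\<forall>x\<in>W. g x \<noteq> 0" "\<forall>x\<in>W. h x \<noteq> 0"
    "\<forall>x\<in>W. F x = g x / h x"
proof -
  obtain V g h W where "open V \<and> q \<in> V \<and> V \<subseteq> U \<and> mv_holomorphic_on g V \<and> mv_holomorphic_on h V \<and>
        open W \<and> W \<subseteq> V \<and> fibre_dense i T V W \<and> (\<forall>x\<in>W. g x \<noteq> 0 \<and> h x \<noteq> 0 \<and> F x = g x / h x)"
    using bspec[OF assms(1)[unfolded fib_mero_def] assms(2)] by (elim exE) (rule that)
  thus ?thesis using that[of V g h W] by simp
qed

lemma fib_meroI: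
  assumes "\<And>q. q \<in> U \<Longrightarrow> \<exists>V g h W. open V \<and> q \<in> V \<and> V \<subseteq> U \<and> mv_holomorphic_on g V \<and>
    mv_holomorphic_on h V \<and> open W \<and> W \<subseteq> V \<and> fibre_dense i T V W \<and>
    (\<forall>x\<in>W. g x \<noteq> 0 \<and> h x \<noteq> 0 \<and> F x = g x / h x)"
  shows "fib_mero i T F U"
  using assms unfolding fib_mero_def by blast

lemma fib_mero_subset:
  assumes "fib_mero i T F U" "open U'" "U' \<subseteq> U"
  shows "fib_mero i T F U'"
proof (rule fib_meroI)
  fix q assume q: "q \<in> U'"
  obtain V g h W where V: "open V" "q \<in> V" "V \<subseteq> U" "mv_holomorphic_on g V" "mv_holomorphic_on h V"
    "open W" "W \<subseteq> V" "fibre_dense i T V W" "\<forall>x\<in>W. g x \<noteq> 0" "\<forall>x\<in>W. h x \<noteq> 0"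
    "\<forall>x\<in>W. F x = g x / h x"
    by (rule fib_meroE[OF assms(1) subsetD[OF assms(3) q]])
  let ?V = "V \<inter> U'"
  have "fibre_dense i T ?V (?V \<inter> W)" using V(1) assms(2) by (intro fibre_dense_restrict[OF V(8)]) auto
  moreover have "mv_holomorphic_on g ?V" "mv_holomorphic_on h ?V"
    using mv_holomorphic_on_subset[OF V(4)] mv_holomorphic_on_subset[OF V(5)] by auto
  ultimately show "\<exists>V g h W. open V \<and> q \<in> V \<and> V \<subseteq> U' \<and> mv_holomorphic_on g V \<and>
    mv_holomorphic_on h V \<and> open W \<and> W \<subseteq> V \<and> fibre_dense i T V W \<and>
    (\<forall>x\<in>W. g x \<noteq> 0 \<and> h x \<noteq> 0 \<and> F x = g x / h x)"
    using V q assms(2) by (intro exI[of _ ?V] exI[of _ g] exI[of _ h] exI[of _ "?V \<inter> W"]) auto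
qed

lemma fib_mero_antimono:
  assumes "fib_mero i T F U" "T' \<subseteq> T"
  shows "fib_mero i T' F U"
proof (rule fib_meroI)
  fix q assume q: "q \<in> U"
  obtain V g h W where V: "open V" "q \<in> V" "V \<subseteq> U" "mv_holomorphic_on g V" "mv_holomorphic_on h V"
    "open W" "W \<subseteq> V" "fibre_dense i T V W" "\<forall>x\<in>W. g x \<noteq> 0" "\<forall>x\<in>W. h x \<noteq> 0"
    "\<forall>x\<in>W. F x = g x / h x" by (rule fib_meroE[OF assms(1) q])
  have "fibre_dense i T' V W" using V(8) assms(2) unfolding fibre_dense_def by blast
  thus "\<exists>V g h W. open V \<and> q \<in> V \<and> V \<subseteq> U \<and> mv_holomorphic_on g V \<and> mv_holomorphic_on h V \<and>
      open W \<and> W \<subseteq> V \<and> fibre_dense i T' V W \<and> (\<forall>x\<in>W. g x \<noteq> 0 \<and> h x \<noteq> 0 \<and> F x = g x / h x)"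
    using V by (intro exI[of _ V] exI[of _ g] exI[of _ h] exI[of _ W]) simp
qed

lemma fib_mero_mult:
  assumes F: "fib_mero i T F U" and G: "fib_mero i T G U"
  shows "fib_mero i T (\<lambda>x. F x * G x) U"
proof (rule fib_meroI)
  fix q assume q: "q \<in> U"
  obtain V1 g1 h1 W1 where 1: "open V1" "q \<in> V1" "V1 \<subseteq> U" "mv_holomorphic_on g1 V1" "mv_holomorphic_on h1 V1"
    "open W1" "W1 \<subseteq> V1" "fibre_dense i T V1 W1" "\<forall>x\<in>W1. g1 x \<noteq> 0" "\<forall>x\<in>W1. h1 x \<noteq> 0"
    "\<forall>x\<in>W1. F x = g1 x / h1 x" by (rule fib_meroE[OF F q])
  obtain V2 g2 h2 W2 where 2: "open V2" "q \<in> V2" "V2 \<subseteq> U" "mv_holomorphic_on g2 V2" "mv_holomorphic_on h2 V2"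
    "open W2" "W2 \<subseteq> V2" "fibre_dense i T V2 W2" "\<forall>x\<in>W2. g2 x \<noteq> 0" "\<forall>x\<in>W2. h2 x \<noteq> 0"
    "\<forall>x\<in>W2. G x = g2 x / h2 x" by (rule fib_meroE[OF G q])
  define V where "V = V1 \<inter> V2"
  have V: "open V" "V \<subseteq> V1" "V \<subseteq> V2" using 1 2 by (auto simp: V_def)
  have "fibre_dense i T V ((V \<inter> W1) \<inter> (V \<inter> W2))"
    by (rule fibre_dense_Int[OF _ _ fibre_dense_restrict[OF 1(8) V(1,2)] fibre_dense_restrict[OF 2(8) V(1,3)]])
      (use V(1) 1(6) in auto)
  moreover have "open ((V \<inter> W1) \<inter> (V \<inter> W2))" using V(1) 1(6) 2(6) by auto
  moreover have "mv_holomorphic_on (\<lambda>x. g1 x * g2 x) V" "mv_holomorphic_on (\<lambda>x. h1 x * h2 x) V"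
    using mv_holomorphic_on_subset[OF 1(4) V(2)] mv_holomorphic_on_subset[OF 1(5) V(2)]
      mv_holomorphic_on_subset[OF 2(4) V(3)] mv_holomorphic_on_subset[OF 2(5) V(3)]
    by (auto intro: mv_holomorphic_on_mult)
  ultimately show "\<exists>V g h W. open V \<and> q \<in> V \<and> V \<subseteq> U \<and> mv_holomorphic_on g V \<and>
    mv_holomorphic_on h V \<and> open W \<and> W \<subseteq> V \<and> fibre_dense i T V W \<and>
    (\<forall>x\<in>W. g x \<noteq> 0 \<and> h x \<noteq> 0 \<and> F x * G x = g x / h x)"
    using 1 2 V by (intro exI[of _ V] exI[of _ "\<lambda>x. g1 x * g2 x"] exI[of _ "\<lambda>x. h1 x * h2 x"]
        exI[of _ "(V \<inter> W1) \<inter> (V \<inter> W2)"]) (auto simp: V_def)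
qed

text \<open>Numerator and denominator are both nonzero on W and enter symmetrically, so they may be
  exchanged.\<close>

lemma fib_mero_inverse:
  assumes F: "fib_mero i T F U"
  shows "fib_mero i T (\<lambda>x. inverse (F x)) U"
proof (rule fib_meroI)
  fix q assume q: "q \<in> U"
  obtain V g h W where 1: "open V" "q \<in> V" "V \<subseteq> U" "mv_holomorphic_on g V" "mv_holomorphic_on h V"
    "open W" "W \<subseteq> V" "fibre_dense i T V W" "\<forall>x\<in>W. g x \<noteq> 0" "\<forall>x\<in>W. h x \<noteq> 0"
    "\<forall>x\<in>W. F x = g x / h x" by (rule fib_meroE[OF F q])
  thus "\<exists>V g h W. open V \<and> q \<in> V \<and> V \<subseteq> U \<and> mv_holomorphic_on g V \<and>
    mv_holomorphic_on h V \<and> open W \<and> W \<subseteq> V \<and> fibre_dense i T V W \<and>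
    (\<forall>x\<in>W. g x \<noteq> 0 \<and> h x \<noteq> 0 \<and> inverse (F x) = g x / h x)"
    by (intro exI[of _ V] exI[of _ h] exI[of _ g] exI[of _ W]) auto
qed

lemma fib_mero_cong:
  assumes F: "fib_mero i T F U" and W0: "open W0" "fibre_dense i T U W0" "\<And>x. x \<in> W0 \<Longrightarrow> F x = G x"
  shows "fib_mero i T G U"
proof (rule fib_meroI)
  fix q assume q: "q \<in> U"
  obtain V g h W where 1: "open V" "q \<in> V" "V \<subseteq> U" "mv_holomorphic_on g V" "mv_holomorphic_on h V"
    "open W" "W \<subseteq> V" "fibre_dense i T V W" "\<forall>x\<in>W. g x \<noteq> 0" "\<forall>x\<in>W. h x \<noteq> 0"
    "\<forall>x\<in>W. F x = g x / h x" by (rule fib_meroE[OF F q])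
  have "fibre_dense i T V (W \<inter> (V \<inter> W0))"
    by (rule fibre_dense_Int[OF 1(6-8) fibre_dense_restrict[OF W0(2) 1(1,3)]])
  moreover have "open (W \<inter> (V \<inter> W0))" "W \<inter> (V \<inter> W0) \<subseteq> V" using 1 W0 by auto
  moreover have "\<forall>x\<in>W \<inter> (V \<inter> W0). g x \<noteq> 0 \<and> h x \<noteq> 0 \<and> G x = g x / h x" using 1(9-11) W0(3) by auto
  ultimately show "\<exists>V g h W. open V \<and> q \<in> V \<and> V \<subseteq> U \<and> mv_holomorphic_on g V \<and>
    mv_holomorphic_on h V \<and> open W \<and> W \<subseteq> V \<and> fibre_dense i T V W \<and>
    (\<forall>x\<in>W. g x \<noteq> 0 \<and> h x \<noteq> 0 \<and> G x = g x / h x)"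
    using 1(1-5) by (intro exI[of _ V] exI[of _ g] exI[of _ h] exI[of _ "W \<inter> (V \<inter> W0)"]) simp
qed

lemma fib_mero_holomorphic:
  assumes "mv_holomorphic_on g U" "open U" "fibre_dense i T U {x\<in>U. g x \<noteq> 0}"
  shows "fib_mero i T g U"
  by (rule fib_meroI, rule exI[of _ U], rule exI[of _ g], rule exI[of _ "\<lambda>x. 1"], rule exI[of _ "{x\<in>U. g x \<noteq> 0}"])
    (use assms mv_holomorphic_on_open_nonzero[OF assms(1,2)] mv_holomorphic_on_const[of 1 U] in auto)

lemma fib_mero_holomorphic_nz:
  assumes "mv_holomorphic_on g U" "open U" "\<And>x. x \<in> U \<Longrightarrow> g x \<noteq> 0"
  shows "fib_mero i T g U"
proof (rule fib_mero_holomorphic[OF assms(1,2)])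
  have "{x \<in> U. g x \<noteq> 0} = U" using assms(3) by auto
  thus "fibre_dense i T U {x\<in>U. g x \<noteq> 0}" by (simp add: fibre_dense_refl)
qed

lemma fib_mero_prod:
  assumes "open U" "\<And>k. k \<in> K \<Longrightarrow> fib_mero i T (F k) U"
  shows "fib_mero i T (\<lambda>x. \<Prod>k\<in>K. F k x) U"
  using assms(2)
proof (induction K rule: infinite_finite_induct)
  case (insert k K)
  thus ?case using fib_mero_mult[of i T "F k" U "\<lambda>x. \<Prod>k\<in>K. F k x"] by simp
qed (use fib_mero_holomorphic_nz[OF mv_holomorphic_on_const[of 1 U] assms(1), of i T] in simp_all)

lemma fib_mero_powi:
  assumes "open U" "fib_mero i T F U"
  shows "fib_mero i T (\<lambda>x. F x powi k) U"
  using fib_mero_prod[OF assms(1), of "{..<nat k}" i T "\<lambda>_. F"]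
    fib_mero_prod[OF assms(1), of "{..<nat (- k)}" i T "\<lambda>_ x. inverse (F x)"] fib_mero_inverse[OF assms(2)] assms(2)
  by (cases "k \<ge> 0") (simp_all add: power_int_def)

lemma fib_mero_imp_meromorphic:
  assumes "fib_mero i T F U"
  shows "mv_meromorphic_on F U"
  unfolding mv_meromorphic_on_def
proof
  fix q assume "q \<in> U"
  then obtain V g h W where 1: "open V" "q \<in> V" "V \<subseteq> U" "mv_holomorphic_on g V" "mv_holomorphic_on h V"
    "open W" "W \<subseteq> V" "fibre_dense i T V W" "\<forall>x\<in>W. g x \<noteq> 0" "\<forall>x\<in>W. h x \<noteq> 0"
    "\<forall>x\<in>W. F x = g x / h x" by (rule fib_meroE[OF assms])
  have d: "V \<subseteq> closure W" using fibre_dense_dense[OF 1(8)] .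
  have "W \<subseteq> {x \<in> V. h x \<noteq> 0}" using 1(7,10) by auto
  hence "V \<subseteq> closure {x \<in> V. h x \<noteq> 0}" using d closure_mono by blast
  moreover have "agree_on V F (\<lambda>x. g x / h x)" unfolding agree_on_def
    using 1 d by (intro exI[of _ W]) auto
  ultimately show "\<exists>V g h. open V \<and> q \<in> V \<and> V \<subseteq> U \<and> mv_holomorphic_on g V \<and> mv_holomorphic_on h V \<and>
        V \<subseteq> closure {x\<in>V. h x \<noteq> 0} \<and> agree_on V F (\<lambda>x. g x / h x)"
    using 1 by (intro exI[of _ V] exI[of _ g] exI[of _ h]) auto
qed

section \<open>Identities on dense sets, regular values and pullbacks\<close>

lemma eq_on_dense:
  fixes f g :: "complex ^ 'n \<Rightarrow> complex"
  assumes "continuous_on V f" "continuous_on V g" "open V" "V \<subseteq> closure W" "\<And>x. x \<in> V \<inter> W \<Longrightarrow> f x = g x" "x \<in> V"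
  shows "f x = g x"
proof (rule ccontr)
  assume ne: "f x \<noteq> g x"
  have "open (V \<inter> (\<lambda>x. f x - g x) -` (- {0}))"
    by (rule continuous_open_preimage) (use assms in \<open>auto intro!: continuous_intros\<close>)
  moreover have "x \<in> V \<inter> (\<lambda>x. f x - g x) -` (- {0})" "x \<in> closure W" using assms ne by auto
  ultimately have "W \<inter> (V \<inter> (\<lambda>x. f x - g x) -` (- {0})) \<noteq> {}"
    using open_Int_closure_eq_empty[of "V \<inter> (\<lambda>x. f x - g x) -` (- {0})" W] by blast
  thus False using assms(5) by auto
qed

lemma fib_mero_not_agree_0:
  assumes "fib_mero i T F U" "U \<noteq> {}"
  shows "\<not> agree_on U F (\<lambda>x. 0)"
proof
  assume a: "agree_on U F (\<lambda>x. 0)"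
  obtain q where "q \<in> U" using assms(2) by blast
  then obtain V g h W where 1: "open V" "q \<in> V" "V \<subseteq> U" "mv_holomorphic_on g V" "mv_holomorphic_on h V"
    "open W" "W \<subseteq> V" "fibre_dense i T V W" "\<forall>x\<in>W. g x \<noteq> 0" "\<forall>x\<in>W. h x \<noteq> 0"
    "\<forall>x\<in>W. F x = g x / h x" by (rule fib_meroE[OF assms(1)])
  obtain W' where W': "open W'" "W' \<subseteq> U" "U \<subseteq> closure W'" "\<forall>x\<in>W'. F x = 0" using a by (auto simp: agree_on_def)
  have "W \<noteq> {}" using fibre_dense_dense[OF 1(8)] 1(2) by auto
  then obtain x where "x \<in> W" by blast
  hence "x \<in> closure W'" using 1(3,7) W'(3) by blast
  hence "W' \<inter> W \<noteq> {}" using \<open>x \<in> W\<close> open_Int_closure_eq_empty[OF 1(6), of W'] by blast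
  thus False using W'(4) 1(9-11) by fastforce
qed

lemma regular_valueI:
  assumes "open V" "p \<in> V" "mv_holomorphic_on g V" "open W" "W \<subseteq> V" "V \<subseteq> closure W" "\<And>x. x \<in> W \<Longrightarrow> F x = g x"
  shows "regular_value F p (g p)"
  unfolding regular_value_def agree_on_def using assms by (intro exI[of _ V] exI[of _ g]) auto

lemma regular_value_quotientI:
  assumes V: "open V" "p \<in> V" and g: "mv_holomorphic_on g V" and h: "mv_holomorphic_on h V" "h p \<noteq> 0"
    and W: "open W" "V \<subseteq> closure W" "\<And>x. x \<in> W \<inter> V \<Longrightarrow> F x = g x / h x"
  shows "regular_value F p (g p / h p)"
proof (rule regular_valueI[where g = "\<lambda>x. g x / h x"])
  let ?V = "{x\<in>V. h x \<noteq> 0}"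
  show o: "open ?V" by (rule mv_holomorphic_on_open_nonzero[OF h(1) V(1)])
  show "mv_holomorphic_on (\<lambda>x. g x / h x) ?V"
    by (rule mv_holomorphic_on_divide)
      (use mv_holomorphic_on_subset[OF g, of ?V] mv_holomorphic_on_subset[OF h(1), of ?V] in auto)
  show "?V \<subseteq> closure (?V \<inter> W)" by (rule dense_subset_open[OF W(2) o]) auto
qed (use V W h mv_holomorphic_on_open_nonzero[OF h(1) V(1)] in auto)

text \<open>The local sections \<open>\<sigma>\<close> of \<open>\<phi>\<close> pull dense subsets of \<open>U'\<close> and of its fibres back to dense subsets of \<open>U\<close>.\<close>

lemma fib_mero_compose:
  fixes \<phi> :: "complex ^ 'n \<Rightarrow> complex ^ 'm"
  assumes F: "fib_mero i T F U'" and \<phi>: "\<And>k. mv_holomorphic_on (\<lambda>x. \<phi> x $ k) U" and U: "open U"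
    and sub: "\<And>x. x \<in> U \<Longrightarrow> \<phi> x \<in> U'"
    and lift: "\<And>q. q \<in> U \<Longrightarrow> \<exists>\<sigma> S. continuous_on UNIV \<sigma> \<and> \<sigma> (\<phi> q) = q \<and>
      (S = UNIV \<or> \<phi> q $ i \<in> T \<and> S = {y. y $ i = \<phi> q $ i}) \<and>
      (\<forall>y\<in>U' \<inter> S. \<sigma> y \<in> U \<and> \<phi> (\<sigma> y) = y \<and> (q $ j \<in> T' \<longrightarrow> \<sigma> y $ j = q $ j))"
  shows "fib_mero j T' (\<lambda>x. F (\<phi> x)) U"
proof (rule fib_meroI)
  fix q assume q: "q \<in> U"
  obtain V g h W where 1: "open V" "\<phi> q \<in> V" "V \<subseteq> U'" "mv_holomorphic_on g V" "mv_holomorphic_on h V"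
    "open W" "W \<subseteq> V" "fibre_dense i T V W" "\<forall>x\<in>W. g x \<noteq> 0" "\<forall>x\<in>W. h x \<noteq> 0"
    "\<forall>x\<in>W. F x = g x / h x" by (rule fib_meroE[OF F sub[OF q]])
  have cont: "continuous_on U \<phi>"
  proof -
    have "continuous_on U (\<lambda>x. \<chi> k. \<phi> x $ k)"
      by (intro continuous_on_vec_lambda mv_holomorphic_on_continuous[OF \<phi>])
    thus ?thesis by (simp add: vec_nth_inverse)
  qed
  define V' where "V' = U \<inter> \<phi> -` V"
  define W' where "W' = U \<inter> \<phi> -` W"
  have o: "open V'" "open W'" using continuous_open_preimage[OF cont U] 1(1,6) by (auto simp: V'_def W'_def)
  have sub': "W' \<subseteq> V'" "V' \<subseteq> U" using 1(7) by (auto simp: V'_def W'_def)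
  have hol: "mv_holomorphic_on (\<lambda>x. g (\<phi> x)) V'" "mv_holomorphic_on (\<lambda>x. h (\<phi> x)) V'"
    by (rule mv_holomorphic_on_compose_map[OF mv_holomorphic_on_subset[OF \<phi> sub'(2)] 1(4)], simp add: V'_def,
        rule mv_holomorphic_on_compose_map[OF mv_holomorphic_on_subset[OF \<phi> sub'(2)] 1(5)], simp add: V'_def)
  \<comment> \<open>The implication combines the two requirements on \<open>W'\<close>: density in
    the whole space, and density in the fibre when \<open>p $ j\<close> lies in
    \<open>T'\<close>.\<close>
  have key: "p \<in> closure {x \<in> W'. p $ j \<in> T' \<longrightarrow> x $ j = p $ j}" if p: "p \<in> V'" for p
  proof -
    have pU: "p \<in> U" "\<phi> p \<in> V" using p by (auto simp: V'_def)
    obtain \<sigma> S where \<sigma>: "continuous_on UNIV \<sigma>" "\<sigma> (\<phi> p) = p"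
      "S = UNIV \<or> \<phi> p $ i \<in> T \<and> S = {y. y $ i = \<phi> p $ i}"
      "\<forall>y\<in>U' \<inter> S. \<sigma> y \<in> U \<and> \<phi> (\<sigma> y) = y \<and> (p $ j \<in> T' \<longrightarrow> \<sigma> y $ j = p $ j)"
      using lift[OF pU(1)] by (elim exE conjE) (rule that; assumption)
    \<comment> \<open>Density of W is used in the whole space or inside one fibre, according to the
      set S over which the section is given.\<close>
    have "\<phi> p \<in> closure (W \<inter> S)"
      using \<sigma>(3)
    proof
      assume "S = UNIV"
      thus ?thesis using fibre_dense_dense[OF 1(8)] pU(2) by auto
    next
      assume S: "\<phi> p $ i \<in> T \<and> S = {y. y $ i = \<phi> p $ i}"
      have "W \<inter> S = {y \<in> W. y $ i = \<phi> p $ i}" using S by auto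
      thus ?thesis using fibre_denseD[OF 1(8) pU(2)] S by simp
    qed
    moreover have "\<sigma> ` closure (W \<inter> S) \<subseteq> closure {x \<in> W'. p $ j \<in> T' \<longrightarrow> x $ j = p $ j}"
    proof (rule image_closure_subset)
      show "continuous_on (closure (W \<inter> S)) \<sigma>" using \<sigma>(1) continuous_on_subset by blast
      have "\<sigma> ` (W \<inter> S) \<subseteq> {x \<in> W'. p $ j \<in> T' \<longrightarrow> x $ j = p $ j}"
      proof
        fix x assume "x \<in> \<sigma> ` (W \<inter> S)"
        then obtain y where y: "y \<in> W" "y \<in> S" "x = \<sigma> y" by blast
        hence "y \<in> U' \<inter> S" using 1(3,7) by blast
        hence "\<sigma> y \<in> U \<and> \<phi> (\<sigma> y) = y \<and> (p $ j \<in> T' \<longrightarrow> \<sigma> y $ j = p $ j)" using \<sigma>(4) by blast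
        thus "x \<in> {x \<in> W'. p $ j \<in> T' \<longrightarrow> x $ j = p $ j}" using y by (simp add: W'_def)
      qed
      thus "\<sigma> ` (W \<inter> S) \<subseteq> closure {x \<in> W'. p $ j \<in> T' \<longrightarrow> x $ j = p $ j}" using closure_subset by blast
    qed auto
    ultimately have "\<sigma> (\<phi> p) \<in> closure {x \<in> W'. p $ j \<in> T' \<longrightarrow> x $ j = p $ j}" by blast
    thus ?thesis by (simp add: \<sigma>(2))
  qed
  have "fibre_dense j T' V' W'"
    unfolding fibre_dense_def
  proof (intro conjI ballI impI)
    show "V' \<subseteq> closure W'"
    proof
      fix p assume p: "p \<in> V'"
      have "closure {x \<in> W'. p $ j \<in> T' \<longrightarrow> x $ j = p $ j} \<subseteq> closure W'" by (intro closure_mono) auto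
      thus "p \<in> closure W'" using key[OF p] by blast
    qed
    show "p \<in> closure {x \<in> W'. x $ j = p $ j}" if "p \<in> V'" "p $ j \<in> T'" for p
      using key[OF that(1)] that(2) by simp
  qed
  moreover have "\<forall>x\<in>W'. g (\<phi> x) \<noteq> 0 \<and> h (\<phi> x) \<noteq> 0 \<and> F (\<phi> x) = g (\<phi> x) / h (\<phi> x)"
    using 1(9-11) by (auto simp: W'_def)
  moreover have "q \<in> V'" using q 1(2) by (simp add: V'_def)
  ultimately show "\<exists>V g h W. open V \<and> q \<in> V \<and> V \<subseteq> U \<and> mv_holomorphic_on g V \<and>
    mv_holomorphic_on h V \<and> open W \<and> W \<subseteq> V \<and> fibre_dense j T' V W \<and>
    (\<forall>x\<in>W. g x \<noteq> 0 \<and> h x \<noteq> 0 \<and> F (\<phi> x) = g x / h x)"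
    using o sub' hol by (intro exI[of _ V'] exI[of _ "\<lambda>x. g (\<phi> x)"] exI[of _ "\<lambda>x. h (\<phi> x)"] exI[of _ W']) auto
qed

text \<open>The numerator is nonzero on a dense set because f * inverse f agrees with 1 on a dense
  open set, a consequence of the identity theorem on the connected set U.\<close>

lemma mv_meromorphic_imp_fib_mero:
  fixes f :: "complex ^ 'n \<Rightarrow> complex"
  assumes f: "mv_meromorphic_on f U" and U: "open U" "connected U" and nz: "\<not> agree_on U f (\<lambda>x. 0)"
  shows "fib_mero i {} f U"
proof (rule fib_meroI)
  fix q assume q: "q \<in> U"
  obtain V g h where V: "open V" "q \<in> V" "V \<subseteq> U" "mv_holomorphic_on g V" "mv_holomorphic_on h V"
    "V \<subseteq> closure {x\<in>V. h x \<noteq> 0}" "agree_on V f (\<lambda>x. g x / h x)"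
    by (rule mv_meromorphic_onE[OF f q])
  have a: "agree_on V (\<lambda>x. f x * inverse (f x)) (\<lambda>x. 1)"
    by (rule agree_on_subset[OF mv_meromorphic_on_inverse(2)[OF f U nz] V(1,3)])
  obtain W0 where W0: "open W0" "W0 \<subseteq> V" "V \<subseteq> closure W0"
    "\<forall>x\<in>W0. f x = g x / h x \<and> f x * inverse (f x) = 1"
    using agree_on_combine[OF V(7) a] by blast
  define W where "W = W0 \<inter> {x\<in>V. h x \<noteq> 0}"
  have "V \<subseteq> closure W" unfolding W_def by (rule dense_open_Int[OF W0(1-3) V(6)])
  hence fd: "fibre_dense i {} V W" by (simp add: fibre_dense_def)
  have oW: "open W" unfolding W_def using W0(1) mv_holomorphic_on_open_nonzero[OF V(5,1)] by (rule open_Int)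
  have sW: "W \<subseteq> V" by (auto simp: W_def)
  have eq: "\<forall>x\<in>W. g x \<noteq> 0 \<and> h x \<noteq> 0 \<and> f x = g x / h x"
  proof
    fix x assume "x \<in> W"
    hence "h x \<noteq> 0" "f x = g x / h x \<and> f x * inverse (f x) = 1" using W0(4) by (auto simp: W_def)
    thus "g x \<noteq> 0 \<and> h x \<noteq> 0 \<and> f x = g x / h x" by (cases "g x = 0") auto
  qed
  show "\<exists>V g h W. open V \<and> q \<in> V \<and> V \<subseteq> U \<and> mv_holomorphic_on g V \<and>
    mv_holomorphic_on h V \<and> open W \<and> W \<subseteq> V \<and> fibre_dense i {} V W \<and>
    (\<forall>x\<in>W. g x \<noteq> 0 \<and> h x \<noteq> 0 \<and> f x = g x / h x)"
    by (rule exI[of _ V], rule exI[of _ g], rule exI[of _ h], rule exI[of _ W], intro conjI) (fact V fd oW sW eq)+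
qed

section \<open>The order along a fibre\<close>

lemma riemann_sum_bound:
  fixes f :: "real \<Rightarrow> complex"
  assumes f: "continuous_on {0..1} f" and N: "N > 0"
    and osc: "\<And>s t. s \<in> {0..1} \<Longrightarrow> t \<in> {0..1} \<Longrightarrow> \<bar>s - t\<bar> \<le> 1 / real N \<Longrightarrow> norm (f s - f t) \<le> e"
  shows "norm (integral {0..1} f - (\<Sum>j<N. f (real j / real N)) / of_nat N) \<le> e"
proof -
  have "norm (integral {0..real k / real N} f - (\<Sum>j<k. f (real j / real N)) / of_nat N) \<le> real k / real N * e"
    if "k \<le> N" for k
    using that
  proof (induction k)
    case (Suc k)
    define a b where "a = real k / real N" and "b = real (Suc k) / real N"
    have ab: "0 \<le> a" "a \<le> b" "b \<le> 1" "b - a = 1 / real N" "b = a + 1 / real N"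
      using Suc.prems N by (auto simp: a_def b_def field_simps)
    have cont: "continuous_on {0..b} f" "continuous_on {a..b} f"
      using ab by (auto intro!: continuous_on_subset[OF f])
    have int: "f integrable_on {0..b}" "f integrable_on {a..b}"
      using cont by (auto intro: integrable_continuous_interval)
    have split: "integral {0..b} f = integral {0..a} f + integral {a..b} f"
      using Henstock_Kurzweil_Integration.integral_combine[OF ab(1,2) int(1)] by simp
    have "integral {a..b} (\<lambda>s. f s - f a) = integral {a..b} f - f a * of_real (b - a)"
      using int(2) ab(2) by (subst Henstock_Kurzweil_Integration.integral_diff)
        (auto simp: scaleR_conv_of_real mult.commute)
    moreover have "norm (integral {a..b} (\<lambda>s. f s - f a)) \<le> e * (b - a)"
    proof (rule integral_bound[OF ab(2)])
      show "continuous_on {a..b} (\<lambda>s. f s - f a)" by (intro continuous_intros cont)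
      show "norm (f t - f a) \<le> e" if "t \<in> {a..b}" for t
        by (rule osc) (use that ab in auto)
    qed
    ultimately have 1: "norm (integral {a..b} f - f a / of_nat N) \<le> e / real N"
      using ab(4) by (simp add: divide_inverse)
    have "integral {0..b} f - (\<Sum>j<Suc k. f (real j / real N)) / of_nat N =
        (integral {0..a} f - (\<Sum>j<k. f (real j / real N)) / of_nat N) + (integral {a..b} f - f a / of_nat N)"
      unfolding split by (simp add: a_def add_divide_distrib)
    also have "norm \<dots> \<le> real k / real N * e + e / real N"
      using Suc 1 by (intro norm_triangle_mono) (auto simp: a_def)
    also have "\<dots> = real (Suc k) / real N * e" by (simp add: add_divide_distrib distrib_right)
    finally show ?case by (simp add: b_def)
  qed simp
  from this[of N] show ?thesis using N by simp
qed

text \<open>Riemann sums are finite sums of holomorphic functions, and uniform continuity on a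
  compact ball times [0, 1] makes them converge uniformly there, so Weierstrass's theorem
  applies.\<close>

lemma mv_holomorphic_on_integral:
  fixes K :: "complex ^ 'n \<Rightarrow> real \<Rightarrow> complex"
  assumes U: "open U" and hol: "\<And>s. s \<in> {0..1} \<Longrightarrow> mv_holomorphic_on (\<lambda>x. K x s) U"
    and cont: "continuous_on (U \<times> {0..1}) (\<lambda>p. K (fst p) (snd p))"
  shows "mv_holomorphic_on (\<lambda>x. integral {0..1} (K x)) U"
proof (rule mv_holomorphic_on_uniform_limit)
  fix n
  show "mv_holomorphic_on (\<lambda>x. (\<Sum>j<Suc n. K x (real j / real (Suc n))) * (1 / of_nat (Suc n))) U"
    by (intro mv_holomorphic_on_mult mv_holomorphic_on_sum mv_holomorphic_on_const hol) (auto simp: field_simps)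
next
  fix p assume "p \<in> U"
  then obtain r where r: "r > 0" "cball p r \<subseteq> U" using U open_contains_cball by blast
  have "uniform_limit (cball p r) (\<lambda>n x. (\<Sum>j<Suc n. K x (real j / real (Suc n))) * (1 / of_nat (Suc n)))
      (\<lambda>x. integral {0..1} (K x)) sequentially"
    unfolding uniform_limit_iff
  proof (intro allI impI)
    fix e :: real assume e: "e > 0"
    have "continuous_on (cball p r \<times> {0..1}) (\<lambda>p. K (fst p) (snd p))"
      by (rule continuous_on_subset[OF cont]) (use r in auto)
    hence UC: "uniformly_continuous_on (cball p r \<times> {0..1}) (\<lambda>p. K (fst p) (snd p))"
      by (intro compact_uniformly_continuous compact_Times compact_cball compact_Icc)
    obtain d where d: "d > 0" "\<And>x s t. x \<in> cball p r \<Longrightarrow> s \<in> {0..1} \<Longrightarrow> t \<in> {0..1} \<Longrightarrow> \<bar>s - t\<bar> < d \<Longrightarrow>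
        dist (K x s) (K x t) < e / 2"
    proof -
      have "e / 2 > 0" using e by simp
      then obtain d where d: "d > 0" "\<And>y y'. y \<in> cball p r \<times> {0..1} \<Longrightarrow> y' \<in> cball p r \<times> {0..1} \<Longrightarrow>
          dist y' y < d \<Longrightarrow> dist (K (fst y') (snd y')) (K (fst y) (snd y)) < e / 2"
        using UC unfolding uniformly_continuous_on_def by meson
      show thesis
      proof (rule that[OF d(1)])
        fix x and s t :: real assume x: "x \<in> cball p r" and st: "s \<in> {0..1}" "t \<in> {0..1}" "\<bar>s - t\<bar> < d"
        have "dist (x, s) (x, t) < d" using st(3) by (simp add: dist_Pair_Pair dist_real_def)
        thus "dist (K x s) (K x t) < e / 2" using d(2)[of "(x, t)" "(x, s)"] x st by simp
      qed
    qed
    obtain N0 where N0: "inverse (real (Suc N0)) < d" using reals_Archimedean[OF d(1)] by blast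
    show "\<forall>\<^sub>F n in sequentially. \<forall>x\<in>cball p r.
       dist ((\<Sum>j<Suc n. K x (real j / real (Suc n))) * (1 / of_nat (Suc n))) (integral {0..1} (K x)) < e"
      using eventually_ge_at_top[of N0]
    proof eventually_elim
      case (elim n)
      show ?case
      proof
        fix x assume x: "x \<in> cball p r"
        have lt: "1 / real (Suc n) < d"
        proof -
          have "1 / real (Suc n) \<le> inverse (real (Suc N0))" using elim by (simp add: field_simps)
          thus ?thesis using N0 by linarith
        qed
        have "norm (integral {0..1} (K x) - (\<Sum>j<Suc n. K x (real j / real (Suc n))) / of_nat (Suc n)) \<le> e / 2"
        proof (rule riemann_sum_bound)
          have "continuous_on {0..1} (\<lambda>s. K (fst (x, s)) (snd (x, s)))"
            by (rule continuous_on_compose2[OF cont]) (use x r in \<open>auto intro!: continuous_intros\<close>)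
          thus "continuous_on {0..1} (K x)" by simp
          fix s t :: real assume st: "s \<in> {0..1}" "t \<in> {0..1}" "\<bar>s - t\<bar> \<le> 1 / real (Suc n)"
          have "\<bar>s - t\<bar> < d" using st(3) lt by linarith
          thus "norm (K x s - K x t) \<le> e / 2" using d(2)[OF x st(1,2)] by (simp add: dist_norm)
        qed simp
        thus "dist ((\<Sum>j<Suc n. K x (real j / real (Suc n))) * (1 / of_nat (Suc n))) (integral {0..1} (K x)) < e"
          using e by (simp add: dist_norm norm_minus_commute)
      qed
    qed
  qed
  thus "\<exists>r>0. cball p r \<subseteq> U \<and> uniform_limit (cball p r)
      (\<lambda>n x. (\<Sum>j<Suc n. K x (real j / real (Suc n))) * (1 / of_nat (Suc n)))
      (\<lambda>x. integral {0..1} (K x)) sequentially"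
    using r by blast
qed

section \<open>Two-variable slices and division by the equation of a fibre\<close>

lemma vector_2_eta: "vector [x $ 1, x $ 2] = (x :: 'a::zero ^ 2)"
  by (simp add: vec_eq_iff forall_2)

lemma mv_holomorphic_on_slice1:
  assumes "mv_holomorphic_on g U"
  shows "(\<lambda>u. g (vector [u, \<theta>] :: complex ^ 2)) holomorphic_on {u. vector [u, \<theta>] \<in> U}"
proof -
  have "vector [0, \<theta>] + u *s vector [1, 0] = (vector [u, \<theta>] :: complex ^ 2)" for u
    by (simp add: vec_eq_iff forall_2)
  thus ?thesis using mv_holomorphic_on_line[OF assms, of "vector [0, \<theta>]" "vector [1, 0]"] by simp
qed

lemma mv_holomorphic_on_slice2:
  assumes "mv_holomorphic_on g U"
  shows "(\<lambda>u. g (vector [c, u] :: complex ^ 2)) holomorphic_on {u. vector [c, u] \<in> U}"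
proof -
  have "vector [c, 0] + u *s vector [0, 1] = (vector [c, u] :: complex ^ 2)" for u
    by (simp add: vec_eq_iff forall_2)
  thus ?thesis using mv_holomorphic_on_line[OF assms, of "vector [c, 0]" "vector [0, 1]"] by simp
qed

lemma norm_vec2_le: "norm (x :: complex ^ 2) \<le> norm (x $ 1) + norm (x $ 2)"
  using L2_set_le_sum[of UNIV "\<lambda>i. norm (x $ i)"] by (simp add: norm_vec_def sum_2)

lemma dist_vector_2: "dist (vector [a, b] :: complex ^ 2) (vector [a', b']) \<le> dist a a' + dist b b'"
  using norm_vec2_le[of "vector [a, b] - vector [a', b']"] by (simp add: dist_norm)

lemma dist_vector_2_same1: "dist (vector [a, b] :: complex ^ 2) (vector [a, b']) = dist b b'"
  by (simp add: dist_norm norm_vec_def L2_set_def sum_2)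

lemma dist_vector_2_same2: "dist (vector [a, b] :: complex ^ 2) (vector [a', b]) = dist a a'"
  by (simp add: dist_norm norm_vec_def L2_set_def sum_2)

lemma continuous_on_vector_2:
  assumes "continuous_on S a" "continuous_on S b"
  shows "continuous_on S (\<lambda>x. vector [a x, b x] :: complex ^ 2)"
proof -
  have "continuous_on S (\<lambda>x. \<chi> k::2. if k = 1 then a x else b x)"
  proof (rule continuous_on_vec_lambda)
    fix k :: 2 show "continuous_on S (\<lambda>x. if k = 1 then a x else b x)"
      using assms by (cases "k = 1") auto
  qed
  moreover have "(\<chi> k::2. if k = 1 then a x else b x) = vector [a x, b x]" for x
    by (simp add: vec_eq_iff forall_2)
  ultimately show ?thesis by simp
qed

lemma mv_holomorphic_on_vector_2:
  assumes "mv_holomorphic_on a U" "mv_holomorphic_on b U"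
  shows "mv_holomorphic_on (\<lambda>x. (vector [a x, b x] :: complex ^ 2) $ k) U"
proof -
  have "k = 1 \<or> k = 2" using exhaust_2 by blast
  thus ?thesis using assms by auto
qed

text \<open>The quotient is the Cauchy integral of \<open>g / (x\<^sub>1 - c)\<close> in the first variable, which is jointly holomorphic as
  a uniform limit of its Riemann sums.\<close>

lemma divide_fibre_local:
  fixes g :: "complex ^ 2 \<Rightarrow> complex" and p :: "complex ^ 2"
  assumes g: "mv_holomorphic_on g U" and U: "open U" and p: "p \<in> U"
    and z: "\<And>x::complex^2. x \<in> U \<Longrightarrow> x $ 1 = p $ 1 \<Longrightarrow> g x = 0"
  shows "\<exists>r>0. \<exists>g'. ball p r \<subseteq> U \<and> mv_holomorphic_on g' (ball p r) \<and> (\<forall>x\<in>ball p r. g x = (x $ 1 - p $ 1) * g' x)"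
proof -
  define c where "c = p $ 1"
  obtain R where R: "R > 0" "cball p R \<subseteq> U" using U p open_contains_cball by blast
  \<comment> \<open>\<open>r < \<rho>\<close> keeps \<open>x $ 1\<close> inside the circle, and
    \<open>\<rho> + r < R\<close> keeps points with first coordinate in the disc and second
    coordinate from the ball inside U.\<close>
  define \<rho> r where "\<rho> = R / 2" and "r = R / 4"
  have \<rho>r: "\<rho> > 0" "r > 0" "r < \<rho>" "r < R" "\<rho> + r < R" using R by (auto simp: \<rho>_def r_def)
  define u where "u = (\<lambda>s::real. c + of_real \<rho> * exp (2 * of_real pi * \<i> * of_real s))"
  define K where "K = (\<lambda>(x::complex^2) s. g (vector [u s, x $ 2]) / (u s - x $ 1))"
  have nu: "norm (u s - c) = \<rho>" for s using \<rho>r by (simp add: u_def norm_mult)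
  have cmp: "norm (x $ k - p $ k) < r" if "x \<in> ball p r" for x and k :: 2
    using that Finite_Cartesian_Product.norm_nth_le[of "x - p" k] by (simp add: dist_norm norm_minus_commute)
  have inU: "vector [v, x $ 2] \<in> U" if "x \<in> ball p r" "norm (v - c) \<le> \<rho>" for v x
  proof -
    have "dist (vector [v, x $ 2]) p \<le> dist v (p $ 1) + dist (x $ 2) (p $ 2)"
      using dist_vector_2[of v "x $ 2" "p $ 1" "p $ 2"] by (simp add: vector_2_eta)
    also have "\<dots> < R" using that(2) cmp[OF that(1), of 2] \<rho>r by (simp add: dist_norm c_def)
    finally show ?thesis using R(2) by (auto simp: dist_commute)
  qed
  have nz: "u s - x $ 1 \<noteq> 0" if "x \<in> ball p r" for x s
  proof
    assume "u s - x $ 1 = 0"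
    hence "norm (x $ 1 - p $ 1) = \<rho>" using nu[of s] by (simp add: c_def)
    thus False using cmp[OF that, of 1] \<rho>r by simp
  qed
  have cu: "continuous_on S u" for S unfolding u_def by (intro continuous_intros)
  have "mv_holomorphic_on (\<lambda>x. integral {0..1} (K x)) (ball p r)"
  proof (rule mv_holomorphic_on_integral)
    fix s :: real
    show "mv_holomorphic_on (\<lambda>x. K x s) (ball p r)" unfolding K_def
    proof (rule mv_holomorphic_on_divide)
      show "mv_holomorphic_on (\<lambda>x. g (vector [u s, x $ 2])) (ball p r)"
        by (rule mv_holomorphic_on_compose_map[OF mv_holomorphic_on_vector_2 g])
          (use inU nu in \<open>auto intro: mv_holomorphic_on_const mv_holomorphic_on_coord\<close>)
      show "mv_holomorphic_on (\<lambda>x. u s - x $ 1) (ball p r)"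
        by (intro mv_holomorphic_on_diff mv_holomorphic_on_const mv_holomorphic_on_coord)
    qed (use nz in auto)
  next
    have "continuous_on (ball p r \<times> {0..1::real}) (\<lambda>q. g (vector [u (snd q), fst q $ 2]))"
      by (rule continuous_on_compose2[OF mv_holomorphic_on_continuous[OF g] continuous_on_vector_2])
        (use inU nu in \<open>auto intro!: continuous_intros continuous_on_compose2[OF cu[of UNIV]]\<close>)
    thus "continuous_on (ball p r \<times> {0..1}) (\<lambda>q. K (fst q) (snd q))" unfolding K_def
      by (intro continuous_on_divide continuous_intros continuous_on_compose2[OF cu[of UNIV]]) (use nz in auto)
  qed simp
  moreover have "g x = (x $ 1 - p $ 1) * integral {0..1} (K x)" if x: "x \<in> ball p r" for x
  proof -
    define \<phi> where "\<phi> = (\<lambda>v. g (vector [v, x $ 2]))"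
    have "{v. vector [v, x $ 2] \<in> U} \<supseteq> cball c \<rho>" using inU[OF x] by (auto simp: dist_norm norm_minus_commute)
    hence hol: "\<phi> holomorphic_on cball c \<rho>"
      unfolding \<phi>_def by (rule holomorphic_on_subset[OF mv_holomorphic_on_slice1[OF g]])
    have cont: "continuous_on (cball c \<rho>) \<phi>" using hol by (rule holomorphic_on_imp_continuous_on)
    have holb: "\<phi> holomorphic_on ball c \<rho>" using hol ball_subset_cball by (rule holomorphic_on_subset)
    have "norm (x $ 1 - p $ 1) < r" by (rule cmp[OF x])
    hence x1: "norm (x $ 1 - c) < \<rho>" using \<rho>r(3) unfolding c_def by linarith
    have "vector [c, x $ 2] \<in> U" using inU[OF x, of c] \<rho>r by simp
    hence \<phi>c: "\<phi> c = 0" unfolding \<phi>_def by (rule z) (simp add: c_def)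
    have \<phi>x: "\<phi> (x $ 1) = g x" by (simp add: \<phi>_def vector_2_eta)
    \<comment> \<open>The Cauchy integral at c has the value 0 because \<phi> c = 0. Subtracting it
      produces the numerator \<open>x $ 1 - c\<close> over two linear factors, and the factor v - c
      cancels against the derivative of the circle.\<close>
    have "((\<lambda>v. \<phi> v / (v - x $ 1) - \<phi> v / (v - c)) has_contour_integral
        (2 * of_real pi * \<i> * \<phi> (x $ 1) - 2 * of_real pi * \<i> * \<phi> c)) (circlepath c \<rho>)"
      by (intro has_contour_integral_diff Cauchy_integral_circlepath cont holb x1) (use \<rho>r in auto)
    hence hi: "((\<lambda>s. (\<phi> (circlepath c \<rho> s) / (circlepath c \<rho> s - x $ 1) - \<phi> (circlepath c \<rho> s) / (circlepath c \<rho> s - c)) *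
        vector_derivative (circlepath c \<rho>) (at s within {0..1})) has_integral 2 * of_real pi * \<i> * g x) {0..1}"
      by (simp add: has_contour_integral_def \<phi>c \<phi>x)
    have "((\<lambda>s. 2 * of_real pi * \<i> * (x $ 1 - c) * K x s) has_integral 2 * of_real pi * \<i> * g x) {0..1}"
    proof (rule has_integral_eq[OF _ hi])
      fix s :: real assume s: "s \<in> {0..1}"
      have e: "circlepath c \<rho> s = u s" by (simp add: circlepath u_def mult_ac)
      have vd: "vector_derivative (circlepath c \<rho>) (at s within {0..1}) = 2 * of_real pi * \<i> * (u s - c)"
        using vector_derivative_circlepath01[of s c \<rho>] s by (simp add: u_def mult_ac)
      have nc: "u s - c \<noteq> 0" using nu[of s] \<rho>r by auto
      define A a b where "A = \<phi> (u s)" and "a = u s - x $ 1" and "b = u s - c"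
      have ab: "a \<noteq> 0" "b \<noteq> 0" "x $ 1 - c = b - a" using nz[OF x, of s] nc by (auto simp: a_def b_def)
      have "(A / a - A / b) * b = A / a * b - A / a * a" using ab(1,2) by (simp add: left_diff_distrib)
      also have "\<dots> = (b - a) * (A / a)" by (simp only: left_diff_distrib mult.commute)
      finally have fin: "(A / a - A / b) * b = (b - a) * (A / a)" .
      have K: "K x s = A / a" by (simp add: K_def A_def a_def \<phi>_def)
      have "(A / a - A / b) * (2 * of_real pi * \<i> * b) = 2 * of_real pi * \<i> * ((A / a - A / b) * b)"
        by (rule mult.left_commute)
      also have "\<dots> = 2 * of_real pi * \<i> * (b - a) * (A / a)" unfolding fin by (rule mult.assoc[symmetric])
      finally show "(\<phi> (circlepath c \<rho> s) / (circlepath c \<rho> s - x $ 1) - \<phi> (circlepath c \<rho> s) / (circlepath c \<rho> s - c)) *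
        vector_derivative (circlepath c \<rho>) (at s within {0..1}) = 2 * of_real pi * \<i> * (x $ 1 - c) * K x s"
        unfolding e vd K ab(3) unfolding A_def a_def b_def .
    qed
    hence "integral {0..1} (\<lambda>s. 2 * of_real pi * \<i> * (x $ 1 - c) * K x s) = 2 * of_real pi * \<i> * g x"
      by (rule integral_unique)
    hence "2 * of_real pi * \<i> * ((x $ 1 - c) * integral {0..1} (K x)) = 2 * of_real pi * \<i> * g x"
      by (simp add: mult.assoc)
    thus ?thesis by (simp add: c_def)
  qed
  moreover have "ball p r \<subseteq> U" using R(2) \<rho>r by auto
  ultimately show ?thesis using \<rho>r by blast
qed

text \<open>Off the fibre the quotient is forced, and on the fibre its value must be the derivative
  of g in the first variable. Defined by these two formulas, it coincides with every local quotient,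
  so these fit together.\<close>

lemma divide_fibre:
  fixes g :: "complex ^ 2 \<Rightarrow> complex"
  assumes g: "mv_holomorphic_on g U" and U: "open U"
    and z: "\<And>x::complex^2. x \<in> U \<Longrightarrow> x $ 1 = c \<Longrightarrow> g x = 0"
  shows "\<exists>g'. mv_holomorphic_on g' U \<and> (\<forall>x\<in>U. g x = (x $ 1 - c) * g' x)"
proof -
  define g' where "g' = (\<lambda>x. if x $ 1 = c then deriv (\<lambda>u. g (vector [u, x $ 2])) c else g x / (x $ 1 - c))"
  have "mv_holomorphic_on g' U"
  proof (rule mv_holomorphic_on_open_cover)
    fix p assume p: "p \<in> U"
    show "\<exists>V. p \<in> V \<and> mv_holomorphic_on g' V"
    proof (cases "p $ 1 = c")
      case False
      let ?V = "U \<inter> {x. x $ 1 \<noteq> c}"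
      have "open ?V" by (intro open_Int U open_Collect_neq continuous_intros)
      have "mv_holomorphic_on (\<lambda>x. g x / (x $ 1 - c)) ?V"
        by (intro mv_holomorphic_on_divide mv_holomorphic_on_diff mv_holomorphic_on_const mv_holomorphic_on_coord
            mv_holomorphic_on_subset[OF g]) auto
      hence "mv_holomorphic_on g' ?V"
        by (rule mv_holomorphic_on_cong[OF _ \<open>open ?V\<close>]) (auto simp: g'_def)
      thus ?thesis using p False by (intro exI[of _ ?V]) simp
    next
      case True
      have ex: "\<exists>r>0. \<exists>g'. ball p r \<subseteq> U \<and> mv_holomorphic_on g' (ball p r) \<and>
          (\<forall>x\<in>ball p r. g x = (x $ 1 - p $ 1) * g' x)"
        by (rule divide_fibre_local[OF g U p]) (use z True in auto)
      obtain r k where r: "r > 0" "ball p r \<subseteq> U" "mv_holomorphic_on k (ball p r)"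
        "\<forall>x\<in>ball p r. g x = (x $ 1 - p $ 1) * k x"
        using ex by (elim exE conjE) (rule that; assumption)
      have "k x = g' x" if x: "x \<in> ball p r" for x
      proof (cases "x $ 1 = c")
        case False
        thus ?thesis using r(4) x True by (simp add: g'_def)
      next
        case xc: True
        let ?S = "{u. vector [u, x $ 2] \<in> ball p r}"
        have oS: "open ?S"
          using open_vimage[of "ball p r" "\<lambda>u. vector [u, x $ 2] :: complex^2"]
          by (simp add: vimage_def continuous_on_vector_2)
        have cS: "c \<in> ?S" using x xc vector_2_eta[of x] by simp
        have "(\<lambda>u. k (vector [u, x $ 2])) field_differentiable at c"
          by (rule holomorphic_on_imp_differentiable_at[OF mv_holomorphic_on_slice1[OF r(3)] oS cS])
        then obtain D where D: "((\<lambda>u. k (vector [u, x $ 2])) has_field_derivative D) (at c)"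
          unfolding field_differentiable_def by (rule exE)
        have "((\<lambda>u. (u - c) * k (vector [u, x $ 2])) has_field_derivative k (vector [c, x $ 2])) (at c)"
          using DERIV_mult[OF DERIV_diff[OF DERIV_ident DERIV_const] D, of c] by simp
        hence "((\<lambda>u. g (vector [u, x $ 2])) has_field_derivative k (vector [c, x $ 2])) (at c)"
          by (rule has_field_derivative_transform_within_open[OF _ oS cS]) (use r(4) True in auto)
        hence "deriv (\<lambda>u. g (vector [u, x $ 2])) c = k (vector [c, x $ 2])" by (rule DERIV_imp_deriv)
        thus ?thesis using xc vector_2_eta[of x] by (simp add: g'_def)
      qed
      hence "mv_holomorphic_on g' (ball p r)" by (intro mv_holomorphic_on_cong[OF r(3)]) auto
      thus ?thesis using r(1) by (intro exI[of _ "ball p r"]) auto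
    qed
  qed
  moreover have "\<forall>x\<in>U. g x = (x $ 1 - c) * g' x" using z by (auto simp: g'_def)
  ultimately show ?thesis by (intro exI[of _ g'] conjI)
qed

lemma open_slice2: "open U \<Longrightarrow> open {u. (vector [c, u] :: complex ^ 2) \<in> U}"
  using continuous_on_open_vimage[of UNIV "\<lambda>u. vector [c, u] :: complex ^ 2"]
  by (simp add: vimage_def continuous_on_vector_2)

lemma open_slice1: "open U \<Longrightarrow> open {u. (vector [u, \<theta>] :: complex ^ 2) \<in> U}"
  using continuous_on_open_vimage[of UNIV "\<lambda>u. vector [u, \<theta>] :: complex ^ 2"]
  by (simp add: vimage_def continuous_on_vector_2)

lemma vector_2_convex_comb:
  assumes "u + v = (1::real)"
  shows "u *\<^sub>R (vector [a, b] :: complex ^ 2) + v *\<^sub>R vector [a', b'] = vector [u *\<^sub>R a + v *\<^sub>R a', u *\<^sub>R b + v *\<^sub>R b']"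
  by (simp add: vec_eq_iff forall_2)

lemma connected_slice1:
  assumes "convex U"
  shows "connected {u. (vector [u, \<theta>] :: complex ^ 2) \<in> U}"
proof (rule convex_connected, rule convexI)
  fix x y :: complex and u v :: real
  assume *: "x \<in> {u. (vector [u, \<theta>] :: complex ^ 2) \<in> U}" "y \<in> {u. (vector [u, \<theta>] :: complex ^ 2) \<in> U}"
    "0 \<le> u" "0 \<le> v" "u + v = 1"
  have "u *\<^sub>R (vector [x, \<theta>] :: complex ^ 2) + v *\<^sub>R vector [y, \<theta>] \<in> U"
    using * by (intro convexD[OF assms]) auto
  moreover have "u *\<^sub>R \<theta> + v *\<^sub>R \<theta> = \<theta>" using * by (simp flip: scaleR_left_distrib)
  ultimately show "u *\<^sub>R x + v *\<^sub>R y \<in> {u. (vector [u, \<theta>] :: complex ^ 2) \<in> U}"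
    using * by (simp add: vector_2_convex_comb)
qed

lemma connected_slice2:
  assumes "convex U"
  shows "connected {u. (vector [c, u] :: complex ^ 2) \<in> U}"
proof (rule convex_connected, rule convexI)
  fix x y :: complex and u v :: real
  assume *: "x \<in> {u. (vector [c, u] :: complex ^ 2) \<in> U}" "y \<in> {u. (vector [c, u] :: complex ^ 2) \<in> U}"
    "0 \<le> u" "0 \<le> v" "u + v = 1"
  have "u *\<^sub>R (vector [c, x] :: complex ^ 2) + v *\<^sub>R vector [c, y] \<in> U"
    using * by (intro convexD[OF assms]) auto
  moreover have "u *\<^sub>R c + v *\<^sub>R c = c" using * by (simp flip: scaleR_left_distrib)
  ultimately show "u *\<^sub>R x + v *\<^sub>R y \<in> {u. (vector [c, u] :: complex ^ 2) \<in> U}"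
    using * by (simp add: vector_2_convex_comb)
qed

lemma slice1_centre:
  assumes "x \<in> ball p r"
  shows "(vector [p $ 1, x $ 2] :: complex ^ 2) \<in> ball p r"
proof -
  have "dist p (vector [p $ 1, x $ 2]) = dist (p $ 2) (x $ 2)"
    using dist_vector_2_same1[of "p $ 1" "p $ 2" "x $ 2"] by (simp add: vector_2_eta)
  also have "\<dots> \<le> dist p x"
    using Finite_Cartesian_Product.norm_nth_le[of "p - x" 2] by (simp add: dist_norm)
  finally show ?thesis using assms by simp
qed

text \<open>The order of vanishing along the fibre is finite, because it is bounded by the order of vanishing at
  the fibre of a one-variable slice on which \<open>g\<close> does not vanish identically.\<close>

lemma fibre_order:
  fixes g :: "complex ^ 2 \<Rightarrow> complex" and p :: "complex ^ 2"
  defines "c \<equiv> p $ 1"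
  assumes g: "mv_holomorphic_on g (ball p r)" and x0: "x0 \<in> ball p r" "g x0 \<noteq> 0"
  shows "\<exists>k g'. mv_holomorphic_on g' (ball p r) \<and> (\<forall>x\<in>ball p r. g x = (x $ 1 - c) ^ k * g' x) \<and>
    (\<exists>x\<in>ball p r. x $ 1 = c \<and> g' x \<noteq> 0)"
proof (rule ccontr)
  assume neg: "\<not> ?thesis"
  \<comment> \<open>If no order existed, every quotient would vanish on the fibre and the division
    could be repeated indefinitely.\<close>
  have all: "\<exists>g'. mv_holomorphic_on g' (ball p r) \<and> (\<forall>x\<in>ball p r. g x = (x $ 1 - c) ^ k * g' x)" for k
  proof (induction k)
    case 0
    show ?case using g by (intro exI[of _ g]) simp
  next
    case (Suc k)
    then obtain g' where g': "mv_holomorphic_on g' (ball p r)" "\<forall>x\<in>ball p r. g x = (x $ 1 - c) ^ k * g' x"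
      by (elim exE conjE) (rule that; assumption)
    have z: "g' x = 0" if "x \<in> ball p r" "x $ 1 = c" for x
    proof (rule ccontr)
      assume "g' x \<noteq> 0"
      hence "\<exists>k g'. mv_holomorphic_on g' (ball p r) \<and> (\<forall>x\<in>ball p r. g x = (x $ 1 - c) ^ k * g' x) \<and>
        (\<exists>x\<in>ball p r. x $ 1 = c \<and> g' x \<noteq> 0)"
        using that g' by (intro exI[of _ k] exI[of _ g'] conjI bexI[of _ x]) simp_all
      thus False using neg by simp
    qed
    have "\<exists>h. mv_holomorphic_on h (ball p r) \<and> (\<forall>x\<in>ball p r. g' x = (x $ 1 - c) * h x)"
      by (rule divide_fibre[OF g'(1)]) (use z in auto)
    then obtain h where h: "mv_holomorphic_on h (ball p r)" "\<forall>x\<in>ball p r. g' x = (x $ 1 - c) * h x"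
      by (elim exE conjE) (rule that; assumption)
    have "\<forall>x\<in>ball p r. g x = (x $ 1 - c) ^ Suc k * h x" using g'(2) h(2) by simp
    thus ?case using h(1) by (intro exI[of _ h] conjI)
  qed
  define \<theta> where "\<theta> = x0 $ 2"
  define S where "S = {u. (vector [u, \<theta>] :: complex ^ 2) \<in> ball p r}"
  define \<phi> where "\<phi> = (\<lambda>u. g (vector [u, \<theta>]))"
  have S: "open S" "connected S" unfolding S_def by (intro open_slice1 open_ball, intro connected_slice1 convex_ball)
  have cS: "c \<in> S" "x0 $ 1 \<in> S"
    using slice1_centre[OF x0(1)] x0(1) by (simp_all add: S_def c_def \<theta>_def vector_2_eta)
  have hol: "\<phi> holomorphic_on S" unfolding \<phi>_def S_def by (rule mv_holomorphic_on_slice1[OF g])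
  have \<phi>x0: "\<phi> (x0 $ 1) \<noteq> 0" using x0(2) by (simp add: \<phi>_def \<theta>_def vector_2_eta)
  have fac: "\<exists>\<psi>. continuous_on S \<psi> \<and> (\<forall>u\<in>S. \<phi> u = (u - c) ^ k * \<psi> u)" for k
  proof -
    obtain g' where g': "mv_holomorphic_on g' (ball p r)" "\<forall>x\<in>ball p r. g x = (x $ 1 - c) ^ k * g' x"
      using all[of k] by (elim exE conjE) (rule that; assumption)
    have "(\<lambda>u. g' (vector [u, \<theta>])) holomorphic_on S"
      unfolding S_def by (rule mv_holomorphic_on_slice1[OF g'(1)])
    hence "continuous_on S (\<lambda>u. g' (vector [u, \<theta>]))" by (rule holomorphic_on_imp_continuous_on)
    moreover have "\<forall>u\<in>S. \<phi> u = (u - c) ^ k * g' (vector [u, \<theta>])" using g'(2) by (simp add: S_def \<phi>_def)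
    ultimately show ?thesis by (intro exI[of _ "\<lambda>u. g' (vector [u, \<theta>])"] conjI)
  qed
  have \<phi>c: "\<phi> c = 0" using fac[of 1] cS by auto
  have "\<not> \<phi> constant_on S" using \<phi>c \<phi>x0 cS unfolding constant_on_def by metis
  from holomorphic_factor_zero_nonconstant[OF hol S cS(1) \<phi>c this]
  obtain \<psi> \<rho> n where \<psi>: "0 < (n::nat)" "0 < \<rho>" "ball c \<rho> \<subseteq> S" "\<psi> holomorphic_on ball c \<rho>"
    "\<And>w. w \<in> ball c \<rho> \<Longrightarrow> \<phi> w = (w - c) ^ n * \<psi> w" "\<And>w. w \<in> ball c \<rho> \<Longrightarrow> \<psi> w \<noteq> 0" by metis
  \<comment> \<open>The slice has exact order n at c, while \<open>fac\<close> also provides the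
    power n + 1; comparing the two near c forces \<psi> c = 0.\<close>
  obtain \<gamma> where \<gamma>: "continuous_on S \<gamma>" "\<forall>u\<in>S. \<phi> u = (u - c) ^ Suc n * \<gamma> u"
    using fac[of "Suc n"] by (elim exE conjE) (rule that; assumption)
  have cb: "c \<in> ball c \<rho>" using \<psi>(2) by simp
  have eq: "\<psi> w = (w - c) * \<gamma> w" if "w \<in> ball c \<rho>" "w \<noteq> c" for w
  proof -
    have "(w - c) ^ n * \<psi> w = (w - c) ^ n * ((w - c) * \<gamma> w)"
      using \<psi>(5)[OF that(1)] \<gamma>(2) that(1) \<psi>(3) by (auto simp: mult_ac)
    thus ?thesis using that(2) by simp
  qed
  have c1: "isCont \<psi> c"
    using holomorphic_on_imp_continuous_on[OF \<psi>(4)] cb by (simp add: continuous_on_eq_continuous_at)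
  have c2: "isCont \<gamma> c" using \<gamma>(1) S cS by (simp add: continuous_on_eq_continuous_at)
  have "((\<lambda>w. (w - c) * \<gamma> w) \<longlongrightarrow> (c - c) * \<gamma> c) (at c)"
    by (intro tendsto_intros c2[unfolded isCont_def])
  moreover have "\<forall>\<^sub>F w in at c. (w - c) * \<gamma> w = \<psi> w"
    unfolding eventually_at using \<psi>(2) eq by (intro exI[of _ \<rho>]) (simp add: dist_commute)
  ultimately have "(\<psi> \<longlongrightarrow> (c - c) * \<gamma> c) (at c)" by (rule Lim_transform_eventually)
  moreover have "(\<psi> \<longlongrightarrow> \<psi> c) (at c)" using c1 by (simp add: isCont_def)
  ultimately have "\<psi> c = (c - c) * \<gamma> c" by (metis LIM_unique)
  thus False using \<psi>(6)[OF cb] by simp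
qed

text \<open>The identity theorem twice: in the ball for density in the whole space, and in the
  convex slice of the ball for density inside the fibre.\<close>

lemma holomorphic_nonzero_fibre_dense:
  fixes g :: "complex ^ 2 \<Rightarrow> complex" and p :: "complex ^ 2"
  assumes g: "mv_holomorphic_on g (ball p r)" and x: "x \<in> ball p r" "x $ 1 = c" "g x \<noteq> 0"
  shows "fibre_dense 1 {c} (ball p r) {y \<in> ball p r. g y \<noteq> 0}"
  unfolding fibre_dense_def
proof (intro conjI ballI impI)
  show "ball p r \<subseteq> closure {y \<in> ball p r. g y \<noteq> 0}"
  proof (rule subsetI, rule ccontr)
    fix a assume a: "a \<in> ball p r" "a \<notin> closure {y \<in> ball p r. g y \<noteq> 0}"
    have "g x = 0"
    proof (rule mv_holomorphic_on_ball_eq_0[OF g, of "ball p r - closure {y \<in> ball p r. g y \<noteq> 0}" a])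
      fix y assume "y \<in> ball p r - closure {y \<in> ball p r. g y \<noteq> 0}"
      thus "g y = 0" using closure_subset[of "{y \<in> ball p r. g y \<noteq> 0}"] by auto
    qed (use a x(1) in auto)
    thus False using x(3) by simp
  qed
  fix q assume q: "q \<in> ball p r" "q $ 1 \<in> {c}"
  define S where "S = {u. (vector [c, u] :: complex ^ 2) \<in> ball p r}"
  have S: "open S" "connected S" unfolding S_def by (intro open_slice2 open_ball, intro connected_slice2 convex_ball)
  have qS: "q = vector [c, q $ 2]" "q $ 2 \<in> S" and xS: "x = vector [c, x $ 2]" "x $ 2 \<in> S"
    using q x vector_2_eta[of q] vector_2_eta[of x] by (auto simp: S_def)
  define Z where "Z = {y \<in> {y \<in> ball p r. g y \<noteq> 0}. y $ 1 = q $ 1}"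
  show "q \<in> closure {y \<in> {y \<in> ball p r. g y \<noteq> 0}. y $ 1 = q $ 1}"
    unfolding Z_def[symmetric]
  proof (rule ccontr)
    assume "q \<notin> closure Z"
    hence "q $ 2 \<in> {u. (vector [c, u] :: complex ^ 2) \<in> - closure Z}" using qS(1) by simp
    moreover have "open {u. (vector [c, u] :: complex ^ 2) \<in> - closure Z}" by (intro open_slice2) auto
    ultimately have A: "open (S \<inter> {u. (vector [c, u] :: complex ^ 2) \<in> - closure Z})"
      "q $ 2 \<in> S \<inter> {u. (vector [c, u] :: complex ^ 2) \<in> - closure Z}" using S qS(2) by auto
    have "g (vector [c, x $ 2]) = 0"
    proof (rule analytic_continuation[of "\<lambda>u. g (vector [c, u])" S "S \<inter> {u. (vector [c, u] :: complex ^ 2) \<in> - closure Z}" "q $ 2"])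
      show "(\<lambda>u. g (vector [c, u])) holomorphic_on S" unfolding S_def by (rule mv_holomorphic_on_slice2[OF g])
      show "q $ 2 islimpt S \<inter> {u. (vector [c, u] :: complex ^ 2) \<in> - closure Z}"
        using A interior_limit_point interior_open by metis
      fix u assume u: "u \<in> S \<inter> {u. (vector [c, u] :: complex ^ 2) \<in> - closure Z}"
      hence "(vector [c, u] :: complex ^ 2) \<notin> Z" using closure_subset[of Z] by auto
      thus "g (vector [c, u]) = 0" using u q(2) by (auto simp: Z_def S_def)
    qed (use S qS xS in auto)
    thus False using x(3) xS(1) by simp
  qed
qed

text \<open>Up to a change on a nowhere dense set, \<open>F\<close> restricts to a nonzero meromorphic function on the
  fibre over \<open>c\<close>.\<close>

definition fibre_ok :: "complex \<Rightarrow> (complex ^ 2 \<Rightarrow> complex) \<Rightarrow> (complex ^ 2) set \<Rightarrow> bool" where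
  "fibre_ok c F V \<longleftrightarrow> (\<exists>G. agree_on V F G \<and> fib_mero 1 {c} G V)"

section \<open>Existence, uniqueness and constancy of the order along a fibre\<close>

lemma fibre_ok_mult:
  assumes "fibre_ok c F V" "fibre_ok c F' V"
  shows "fibre_ok c (\<lambda>x. F x * F' x) V"
proof -
  obtain G G' where G: "agree_on V F G" "fib_mero 1 {c} G V" "agree_on V F' G'" "fib_mero 1 {c} G' V"
    using assms unfolding fibre_ok_def by (elim exE conjE) (rule that; assumption)
  have "agree_on V (\<lambda>x. F x * F' x) (\<lambda>x. G x * G' x)"
    using agree_on_combine[OF G(1,3)] unfolding agree_on_def
    by (elim exE conjE) (rule exI, intro conjI, assumption+, simp)
  thus ?thesis unfolding fibre_ok_def using fib_mero_mult[OF G(2,4)]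
    by (intro exI[of _ "\<lambda>x. G x * G' x"] conjI)
qed

lemma fibre_ok_inverse:
  assumes "fibre_ok c F V"
  shows "fibre_ok c (\<lambda>x. inverse (F x)) V"
proof -
  obtain G where G: "agree_on V F G" "fib_mero 1 {c} G V"
    using assms unfolding fibre_ok_def by (elim exE conjE) (rule that; assumption)
  have "agree_on V (\<lambda>x. inverse (F x)) (\<lambda>x. inverse (G x))"
    using G(1) unfolding agree_on_def by (elim exE conjE) (rule exI, intro conjI, assumption+, simp)
  thus ?thesis unfolding fibre_ok_def using fib_mero_inverse[OF G(2)]
    by (intro exI[of _ "\<lambda>x. inverse (G x)"] conjI)
qed

lemma fibre_ok_cong: "agree_on V F F' \<Longrightarrow> fibre_ok c F V \<Longrightarrow> fibre_ok c F' V"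
  unfolding fibre_ok_def using agree_on_trans[OF agree_on_sym] by blast

lemma fibre_ok_subset: "fibre_ok c F V \<Longrightarrow> open V' \<Longrightarrow> V' \<subseteq> V \<Longrightarrow> fibre_ok c F V'"
  unfolding fibre_ok_def using agree_on_subset fib_mero_subset by blast

lemma dense_fibre_complement:
  assumes "open (V :: (complex ^ 2) set)"
  shows "V \<subseteq> closure {x\<in>V. x $ 1 \<noteq> c}"
proof
  fix x assume x: "x \<in> V"
  show "x \<in> closure {x\<in>V. x $ 1 \<noteq> c}"
  proof (cases "x $ 1 = c")
    case False
    thus ?thesis using x by (intro subsetD[OF closure_subset]) simp
  next
    case True
    have cV: "c \<in> {u. (vector [u, x $ 2] :: complex ^ 2) \<in> V}" using x True vector_2_eta[of x] by simp
    obtain s where s: "s > 0" "ball c s \<subseteq> {u. (vector [u, x $ 2] :: complex ^ 2) \<in> V}"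
      by (rule openE[OF open_slice1[OF assms] cV])
    show ?thesis
      unfolding closure_approachable
    proof (intro allI impI)
      fix e :: real assume e: "e > 0"
      define u where "u = c + of_real (min s e / 2)"
      have du: "dist u c = min s e / 2" using s(1) e by (simp add: u_def dist_norm)
      have "min s e / 2 > 0" "min s e / 2 < e" "min s e / 2 < s" using s(1) e by linarith+
      hence u: "dist u c < e" "u \<in> ball c s" "u \<noteq> c" using du by (simp, simp add: dist_commute, force)
      have "dist (vector [u, x $ 2] :: complex ^ 2) x = dist u c"
      proof -
        have "vector [c, x $ 2] = x" using vector_2_eta[of x] unfolding True .
        thus ?thesis using dist_vector_2_same2[of u "x $ 2" c] by simp
      qed
      thus "\<exists>y\<in>{x\<in>V. x $ 1 \<noteq> c}. dist y x < e"
        using u s(2) by (intro bexI[of _ "vector [u, x $ 2]"]) auto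
    qed
  qed
qed

text \<open>Numerator and denominator have finite orders k and l along the fibre. The exponent m = l
  - k is the negative of the order of H, and what remains is a quotient of functions that do not
  vanish identically on the fibre.\<close>

lemma fibre_order_local:
  fixes q :: "complex ^ 2"
  defines "c \<equiv> q $ 1"
  assumes H: "fib_mero 1 {} H U" and q: "q \<in> U"
  shows "\<exists>(m::int) V. open V \<and> q \<in> V \<and> V \<subseteq> U \<and> fibre_ok c (\<lambda>x. H x * (x $ 1 - c) powi m) V"
proof -
  obtain V0 g h W where 1: "open V0" "q \<in> V0" "V0 \<subseteq> U" "mv_holomorphic_on g V0" "mv_holomorphic_on h V0"
    "open W" "W \<subseteq> V0" "fibre_dense 1 {} V0 W" "\<forall>x\<in>W. g x \<noteq> 0" "\<forall>x\<in>W. h x \<noteq> 0"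
    "\<forall>x\<in>W. H x = g x / h x" by (rule fib_meroE[OF H q])
  obtain r where r: "r > 0" "ball q r \<subseteq> V0" using 1(1,2) openE by blast
  let ?B = "ball q r"
  have fd: "fibre_dense 1 {} ?B (?B \<inter> W)" by (rule fibre_dense_restrict[OF 1(8) open_ball r(2)])
  hence dW: "?B \<subseteq> closure (?B \<inter> W)" by (rule fibre_dense_dense)
  have "?B \<inter> W \<noteq> {}"
  proof
    assume "?B \<inter> W = {}"
    hence "?B \<subseteq> {}" using dW by simp
    thus False using r(1) by simp
  qed
  then obtain x0 where x0: "x0 \<in> ?B" "x0 \<in> W" by auto
  have gB: "mv_holomorphic_on g ?B" "mv_holomorphic_on h ?B"
    using mv_holomorphic_on_subset[OF 1(4) r(2)] mv_holomorphic_on_subset[OF 1(5) r(2)] by auto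
  have nz: "g x0 \<noteq> 0" "h x0 \<noteq> 0" using 1(9,10) x0(2) by auto
  obtain k g' xg where g': "mv_holomorphic_on g' ?B" "\<forall>x\<in>?B. g x = (x $ 1 - c) ^ k * g' x"
    "xg \<in> ?B" "xg $ 1 = c" "g' xg \<noteq> 0"
    using fibre_order[OF gB(1) x0(1) nz(1), folded c_def] by (elim exE conjE bexE) (rule that, assumption+)
  obtain l h' xh where h': "mv_holomorphic_on h' ?B" "\<forall>x\<in>?B. h x = (x $ 1 - c) ^ l * h' x"
    "xh \<in> ?B" "xh $ 1 = c" "h' xh \<noteq> 0"
    using fibre_order[OF gB(2) x0(1) nz(2), folded c_def] by (elim exE conjE bexE) (rule that, assumption+)
  have fg: "fib_mero 1 {c} g' ?B"
    by (rule fib_mero_holomorphic[OF g'(1) open_ball holomorphic_nonzero_fibre_dense[OF g'(1,3,4,5)]])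
  have fh: "fib_mero 1 {c} h' ?B"
    by (rule fib_mero_holomorphic[OF h'(1) open_ball holomorphic_nonzero_fibre_dense[OF h'(1,3,4,5)]])
  define m where "m = int l - int k"
  have "agree_on ?B (\<lambda>x. H x * (x $ 1 - c) powi m) (\<lambda>x. g' x * inverse (h' x))"
    unfolding agree_on_def
  proof (intro exI[of _ "(?B \<inter> W) \<inter> {x\<in>?B. x $ 1 \<noteq> c}"] conjI ballI)
    have "open {x :: complex ^ 2. x $ 1 \<noteq> c}" by (intro open_Collect_neq continuous_intros)
    moreover have "(?B \<inter> W) \<inter> {x\<in>?B. x $ 1 \<noteq> c} = ?B \<inter> W \<inter> {x. x $ 1 \<noteq> c}" by auto
    ultimately show "open ((?B \<inter> W) \<inter> {x\<in>?B. x $ 1 \<noteq> c})" using 1(6) by auto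
    show "?B \<subseteq> closure ((?B \<inter> W) \<inter> {x\<in>?B. x $ 1 \<noteq> c})"
      by (rule dense_open_Int[OF _ _ dW dense_fibre_complement]) (use 1(6) in auto)
    fix x assume x: "x \<in> (?B \<inter> W) \<inter> {x\<in>?B. x $ 1 \<noteq> c}"
    define d where "d = x $ 1 - c"
    have d: "d \<noteq> 0" using x by (simp add: d_def)
    have "g x = d ^ k * g' x" "h x = d ^ l * h' x" "H x = g x / h x" using x g'(2) h'(2) 1(11) by (auto simp: d_def)
    moreover have "d powi m = d ^ l / d ^ k" using d by (simp add: m_def power_int_diff)
    ultimately have "H x * d powi m = g' x * inverse (h' x)" using d by (simp add: field_simps)
    thus "H x * (x $ 1 - c) powi m = g' x * inverse (h' x)" by (simp add: d_def)
  qed auto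
  hence "fibre_ok c (\<lambda>x. H x * (x $ 1 - c) powi m) ?B"
    unfolding fibre_ok_def using fib_mero_mult[OF fg fib_mero_inverse[OF fh]]
    by (intro exI[of _ "\<lambda>x. g' x * inverse (h' x)"] conjI)
  thus ?thesis using r 1(3) by (intro exI[of _ m] exI[of _ ?B] conjI) auto
qed

text \<open>Clearing denominators gives g = (x1 - c)^d h at every point by continuity, so g vanishes
  on the fibre, although W, where g is nonzero, is dense in the fibre.\<close>

lemma not_fibre_ok_power:
  fixes q :: "complex ^ 2"
  assumes V: "open V" "q \<in> V" "q $ 1 = c" and d: "d > 0"
  shows "\<not> fibre_ok c (\<lambda>x. (x $ 1 - c) ^ d) V"
proof
  assume "fibre_ok c (\<lambda>x. (x $ 1 - c) ^ d) V"
  then obtain G where G: "agree_on V (\<lambda>x. (x $ 1 - c) ^ d) G" "fib_mero 1 {c} G V"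
    unfolding fibre_ok_def by (elim exE conjE) (rule that; assumption)
  obtain V0 g h W where 1: "open V0" "q \<in> V0" "V0 \<subseteq> V" "mv_holomorphic_on g V0" "mv_holomorphic_on h V0"
    "open W" "W \<subseteq> V0" "fibre_dense 1 {c} V0 W" "\<forall>x\<in>W. g x \<noteq> 0" "\<forall>x\<in>W. h x \<noteq> 0"
    "\<forall>x\<in>W. G x = g x / h x" by (rule fib_meroE[OF G(2) V(2)])
  obtain W' where W': "open W'" "W' \<subseteq> V0" "V0 \<subseteq> closure W'" "\<forall>x\<in>W'. (x $ 1 - c) ^ d = G x"
    using agree_on_subset[OF G(1) 1(1,3)] unfolding agree_on_def by (elim exE conjE) (rule that; assumption)
  have hol: "mv_holomorphic_on (\<lambda>x. (x $ 1 - c) ^ d * h x) V0"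
    by (intro mv_hol_intros 1(5))
  have eq: "(x $ 1 - c) ^ d * h x = g x" if "x \<in> V0" for x
  proof (rule eq_on_dense[OF mv_holomorphic_on_continuous[OF hol] mv_holomorphic_on_continuous[OF 1(4)] 1(1) _ _ that])
    show "V0 \<subseteq> closure (W' \<inter> W)" by (rule dense_open_Int[OF W'(1-3) fibre_dense_dense[OF 1(8)]])
    fix x assume "x \<in> V0 \<inter> (W' \<inter> W)"
    hence "(x $ 1 - c) ^ d = g x / h x" "h x \<noteq> 0" using W'(4) 1(10,11) by auto
    thus "(x $ 1 - c) ^ d * h x = g x" by simp
  qed
  have "q \<in> closure {x\<in>W. x $ 1 = q $ 1}" using 1(2) V(3) by (intro fibre_denseD[OF 1(8)]) auto
  hence "{x\<in>W. x $ 1 = q $ 1} \<noteq> {}" by (metis closure_empty empty_iff)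
  then obtain x where x: "x \<in> W" "x $ 1 = c" using V(3) by auto
  have "g x = 0" using eq[of x] x 1(7) d by (auto simp: power_0_left)
  thus False using 1(9) x(1) by simp
qed

text \<open>The two normalisations differ by the factor (x1 - c)^(m - n), which is excluded for a
  positive exponent. Exchanging m and n yields equality.\<close>

lemma fibre_order_unique:
  fixes q :: "complex ^ 2" and m n :: int
  assumes H: "fib_mero 1 {} H U" and V: "open V" "q \<in> V" "V \<subseteq> U" "q $ 1 = c"
    and m: "fibre_ok c (\<lambda>x. H x * (x $ 1 - c) powi m) V" and n: "fibre_ok c (\<lambda>x. H x * (x $ 1 - c) powi n) V"
  shows "m \<le> n"
proof (rule ccontr)
  assume "\<not> m \<le> n"
  define d where "d = nat (m - n)"
  have d: "d > 0" "m = n + int d" using \<open>\<not> m \<le> n\<close> by (auto simp: d_def)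
  have qU: "q \<in> U" using V by auto
  obtain V0 g h W where 1: "open V0" "q \<in> V0" "V0 \<subseteq> U" "mv_holomorphic_on g V0" "mv_holomorphic_on h V0"
    "open W" "W \<subseteq> V0" "fibre_dense 1 {} V0 W" "\<forall>x\<in>W. g x \<noteq> 0" "\<forall>x\<in>W. h x \<noteq> 0"
    "\<forall>x\<in>W. H x = g x / h x" by (rule fib_meroE[OF H qU])
  let ?N = "V \<inter> V0"
  have N: "open ?N" "?N \<subseteq> V" "?N \<subseteq> V0" "q \<in> ?N" using V 1 by auto
  have "fibre_ok c (\<lambda>x. (H x * (x $ 1 - c) powi m) * inverse (H x * (x $ 1 - c) powi n)) ?N"
    by (intro fibre_ok_mult fibre_ok_inverse fibre_ok_subset[OF m N(1,2)] fibre_ok_subset[OF n N(1,2)])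
  moreover have "agree_on ?N (\<lambda>x. (H x * (x $ 1 - c) powi m) * inverse (H x * (x $ 1 - c) powi n)) (\<lambda>x. (x $ 1 - c) ^ d)"
    unfolding agree_on_def
  proof (intro exI[of _ "(?N \<inter> W) \<inter> {x\<in>?N. x $ 1 \<noteq> c}"] conjI ballI)
    have "open {x :: complex ^ 2. x $ 1 \<noteq> c}" by (intro open_Collect_neq continuous_intros)
    moreover have "(?N \<inter> W) \<inter> {x\<in>?N. x $ 1 \<noteq> c} = ?N \<inter> W \<inter> {x. x $ 1 \<noteq> c}" by auto
    ultimately show "open ((?N \<inter> W) \<inter> {x\<in>?N. x $ 1 \<noteq> c})" using 1(6) N(1) by auto
    have "?N \<subseteq> closure (?N \<inter> W)" by (rule dense_subset_open[OF fibre_dense_dense[OF 1(8)] N(1,3)])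
    thus "?N \<subseteq> closure ((?N \<inter> W) \<inter> {x\<in>?N. x $ 1 \<noteq> c})"
      by (intro dense_open_Int[OF _ _ _ dense_fibre_complement[OF N(1)]]) (use 1(6) N(1) in auto)
    fix x assume x: "x \<in> (?N \<inter> W) \<inter> {x\<in>?N. x $ 1 \<noteq> c}"
    define e where "e = x $ 1 - c"
    have e: "e \<noteq> 0" using x by (simp add: e_def)
    have "H x = g x / h x" "g x \<noteq> 0" "h x \<noteq> 0" using x 1(9-11) by blast+
    hence Hx: "H x \<noteq> 0" by simp
    have "e powi m = e powi n * e ^ d" using e by (simp add: d(2) power_int_add)
    moreover have "e powi n \<noteq> 0" using e by simp
    ultimately have "(H x * e powi m) * inverse (H x * e powi n) = e ^ d" using Hx by (simp add: field_simps)
    thus "(H x * (x $ 1 - c) powi m) * inverse (H x * (x $ 1 - c) powi n) = (x $ 1 - c) ^ d" by (simp add: e_def)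
  qed auto
  ultimately have "fibre_ok c (\<lambda>x. (x $ 1 - c) ^ d) ?N" by (rule fibre_ok_cong[rotated])
  thus False using not_fibre_ok_power[OF N(1,4) V(4) d(1)] by simp
qed

lemma fibre_ok_everywhere:
  fixes p :: "complex ^ 2"
  defines "c \<equiv> p $ 1"
  assumes H: "fib_mero 1 {} H HC" and p: "p \<in> HC" and v: "regular_value H p v" "v \<noteq> 0"
    and q: "q \<in> HC" "q $ 1 = c"
  shows "\<exists>V. open V \<and> q \<in> V \<and> V \<subseteq> HC \<and> fibre_ok c H V"
proof -
  \<comment> \<open>\<open>A m\<close> consists of the \<theta> at which the order along the fibre
    is - m. These sets are open, disjoint and cover the plane, and a regular nonzero value puts
    \<open>p $ 2\<close> into \<open>A 0\<close>.\<close>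
  define A :: "int \<Rightarrow> complex set" where
    "A m = {\<theta>. \<exists>V. open V \<and> vector [c, \<theta>] \<in> V \<and> V \<subseteq> HC \<and> fibre_ok c (\<lambda>x. H x * (x $ 1 - c) powi m) V}" for m
  have inHC: "(vector [c, \<theta>] :: complex ^ 2) \<in> HC" for \<theta> using p by (simp add: HC_def c_def)
  have oA: "open (A m)" for m
    unfolding open_subopen[of "A m"]
  proof
    fix \<theta> assume "\<theta> \<in> A m"
    then obtain V where V: "open V" "vector [c, \<theta>] \<in> V" "V \<subseteq> HC" "fibre_ok c (\<lambda>x. H x * (x $ 1 - c) powi m) V"
      unfolding A_def mem_Collect_eq by (elim exE conjE) (rule that; assumption)
    have "{u. (vector [c, u] :: complex ^ 2) \<in> V} \<subseteq> A m"
    proof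
      fix u assume "u \<in> {u. (vector [c, u] :: complex ^ 2) \<in> V}"
      thus "u \<in> A m" unfolding A_def mem_Collect_eq using V by (intro exI[of _ V] conjI)
    qed
    thus "\<exists>T. open T \<and> \<theta> \<in> T \<and> T \<subseteq> A m" using open_slice2[OF V(1), of c] V(2)
      by (intro exI[of _ "{u. (vector [c, u] :: complex ^ 2) \<in> V}"]) simp
  qed
  have cover: "\<exists>m. \<theta> \<in> A m" for \<theta>
    using fibre_order_local[OF H inHC[of \<theta>]] unfolding A_def mem_Collect_eq by simp
  have le: "m \<le> n" if a: "\<theta> \<in> A m" "\<theta> \<in> A n" for \<theta> m n
  proof -
    obtain V where V: "open V" "vector [c, \<theta>] \<in> V" "V \<subseteq> HC" "fibre_ok c (\<lambda>x. H x * (x $ 1 - c) powi m) V"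
      using a(1) unfolding A_def mem_Collect_eq by (elim exE conjE) (rule that; assumption)
    obtain V' where V': "open V'" "vector [c, \<theta>] \<in> V'" "V' \<subseteq> HC" "fibre_ok c (\<lambda>x. H x * (x $ 1 - c) powi n) V'"
      using a(2) unfolding A_def mem_Collect_eq by (elim exE conjE) (rule that; assumption)
    have o: "open (V \<inter> V')" using V(1) V'(1) by auto
    show ?thesis
      by (rule fibre_order_unique[OF H o _ _ _ fibre_ok_subset[OF V(4) o] fibre_ok_subset[OF V'(4) o], of "vector [c, \<theta>]"])
        (use V V' in auto)
  qed
  have "p $ 2 \<in> A 0"
  proof -
    obtain V G where V: "open V" "p \<in> V" "mv_holomorphic_on G V" "agree_on V H G" "G p = v"
      using v(1) unfolding regular_value_def by (elim exE conjE) (rule that; assumption)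
    let ?V = "V \<inter> HC"
    let ?N = "{x\<in>?V. G x \<noteq> 0}"
    have o: "open ?V" using V(1) open_HC by auto
    have holV: "mv_holomorphic_on G ?V" using V(3) by (rule mv_holomorphic_on_subset) auto
    have oN: "open ?N" by (rule mv_holomorphic_on_open_nonzero[OF holV o])
    have "fib_mero 1 {c} G ?N"
      by (rule fib_mero_holomorphic_nz[OF mv_holomorphic_on_subset[OF holV] oN]) auto
    moreover have "agree_on ?N H G" by (rule agree_on_subset[OF V(4) oN]) auto
    ultimately have "fibre_ok c H ?N" unfolding fibre_ok_def by (intro exI[of _ G] conjI)
    moreover have "p \<in> ?N" using V p v(2) by simp
    moreover have "vector [c, p $ 2] = p" by (simp add: c_def vector_2_eta)
    ultimately show ?thesis unfolding A_def mem_Collect_eq using oN by (intro exI[of _ ?N]) auto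
  qed
  moreover have "open (- A 0)"
  proof -
    have "- A 0 = (\<Union>m\<in>-{0}. A m)"
    proof (intro equalityI subsetI)
      fix \<theta> assume "\<theta> \<in> - A 0"
      moreover obtain m where "\<theta> \<in> A m" using cover by blast
      ultimately have "m \<noteq> 0" by auto
      thus "\<theta> \<in> (\<Union>m\<in>-{0}. A m)" using \<open>\<theta> \<in> A m\<close> by auto
    next
      fix \<theta> assume "\<theta> \<in> (\<Union>m\<in>-{0}. A m)"
      then obtain m where m: "m \<noteq> 0" "\<theta> \<in> A m" by auto
      show "\<theta> \<in> - A 0"
      proof
        assume "\<theta> \<in> A 0"
        hence "m = 0" using le[OF m(2), of 0] le[OF _ m(2), of 0] by (intro antisym)
        thus False using m(1) by simp
      qed
    qed
    thus ?thesis using oA by auto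
  qed
  ultimately have "A 0 = UNIV" using connected_UNIV oA[of 0] unfolding connected_clopen
    by (metis closed_closedin closed_def empty_iff open_openin subtopology_UNIV)
  hence "q $ 2 \<in> A 0" by simp
  moreover have "vector [c, q $ 2] = q" using q(2) vector_2_eta[of q] by simp
  ultimately show ?thesis unfolding A_def mem_Collect_eq by simp
qed

text \<open>Splitting off the zero at \<open>a\<close> leaves a factor bounded away from 0, and f is
  bounded near \<open>a\<close>. Both constants disappear at small distances: one more power of |d|
  absorbs the lower one, the factor 1/|d| the upper one.\<close>

lemma holomorphic_power_bounds:
  assumes f: "f holomorphic_on ball a r" and r: "r > 0" and nz: "\<exists>u\<in>ball a r. f u \<noteq> 0"
  shows "\<exists>\<epsilon>>0. \<exists>k::nat. \<forall>d. 0 < norm d \<and> norm d < \<epsilon> \<longrightarrow> norm d ^ k \<le> norm (f (a + d)) \<and> norm (f (a + d)) \<le> inverse (norm d)"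
proof -
  have lower: "\<exists>\<epsilon>>0. \<exists>k. \<exists>b>0. \<forall>d. norm d < \<epsilon> \<longrightarrow> b * norm d ^ k \<le> norm (f (a + d))"
  proof -
    have nzlow: "\<exists>\<epsilon>>0. \<exists>b>0. \<forall>d. norm d < \<epsilon> \<longrightarrow> b \<le> norm (g (a + d))"
      if g: "isCont g a" "g a \<noteq> 0" for g :: "complex \<Rightarrow> complex"
    proof -
      have "norm (g a) / 2 > 0" using g by simp
      then obtain \<epsilon> where e: "\<epsilon> > 0" "\<And>x. dist x a < \<epsilon> \<Longrightarrow> dist (g x) (g a) < norm (g a) / 2"
        using g(1) unfolding continuous_at_eps_delta by metis
      have "norm (g a) / 2 \<le> norm (g (a + d))" if "norm d < \<epsilon>" for d
        using e(2)[of "a + d"] that norm_triangle_ineq2[of "g a" "g (a + d)"]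
        by (simp add: dist_norm norm_minus_commute)
      thus ?thesis using e(1) \<open>norm (g a) / 2 > 0\<close> by blast
    qed
    have cont: "isCont h a" if "h holomorphic_on ball a s" "s > 0" for h s
      using holomorphic_on_imp_continuous_on[OF that(1)] that(2) by (simp add: continuous_on_eq_continuous_at)
    show ?thesis
    proof (cases "f a = 0")
      case False
      then obtain \<epsilon> b where "\<epsilon> > 0" "b > 0" "\<forall>d. norm d < \<epsilon> \<longrightarrow> b \<le> norm (f (a + d))"
        using nzlow[OF cont[OF f r]] by blast
      thus ?thesis by (intro exI[of _ \<epsilon>] conjI exI[of _ "0::nat"] exI[of _ b]) auto
    next
      case True
      obtain u where u: "u \<in> ball a r" "f u \<noteq> 0" using nz by blast
      have "\<not> f constant_on ball a r"
        using u True r unfolding constant_on_def by (metis centre_in_ball)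
      from holomorphic_factor_zero_nonconstant[OF f open_ball connected_ball _ True this]
      obtain g s n where g: "0 < s" "g holomorphic_on ball a s"
        "\<And>w. w \<in> ball a s \<Longrightarrow> f w = (w - a) ^ n * g w" "\<And>w. w \<in> ball a s \<Longrightarrow> g w \<noteq> 0"
        using r by (metis centre_in_ball)
      obtain \<epsilon> b where e: "\<epsilon> > 0" "b > 0" "\<forall>d. norm d < \<epsilon> \<longrightarrow> b \<le> norm (g (a + d))"
        using nzlow[OF cont[OF g(2,1)] g(4)] g(1) by auto
      have "b * norm d ^ n \<le> norm (f (a + d))" if "norm d < min \<epsilon> s" for d
      proof -
        have "a + d \<in> ball a s" using that by (simp add: dist_norm)
        hence "norm (f (a + d)) = norm d ^ n * norm (g (a + d))" by (simp add: g(3) norm_mult norm_power)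
        moreover have "norm d ^ n * b \<le> norm d ^ n * norm (g (a + d))"
          using e(3) that by (intro mult_left_mono) auto
        ultimately show ?thesis by (simp add: mult.commute)
      qed
      thus ?thesis using e g(1) by (intro exI[of _ "min \<epsilon> s"] conjI exI[of _ n] exI[of _ b]) auto
    qed
  qed
  then obtain \<epsilon> k b where e: "\<epsilon> > 0" "b > 0" "\<forall>d. norm d < \<epsilon> \<longrightarrow> b * norm d ^ k \<le> norm (f (a + d))"
    by blast
  have "continuous_on (cball a (r / 2)) f"
    by (rule continuous_on_subset[OF holomorphic_on_imp_continuous_on[OF f]]) (use r in auto)
  hence "bounded (f ` cball a (r / 2))" by (intro compact_imp_bounded compact_continuous_image compact_cball)
  then obtain M where M: "M > 0" "\<And>x. x \<in> cball a (r / 2) \<Longrightarrow> norm (f x) \<le> M" unfolding bounded_pos by auto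
  define \<delta> where "\<delta> = min (min \<epsilon> b) (min (r / 2) (inverse M))"
  have "norm d ^ Suc k \<le> norm (f (a + d)) \<and> norm (f (a + d)) \<le> inverse (norm d)" if "0 < norm d" "norm d < \<delta>" for d
  proof
    have d: "norm d < \<epsilon>" "norm d < b" "norm d < r / 2" "norm d < inverse M" using that by (auto simp: \<delta>_def)
    have "norm d ^ Suc k \<le> b * norm d ^ k" using d(2) by (simp add: mult_right_mono)
    also have "\<dots> \<le> norm (f (a + d))" using e(3) d(1) by blast
    finally show "norm d ^ Suc k \<le> norm (f (a + d))" .
    have "norm (f (a + d)) \<le> M" using d(3) by (intro M(2)) (simp add: dist_norm)
    also have "\<dots> \<le> inverse (norm d)" using d(4) M(1) that(1)
      by (metis inverse_inverse_eq less_imp_le le_imp_inverse_le)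
    finally show "norm (f (a + d)) \<le> inverse (norm d)" .
  qed
  moreover have "\<delta> > 0" using e r M(1) by (simp add: \<delta>_def)
  ultimately show ?thesis by (intro exI[of _ \<delta>] conjI exI[of _ "Suc k"]) auto
qed

text \<open>On the fibre, numerator and denominator are holomorphic in one variable and not
  identically zero, so \<open>holomorphic_power_bounds\<close> applies to both. The puncture
  matters: q itself may be a zero, a pole or a point of indeterminacy.\<close>

lemma fibre_ok_bounds:
  fixes q :: "complex ^ 2"
  assumes V: "open V" "q \<in> V" and F: "fibre_ok (q $ 1) F V"
  shows "\<exists>\<epsilon>>0. \<exists>k::nat. \<forall>d. 0 < norm d \<and> norm d < \<epsilon> \<longrightarrow>
    (\<exists>v. regular_value F (vector [q $ 1, q $ 2 + d]) v \<and> norm d ^ k \<le> norm v \<and> norm v \<le> inverse (norm d ^ k))"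
proof -
  obtain G where G: "agree_on V F G" "fib_mero 1 {q $ 1} G V"
    using F unfolding fibre_ok_def by (elim exE conjE) (rule that; assumption)
  obtain V0 g h W where 1: "open V0" "q \<in> V0" "V0 \<subseteq> V" "mv_holomorphic_on g V0" "mv_holomorphic_on h V0"
    "open W" "W \<subseteq> V0" "fibre_dense 1 {q $ 1} V0 W" "\<forall>x\<in>W. g x \<noteq> 0" "\<forall>x\<in>W. h x \<noteq> 0"
    "\<forall>x\<in>W. G x = g x / h x" by (rule fib_meroE[OF G(2) V(2)])
  obtain W' where W': "open W'" "W' \<subseteq> V0" "V0 \<subseteq> closure W'" "\<forall>x\<in>W'. F x = G x"
    using agree_on_subset[OF G(1) 1(1,3)] unfolding agree_on_def by (elim exE conjE) (rule that; assumption)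
  obtain r where r: "r > 0" "ball q r \<subseteq> V0" using 1(1,2) openE by blast
  let ?l = "\<lambda>u. vector [q $ 1, u] :: complex ^ 2"
  have sub: "ball (q $ 2) r \<subseteq> {u. ?l u \<in> V0}"
  proof
    fix u assume "u \<in> ball (q $ 2) r"
    hence "?l u \<in> ball q r" using dist_vector_2_same1[of "q $ 1" "q $ 2" u] by (simp add: vector_2_eta)
    thus "u \<in> {u. ?l u \<in> V0}" using r(2) by blast
  qed
  have "q \<in> closure {x\<in>ball q r \<inter> W. x $ 1 = q $ 1}"
    using r(1) by (intro fibre_denseD[OF fibre_dense_restrict[OF 1(8) open_ball r(2)]]) auto
  hence "{x\<in>ball q r \<inter> W. x $ 1 = q $ 1} \<noteq> {}" by (metis closure_empty empty_iff)
  then obtain x where x: "x \<in> ball q r" "x \<in> W" "x $ 1 = q $ 1" by auto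
  have xl: "x = ?l (x $ 2)" using vector_2_eta[of x] x(3) by simp
  have x2: "x $ 2 \<in> ball (q $ 2) r"
    using x(1) Finite_Cartesian_Product.norm_nth_le[of "q - x" 2] by (simp add: dist_norm)
  have hol: "(\<lambda>u. g (?l u)) holomorphic_on ball (q $ 2) r" "(\<lambda>u. h (?l u)) holomorphic_on ball (q $ 2) r"
    by (rule holomorphic_on_subset[OF mv_holomorphic_on_slice2[OF 1(4)] sub],
        rule holomorphic_on_subset[OF mv_holomorphic_on_slice2[OF 1(5)] sub])
  have nz: "\<exists>u\<in>ball (q $ 2) r. g (?l u) \<noteq> 0" "\<exists>u\<in>ball (q $ 2) r. h (?l u) \<noteq> 0"
    using x2 xl 1(9,10) x(2) by (metis, metis)
  obtain e1 k1 where 2: "e1 > 0" "\<forall>d. 0 < norm d \<and> norm d < e1 \<longrightarrow>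
      norm d ^ k1 \<le> norm (g (?l (q $ 2 + d))) \<and> norm (g (?l (q $ 2 + d))) \<le> inverse (norm d)"
    using holomorphic_power_bounds[OF hol(1) r(1) nz(1)] by (elim exE conjE) (rule that; assumption)
  obtain e2 k2 where 3: "e2 > 0" "\<forall>d. 0 < norm d \<and> norm d < e2 \<longrightarrow>
      norm d ^ k2 \<le> norm (h (?l (q $ 2 + d))) \<and> norm (h (?l (q $ 2 + d))) \<le> inverse (norm d)"
    using holomorphic_power_bounds[OF hol(2) r(1) nz(2)] by (elim exE conjE) (rule that; assumption)
  \<comment> \<open>The lower bound uses the exponent k1 + 1 and the upper bound k2 + 1; as the
    distance is below 1, the sum serves for both.\<close>
  define k where "k = Suc k1 + Suc k2"
  define \<epsilon> where "\<epsilon> = min (min e1 e2) (min r 1)"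
  have "\<exists>v. regular_value F (?l (q $ 2 + d)) v \<and> norm d ^ k \<le> norm v \<and> norm v \<le> inverse (norm d ^ k)"
    if d: "0 < norm d" "norm d < \<epsilon>" for d
  proof -
    define G' H' where "G' = g (?l (q $ 2 + d))" and "H' = h (?l (q $ 2 + d))"
    define n where "n = norm d"
    have n: "0 < n" "n < 1" "n \<le> 1" using d by (auto simp: n_def \<epsilon>_def)
    have bg: "n ^ k1 \<le> norm G'" "norm G' \<le> inverse n" and bh: "n ^ k2 \<le> norm H'" "norm H' \<le> inverse n"
      using 2(2) 3(2) d by (auto simp: G'_def H'_def n_def \<epsilon>_def)
    have H0: "H' \<noteq> 0" 
    proof -
      have "0 < norm H'" using bh(1) zero_less_power[OF n(1), of k2] by linarith
      thus ?thesis by simp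
    qed
    have "q $ 2 + d \<in> ball (q $ 2) r" using d by (simp add: dist_norm \<epsilon>_def)
    hence V0: "?l (q $ 2 + d) \<in> V0" using sub by auto
    have "regular_value F (?l (q $ 2 + d)) (G' / H')"
      unfolding G'_def H'_def
    proof (rule regular_value_quotientI[OF 1(1) V0 1(4,5) _ , of "W' \<inter> W"])
      show "h (?l (q $ 2 + d)) \<noteq> 0" using H0 by (simp add: H'_def)
      show "V0 \<subseteq> closure (W' \<inter> W)" by (rule dense_open_Int[OF W'(1-3) fibre_dense_dense[OF 1(8)]])
    qed (use W' 1 in auto)
    moreover have "n ^ k \<le> norm (G' / H')"
    proof -
      have "n ^ k \<le> n ^ Suc k1" using n by (intro power_decreasing) (auto simp: k_def)
      also have "\<dots> = n ^ k1 * n" by simp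
      also have "\<dots> \<le> norm G' * inverse (norm H')"
      proof (intro mult_mono bg(1))
        show "n \<le> inverse (norm H')" using bh(2) H0 n(1) le_imp_inverse_le[of "norm H'" "inverse n"] by simp
      qed (use n in auto)
      finally show ?thesis by (simp add: divide_inverse norm_mult norm_inverse)
    qed
    moreover have "norm (G' / H') \<le> inverse (n ^ k)"
    proof -
      have "norm (G' / H') = norm G' * inverse (norm H')" by (simp add: divide_inverse norm_mult norm_inverse)
      also have "\<dots> \<le> inverse n * inverse (n ^ k2)"
        using bg(2) bh(1) n by (intro mult_mono le_imp_inverse_le) auto
      also have "\<dots> = inverse (n ^ Suc k2)" by simp
      also have "\<dots> \<le> inverse (n ^ k)"
        using n by (intro le_imp_inverse_le power_decreasing) (auto simp: k_def)
      finally show ?thesis .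
    qed
    ultimately show ?thesis by (intro exI[of _ "G' / H'"]) (simp add: n_def)
  qed
  moreover have "\<epsilon> > 0" using 2(1) 3(1) r(1) by (simp add: \<epsilon>_def)
  ultimately show ?thesis by (intro exI[of _ \<epsilon>] conjI exI[of _ k]) auto
qed

section \<open>Values of meromorphic functions and the quantum dilogarithm\<close>

lemma mero_rel_refl_iff: "mero_rel f f \<longleftrightarrow> mv_meromorphic_on f HC"
  by (auto simp: mero_rel_def agree_on_refl open_HC)

lemma abs_mero_cases:
  obtains F where "a = abs_mero F" "mv_meromorphic_on F HC"
  using Quotient_abs_rep[OF Quotient_mero, of a] Quotient_rep_reflp[OF Quotient_mero, of a]
  by (metis mero_rel_refl_iff)

lemma abs_mero_mult:
  "mv_meromorphic_on f HC \<Longrightarrow> mv_meromorphic_on g HC \<Longrightarrow> abs_mero f * abs_mero g = abs_mero (\<lambda>p. f p * g p)"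
  by (simp add: times_mero.abs_eq mero_rel_refl_iff)

lemma abs_mero_inverse: "mv_meromorphic_on f HC \<Longrightarrow> inverse (abs_mero f) = abs_mero (\<lambda>p. inverse (f p))"
  by (simp add: inverse_mero.abs_eq mero_rel_refl_iff)

lemma abs_mero_shift: "mv_meromorphic_on f HC \<Longrightarrow> shift c d (abs_mero f) = abs_mero (\<lambda>p. f (shear c d p))"
  by (simp add: shift.abs_eq mero_rel_refl_iff)

lemma mv_meromorphic_shear_HC: "mv_meromorphic_on f HC \<Longrightarrow> mv_meromorphic_on (\<lambda>p. f (shear c d p)) HC"
  using mv_meromorphic_on_HC_shear[of f] by (simp add: mero_rel_refl_iff)

lemma abs_mero_eq_0_iff: "mv_meromorphic_on f HC \<Longrightarrow> abs_mero f = 0 \<longleftrightarrow> agree_on HC f (\<lambda>x. 0)"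
  using Quotient_rel[OF Quotient_mero, of f "\<lambda>p. 0"] mero_rel_const[of 0] mero_rel_refl_iff[of f]
  by (auto simp: zero_mero.abs_eq mero_rel_def)

lemma abs_mero_fib_mero: 
  assumes "mv_meromorphic_on f HC" "abs_mero f \<noteq> 0"
  shows "fib_mero i {} f HC"
  by (rule mv_meromorphic_imp_fib_mero[OF assms(1) open_HC connected_HC])
    (use assms abs_mero_eq_0_iff in auto)

lemma HC_nonempty: "HC \<noteq> {}"
proof -
  have "vector [\<i>, 0] \<in> HC" by (simp add: HC_def)
  thus ?thesis by auto
qed

lemma fib_mero_abs_mero_neq_0:
  assumes "fib_mero i T f HC"
  shows "abs_mero f \<noteq> 0"
  using fib_mero_not_agree_0[OF assms HC_nonempty] fib_mero_imp_meromorphic[OF assms] abs_mero_eq_0_iff by blast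

lemma regular_value_mult:
  assumes "regular_value f p u" "regular_value g p v"
  shows "regular_value (\<lambda>x. f x * g x) p (u * v)"
proof -
  obtain V a where V: "open V" "p \<in> V" "mv_holomorphic_on a V" "agree_on V f a" "a p = u"
    using assms(1) unfolding regular_value_def by (elim exE conjE) (rule that; assumption)
  obtain V' b where V': "open V'" "p \<in> V'" "mv_holomorphic_on b V'" "agree_on V' g b" "b p = v"
    using assms(2) unfolding regular_value_def by (elim exE conjE) (rule that; assumption)
  let ?V = "V \<inter> V'"
  have o: "open ?V" using V V' by auto
  have "mv_holomorphic_on (\<lambda>x. a x * b x) ?V"
    by (intro mv_holomorphic_on_mult mv_holomorphic_on_subset[OF V(3)] mv_holomorphic_on_subset[OF V'(3)]) auto
  moreover have "agree_on ?V (\<lambda>x. f x * g x) (\<lambda>x. a x * b x)"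
    using agree_on_combine[OF agree_on_subset[OF V(4) o inf_le1] agree_on_subset[OF V'(4) o inf_le2]]
    unfolding agree_on_def by (elim exE conjE) (rule exI, intro conjI, assumption+, simp)
  ultimately show ?thesis unfolding regular_value_def
    using o V(2,5) V'(2,5) by (intro exI[of _ ?V] exI[of _ "\<lambda>x. a x * b x"]) simp
qed

lemma regular_value_inverse:
  assumes "regular_value f p v" "v \<noteq> 0"
  shows "regular_value (\<lambda>x. inverse (f x)) p (inverse v)"
proof -
  obtain V a where V: "open V" "p \<in> V" "mv_holomorphic_on a V" "agree_on V f a" "a p = v"
    using assms(1) unfolding regular_value_def by (elim exE conjE) (rule that; assumption)
  obtain W where W: "open W" "W \<subseteq> V" "V \<subseteq> closure W" "\<forall>x\<in>W. f x = a x"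
    using V(4) unfolding agree_on_def by (elim exE conjE) (rule that; assumption)
  have "regular_value (\<lambda>x. inverse (f x)) p (1 / a p)"
    by (rule regular_value_quotientI[OF V(1,2) mv_holomorphic_on_const V(3) _ W(1,3)])
      (use assms(2) V(5) W(4) in \<open>auto simp: inverse_eq_divide\<close>)
  thus ?thesis by (simp add: V(5) inverse_eq_divide)
qed

lemma regular_value_shear:
  assumes "regular_value f (shear c d p) v"
  shows "regular_value (\<lambda>x. f (shear c d x)) p v"
proof -
  obtain V a where V: "open V" "shear c d p \<in> V" "mv_holomorphic_on a V" "agree_on V f a" "a (shear c d p) = v"
    using assms unfolding regular_value_def by (elim exE conjE) (rule that; assumption)
  show ?thesis unfolding regular_value_def
    using open_shear[OF V(1), of c d] mv_holomorphic_on_shear[OF V(3), of c d] agree_on_shear[OF V(4), of c d] V(2,5)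
    by (intro exI[of _ "shear c d -` V"] exI[of _ "\<lambda>x. a (shear c d x)"]) simp
qed

lemma regular_value_holomorphic:
  "mv_holomorphic_on f V \<Longrightarrow> open V \<Longrightarrow> p \<in> V \<Longrightarrow> regular_value f p (f p)"
  unfolding regular_value_def by (intro exI[of _ V] exI[of _ f]) (simp add: agree_on_refl)

lemma regular_value_0: "regular_value (\<lambda>x. 0) p v \<Longrightarrow> v = 0"
proof -
  assume "regular_value (\<lambda>x. 0) p v"
  then obtain V a where V: "open V" "p \<in> V" "mv_holomorphic_on a V" "agree_on V (\<lambda>x. 0) a" "a p = v"
    unfolding regular_value_def by (elim exE conjE) (rule that; assumption)
  obtain W where W: "open W" "W \<subseteq> V" "V \<subseteq> closure W" "\<forall>x\<in>W. 0 = a x"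
    using V(4) unfolding agree_on_def by (elim exE conjE) (rule that; assumption)
  have "a p = 0"
    by (rule eq_on_dense[OF mv_holomorphic_on_continuous[OF V(3)] _ V(1) W(3) _ V(2)]) (use W(4) in auto)
  thus ?thesis using V(5) by simp
qed

lemma mero_value_abs_mero:
  "mv_meromorphic_on f HC \<Longrightarrow> mero_value (abs_mero f) \<tau> \<theta> v \<longleftrightarrow> 0 < Im \<tau> \<and> regular_value f (vector [\<tau>, \<theta>]) v"
  by (simp add: mero_value.abs_eq mero_rel_refl_iff HC_def)

lemma mero_value_mult: "mero_value a \<tau> \<theta> u \<Longrightarrow> mero_value b \<tau> \<theta> v \<Longrightarrow> mero_value (a * b) \<tau> \<theta> (u * v)"
  by (cases a rule: abs_mero_cases, cases b rule: abs_mero_cases)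
    (simp add: abs_mero_mult mero_value_abs_mero mv_meromorphic_on_mult regular_value_mult)

lemma mv_meromorphic_inverse_HC:
  assumes "mv_meromorphic_on f HC"
  shows "mv_meromorphic_on (\<lambda>p. inverse (f p)) HC"
  using inverse_mero.rsp assms by (auto simp: rel_fun_def mero_rel_refl_iff[symmetric])

lemma mero_value_inverse: "mero_value a \<tau> \<theta> v \<Longrightarrow> v \<noteq> 0 \<Longrightarrow> mero_value (inverse a) \<tau> \<theta> (inverse v)"
  by (cases a rule: abs_mero_cases)
    (simp add: abs_mero_inverse mero_value_abs_mero mv_meromorphic_inverse_HC regular_value_inverse)

lemma mero_value_shift:
  assumes "mero_value a \<tau> (\<theta> + c * \<tau> + d) v"
  shows "mero_value (shift c d a) \<tau> \<theta> v"
proof -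
  obtain F where F: "a = abs_mero F" "mv_meromorphic_on F HC" by (rule abs_mero_cases)
  have "shear c d (vector [\<tau>, \<theta>]) = vector [\<tau>, \<theta> + c * \<tau> + d]" by (simp add: shear_def)
  hence "0 < Im \<tau> \<and> regular_value F (shear c d (vector [\<tau>, \<theta>])) v"
    using assms by (simp only: F(1) mero_value_abs_mero[OF F(2)])
  thus ?thesis
    unfolding F(1) abs_mero_shift[OF F(2)] mero_value_abs_mero[OF mv_meromorphic_shear_HC[OF F(2)]]
    using regular_value_shear by blast
qed

lemma mero_value_0: "mero_value 0 \<tau> \<theta> v \<Longrightarrow> v = 0"
  using mero_value_abs_mero[of "\<lambda>x. 0" \<tau> \<theta> v] mero_rel_const[of 0]
  by (auto simp: zero_mero.abs_eq mero_rel_refl_iff dest: regular_value_0)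

lemma mero_value_1: "0 < Im \<tau> \<Longrightarrow> mero_value 1 \<tau> \<theta> 1"
  unfolding one_mero.abs_eq using mero_rel_const[of 1]
  using regular_value_holomorphic[OF mv_holomorphic_on_const[of 1 UNIV] open_UNIV]
  by (simp add: mero_value_abs_mero mero_rel_refl_iff)

lemma mero_value_prod:
  assumes "0 < Im \<tau>" "\<And>k. k \<in> K \<Longrightarrow> mero_value (a k) \<tau> \<theta> (v k)"
  shows "mero_value (\<Prod>k\<in>K. a k) \<tau> \<theta> (\<Prod>k\<in>K. v k)"
  using assms(2) by (induction K rule: infinite_finite_induct) (simp_all add: mero_value_mult mero_value_1 assms(1))

section \<open>The quantum dilogarithm\<close>

lemma convergent_prod_q_dilog:
  fixes q x :: complex
  assumes "norm q < 1"
  shows "convergent_prod (\<lambda>k. 1 - q ^ k * x)"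
proof (rule abs_convergent_prod_imp_convergent_prod)
  have "summable (\<lambda>k. norm q ^ k * norm x)" using assms by (intro summable_mult2 summable_geometric) simp
  thus "abs_convergent_prod (\<lambda>k. 1 - q ^ k * x)"
    by (simp add: abs_convergent_prod_conv_summable norm_mult norm_power)
qed

lemma q_dilog_LIMSEQ:
  assumes "norm q < 1"
  shows "(\<lambda>n. \<Prod>k<n. 1 - q ^ k * x) \<longlonglongrightarrow> q_dilog q x"
  using convergent_prod_LIMSEQ[OF convergent_prod_q_dilog[OF assms]]
  by (simp add: q_dilog_def LIMSEQ_lessThan_iff_atMost)

lemma q_dilog_shift:
  assumes "norm q < 1"
  shows "q_dilog q x = (1 - x) * q_dilog q (q * x)"
proof (rule LIMSEQ_unique)
  show "(\<lambda>n. \<Prod>k<Suc n. 1 - q ^ k * x) \<longlonglongrightarrow> q_dilog q x"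
    using q_dilog_LIMSEQ[OF assms] by (rule LIMSEQ_Suc)
  have "(\<Prod>k<Suc n. 1 - q ^ k * x) = (1 - x) * (\<Prod>k<n. 1 - q ^ k * (q * x))" for n
    by (subst prod.lessThan_Suc_shift) (simp add: mult_ac)
  thus "(\<lambda>n. \<Prod>k<Suc n. 1 - q ^ k * x) \<longlonglongrightarrow> (1 - x) * q_dilog q (q * x)"
    using tendsto_mult[OF tendsto_const q_dilog_LIMSEQ[OF assms]] by simp
qed

text \<open>The partial products converge locally uniformly by the Weierstrass test, with the
  geometric series formed from the maxima of |Q| and |X| on a compact ball as majorant.\<close>

lemma mv_holomorphic_on_q_dilog:
  assumes U: "open U" and Q: "mv_holomorphic_on Q U" and X: "mv_holomorphic_on X U"
    and Q1: "\<And>p. p \<in> U \<Longrightarrow> norm (Q p) < 1"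
  shows "mv_holomorphic_on (\<lambda>p. q_dilog (Q p) (X p)) U"
proof (rule mv_holomorphic_on_uniform_limit)
  fix n
  show "mv_holomorphic_on (\<lambda>p. \<Prod>k<n. 1 - Q p ^ k * X p) U"
    by (intro mv_hol_intros Q X)
next
  fix p assume "p \<in> U"
  then obtain r where r: "r > 0" "cball p r \<subseteq> U" using U open_contains_cball by blast
  let ?C = "cball p r"
  have cont: "continuous_on ?C Q" "continuous_on ?C X"
    using mv_holomorphic_on_continuous[OF Q] mv_holomorphic_on_continuous[OF X] r(2) continuous_on_subset by blast+
  have ne: "?C \<noteq> {}" using r(1) by simp
  obtain x0 where x0: "x0 \<in> ?C" "\<forall>x\<in>?C. norm (Q x) \<le> norm (Q x0)"
    using continuous_attains_sup[OF compact_cball ne continuous_on_norm[OF cont(1)]] by (elim bexE) (rule that)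
  obtain x1 where x1: "x1 \<in> ?C" "\<forall>x\<in>?C. norm (X x) \<le> norm (X x1)"
    using continuous_attains_sup[OF compact_cball ne continuous_on_norm[OF cont(2)]] by (elim bexE) (rule that)
  have "norm (Q x0) < 1" using x0(1) r(2) by (intro Q1) auto
  hence "summable (\<lambda>k. norm (Q x0) ^ k * norm (X x1))" by (intro summable_mult2 summable_geometric) simp
  hence "uniformly_convergent_on ?C (\<lambda>N x. \<Sum>n<N. norm (1 - Q x ^ n * X x - 1))"
  proof (rule Weierstrass_m_test'[rotated])
    fix n x assume x: "x \<in> ?C"
    have "norm (Q x) ^ n * norm (X x) \<le> norm (Q x0) ^ n * norm (X x1)"
      using x0(2) x1(2) x by (intro mult_mono power_mono) auto
    thus "norm (norm (1 - Q x ^ n * X x - 1)) \<le> norm (Q x0) ^ n * norm (X x1)"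
      by (simp add: norm_mult norm_power)
  qed
  hence "uniformly_convergent_on ?C (\<lambda>N x. \<Prod>n<N. 1 - Q x ^ n * X x)"
    by (intro uniformly_convergent_on_prod' compact_cball continuous_intros cont)
  hence ul: "uniform_limit ?C (\<lambda>N x. \<Prod>n<N. 1 - Q x ^ n * X x) (\<lambda>x. lim (\<lambda>N. \<Prod>n<N. 1 - Q x ^ n * X x)) sequentially"
    by (simp add: uniformly_convergent_uniform_limit_iff)
  have "lim (\<lambda>N. \<Prod>n<N. 1 - Q x ^ n * X x) = q_dilog (Q x) (X x)" if "x \<in> ?C" for x
    using that r(2) by (intro limI q_dilog_LIMSEQ Q1) auto
  hence "uniform_limit ?C (\<lambda>N x. \<Prod>n<N. 1 - Q x ^ n * X x) (\<lambda>x. q_dilog (Q x) (X x)) sequentially"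
    by (intro uniform_limit_cong'[THEN iffD1, OF _ _ ul]) auto
  thus "\<exists>r>0. cball p r \<subseteq> U \<and>
      uniform_limit (cball p r) (\<lambda>N x. \<Prod>n<N. 1 - Q x ^ n * X x) (\<lambda>x. q_dilog (Q x) (X x)) sequentially"
    using r by (intro exI[of _ r]) simp
qed

definition DT_fun :: "int \<Rightarrow> complex ^ 2 \<Rightarrow> complex" where
  "DT_fun s = (\<lambda>p. q_dilog (exp (2 * of_real pi * \<i> * p $ 1))
     (- exp (of_real pi * \<i> * p $ 1 + of_int s * (2 * of_real pi * \<i> * p $ 2))))"

lemma norm_nome_less_1: "p \<in> HC \<Longrightarrow> norm (exp (2 * of_real pi * \<i> * p $ 1)) < 1"
  by (simp add: HC_def)

lemma mv_holomorphic_on_DT_fun: "mv_holomorphic_on (DT_fun s) HC"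
  unfolding DT_fun_def
  by (intro mv_holomorphic_on_q_dilog open_HC mv_hol_intros) (rule norm_nome_less_1)

lemma mv_meromorphic_on_DT_fun: "mv_meromorphic_on (DT_fun s) HC"
  by (rule mv_holomorphic_on_imp_meromorphic_on[OF mv_holomorphic_on_DT_fun open_HC])

text \<open>At \<tau> = \<i>, \<theta> = 0 all factors of the convergent product are positive reals,
  so its value there is nonzero.\<close>

lemma DT_fun_neq_0: "abs_mero (DT_fun s) \<noteq> 0"
proof
  assume "abs_mero (DT_fun s) = 0"
  hence "agree_on HC (DT_fun s) (\<lambda>x. 0)" using abs_mero_eq_0_iff[OF mv_meromorphic_on_DT_fun] by blast
  then obtain W where W: "open W" "W \<subseteq> HC" "HC \<subseteq> closure W" "\<forall>x\<in>W. DT_fun s x = 0"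
    unfolding agree_on_def by (elim exE conjE) (rule that; assumption)
  define p :: "complex ^ 2" where "p = vector [\<i>, 0]"
  have p: "p \<in> HC" by (simp add: p_def HC_def)
  have "DT_fun s p = 0"
    by (rule eq_on_dense[OF mv_holomorphic_on_continuous[OF mv_holomorphic_on_DT_fun] _ open_HC W(3) _ p])
      (use W(4) in auto)
  moreover have "DT_fun s p \<noteq> 0"
    unfolding DT_fun_def q_dilog_def
  proof (rule prodinf_nonzero[OF convergent_prod_q_dilog[OF norm_nome_less_1[OF p]]])
    fix k
    let ?q = "exp (2 * of_real pi * \<i> * p $ 1)" and ?x = "exp (of_real pi * \<i> * p $ 1 + of_int s * (2 * of_real pi * \<i> * p $ 2))"
    have "?q = of_real (exp (- 2 * pi))" "?x = of_real (exp (- pi))"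
      unfolding p_def exp_of_real[symmetric] by (simp_all add: mult.assoc)
    hence "1 - ?q ^ k * - ?x = of_real (1 + exp (- 2 * pi) ^ k * exp (- pi))" by simp
    moreover have "1 + exp (- 2 * pi) ^ k * exp (- pi) > 0" by (simp add: add_pos_pos)
    ultimately show "1 - ?q ^ k * - ?x \<noteq> 0" by (metis of_real_eq_0_iff less_irrefl)
  qed
  ultimately show False by simp
qed

lemma DT_fun_shear_pos:
  assumes "p \<in> HC"
  shows "DT_fun 1 p = (1 + exp (2 * of_real pi * \<i> * (p $ 2 + p $ 1 / 2))) * DT_fun 1 (shear 1 0 p)"
proof -
  define q x where "q = exp (2 * of_real pi * \<i> * p $ 1)" and
    "x = - exp (of_real pi * \<i> * p $ 1 + of_int 1 * (2 * of_real pi * \<i> * p $ 2))"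
  have "q_dilog q x = (1 - x) * q_dilog q (q * x)"
    unfolding q_def by (rule q_dilog_shift[OF norm_nome_less_1[OF assms]])
  moreover have "DT_fun 1 p = q_dilog q x" by (simp add: DT_fun_def q_def x_def)
  moreover have "DT_fun 1 (shear 1 0 p) = q_dilog q (q * x)"
    unfolding DT_fun_def q_def x_def by (simp add: shear_def exp_add[symmetric] algebra_simps)
  moreover have "1 - x = 1 + exp (2 * of_real pi * \<i> * (p $ 2 + p $ 1 / 2))"
    by (simp add: x_def algebra_simps)
  ultimately show ?thesis by simp
qed

text \<open>For the sign -1, the translation by \<tau> divides the argument of the dilogarithm by q
  instead of multiplying it, so the factor appears on the other side and with the opposite
  exponent.\<close>

lemma DT_fun_shear_neg:
  assumes "p \<in> HC"
  shows "DT_fun (- 1) (shear 1 0 p) = (1 + exp (- (2 * of_real pi * \<i> * (p $ 2 + p $ 1 / 2)))) * DT_fun (- 1) p"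
proof -
  define q x where "q = exp (2 * of_real pi * \<i> * p $ 1)" and
    "x = - exp (- (of_real pi * \<i> * p $ 1) - 2 * of_real pi * \<i> * p $ 2)"
  have "q_dilog q x = (1 - x) * q_dilog q (q * x)"
    unfolding q_def by (rule q_dilog_shift[OF norm_nome_less_1[OF assms]])
  moreover have "DT_fun (- 1) p = q_dilog q (q * x)"
    unfolding DT_fun_def q_def x_def by (simp add: exp_add[symmetric] algebra_simps)
  moreover have "DT_fun (- 1) (shear 1 0 p) = q_dilog q x"
    unfolding DT_fun_def q_def x_def by (simp add: shear_def algebra_simps)
  moreover have "1 - x = 1 + exp (- (2 * of_real pi * \<i> * (p $ 2 + p $ 1 / 2)))"
    by (simp add: x_def algebra_simps)
  ultimately show ?thesis by simp
qed

section \<open>Automorphisms trivial in degree zero\<close>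

lemma shift_eq_0_iff [simp]: "shift c d f = 0 \<longleftrightarrow> f = 0"
proof
  assume "shift c d f = 0"
  hence "shift (- c) (- d) (shift c d f) = 0" by simp
  thus "f = 0" by (simp add: shift_shift)
qed simp

lemma shift_inverse: "shift c d (inverse f) = inverse (shift c d f)"
proof (cases "f = 0")
  case False
  have "shift c d (inverse f) * shift c d f = 1" using False by (simp flip: shift_mult)
  thus ?thesis by (metis inverse_unique mult.commute)
qed simp

text \<open>A crossed homomorphism from the integers to the nonzero meromorphic functions, n acting
  by \<theta> \<mapsto> \<theta> + n \<tau>: the condition that makes a diagonal map multiplicative
  for the twisted product.\<close>

definition cocycle :: "(int \<Rightarrow> mero) \<Rightarrow> bool" where
  "cocycle c \<longleftrightarrow> c 0 = 1 \<and> (\<forall>m n. c (m + n) = c m * shift (of_int m) 0 (c n))"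

lemma cocycle_0: "cocycle c \<Longrightarrow> c 0 = 1"
  and cocycle_add: "cocycle c \<Longrightarrow> c (m + n) = c m * shift (of_int m) 0 (c n)"
  by (auto simp: cocycle_def)

lemma cocycle_neq_0: assumes "cocycle c" shows "c n \<noteq> 0"
  using cocycle_add[OF assms, of n "- n"] cocycle_0[OF assms] by auto

text \<open>The integers are generated by 1, and nonvanishing of the values permits descending as
  well as ascending steps.\<close>

lemma cocycle_unique:
  assumes c: "cocycle c" and c': "cocycle c'" and eq: "c 1 = c' 1"
  shows "c n = c' n"
proof (induction n rule: int_induct[where k = 0])
  case base
  show ?case using c c' by (simp add: cocycle_0)
next
  case (step1 i)
  thus ?case using cocycle_add[OF c, of i 1] cocycle_add[OF c', of i 1] eq by simp
next
  case (step2 i)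
  have "c (i - 1) * shift (of_int (i - 1)) 0 (c 1) = c' (i - 1) * shift (of_int (i - 1)) 0 (c' 1)"
    using cocycle_add[OF c, of "i - 1" 1] cocycle_add[OF c', of "i - 1" 1] step2 by simp
  thus ?case using eq cocycle_neq_0[OF c', of 1] by simp
qed

lemma cocycle_mult: "cocycle c \<Longrightarrow> cocycle c' \<Longrightarrow> cocycle (\<lambda>n. c n * c' n)"
  by (simp add: cocycle_def shift_mult mult_ac)

lemma cocycle_inverse: "cocycle c \<Longrightarrow> cocycle (\<lambda>n. inverse (c n))"
  by (simp add: cocycle_def shift_inverse)

lemma cocycle_shift: "cocycle c \<Longrightarrow> cocycle (\<lambda>n. shift 0 d (c n))"
  by (simp add: cocycle_def shift_mult shift_shift add.commute)

lemma cocycle_coboundary: "f \<noteq> 0 \<Longrightarrow> cocycle (\<lambda>n. shift (of_int n) 0 f * inverse f)"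
  by (simp add: cocycle_def shift_mult shift_inverse shift_shift)

text \<open>The cocycle with value g in degree 1. In degree -1 the relation forces the inverse of g
  translated by - \<tau>, whence the inverses and the \<open>Suc k\<close> in the negative
  branch.\<close>

definition cocyc :: "mero \<Rightarrow> int \<Rightarrow> mero" where
  "cocyc g n = (if n \<ge> 0 then \<Prod>k<nat n. shift (of_nat k) 0 g
     else \<Prod>k<nat (- n). inverse (shift (- of_nat (Suc k)) 0 g))"

lemma cocyc_0: "cocyc g 0 = 1" and cocyc_1: "cocyc g 1 = g"
  by (simp_all add: cocyc_def)

lemma cocyc_Suc:
  assumes "g \<noteq> 0"
  shows "cocyc g (n + 1) = cocyc g n * shift (of_int n) 0 g"
proof (cases "n \<ge> 0")
  case True
  hence "nat (n + 1) = Suc (nat n)" by simp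
  thus ?thesis using True by (simp add: cocyc_def)
next
  case False
  define m where "m = nat (- n - 1)"
  have m: "n = - int (Suc m)" using False by (simp add: m_def)
  have "cocyc g n = cocyc g (n + 1) * inverse (shift (of_int n) 0 g)"
  proof -
    have "nat (- n) = Suc m" "nat (- (n + 1)) = m" using m by simp_all
    moreover have "cocyc g (n + 1) = (\<Prod>k<m. inverse (shift (- of_nat (Suc k)) 0 g))"
      using m by (cases "m = 0") (simp_all add: cocyc_def)
    ultimately show ?thesis using False m by (simp add: cocyc_def)
  qed
  thus ?thesis using assms by simp
qed

lemma cocycle_cocyc:
  assumes g: "g \<noteq> 0"
  shows "cocycle (cocyc g)"
  unfolding cocycle_def
proof (intro conjI allI cocyc_0)
  fix m n
  show "cocyc g (m + n) = cocyc g m * shift (of_int m) 0 (cocyc g n)"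
  proof (induction n rule: int_induct[where k = 0])
    case base
    show ?case by (simp add: cocyc_0)
  next
    case (step1 i)
    have "cocyc g (m + (i + 1)) = cocyc g (m + i) * shift (of_int (m + i)) 0 g"
      using cocyc_Suc[OF g, of "m + i"] by (simp add: add.assoc)
    thus ?case using step1 cocyc_Suc[OF g, of i] by (simp add: shift_mult shift_shift mult.assoc)
  next
    case (step2 i)
    have "cocyc g (m + (i - 1)) * shift (of_int (m + (i - 1))) 0 g = cocyc g (m + i)"
      using cocyc_Suc[OF g, of "m + (i - 1)"] by (simp add: algebra_simps)
    also have "\<dots> = cocyc g m * shift (of_int m) 0 (cocyc g (i - 1) * shift (of_int (i - 1)) 0 g)"
      using step2 cocyc_Suc[OF g, of "i - 1"] by simp
    also have "\<dots> = cocyc g m * shift (of_int m) 0 (cocyc g (i - 1)) * shift (of_int (m + (i - 1))) 0 g"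
      by (simp add: shift_mult shift_shift mult.assoc)
    finally show ?case using g by simp
  qed
qed

section \<open>Diagonal maps of the extended quantum torus\<close>

lift_definition diag_map :: "(int \<Rightarrow> mero) \<Rightarrow> qtorus \<Rightarrow> qtorus" is "\<lambda>c a n. a n * c n"
  by (rule finite_subset[rotated], assumption) auto

lemma diag_map_compose: "diag_map c (diag_map c' a) = diag_map (\<lambda>n. c' n * c n) a"
  by (rule qtorus_eqI) (simp add: diag_map.rep_eq mult.assoc)

lemma diag_map_1: "diag_map (\<lambda>n. 1) a = a"
  by (rule qtorus_eqI) (simp add: diag_map.rep_eq)

lemma diag_map_inverse:
  assumes "\<And>n. c n \<noteq> 0"
  shows "diag_map c (diag_map (\<lambda>n. inverse (c n)) a) = a" "diag_map (\<lambda>n. inverse (c n)) (diag_map c a) = a"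
  by (simp_all add: diag_map_compose assms diag_map_1)

lemma bij_diag_map:
  assumes "\<And>n. c n \<noteq> 0"
  shows "bij (diag_map c)" "inv (diag_map c) = diag_map (\<lambda>n. inverse (c n))"
  by (rule o_bij[of "diag_map (\<lambda>n. inverse (c n))"]; simp add: fun_eq_iff diag_map_inverse assms)
    (rule inv_equality; simp add: diag_map_inverse assms)

lemma qcoeff_times_support: "qcoeff (a * b) n = (\<Sum>k | qcoeff a k \<noteq> 0. qcoeff a k * shift (of_int k) 0 (qcoeff b (n - k)))"
  by (rule qcoeff_times[OF finite_support]) simp

lemma diag_map_times:
  assumes "cocycle c"
  shows "diag_map c (a * b) = diag_map c a * diag_map c b"
proof (rule qtorus_eqI)
  fix n
  let ?K = "{k. qcoeff a k \<noteq> 0}"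
  have "qcoeff (diag_map c a * diag_map c b) n =
      (\<Sum>k\<in>?K. qcoeff (diag_map c a) k * shift (of_int k) 0 (qcoeff (diag_map c b) (n - k)))"
    by (rule qcoeff_times[OF finite_support]) (auto simp: diag_map.rep_eq)
  also have "\<dots> = (\<Sum>k\<in>?K. qcoeff a k * shift (of_int k) 0 (qcoeff b (n - k)) * c n)"
  proof (rule sum.cong[OF refl])
    fix k
    have "c n = c k * shift (of_int k) 0 (c (n - k))" using cocycle_add[OF assms, of k "n - k"] by simp
    thus "qcoeff (diag_map c a) k * shift (of_int k) 0 (qcoeff (diag_map c b) (n - k)) =
        qcoeff a k * shift (of_int k) 0 (qcoeff b (n - k)) * c n"
      by (simp add: diag_map.rep_eq shift_mult mult_ac)
  qed
  also have "\<dots> = qcoeff (diag_map c (a * b)) n"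
    by (simp add: diag_map.rep_eq qcoeff_times_support sum_distrib_right)
  finally show "qcoeff (diag_map c (a * b)) n = qcoeff (diag_map c a * diag_map c b) n" ..
qed

lemma diag_map_qmon: "diag_map c (qmon f n) = qmon (f * c n) n"
  by (rule qtorus_eqI) (simp add: diag_map.rep_eq qmon.rep_eq)

lemma is_aut_diag_map:
  assumes c: "cocycle c"
  shows "is_aut (diag_map c)"
  unfolding is_aut_def
proof (intro conjI allI)
  show "bij (diag_map c)" by (intro bij_diag_map cocycle_neq_0[OF c])
  show "diag_map c 1 = 1" using diag_map_qmon[of c 1 0] by (simp add: qmon_one cocycle_0[OF c])
  show "diag_map c (a + b) = diag_map c a + diag_map c b" for a b
    by (rule qtorus_eqI) (simp add: diag_map.rep_eq plus_qtorus.rep_eq distrib_right)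
  show "diag_map c (a * b) = diag_map c a * diag_map c b" for a b by (rule diag_map_times[OF c])
  show "diag_map c (qmon (mero_const k) 0 * a) = qmon (mero_const k) 0 * diag_map c a" for k a
    by (simp add: diag_map_times[OF c] diag_map_qmon cocycle_0[OF c])
qed

lemma is_aut_comp:
  assumes "is_aut \<phi>" "is_aut \<psi>" shows "is_aut (\<phi> \<circ> \<psi>)"
  unfolding is_aut_def
proof (intro conjI allI)
  show "bij (\<phi> \<circ> \<psi>)" using assms by (simp add: is_aut_def bij_comp)
  show "(\<phi> \<circ> \<psi>) (qmon (mero_const k) 0 * a) = qmon (mero_const k) 0 * (\<phi> \<circ> \<psi>) a" for k a
    using assms unfolding is_aut_def by (metis o_apply)
qed (use assms in \<open>simp_all add: is_aut_def\<close>)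

lemma qcoeff_sum: "qcoeff (sum f A) n = (\<Sum>x\<in>A. qcoeff (f x) n)"
  by (induction A rule: infinite_finite_induct) (simp_all add: zero_qtorus.rep_eq plus_qtorus.rep_eq)

lemma qtorus_expansion: "a = (\<Sum>n | qcoeff a n \<noteq> 0. qmon (qcoeff a n) n)"
proof (rule qtorus_eqI)
  fix m
  have "qcoeff (\<Sum>n | qcoeff a n \<noteq> 0. qmon (qcoeff a n) n) m =
      (\<Sum>n | qcoeff a n \<noteq> 0. if m = n then qcoeff a n else 0)"
    by (simp add: qcoeff_sum qmon.rep_eq)
  also have "\<dots> = qcoeff a m" using finite_support[of a] by (simp add: sum.delta')
  finally show "qcoeff a m = qcoeff (\<Sum>n | qcoeff a n \<noteq> 0. qmon (qcoeff a n) n) m" ..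
qed

lemma is_aut_sum:
  assumes "is_aut \<phi>" shows "\<phi> (sum f A) = (\<Sum>x\<in>A. \<phi> (f x))"
proof -
  have add: "\<phi> (a + b) = \<phi> a + \<phi> b" for a b using assms by (simp add: is_aut_def)
  have "\<phi> 0 + \<phi> 0 = \<phi> 0" using add[of 0 0] by simp
  hence "\<phi> 0 = 0" by simp
  thus ?thesis by (induction A rule: infinite_finite_induct) (simp_all add: add)
qed

text \<open>Multiplicativity propagates the image of the generator to all degrees, the negative ones
  through invertibility of g times the generator; triviality in degree 0 and additivity determine
  the rest.\<close>

lemma aut_eq_diag_map:
  assumes \<psi>: "is_aut \<psi>" and triv: "\<And>f. \<psi> (qmon f 0) = qmon f 0" and y: "\<psi> (qmon 1 1) = qmon g 1" and g: "g \<noteq> 0"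
  shows "\<psi> = diag_map (cocyc g)"
proof
  fix a
  have mult: "\<psi> (a * b) = \<psi> a * \<psi> b" for a b using \<psi> by (simp add: is_aut_def)
  have mon1: "\<psi> (qmon 1 n) = qmon (cocyc g n) n" for n
  proof (induction n rule: int_induct[where k = 0])
    case base
    show ?case by (simp add: triv cocyc_0)
  next
    case (step1 i)
    have "\<psi> (qmon 1 i * qmon 1 1) = qmon (cocyc g i) i * qmon g 1" by (simp only: mult y step1)
    thus ?case by (simp add: qmon_times_qmon cocyc_Suc[OF g])
  next
    case (step2 i)
    \<comment> \<open>A coefficient moved past the generator is translated by \<tau>, so the
      coefficient of the right inverse must be translated back beforehand.\<close>
    define h where "h = shift (- 1) 0 (inverse g)"
    have inv: "qmon g 1 * qmon h (- 1) = 1"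
      using g by (simp add: qmon_times_qmon h_def shift_shift qmon_one)
    have "qmon 1 (i - 1) * qmon 1 1 = qmon 1 i" by (simp add: qmon_times_qmon)
    hence "\<psi> (qmon 1 (i - 1)) * qmon g 1 = qmon (cocyc g i) i" using step2 by (metis mult y)
    hence "\<psi> (qmon 1 (i - 1)) * (qmon g 1 * qmon h (- 1)) = qmon (cocyc g i) i * qmon h (- 1)"
      by (simp flip: mult.assoc)
    hence "\<psi> (qmon 1 (i - 1)) = qmon (cocyc g i * shift (of_int i) 0 h) (i - 1)"
      unfolding inv by (simp add: qmon_times_qmon)
    also have "cocyc g i * shift (of_int i) 0 h = cocyc g (i - 1)"
      using cocyc_Suc[OF g, of "i - 1"] g by (simp add: h_def shift_shift shift_inverse)
    finally show ?case .
  qed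
  have mon: "\<psi> (qmon f n) = diag_map (cocyc g) (qmon f n)" for f n
  proof -
    have "\<psi> (qmon f 0 * qmon 1 n) = qmon f 0 * qmon (cocyc g n) n" by (simp only: mult triv mon1)
    thus ?thesis by (simp add: diag_map_qmon qmon_times_qmon)
  qed
  have "\<psi> a = (\<Sum>n | qcoeff a n \<noteq> 0. \<psi> (qmon (qcoeff a n) n))"
    by (subst qtorus_expansion[of a]) (rule is_aut_sum[OF \<psi>])
  also have "\<dots> = (\<Sum>n | qcoeff a n \<noteq> 0. diag_map (cocyc g) (qmon (qcoeff a n) n))" by (simp add: mon)
  also have "\<dots> = diag_map (cocyc g) (\<Sum>n | qcoeff a n \<noteq> 0. qmon (qcoeff a n) n)"
    by (rule is_aut_sum[OF is_aut_diag_map[OF cocycle_cocyc[OF g]], symmetric])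
  also have "\<dots> = diag_map (cocyc g) a" by (simp flip: qtorus_expansion)
  finally show "\<psi> a = diag_map (cocyc g) a" .
qed

section \<open>The translation automorphism and conjugation by degree-zero elements\<close>

lemma inv_eps_Z: "inv (eps_Z z t) = eps_Z (- z) t"
  by (rule inv_equality; rule qtorus_eqI) (simp_all add: eps_Z.rep_eq shift_shift)

lemma is_aut_eps_Z: "is_aut (eps_Z z t)"
  unfolding is_aut_def
proof (intro conjI allI)
  show "bij (eps_Z z t)" by (rule bij_eps_Z)
  have qm: "eps_Z z t (qmon f 0) = qmon (shift 0 (z / (2 * of_real pi * \<i> * t)) f) 0" for f
    by (rule qtorus_eqI) (simp add: eps_Z.rep_eq qmon.rep_eq)
  show "eps_Z z t 1 = 1" using qm[of 1] by (simp add: qmon_one)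
  show "eps_Z z t (a + b) = eps_Z z t a + eps_Z z t b" for a b
    by (rule qtorus_eqI) (simp add: eps_Z.rep_eq plus_qtorus.rep_eq shift_add)
  show mult: "eps_Z z t (a * b) = eps_Z z t a * eps_Z z t b" for a b
  proof (rule qtorus_eqI)
    fix n
    have "qcoeff (eps_Z z t a * eps_Z z t b) n =
      (\<Sum>k | qcoeff a k \<noteq> 0. qcoeff (eps_Z z t a) k * shift (of_int k) 0 (qcoeff (eps_Z z t b) (n - k)))"
      by (rule qcoeff_times[OF finite_support]) (auto simp: eps_Z.rep_eq)
    thus "qcoeff (eps_Z z t (a * b)) n = qcoeff (eps_Z z t a * eps_Z z t b) n"
      by (simp add: eps_Z.rep_eq qcoeff_times_support shift_sum shift_mult shift_shift add.commute)
  qed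
  show "eps_Z z t (qmon (mero_const k) 0 * a) = qmon (mero_const k) 0 * eps_Z z t a" for k a
    by (simp add: mult qm)
qed

lemma qinverse_qmon:
  assumes "f \<noteq> 0"
  shows "qinverse (qmon f 0) = qmon (inverse f) 0"
  unfolding qinverse_def
proof (rule the_equality)
  show "qmon f 0 * qmon (inverse f) 0 = 1 \<and> qmon (inverse f) 0 * qmon f 0 = 1"
    using assms by (simp add: qmon_times_qmon qmon_one)
  fix h assume h: "qmon f 0 * h = 1 \<and> h * qmon f 0 = 1"
  have "h = (qmon (inverse f) 0 * qmon f 0) * h" using assms by (simp add: qmon_times_qmon qmon_one)
  also have "\<dots> = qmon (inverse f) 0" using h by (simp add: mult.assoc)
  finally show "h = qmon (inverse f) 0" .
qed

text \<open>An element of degree 0 standing to the right of the symbol of degree n is translated by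
  n \<tau> when moved to the left, so conjugation is a diagonal map whose coefficients form a
  coboundary.\<close>

lemma Ad_qmon:
  assumes "f \<noteq> 0"
  shows "Ad (qmon f 0) = diag_map (\<lambda>n. f * shift (of_int n) 0 (inverse f))"
proof (rule ext, rule qtorus_eqI)
  fix a n
  have left: "qcoeff (qmon f 0 * b) n = f * qcoeff b n" for b n
    by (subst qcoeff_times[of "{0}"]) (auto simp: qmon.rep_eq split: if_splits)
  have right: "qcoeff (b * qmon h 0) n = qcoeff b n * shift (of_int n) 0 h" for b n h
  proof -
    have "qcoeff (b * qmon h 0) n = (\<Sum>k\<in>insert n {k. qcoeff b k \<noteq> 0}. qcoeff b k * shift (of_int k) 0 (qcoeff (qmon h 0) (n - k)))"
      using finite_support by (intro qcoeff_times) auto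
    also have "\<dots> = (\<Sum>k\<in>insert n {k. qcoeff b k \<noteq> 0}. if k = n then qcoeff b k * shift (of_int k) 0 h else 0)"
      by (intro sum.cong) (auto simp: qmon.rep_eq)
    also have "\<dots> = qcoeff b n * shift (of_int n) 0 h" using finite_support[of b] by (subst sum.delta) auto
    finally show ?thesis .
  qed
  show "qcoeff (Ad (qmon f 0) a) n = qcoeff (diag_map (\<lambda>n. f * shift (of_int n) 0 (inverse f)) a) n"
    by (simp add: Ad_def qinverse_qmon[OF assms] left right diag_map.rep_eq mult_ac)
qed

section \<open>The modified gamma function along fibres\<close>

text \<open>Used to leave the poles of Gamma by small displacements. If some integer lies at
  distance |d0| < 1/2 from \<open>a\<close> with d0 nonzero, two integers within that radius would
  differ by less than 1; then |d0| serves as \<epsilon>.\<close>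

lemma nonpos_Ints_isolated: "\<exists>\<epsilon>>0. \<forall>d. 0 < norm d \<and> norm d < \<epsilon> \<longrightarrow> a + d \<notin> (\<int>\<^sub>\<le>\<^sub>0 :: complex set)"
proof (cases "\<exists>d. 0 < norm d \<and> norm d < 1/2 \<and> a + d \<in> \<int>\<^sub>\<le>\<^sub>0")
  case False
  thus ?thesis by (intro exI[of _ "1/2"]) auto
next
  case True
  then obtain d0 where d0: "0 < norm d0" "norm d0 < 1/2" "a + d0 \<in> \<int>\<^sub>\<le>\<^sub>0" by blast
  have "a + d \<notin> \<int>\<^sub>\<le>\<^sub>0" if d: "0 < norm d" "norm d < norm d0" for d
  proof
    assume "a + d \<in> \<int>\<^sub>\<le>\<^sub>0"
    then obtain m n where m: "a + d = of_int m" and n: "a + d0 = of_int n"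
      using d0(3) by (elim nonpos_Ints_cases) auto
    have "d - d0 = (a + d) - (a + d0)" by simp
    hence e: "d - d0 = of_int (m - n)" by (simp add: m n)
    have "norm (d - d0) < 1" using norm_triangle_ineq4[of d d0] d d0 by linarith
    hence "\<bar>real_of_int (m - n)\<bar> < 1" unfolding e norm_of_int .
    hence "m = n" by linarith
    thus False using e d by simp
  qed
  thus ?thesis using d0(1) by blast
qed

text \<open>Moving the argument of \<open>rGamma\<close> linearly inside a fibre of the coordinate \<open>i\<close> leaves its zeros.\<close>

lemma fib_mero_rGamma:
  fixes A :: "complex ^ 'n \<Rightarrow> complex"
  assumes U: "open U" and A: "mv_holomorphic_on A U" and ji: "j \<noteq> i" and c: "c \<noteq> 0"
    and lin: "\<And>x d. A (x + d *s axis j 1) = A x + c * d"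
  shows "fib_mero i T (\<lambda>x. rGamma (A x)) U"
proof (rule fib_mero_holomorphic[OF mv_holomorphic_on_compose_field[OF A field_differentiable_rGamma] U])
  have key: "q \<in> closure {x \<in> {x \<in> U. rGamma (A x) \<noteq> 0}. x $ i = q $ i}" if q: "q \<in> U" for q
    unfolding closure_approachable
  proof (intro allI impI)
    fix e :: real assume e: "e > 0"
    obtain r where r: "r > 0" "ball q r \<subseteq> U" using U q openE by blast
    obtain \<epsilon> where \<epsilon>: "\<epsilon> > 0" "\<forall>d. 0 < norm d \<and> norm d < \<epsilon> \<longrightarrow> A q + d \<notin> \<int>\<^sub>\<le>\<^sub>0"
      using nonpos_Ints_isolated by blast
    \<comment> \<open>The displacement must stay below e and inside the ball, and after
      multiplication by c within the isolation radius \<epsilon>.\<close>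
    define \<mu> where "\<mu> = min (min e r) (\<epsilon> / norm c)"
    define m where "m = \<mu> / 2"
    define d :: complex where "d = of_real m"
    have \<mu>: "\<mu> > 0" "\<mu> \<le> e" "\<mu> \<le> r" "\<mu> \<le> \<epsilon> / norm c" using e r \<epsilon> c by (auto simp: \<mu>_def)
    have "m > 0" "m < \<mu>" using \<mu>(1) by (simp_all add: m_def)
    hence m: "m > 0" "m < e" "m < r" "m < \<epsilon> / norm c" using \<mu> by (simp_all add: less_le_trans)
    have nd: "norm d = m" using m(1) by (simp add: d_def)
    define x where "x = q + d *s axis j 1"
    have dx: "dist x q = m" by (simp add: x_def dist_norm norm_vector_scalar_mult nd norm_axis_1)
    have "x \<in> U" using r(2) dx m(3) by (auto simp: dist_commute)
    moreover have "x $ i = q $ i" using ji by (simp add: x_def axis_def)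
    moreover have "rGamma (A x) \<noteq> 0"
    proof -
      have "norm (c * d) = norm c * m" by (simp add: norm_mult nd)
      moreover have "norm c * m < \<epsilon>" using m(4) c by (simp add: pos_less_divide_eq mult.commute)
      moreover have "norm c * m > 0" using c m(1) by simp
      ultimately have "0 < norm (c * d) \<and> norm (c * d) < \<epsilon>" by simp
      hence "A q + c * d \<notin> \<int>\<^sub>\<le>\<^sub>0" by (rule mp[OF spec[OF \<epsilon>(2), of "c * d"]])
      thus ?thesis by (simp add: x_def lin rGamma_eq_zero_iff)
    qed
    ultimately show "\<exists>y\<in>{x \<in> {x \<in> U. rGamma (A x) \<noteq> 0}. x $ i = q $ i}. dist y q < e"
      using dx m(2) by (intro bexI[of _ x]) auto
  qed
  show "fibre_dense i T U {x \<in> U. rGamma (A x) \<noteq> 0}"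
    unfolding fibre_dense_def
  proof (intro conjI ballI impI key)
    show "U \<subseteq> closure {x \<in> U. rGamma (A x) \<noteq> 0}"
    proof
      fix q assume "q \<in> U"
      moreover have "closure {x \<in> {x \<in> U. rGamma (A x) \<noteq> 0}. x $ i = q $ i} \<subseteq> closure {x \<in> U. rGamma (A x) \<noteq> 0}"
        by (intro closure_mono) auto
      ultimately show "q \<in> closure {x \<in> U. rGamma (A x) \<noteq> 0}" using key by blast
    qed
  qed
qed

text \<open>The reciprocal of Gamma is entire, so this presents \<Lambda> as a quotient of
  holomorphic functions with poles confined to the zeros of \<open>rGamma\<close>.\<close>

lemma Lambda_rGamma:
  assumes "u \<noteq> 0"
  shows "Lambda u \<eta> = inverse (rGamma (u + \<eta>)) *
    (exp u / (of_real (sqrt (2 * pi)) * exp ((\<eta> + u - 1/2) * Ln u)))"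
  using assms by (simp add: Lambda_eq Gamma_def)

lemma mv_holomorphic_on_Lambda_factor:
  assumes u: "mv_holomorphic_on u U" and \<eta>: "mv_holomorphic_on \<eta> U" and nr: "\<And>x. x \<in> U \<Longrightarrow> u x \<notin> \<real>\<^sub>\<le>\<^sub>0"
  shows "mv_holomorphic_on (\<lambda>x. exp (u x) / (of_real (sqrt (2 * pi)) * exp ((\<eta> x + u x - 1/2) * Ln (u x)))) U"
proof -
  have "mv_holomorphic_on (\<lambda>x. Ln (u x)) U"
    by (rule mv_holomorphic_on_compose_field[OF u]) (use nr in \<open>auto intro: field_differentiable_at_Ln\<close>)
  thus ?thesis by (intro mv_holomorphic_on_divide mv_hol_intros u \<eta>) auto
qed

lemma fib_mero_Lambda:
  fixes u \<eta> :: "complex ^ 'n \<Rightarrow> complex"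
  assumes U: "open U" and u: "mv_holomorphic_on u U" and \<eta>: "mv_holomorphic_on \<eta> U"
    and nr: "\<And>x. x \<in> U \<Longrightarrow> u x \<notin> \<real>\<^sub>\<le>\<^sub>0" and ji: "j \<noteq> i" and c: "c \<noteq> 0"
    and lin: "\<And>x d. u (x + d *s axis j 1) = u x" "\<And>x d. \<eta> (x + d *s axis j 1) = \<eta> x + c * d"
  shows "fib_mero i T (\<lambda>x. Lambda (u x) (\<eta> x)) U"
proof (rule fib_mero_cong[OF fib_mero_mult[OF fib_mero_inverse[OF fib_mero_rGamma] fib_mero_holomorphic_nz] U fibre_dense_refl])
  show "open U" by (rule U)
  show "mv_holomorphic_on (\<lambda>x. u x + \<eta> x) U" by (intro mv_hol_intros u \<eta>)
  show "u (x + d *s axis j 1) + \<eta> (x + d *s axis j 1) = u x + \<eta> x + c * d" for x d by (simp add: lin)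
  show "mv_holomorphic_on (\<lambda>x. exp (u x) / (of_real (sqrt (2 * pi)) * exp ((\<eta> x + u x - 1/2) * Ln (u x)))) U"
    by (rule mv_holomorphic_on_Lambda_factor[OF u \<eta> nr])
  show "inverse (rGamma (u x + \<eta> x)) * (exp (u x) / (of_real (sqrt (2 * pi)) * exp ((\<eta> x + u x - 1/2) * Ln (u x)))) =
      Lambda (u x) (\<eta> x)" if "x \<in> U" for x
    using nr[OF that] by (subst Lambda_rGamma) auto
qed (use U ji c in auto)

text \<open>At a pole, Gamma takes the value 0 by convention, hence so does \<Lambda>. A nonzero
  value therefore shows that the denominator \<open>rGamma\<close> does not vanish at p.\<close>

lemma regular_value_Lambda:
  fixes u \<eta> :: "complex ^ 'n \<Rightarrow> complex"
  assumes U: "open U" and u: "mv_holomorphic_on u U" and \<eta>: "mv_holomorphic_on \<eta> U"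
    and nr: "\<And>x. x \<in> U \<Longrightarrow> u x \<notin> \<real>\<^sub>\<le>\<^sub>0" and p: "p \<in> U" "Lambda (u p) (\<eta> p) \<noteq> 0"
  shows "regular_value (\<lambda>x. Lambda (u x) (\<eta> x)) p (Lambda (u p) (\<eta> p))"
proof -
  have hol: "mv_holomorphic_on (\<lambda>x. rGamma (u x + \<eta> x)) U"
    by (intro mv_holomorphic_on_compose_field[OF mv_holomorphic_on_add[OF u \<eta>]] field_differentiable_rGamma)
  have u0: "u x \<noteq> 0" if "x \<in> U" for x using nr[OF that] by auto
  let ?E = "\<lambda>x. exp (u x) / (of_real (sqrt (2 * pi)) * exp ((\<eta> x + u x - 1/2) * Ln (u x)))"
  have L: "Lambda (u x) (\<eta> x) = ?E x / rGamma (u x + \<eta> x)" if "x \<in> U" for x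
    unfolding Lambda_rGamma[OF u0[OF that]] by (simp only: divide_inverse[of _ "rGamma (u x + \<eta> x)"] mult.commute)
  have nz: "rGamma (u p + \<eta> p) \<noteq> 0"
  proof
    assume "rGamma (u p + \<eta> p) = 0"
    thus False using p(2) unfolding L[OF p(1)] by simp
  qed
  have "regular_value (\<lambda>x. Lambda (u x) (\<eta> x)) p (?E p / rGamma (u p + \<eta> p))"
  proof (rule regular_value_quotientI[OF U p(1) mv_holomorphic_on_Lambda_factor[OF u \<eta> nr] hol nz U closure_subset])
    show "Lambda (u x) (\<eta> x) = ?E x / rGamma (u x + \<eta> x)" if "x \<in> U \<inter> U" for x using that by (intro L) simp
  qed
  thus ?thesis unfolding L[OF p(1)] .
qed

section \<open>Power bounds for the modified gamma function near zero\<close>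

lemma norm_Ln_le:
  assumes "u \<noteq> 0"
  shows "norm (Ln u) \<le> \<bar>ln (norm u)\<bar> + pi"
proof -
  have "\<bar>Im (Ln u)\<bar> \<le> pi" using mpi_less_Im_Ln[OF assms] Im_Ln_le_pi[OF assms] by linarith
  thus ?thesis using cmod_le[of "Ln u"] assms by simp
qed

text \<open>Three factors are bounded separately: the reciprocal gamma value by its order at \<eta>,
  the elementary constant, and the power of u, whose modulus is controlled by |\<eta> + u - 1/2| |Ln
  u|.\<close>

lemma Lambda_power_bounds:
  "\<exists>\<epsilon>>0. \<exists>m::nat. \<forall>u. u \<notin> \<real>\<^sub>\<le>\<^sub>0 \<and> norm u < \<epsilon> \<longrightarrow>
     norm u ^ m \<le> norm (Lambda u \<eta>) \<and> norm (Lambda u \<eta>) \<le> inverse (norm u ^ m)"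
proof -
  have hol: "rGamma holomorphic_on ball \<eta> 1"
    by (simp add: holomorphic_on_def field_differentiable_at_within field_differentiable_rGamma)
  have nz: "\<exists>x\<in>ball \<eta> 1. rGamma x \<noteq> 0"
  proof -
    obtain \<epsilon> where \<epsilon>: "\<epsilon> > 0" "\<forall>d. 0 < norm d \<and> norm d < \<epsilon> \<longrightarrow> \<eta> + d \<notin> \<int>\<^sub>\<le>\<^sub>0"
      using nonpos_Ints_isolated by blast
    define d :: complex where "d = of_real (min \<epsilon> 1 / 2)"
    have nd: "norm d = min \<epsilon> 1 / 2" using \<epsilon>(1) by (simp add: d_def)
    have "0 < norm d" "norm d < \<epsilon>" "norm d < 1" unfolding nd using \<epsilon>(1) by (auto simp: min_def)
    hence "\<eta> + d \<notin> \<int>\<^sub>\<le>\<^sub>0" "\<eta> + d \<in> ball \<eta> 1" using spec[OF \<epsilon>(2), of d] by (simp_all add: dist_norm)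
    thus ?thesis by (intro bexI[of _ "\<eta> + d"]) (simp_all add: rGamma_eq_zero_iff)
  qed
  obtain e1 k where e1: "e1 > 0" "\<forall>d. 0 < norm d \<and> norm d < e1 \<longrightarrow>
      norm d ^ k \<le> norm (rGamma (\<eta> + d)) \<and> norm (rGamma (\<eta> + d)) \<le> inverse (norm d)"
    using holomorphic_power_bounds[OF hol zero_less_one nz] by (elim exE conjE) (rule that; assumption)
  \<comment> \<open>|\<eta> + u - 1/2| is at most |\<eta>| + 2, and |Ln u| at most twice the modulus
    of ln |u|, so M dominates the exponent of the power of u.\<close>
  obtain M :: nat where M: "2 * (norm \<eta> + 2) \<le> real M" using real_arch_simple by blast
  define m where "m = Suc k + M + 2"
  \<comment> \<open>\<open>exp (- pi)\<close> makes \<pi> smaller than - ln |u|, which absorbs the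
    argument of u; \<open>exp (- 3)\<close> lets one power of |u| absorb exp (Re u) / sqrt (2
    \<pi>).\<close>
  define \<epsilon> where "\<epsilon> = min (min e1 (exp (- pi))) (exp (- 3))"
  have "norm u ^ m \<le> norm (Lambda u \<eta>) \<and> norm (Lambda u \<eta>) \<le> inverse (norm u ^ m)"
    if u: "u \<notin> \<real>\<^sub>\<le>\<^sub>0" "norm u < \<epsilon>" for u
  proof -
    define n where "n = norm u"
    have u0: "u \<noteq> 0" using u(1) by auto
    have n: "0 < n" "n < e1" "n < exp (- pi)" "n < exp (- 3)" using u0 u(2) by (auto simp: n_def \<epsilon>_def)
    have "exp (- 3) < exp (0::real)" unfolding exp_less_cancel_iff by simp
    hence n1: "n < 1" using n(4) unfolding exp_zero by linarith
    define R where "R = norm (rGamma (u + \<eta>))"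
    have R: "n ^ k \<le> R" "R \<le> inverse n" using e1(2) n(1,2) by (auto simp: R_def n_def add.commute)
    have R0: "R > 0" using R(1) zero_less_power[OF n(1), of k] by linarith
    define E where "E = exp (Re u) / sqrt (2 * pi)"
    have "\<bar>Re u\<bar> < 1" using abs_Re_le_cmod[of u] n1 by (simp add: n_def)
    hence reu: "exp (- 1) \<le> exp (Re u)" "exp (Re u) \<le> exp 1" by auto
    have sq: "1 \<le> sqrt (2 * pi)" "sqrt (2 * pi) \<le> exp 2"
    proof -
      show "1 \<le> sqrt (2 * pi)" using pi_gt3 by simp
      have "sqrt (2 * pi) \<le> sqrt (3 ^ 2)" using pi_less_4 by (intro real_sqrt_le_mono) simp
      also have "\<dots> = 1 + 2" by simp
      also have "\<dots> \<le> exp 2" by (rule exp_ge_add_one_self)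
      finally show "sqrt (2 * pi) \<le> exp 2" .
    qed
    have E: "n \<le> E" "E \<le> inverse n"
    proof -
      have "n \<le> exp (- 1) / exp 2" using n(4) by (simp flip: exp_diff)
      also have "\<dots> \<le> E" unfolding E_def using reu sq by (intro frac_le) auto
      finally show "n \<le> E" .
      have "E \<le> exp 1 / 1" unfolding E_def using reu sq by (intro frac_le) auto
      also have "\<dots> \<le> inverse (exp (- 3))" by (simp add: exp_minus)
      also have "\<dots> \<le> inverse n" using n by (intro le_imp_inverse_le) auto
      finally show "E \<le> inverse n" .
    qed
    define X where "X = exp (- Re ((\<eta> + u - 1/2) * Ln u))"
    have lnn: "ln n < - pi" using n(1,3) by (metis exp_less_cancel_iff exp_ln)
    have "norm (Ln u) \<le> - ln n + pi" 
    proof -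
      have "ln n < 0" using lnn pi_gt_zero by linarith
      thus ?thesis using norm_Ln_le[OF u0] unfolding n_def[symmetric] by linarith
    qed
    also have "\<dots> \<le> 2 * (- ln n)" using lnn by simp
    finally have nL: "norm (Ln u) \<le> 2 * (- ln n)" .
    have "\<bar>Re ((\<eta> + u - 1/2) * Ln u)\<bar> \<le> norm (\<eta> + u - 1/2) * norm (Ln u)"
      using abs_Re_le_cmod[of "(\<eta> + u - 1/2) * Ln u"] by (simp add: norm_mult)
    also have "\<dots> \<le> (norm \<eta> + 2) * (2 * (- ln n))"
    proof (intro mult_mono nL)
      have "norm (\<eta> + u - 1/2) \<le> norm \<eta> + norm u + norm (1/2 :: complex)"
        by (meson norm_triangle_ineq norm_triangle_ineq4 order_trans add_right_mono)
      thus "norm (\<eta> + u - 1/2) \<le> norm \<eta> + 2" using n1 by (simp add: n_def)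
    qed auto
    also have "\<dots> = 2 * (norm \<eta> + 2) * (- ln n)" by simp
    also have "\<dots> \<le> real M * (- ln n)" using lnn pi_gt_zero by (intro mult_right_mono M) linarith
    finally have XL: "\<bar>Re ((\<eta> + u - 1/2) * Ln u)\<bar> \<le> real M * (- ln n)" .
    have nM: "exp (real M * ln n) = n ^ M" using n(1) by (simp add: exp_of_nat_mult)
    have X: "n ^ M \<le> X" "X \<le> inverse (n ^ M)"
      unfolding nM[symmetric] exp_minus[symmetric] X_def exp_le_cancel_iff using XL by linarith+
    have nsq: "norm (complex_of_real (sqrt (2 * pi))) = sqrt (2 * pi)" by simp
    have quot: "a / (b * c) = a / b * inverse c" for a b c :: real by (simp add: divide_inverse)
    have L: "norm (Lambda u \<eta>) = inverse R * (E * X)"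
      unfolding Lambda_rGamma[OF u0] norm_mult norm_inverse norm_divide norm_exp_eq_Re nsq R_def E_def X_def exp_minus quot ..
    have "n ^ m \<le> n ^ (1 + 1 + M)" using n(1) n1 by (intro power_decreasing) (auto simp: m_def)
    also have "\<dots> = n * (n * n ^ M)" by simp
    also have "\<dots> \<le> inverse R * (E * X)"
    proof (intro mult_mono E(1) X(1))
      show "n \<le> inverse R" using R(2) R0 n(1) le_imp_inverse_le[of R "inverse n"] by simp
    qed (use n R0 E(1) in auto)
    finally have lo: "n ^ m \<le> norm (Lambda u \<eta>)" unfolding L .
    have X0: "X \<ge> 0" "E \<ge> 0" by (simp_all add: X_def E_def)
    have "norm (Lambda u \<eta>) \<le> inverse (n ^ k) * (inverse n * inverse (n ^ M))"
      unfolding L using R(1) n(1) R0 X0 by (intro mult_mono E(2) X(2) le_imp_inverse_le) auto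
    also have "\<dots> = inverse (n ^ (k + 1 + M))" by (simp add: power_add)
    also have "\<dots> \<le> inverse (n ^ m)"
      using n(1) n1 by (intro le_imp_inverse_le power_decreasing) (auto simp: m_def)
    finally show ?thesis using lo unfolding n_def by blast
  qed
  moreover have "\<epsilon> > 0" using e1(1) by (simp add: \<epsilon>_def)
  ultimately show ?thesis by (intro exI[of _ \<epsilon>] conjI exI[of _ m]) auto
qed

section \<open>The solution\<close>

text \<open>The natural variable of the problem: t \<rightarrow> 0 becomes w \<rightarrow>
  \<infinity>, the range of Stirling's formula, and t \<rightarrow> \<infinity> becomes w
  \<rightarrow> 0.\<close>

definition wz :: "complex \<Rightarrow> complex \<Rightarrow> complex" where
  "wz z t = z / (2 * of_real pi * \<i> * t)"

lemma wz_eq_0_iff [simp]: "wz z t = 0 \<longleftrightarrow> z = 0 \<or> t = 0"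
  by (auto simp: wz_def)

text \<open>A point t = \<i> s r z has s w = - 1 / (2 \<pi> r), so the slit corresponds exactly to
  the branch cut of \<Lambda>.\<close>

lemma slit_plane_iff:
  assumes z: "z \<noteq> 0" and s: "s \<in> {1, - 1}"
  shows "t \<in> slit_plane z s \<longleftrightarrow> t \<noteq> 0 \<and> of_int s * wz z t \<notin> \<real>\<^sub>\<le>\<^sub>0"
proof (cases "t = 0")
  case True
  thus ?thesis by (simp add: slit_plane_def)
next
  case t: False
  have ss: "of_int s * of_int s = (1 :: complex)" using s by auto
  have s0: "of_int s \<noteq> (0 :: complex)" using s by auto
  have "t \<in> (\<lambda>u. \<i> * u) ` ray z s \<longleftrightarrow> of_int s * wz z t \<in> \<real>\<^sub>\<le>\<^sub>0"
  proof
    assume "t \<in> (\<lambda>u. \<i> * u) ` ray z s"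
    then obtain r :: real where r: "r > 0" "t = \<i> * (of_int s * of_real r * z)" by (auto simp: ray_def)
    have "of_int s * wz z t = of_real (- 1 / (2 * pi * r))"
      using z s r(1) by (auto simp: wz_def r(2) field_simps)
    moreover have "- 1 / (2 * pi * r) \<le> 0" using r(1) by simp
    ultimately show "of_int s * wz z t \<in> \<real>\<^sub>\<le>\<^sub>0" by (metis nonpos_Reals_of_real_iff)
  next
    assume "of_int s * wz z t \<in> \<real>\<^sub>\<le>\<^sub>0"
    then obtain x where x: "of_int s * wz z t = of_real x" "x \<le> 0" by (auto elim: nonpos_Reals_cases)
    have "of_int s * wz z t \<noteq> 0" using z t s0 by simp
    hence x0: "x < 0" using x by (cases "x = 0") auto
    define r where "r = - 1 / (2 * pi * x)"
    have r: "r > 0" using x0 by (simp add: r_def divide_neg_neg mult_pos_neg)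
    have "of_int s * z = of_real x * (2 * of_real pi * \<i> * t)" using x(1) t by (simp add: wz_def field_simps)
    hence "\<i> * (of_real r * (of_int s * z)) = \<i> * (of_real r * (of_real x * (2 * of_real pi * \<i> * t)))" by simp
    also have "\<dots> = (\<i> * \<i>) * of_real (r * x * 2 * pi) * t" by simp
    also have "r * x * 2 * pi = - 1" using x0 by (simp add: r_def)
    finally have "t = \<i> * (of_int s * of_real r * z)" by (simp add: mult_ac)
    thus "t \<in> (\<lambda>u. \<i> * u) ` ray z s" using r by (auto simp: ray_def)
  qed
  thus ?thesis using t by (simp add: slit_plane_def)
qed

lemma open_slit_plane:
  assumes "z \<noteq> 0" "s \<in> {1, - 1}"
  shows "open (slit_plane z s)"
proof -
  have "continuous_on (- {0}) (\<lambda>t. of_int s * wz z t)"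
    unfolding wz_def by (intro continuous_intros) auto
  hence "open (- {0} \<inter> (\<lambda>t. of_int s * wz z t) -` (- \<real>\<^sub>\<le>\<^sub>0))"
    by (rule continuous_open_preimage) (auto simp: open_Compl closed_nonpos_Reals_complex)
  moreover have "slit_plane z s = - {0} \<inter> (\<lambda>t. of_int s * wz z t) -` (- \<real>\<^sub>\<le>\<^sub>0)"
    using slit_plane_iff[OF assms] by auto
  ultimately show ?thesis by simp
qed

text \<open>The factors of the cocycle of \<open>\<Psi>\<^sub>\<plusminus>\<close>: the translate of the defining modified gamma function by
  \<open>\<theta> \<mapsto> \<theta> + \<kappa> \<tau>\<close>.\<close>

definition Lam :: "int \<Rightarrow> complex \<Rightarrow> complex \<Rightarrow> complex ^ 2 \<Rightarrow> complex" where
  "Lam s u \<kappa> p = Lambda u (1/2 - of_int s * (p $ 2 + \<kappa> * p $ 1 + p $ 1 / 2))"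

lemma mv_holomorphic_on_divide_const: "mv_holomorphic_on f U \<Longrightarrow> mv_holomorphic_on (\<lambda>p. f p / c) U"
  unfolding divide_inverse by (intro mv_hol_intros)

lemma fib_mero_Lam:
  assumes "u \<notin> \<real>\<^sub>\<le>\<^sub>0" "s \<in> {1, - 1}"
  shows "fib_mero 1 T (Lam s u \<kappa>) HC"
  unfolding Lam_def[abs_def]
proof (rule fib_mero_Lambda[OF open_HC mv_holomorphic_on_const, where j = 2 and c = "- of_int s"])
  show "mv_holomorphic_on (\<lambda>p :: complex ^ 2. 1/2 - of_int s * (p $ 2 + \<kappa> * p $ 1 + p $ 1 / 2)) HC"
    by (intro mv_hol_intros mv_holomorphic_on_divide_const)
qed (use assms in \<open>auto simp: axis_def algebra_simps\<close>)

lemma mv_meromorphic_on_Lam: "u \<notin> \<real>\<^sub>\<le>\<^sub>0 \<Longrightarrow> s \<in> {1, - 1} \<Longrightarrow> mv_meromorphic_on (Lam s u \<kappa>) HC"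
  using fib_mero_imp_meromorphic[OF fib_mero_Lam] .

lemma regular_value_Lam:
  assumes "u \<notin> \<real>\<^sub>\<le>\<^sub>0" "p \<in> HC" "Lam s u \<kappa> p \<noteq> 0"
  shows "regular_value (Lam s u \<kappa>) p (Lam s u \<kappa> p)"
proof -
  let ?\<eta> = "\<lambda>p :: complex ^ 2. 1/2 - of_int s * (p $ 2 + \<kappa> * p $ 1 + p $ 1 / 2)"
  have hol: "mv_holomorphic_on ?\<eta> HC" by (intro mv_hol_intros mv_holomorphic_on_divide_const)
  have "regular_value (\<lambda>p. Lambda u (?\<eta> p)) p (Lambda u (?\<eta> p))"
    by (rule regular_value_Lambda[OF open_HC mv_holomorphic_on_const hol assms(1,2)]) (use assms(3) in \<open>simp add: Lam_def\<close>)
  thus ?thesis by (simp only: Lam_def[abs_def] Lam_def)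
qed

definition PsiG :: "int \<Rightarrow> complex \<Rightarrow> mero" where
  "PsiG s u = abs_mero (Lam s u 0) powi s"

text \<open>Together with \<open>cexp\<close> this merges the two branches of \<open>cocyc\<close>
  into one product over k < |n|, with translates k or - (k + 1) and exponents s or - s.\<close>

definition cshift :: "int \<Rightarrow> nat \<Rightarrow> complex" where
  "cshift n k = (if n \<ge> 0 then of_nat k else - of_nat (Suc k))"

definition cexp :: "int \<Rightarrow> int \<Rightarrow> int" where
  "cexp s n = (if n \<ge> 0 then s else - s)"

text \<open>A representative with values at points of the class \<open>cocyc (PsiG s u) n\<close>;
  limits and bounds are computed on it.\<close>

definition Cfun :: "int \<Rightarrow> complex \<Rightarrow> int \<Rightarrow> complex ^ 2 \<Rightarrow> complex" where
  "Cfun s u n p = (\<Prod>k<nat \<bar>n\<bar>. Lam s u (cshift n k) p powi cexp s n)"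

lemma cexp_cases: "s \<in> {1, - 1} \<Longrightarrow> cexp s n \<in> {1, - 1}"
  by (auto simp: cexp_def)

lemma abs_mero_powi:
  assumes "mv_meromorphic_on f HC" "e \<in> {1, - 1 :: int}"
  shows "abs_mero f powi e = abs_mero (\<lambda>p. f p powi e)"
  using assms by (auto simp: abs_mero_inverse power_int_minus)

lemma abs_mero_prod:
  assumes "\<And>k. k \<in> K \<Longrightarrow> mv_meromorphic_on (f k) HC"
  shows "(\<Prod>k\<in>K. abs_mero (f k)) = abs_mero (\<lambda>p. \<Prod>k\<in>K. f k p) \<and> mv_meromorphic_on (\<lambda>p. \<Prod>k\<in>K. f k p) HC"
  using assms
proof (induction K rule: infinite_finite_induct)
  case (insert k K)
  thus ?case using abs_mero_mult[of "f k" "\<lambda>p. \<Prod>k\<in>K. f k p"] mv_meromorphic_on_mult[of "f k" HC "\<lambda>p. \<Prod>k\<in>K. f k p"]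
    by simp
qed (use mero_rel_const[of 1] in \<open>simp_all add: one_mero.abs_eq mero_rel_refl_iff\<close>)

lemma cocyc_powi:
  assumes "s \<in> {1, - 1}"
  shows "cocyc (g powi s) n = (\<Prod>k<nat \<bar>n\<bar>. shift (cshift n k) 0 g powi cexp s n)"
  using assms by (cases "n \<ge> 0") (auto simp: cocyc_def cshift_def cexp_def power_int_minus shift_inverse)

lemma abs_mero_Lam_shift:
  assumes "u \<notin> \<real>\<^sub>\<le>\<^sub>0" "s \<in> {1, - 1}"
  shows "shift \<kappa> 0 (abs_mero (Lam s u 0)) = abs_mero (Lam s u \<kappa>)"
proof -
  have "(\<lambda>p. Lam s u 0 (shear \<kappa> 0 p)) = Lam s u \<kappa>" by (rule ext) (simp add: Lam_def shear_def)
  thus ?thesis by (simp only: abs_mero_shift[OF mv_meromorphic_on_Lam[OF assms]])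
qed

lemma cocyc_PsiG_prod:
  assumes "u \<notin> \<real>\<^sub>\<le>\<^sub>0" "s \<in> {1, - 1}"
  shows "cocyc (PsiG s u) n = (\<Prod>k<nat \<bar>n\<bar>. abs_mero (Lam s u (cshift n k)) powi cexp s n)"
  unfolding PsiG_def cocyc_powi[OF assms(2)] abs_mero_Lam_shift[OF assms] ..

lemma fib_mero_Cfun:
  assumes "u \<notin> \<real>\<^sub>\<le>\<^sub>0" "s \<in> {1, - 1}"
  shows "fib_mero 1 T (Cfun s u n) HC"
  unfolding Cfun_def[abs_def] by (intro fib_mero_prod fib_mero_powi open_HC fib_mero_Lam assms)

lemma cocyc_PsiG:
  assumes "u \<notin> \<real>\<^sub>\<le>\<^sub>0" "s \<in> {1, - 1}"
  shows "cocyc (PsiG s u) n = abs_mero (Cfun s u n)"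
proof -
  have e: "abs_mero (Lam s u \<kappa>) powi cexp s n = abs_mero (\<lambda>p. Lam s u \<kappa> p powi cexp s n)" for \<kappa>
    by (rule abs_mero_powi[OF mv_meromorphic_on_Lam[OF assms] cexp_cases[OF assms(2)]])
  have m: "mv_meromorphic_on (\<lambda>p. Lam s u \<kappa> p powi cexp s n) HC" for \<kappa>
    by (rule fib_mero_imp_meromorphic[OF fib_mero_powi[OF open_HC fib_mero_Lam[OF assms]]])
  show ?thesis unfolding cocyc_PsiG_prod[OF assms] e
    using abs_mero_prod[of "{..<nat \<bar>n\<bar>}" "\<lambda>k p. Lam s u (cshift n k) p powi cexp s n"] m
    by (simp add: Cfun_def[abs_def])
qed

lemma PsiG_neq_0:
  assumes "u \<notin> \<real>\<^sub>\<le>\<^sub>0" "s \<in> {1, - 1}"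
  shows "PsiG s u \<noteq> 0"
  using fib_mero_abs_mero_neq_0[OF fib_mero_Cfun[OF assms, of _ 1]] cocyc_PsiG[OF assms, of 1]
  by (simp add: cocyc_1)

text \<open>Nonvanishing of the factors excludes their poles, where \<Lambda> is 0 by convention,
  and also their zeros, which would be poles of the inverse factors. So the pointwise product is the
  value of the class.\<close>

lemma cocyc_value:
  assumes u: "u \<notin> \<real>\<^sub>\<le>\<^sub>0" and s: "s \<in> {1, - 1}" and \<tau>: "0 < Im \<tau>"
    and nz: "\<And>k. k < nat \<bar>n\<bar> \<Longrightarrow> Lam s u (cshift n k) (vector [\<tau>, \<theta>]) \<noteq> 0"
  shows "mero_value (cocyc (PsiG s u) n) \<tau> \<theta> (Cfun s u n (vector [\<tau>, \<theta>]))" "Cfun s u n (vector [\<tau>, \<theta>]) \<noteq> 0"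
proof -
  have p: "vector [\<tau>, \<theta>] \<in> HC" using \<tau> by (simp add: HC_def)
  show "mero_value (cocyc (PsiG s u) n) \<tau> \<theta> (Cfun s u n (vector [\<tau>, \<theta>]))"
    unfolding cocyc_PsiG_prod[OF u s] Cfun_def
  proof (rule mero_value_prod[OF \<tau>])
    fix k assume "k \<in> {..<nat \<bar>n\<bar>}"
    hence nzk: "Lam s u (cshift n k) (vector [\<tau>, \<theta>]) \<noteq> 0" using nz by simp
    have "mero_value (abs_mero (Lam s u (cshift n k))) \<tau> \<theta> (Lam s u (cshift n k) (vector [\<tau>, \<theta>]))"
      using regular_value_Lam[OF u p nzk] \<tau> by (simp add: mero_value_abs_mero mv_meromorphic_on_Lam u s[simplified])
    thus "mero_value (abs_mero (Lam s u (cshift n k)) powi cexp s n) \<tau> \<theta>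
        (Lam s u (cshift n k) (vector [\<tau>, \<theta>]) powi cexp s n)"
      using mero_value_inverse[OF _ nzk] cexp_cases[OF s, of n] by (auto simp: power_int_minus)
  qed
  show "Cfun s u n (vector [\<tau>, \<theta>]) \<noteq> 0" using nz by (simp add: Cfun_def)
qed

lemma is_Psi_iff:
  assumes u: "of_int s * wz z t \<notin> \<real>\<^sub>\<le>\<^sub>0" and s: "s \<in> {1, - 1}"
  shows "is_Psi z s t \<psi> \<longleftrightarrow> \<psi> = diag_map (cocyc (PsiG s (of_int s * wz z t)))"
proof -
  let ?g = "PsiG s (of_int s * wz z t)"
  have g: "?g \<noteq> 0" by (rule PsiG_neq_0[OF u s])
  have e: "abs_mero (\<lambda>p. Lambda (of_int s * (z / (2 * of_real pi * \<i> * t)))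
      (1 / 2 - of_int s * (p $ 2 + p $ 1 / 2))) powi s = ?g"
    by (simp add: PsiG_def Lam_def[abs_def] wz_def)
  show ?thesis
  proof
    assume "is_Psi z s t \<psi>"
    thus "\<psi> = diag_map (cocyc ?g)"
      unfolding is_Psi_def e by (intro aut_eq_diag_map[OF _ _ _ g]) auto
  next
    assume \<psi>: "\<psi> = diag_map (cocyc ?g)"
    have c: "cocycle (cocyc ?g)" by (rule cocycle_cocyc[OF g])
    show "is_Psi z s t \<psi>"
      unfolding is_Psi_def e \<psi> by (simp add: is_aut_diag_map[OF c] diag_map_qmon cocyc_0 cocyc_1)
  qed
qed

lemma Psi_eq:
  assumes "of_int s * wz z t \<notin> \<real>\<^sub>\<le>\<^sub>0" "s \<in> {1, - 1}"
  shows "Psi z s t = diag_map (cocyc (PsiG s (of_int s * wz z t)))"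
  unfolding Psi_def by (rule the_equality) (simp_all add: is_Psi_iff[OF assms])

lemma qcoeff_Phi:
  assumes "of_int s * wz z t \<notin> \<real>\<^sub>\<le>\<^sub>0" "s \<in> {1, - 1}"
  shows "qcoeff (Phi z s t a) n = shift 0 (- wz z t) (qcoeff a n) * cocyc (PsiG s (of_int s * wz z t)) n"
  by (simp add: Phi_def Psi_eq[OF assms] inv_eps_Z diag_map.rep_eq eps_Z.rep_eq wz_def)

lemma is_aut_Phi:
  assumes "of_int s * wz z t \<notin> \<real>\<^sub>\<le>\<^sub>0" "s \<in> {1, - 1}"
  shows "is_aut (Phi z s t)"
  unfolding Phi_def Psi_eq[OF assms] inv_eps_Z
  by (intro is_aut_comp is_aut_diag_map cocycle_cocyc is_aut_eps_Z PsiG_neq_0 assms)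

section \<open>Slices at fixed t and meromorphic dependence on t\<close>

definition slice3 :: "complex \<Rightarrow> complex ^ 2 \<Rightarrow> complex ^ 3" where
  "slice3 t p = vector [p $ 1, p $ 2, t]"

definition slice_domain :: "complex set \<Rightarrow> (complex ^ 3) set" where
  "slice_domain D = {p. 0 < Im (p $ 1) \<and> p $ 3 \<in> D}"

lemma continuous_on_vector_3:
  assumes "continuous_on S a" "continuous_on S b" "continuous_on S c"
  shows "continuous_on S (\<lambda>x. vector [a x, b x, c x] :: complex ^ 3)"
proof -
  have "continuous_on S (\<lambda>x. \<chi> k::3. if k = 1 then a x else if k = 2 then b x else c x)"
  proof (rule continuous_on_vec_lambda)
    fix k :: 3 show "continuous_on S (\<lambda>x. if k = 1 then a x else if k = 2 then b x else c x)"
      using assms by (cases "k = 1"; cases "k = 2") auto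
  qed
  moreover have "(\<chi> k::3. if k = 1 then a x else if k = 2 then b x else c x) = vector [a x, b x, c x]" for x
    by (simp add: vec_eq_iff forall_3)
  ultimately show ?thesis by simp
qed

lemma vector_3_eta: "x $ 3 = t \<Longrightarrow> vector [x $ 1, x $ 2, t] = (x :: complex ^ 3)"
  by (simp add: vec_eq_iff forall_3)

lemma mv_holomorphic_on_slice3: "mv_holomorphic_on (\<lambda>p. slice3 t p $ k) U"
proof -
  have "k = 1 \<or> k = 2 \<or> k = 3" using exhaust_3 by blast
  thus ?thesis unfolding slice3_def by (auto intro: mv_holomorphic_on_coord mv_holomorphic_on_const)
qed

lemma open_slice_domain:
  assumes "open D"
  shows "open (slice_domain D)"
proof -
  have "slice_domain D = {p. 0 < Im (p $ 1)} \<inter> (\<lambda>p. p $ 3) -` D" by (auto simp: slice_domain_def)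
  moreover have "open {p :: complex ^ 3. 0 < Im (p $ 1)}" by (intro open_Collect_less continuous_intros)
  moreover have "open ((\<lambda>p :: complex ^ 3. p $ 3) -` D)" by (intro open_vimage assms continuous_intros)
  ultimately show ?thesis by auto
qed

lemma continuous_on_slice3: "continuous_on S (slice3 t)"
  unfolding slice3_def by (intro continuous_on_vector_3 continuous_intros)

text \<open>Over the single fibre \<open>x $ 3 = t\<close> the projection to (\<tau>, \<theta>)
  inverts the inclusion of the slice, so density inside that fibre becomes density in
  \<open>HC\<close>.\<close>

lemma fib_mero_slice3:
  assumes F: "fib_mero 3 UNIV F (slice_domain D)" and t: "t \<in> D"
  shows "fib_mero i {} (\<lambda>p. F (slice3 t p)) HC"
proof (rule fib_mero_compose[OF F mv_holomorphic_on_slice3 open_HC])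
  show "slice3 t x \<in> slice_domain D" if "x \<in> HC" for x
    using that t by (simp add: slice3_def slice_domain_def HC_def)
  fix q assume "q \<in> HC"
  show "\<exists>\<sigma> S. continuous_on UNIV \<sigma> \<and> \<sigma> (slice3 t q) = q \<and>
      (S = UNIV \<or> slice3 t q $ 3 \<in> UNIV \<and> S = {y. y $ 3 = slice3 t q $ 3}) \<and>
      (\<forall>y\<in>slice_domain D \<inter> S. \<sigma> y \<in> HC \<and> slice3 t (\<sigma> y) = y \<and> (q $ i \<in> {} \<longrightarrow> \<sigma> y $ i = q $ i))"
  proof (intro exI[of _ "\<lambda>y :: complex ^ 3. vector [y $ 1, y $ 2] :: complex ^ 2"] exI[of _ "{y :: complex ^ 3. y $ 3 = t}"] conjI ballI)
    show "continuous_on UNIV (\<lambda>y :: complex ^ 3. vector [y $ 1, y $ 2] :: complex ^ 2)"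
      by (intro continuous_on_vector_2 continuous_intros)
    fix y :: "complex ^ 3" assume y: "y \<in> slice_domain D \<inter> {y. y $ 3 = t}"
    show "slice3 t (vector [y $ 1, y $ 2]) = y" using y vector_3_eta[of y t] by (simp add: slice3_def)
    show "vector [y $ 1, y $ 2] \<in> HC" using y by (simp add: slice_domain_def HC_def)
  qed (auto simp: slice3_def vector_2_eta)
qed

lemma slice3_dense:
  assumes "fibre_dense 3 UNIV V W"
  shows "{p. slice3 t p \<in> V} \<subseteq> closure {p. slice3 t p \<in> W}"
proof
  fix p assume p: "p \<in> {p. slice3 t p \<in> V}"
  let ?\<sigma> = "\<lambda>y :: complex ^ 3. vector [y $ 1, y $ 2] :: complex ^ 2"
  have "slice3 t p \<in> closure {x \<in> W. x $ 3 = slice3 t p $ 3}" using p by (intro fibre_denseD[OF assms]) auto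
  moreover have "?\<sigma> ` closure {x \<in> W. x $ 3 = slice3 t p $ 3} \<subseteq> closure {p. slice3 t p \<in> W}"
  proof (rule image_closure_subset)
    show "continuous_on (closure {x \<in> W. x $ 3 = slice3 t p $ 3}) ?\<sigma>"
      by (intro continuous_on_vector_2 continuous_intros)
    have "slice3 t (?\<sigma> x) = x" if "x $ 3 = t" for x using vector_3_eta[OF that] by (simp add: slice3_def)
    hence "?\<sigma> ` {x \<in> W. x $ 3 = slice3 t p $ 3} \<subseteq> {p. slice3 t p \<in> W}" by (auto simp: slice3_def)
    thus "?\<sigma> ` {x \<in> W. x $ 3 = slice3 t p $ 3} \<subseteq> closure {p. slice3 t p \<in> W}" using closure_subset by (rule order_trans)
  qed simp
  ultimately have "?\<sigma> (slice3 t p) \<in> closure {p. slice3 t p \<in> W}" by blast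
  thus "p \<in> closure {p. slice3 t p \<in> W}" by (simp add: slice3_def vector_2_eta)
qed

text \<open>Points of W on the slice supply a regular value. Conversely, a holomorphic germ G equal
  to F on a dense set of the three-dimensional space need not equal F on the slice; density of W
  inside the slice bridges this gap.\<close>

lemma is_slice_fib_mero:
  assumes F: "fib_mero 3 UNIV F (slice_domain D)" and t: "t \<in> D"
  shows "is_slice F t (abs_mero (\<lambda>p. F (slice3 t p)))"
  unfolding is_slice_def
proof (intro conjI allI impI)
  have mm: "mv_meromorphic_on (\<lambda>p. F (slice3 t p)) HC"
    by (rule fib_mero_imp_meromorphic[OF fib_mero_slice3[OF F t]])
  have inD: "vector [\<tau>, \<theta>, t] \<in> slice_domain D" if "0 < Im \<tau>" for \<tau> \<theta> using that t by (simp add: slice_domain_def)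
  show "\<exists>\<tau> \<theta> v. 0 < Im \<tau> \<and> regular_value F (vector [\<tau>, \<theta>, t]) v"
  proof -
    obtain V g h W where 1: "open V" "vector [\<i>, 0, t] \<in> V" "V \<subseteq> slice_domain D" "mv_holomorphic_on g V" "mv_holomorphic_on h V"
      "open W" "W \<subseteq> V" "fibre_dense 3 UNIV V W" "\<forall>x\<in>W. g x \<noteq> 0" "\<forall>x\<in>W. h x \<noteq> 0"
      "\<forall>x\<in>W. F x = g x / h x" by (rule fib_meroE[OF F inD[of \<i> 0]]) simp
    have "(vector [\<i>, 0, t] :: complex ^ 3) \<in> closure {x\<in>W. x $ 3 = (vector [\<i>, 0, t] :: complex ^ 3) $ 3}"
      by (rule fibre_denseD[OF 1(8,2) UNIV_I])
    hence ne: "(vector [\<i>, 0, t] :: complex ^ 3) \<in> closure {x\<in>W. x $ 3 = t}" by (simp only: vector_3)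
    have "{x\<in>W. x $ 3 = t} \<noteq> {}"
    proof
      assume "{x\<in>W. x $ 3 = t} = {}"
      thus False using ne by (simp only: closure_empty empty_iff)
    qed
    then obtain x where x: "x \<in> W" "x $ 3 = t" by auto
    have "regular_value F x (g x / h x)"
      by (rule regular_value_quotientI[OF 1(1) _ 1(4,5) _ 1(6) fibre_dense_dense[OF 1(8)]]) (use x 1 in auto)
    moreover have "0 < Im (x $ 1)" using x(1) 1(3,7) by (auto simp: slice_domain_def)
    ultimately show ?thesis
      using vector_3_eta[OF x(2)] by (intro exI[of _ "x $ 1"] exI[of _ "x $ 2"] exI[of _ "g x / h x"]) simp
  qed
  fix \<tau> \<theta> v assume v: "0 < Im \<tau> \<and> regular_value F (vector [\<tau>, \<theta>, t]) v"
  let ?q = "vector [\<tau>, \<theta>, t] :: complex ^ 3"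
  obtain V0 G where V0: "open V0" "?q \<in> V0" "mv_holomorphic_on G V0" "agree_on V0 F G" "G ?q = v"
    using conjunct2[OF v] unfolding regular_value_def by (elim exE conjE) (rule that; assumption)
  have qD: "?q \<in> slice_domain D" using v by (intro inD) simp
  obtain V g h W where 1: "open V" "?q \<in> V" "V \<subseteq> slice_domain D" "mv_holomorphic_on g V" "mv_holomorphic_on h V"
    "open W" "W \<subseteq> V" "fibre_dense 3 UNIV V W" "\<forall>x\<in>W. g x \<noteq> 0" "\<forall>x\<in>W. h x \<noteq> 0"
    "\<forall>x\<in>W. F x = g x / h x" by (rule fib_meroE[OF F qD])
  define N where "N = V \<inter> V0"
  have N: "open N" "N \<subseteq> V" "N \<subseteq> V0" "?q \<in> N" using 1 V0 by (auto simp: N_def)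
  obtain W0 where W0: "open W0" "W0 \<subseteq> N" "N \<subseteq> closure W0" "\<forall>x\<in>W0. F x = G x"
    using agree_on_subset[OF V0(4) N(1,3)] unfolding agree_on_def by (elim exE conjE) (rule that; assumption)
  have fd: "fibre_dense 3 UNIV N (N \<inter> W)" by (rule fibre_dense_restrict[OF 1(8) N(1,2)])
  have hol: "mv_holomorphic_on (\<lambda>x. G x * h x) N" "mv_holomorphic_on g N"
    by (intro mv_holomorphic_on_mult mv_holomorphic_on_subset[OF V0(3) N(3)] mv_holomorphic_on_subset[OF 1(5) N(2)],
        rule mv_holomorphic_on_subset[OF 1(4) N(2)])
  \<comment> \<open>Without denominators the identity extends by continuity from a dense set to
    every point of N, in particular to the slice.\<close>
  have eq: "G x * h x = g x" if "x \<in> N" for x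
  proof (rule eq_on_dense[OF mv_holomorphic_on_continuous[OF hol(1)] mv_holomorphic_on_continuous[OF hol(2)] N(1) _ _ that])
    show "N \<subseteq> closure (W0 \<inter> (N \<inter> W))" by (rule dense_open_Int[OF W0(1-3) fibre_dense_dense[OF fd]])
    fix x assume x: "x \<in> N \<inter> (W0 \<inter> (N \<inter> W))"
    hence "G x = g x / h x" "h x \<noteq> 0" using W0(4) 1(10,11) by auto
    thus "G x * h x = g x" by simp
  qed
  have "regular_value (\<lambda>p. F (slice3 t p)) (vector [\<tau>, \<theta>]) (G (slice3 t (vector [\<tau>, \<theta>])))"
  proof (rule regular_valueI[where V = "{p. slice3 t p \<in> N}" and W = "{p. slice3 t p \<in> N \<inter> W}" and g = "\<lambda>p. G (slice3 t p)"])
    show "open {p. slice3 t p \<in> N}" "open {p. slice3 t p \<in> N \<inter> W}"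
      using open_vimage[OF N(1) continuous_on_slice3] open_vimage[OF open_Int[OF N(1) 1(6)] continuous_on_slice3]
      by (simp_all add: vimage_def)
    show "vector [\<tau>, \<theta>] \<in> {p. slice3 t p \<in> N}" using N(4) by (simp add: slice3_def)
    show "mv_holomorphic_on (\<lambda>p. G (slice3 t p)) {p. slice3 t p \<in> N}"
      by (rule mv_holomorphic_on_compose_map[OF mv_holomorphic_on_slice3 V0(3)]) (use N(3) in auto)
    show "{p. slice3 t p \<in> N} \<subseteq> closure {p. slice3 t p \<in> N \<inter> W}" by (rule slice3_dense[OF fd])
    fix p assume "p \<in> {p. slice3 t p \<in> N \<inter> W}"
    hence x: "slice3 t p \<in> N" "slice3 t p \<in> W" by auto
    have "F (slice3 t p) = g (slice3 t p) / h (slice3 t p)" "h (slice3 t p) \<noteq> 0" using x(2) 1(10,11) by auto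
    thus "F (slice3 t p) = G (slice3 t p)" unfolding eq[OF x(1), symmetric] by simp
  qed auto
  moreover have "G (slice3 t (vector [\<tau>, \<theta>])) = v" using V0(5) by (simp add: slice3_def)
  ultimately show "mero_value (abs_mero (\<lambda>p. F (slice3 t p))) \<tau> \<theta> v"
    using v by (simp add: mero_value_abs_mero[OF mm])
qed

text \<open>For fixed t the substitution is a translation of \<theta> and has a global section, so a
  dense set of \<open>HC\<close> pulls back to a set dense in every slice.\<close>

lemma fib_mero_theta_shift:
  assumes f: "fib_mero i {} f HC" and D: "open D" "0 \<notin> D"
  shows "fib_mero 3 UNIV (\<lambda>x. f (vector [x $ 1, x $ 2 - wz z (x $ 3)])) (slice_domain D)"
proof (rule fib_mero_compose[OF f _ open_slice_domain[OF D(1)]])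
  have w: "mv_holomorphic_on (\<lambda>x :: complex ^ 3. wz z (x $ 3)) (slice_domain D)"
    unfolding wz_def
  proof (rule mv_holomorphic_on_divide)
    fix p :: "complex ^ 3" assume "p \<in> slice_domain D"
    hence "p $ 3 \<noteq> 0" using D(2) by (auto simp: slice_domain_def)
    thus "2 * of_real pi * \<i> * p $ 3 \<noteq> 0" by simp
  qed (intro mv_hol_intros)+
  show "mv_holomorphic_on (\<lambda>x. (vector [x $ 1, x $ 2 - wz z (x $ 3)] :: complex ^ 2) $ k) (slice_domain D)" for k
    by (intro mv_holomorphic_on_vector_2 mv_holomorphic_on_diff mv_holomorphic_on_coord w)
  show "(vector [x $ 1, x $ 2 - wz z (x $ 3)] :: complex ^ 2) \<in> HC" if "x \<in> slice_domain D" for x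
    using that by (simp add: slice_domain_def HC_def)
  fix q assume q: "q \<in> slice_domain D"
  let ?\<phi> = "\<lambda>x :: complex ^ 3. vector [x $ 1, x $ 2 - wz z (x $ 3)] :: complex ^ 2"
  show "\<exists>\<sigma> S. continuous_on UNIV \<sigma> \<and> \<sigma> (?\<phi> q) = q \<and>
      (S = UNIV \<or> ?\<phi> q $ i \<in> {} \<and> S = {y. y $ i = ?\<phi> q $ i}) \<and>
      (\<forall>y\<in>HC \<inter> S. \<sigma> y \<in> slice_domain D \<and> ?\<phi> (\<sigma> y) = y \<and> (q $ 3 \<in> UNIV \<longrightarrow> \<sigma> y $ 3 = q $ 3))"
  proof (intro exI[of _ "\<lambda>y :: complex ^ 2. vector [y $ 1, y $ 2 + wz z (q $ 3), q $ 3] :: complex ^ 3"] exI[of _ UNIV] conjI ballI)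
    show "continuous_on UNIV (\<lambda>y :: complex ^ 2. vector [y $ 1, y $ 2 + wz z (q $ 3), q $ 3] :: complex ^ 3)"
      by (intro continuous_on_vector_3 continuous_intros)
  qed (use q in \<open>auto simp: slice_domain_def HC_def vector_2_eta vector_3_eta\<close>)
qed

lemma fib_mero_Lam3:
  assumes z: "z \<noteq> 0" and s: "s \<in> {1, - 1}"
  shows "fib_mero 3 UNIV (\<lambda>x. Lam s (of_int s * wz z (x $ 3)) \<kappa> (vector [x $ 1, x $ 2])) (slice_domain (slit_plane z s))"
proof -
  let ?U = "slice_domain (slit_plane z s)"
  have "fib_mero 3 UNIV (\<lambda>x. Lambda (of_int s * wz z (x $ 3)) (1/2 - of_int s * (x $ 2 + \<kappa> * x $ 1 + x $ 1 / 2))) ?U"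
  proof (rule fib_mero_Lambda[OF open_slice_domain[OF open_slit_plane[OF z s]], where j = 2 and c = "- of_int s"])
    show "mv_holomorphic_on (\<lambda>x :: complex ^ 3. of_int s * wz z (x $ 3)) ?U"
      unfolding wz_def
    proof (intro mv_holomorphic_on_mult mv_holomorphic_on_divide)
      fix p assume "p \<in> ?U"
      hence "p $ 3 \<noteq> 0" by (auto simp: slice_domain_def slit_plane_def)
      thus "2 * of_real pi * \<i> * p $ 3 \<noteq> 0" by simp
    qed (intro mv_hol_intros)+
    show "mv_holomorphic_on (\<lambda>x :: complex ^ 3. 1/2 - of_int s * (x $ 2 + \<kappa> * x $ 1 + x $ 1 / 2)) ?U"
      by (intro mv_hol_intros mv_holomorphic_on_divide_const)
    show "of_int s * wz z (x $ 3) \<notin> \<real>\<^sub>\<le>\<^sub>0" if "x \<in> ?U" for x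
      using that slit_plane_iff[OF z s] by (simp add: slice_domain_def)
  qed (use s in \<open>auto simp: axis_def algebra_simps\<close>)
  thus ?thesis by (simp add: Lam_def)
qed

lemma meromorphic_map_Phi:
  assumes z: "z \<noteq> 0" and s: "s \<in> {1, - 1}"
  shows "meromorphic_map (slit_plane z s) (\<lambda>t. Phi z s t a)"
proof -
  let ?D = "slit_plane z s"
  \<comment> \<open>Vanishing coefficients are left out because \<open>fib_mero\<close> describes
    nonzero functions; \<open>Phi\<close> creates no new degrees, so N does not depend on t.\<close>
  define N where "N = {n. qcoeff a n \<noteq> 0}"
  have "\<forall>n. \<exists>f. qcoeff a n = abs_mero f \<and> mv_meromorphic_on f HC" by (metis abs_mero_cases)
  then obtain f where f: "\<And>n. qcoeff a n = abs_mero (f n)" "\<And>n. mv_meromorphic_on (f n) HC" by metis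
  define F where "F = (\<lambda>n (x :: complex ^ 3). f n (vector [x $ 1, x $ 2 - wz z (x $ 3)]) *
    (\<Prod>k<nat \<bar>n\<bar>. Lam s (of_int s * wz z (x $ 3)) (cshift n k) (vector [x $ 1, x $ 2]) powi cexp s n))"
  have oD: "open ?D" by (rule open_slit_plane[OF z s])
  have oU: "open (slice_domain ?D)" by (rule open_slice_domain[OF oD])
  have fibF: "fib_mero 3 UNIV (F n) (slice_domain ?D)" if n: "n \<in> N" for n
    unfolding F_def
  proof (intro fib_mero_mult fib_mero_prod fib_mero_powi oU)
    have "fib_mero 1 {} (f n) HC" using n f[of n] by (intro abs_mero_fib_mero) (auto simp: N_def)
    thus "fib_mero 3 UNIV (\<lambda>x. f n (vector [x $ 1, x $ 2 - wz z (x $ 3)])) (slice_domain ?D)"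
      by (rule fib_mero_theta_shift[OF _ oD]) (simp add: slit_plane_def)
  qed (rule fib_mero_Lam3[OF z s])
  have coeff: "qcoeff (Phi z s t a) n = abs_mero (\<lambda>p. F n (slice3 t p))" if t: "t \<in> ?D" for n t
  proof -
    have u: "of_int s * wz z t \<notin> \<real>\<^sub>\<le>\<^sub>0" using t slit_plane_iff[OF z s] by blast
    have "qcoeff (Phi z s t a) n = shift 0 (- wz z t) (abs_mero (f n)) * abs_mero (Cfun s (of_int s * wz z t) n)"
      by (simp only: qcoeff_Phi[OF u s] cocyc_PsiG[OF u s] f(1))
    also have "\<dots> = abs_mero (\<lambda>p. f n (shear 0 (- wz z t) p) * Cfun s (of_int s * wz z t) n p)"
      unfolding abs_mero_shift[OF f(2)]
      by (rule abs_mero_mult[OF mv_meromorphic_shear_HC[OF f(2)] fib_mero_imp_meromorphic[OF fib_mero_Cfun[OF u s]]])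
    also have "(\<lambda>p. f n (shear 0 (- wz z t) p) * Cfun s (of_int s * wz z t) n p) = (\<lambda>p. F n (slice3 t p))"
      by (rule ext) (simp add: F_def slice3_def shear_def Cfun_def vector_2_eta)
    finally show ?thesis .
  qed
  show ?thesis
    unfolding meromorphic_map_def
  proof (intro exI[of _ N] exI[of _ F] conjI ballI allI impI)
    show "finite N" unfolding N_def by (rule finite_support)
    show "mv_meromorphic_on (F n) {p. 0 < Im (p $ 1) \<and> p $ 3 \<in> ?D}" if "n \<in> N" for n
      using fib_mero_imp_meromorphic[OF fibF[OF that]] by (simp only: slice_domain_def)
    show "is_slice (F n) t (qcoeff (Phi z s t a) n)" if "t \<in> ?D" "n \<in> N" for t n
      unfolding coeff[OF that(1)] by (rule is_slice_fib_mero[OF fibF[OF that(2)] that(1)])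
    show "qcoeff (Phi z s t a) n = 0" if "t \<in> ?D" "n \<notin> N" for t n
    proof -
      have u: "of_int s * wz z t \<notin> \<real>\<^sub>\<le>\<^sub>0" using that(1) slit_plane_iff[OF z s] by blast
      show ?thesis using that(2) by (simp add: qcoeff_Phi[OF u s] N_def)
    qed
  qed
qed

lemma meromorphic_aut_map_Phi:
  assumes z: "z \<noteq> 0" and s: "s \<in> {1, - 1}"
  shows "meromorphic_aut_map (slit_plane z s) (Phi z s)"
  unfolding meromorphic_aut_map_def
  using is_aut_Phi[OF _ s] meromorphic_map_Phi[OF z s] slit_plane_iff[OF z s] by blast

section \<open>The jump condition\<close>

lemma abs_mero_eqI:
  assumes "mv_meromorphic_on f HC" "\<And>p. p \<in> HC \<Longrightarrow> f p = g p"
  shows "abs_mero f = abs_mero g"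
proof -
  have "agree_on HC f g" unfolding agree_on_def using assms(2) open_HC closure_subset by (intro exI[of _ HC]) auto
  hence "mero_rel f g" using assms(1) by (intro mero_rel_I)
  thus ?thesis by (rule Quotient_rel_abs[OF Quotient_mero])
qed

text \<open>The element of degree 0 is the reciprocal of the dilogarithm E, so conjugation by it
  multiplies degree n by E (\<theta> + n \<tau>) / E (\<theta>).\<close>

lemma S_q_eq: "S_q s = diag_map (\<lambda>n. shift (of_int n) 0 (abs_mero (DT_fun s)) * inverse (abs_mero (DT_fun s)))"
proof -
  have "DT_q s = qmon (inverse (abs_mero (DT_fun s))) 0" by (simp add: DT_q_def DT_fun_def)
  thus ?thesis using DT_fun_neq_0[of s] by (simp add: S_q_def Ad_qmon shift_inverse mult.commute)
qed

lemma stokes_ratio: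
  "shift 1 0 (abs_mero (DT_fun 1)) * abs_mero (\<lambda>p. 1 + exp (2 * of_real pi * \<i> * (p $ 2 + p $ 1 / 2))) = abs_mero (DT_fun 1)"
  "shift 1 0 (abs_mero (DT_fun (- 1))) = abs_mero (DT_fun (- 1)) * abs_mero (\<lambda>p. 1 + exp (- (2 * of_real pi * \<i> * (p $ 2 + p $ 1 / 2))))"
proof -
  have m: "mv_meromorphic_on (\<lambda>p :: complex ^ 2. 1 + exp (2 * of_real pi * \<i> * (p $ 2 + p $ 1 / 2))) HC"
    "mv_meromorphic_on (\<lambda>p :: complex ^ 2. 1 + exp (- (2 * of_real pi * \<i> * (p $ 2 + p $ 1 / 2)))) HC"
    by (intro mv_holomorphic_on_imp_meromorphic_on mv_hol_intros mv_holomorphic_on_divide_const open_HC)+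
  note sh = mv_meromorphic_shear_HC[OF mv_meromorphic_on_DT_fun]
  show "shift 1 0 (abs_mero (DT_fun 1)) * abs_mero (\<lambda>p. 1 + exp (2 * of_real pi * \<i> * (p $ 2 + p $ 1 / 2))) = abs_mero (DT_fun 1)"
    unfolding abs_mero_shift[OF mv_meromorphic_on_DT_fun] abs_mero_mult[OF sh m(1)]
    by (rule abs_mero_eqI[OF mv_meromorphic_on_mult[OF sh m(1)]]) (simp add: DT_fun_shear_pos mult.commute)
  show "shift 1 0 (abs_mero (DT_fun (- 1))) = abs_mero (DT_fun (- 1)) * abs_mero (\<lambda>p. 1 + exp (- (2 * of_real pi * \<i> * (p $ 2 + p $ 1 / 2))))"
    unfolding abs_mero_shift[OF mv_meromorphic_on_DT_fun] abs_mero_mult[OF mv_meromorphic_on_DT_fun m(2)]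
    by (rule abs_mero_eqI[OF sh]) (simp add: DT_fun_shear_neg mult.commute)
qed

lemma Lam_0:
  "Lam 1 u 0 p = Lambda u (1/2 - (p $ 2 + p $ 1 / 2))" "Lam (- 1) u 0 p = Lambda u (1/2 + (p $ 2 + p $ 1 / 2))"
proof -
  have "1/2 - of_int 1 * (p $ 2 + 0 * p $ 1 + p $ 1 / 2) = 1/2 - (p $ 2 + p $ 1 / 2)"
    "1/2 - of_int (- 1) * (p $ 2 + 0 * p $ 1 + p $ 1 / 2) = 1/2 + (p $ 2 + p $ 1 / 2)" by simp_all
  thus "Lam 1 u 0 p = Lambda u (1/2 - (p $ 2 + p $ 1 / 2))" "Lam (- 1) u 0 p = Lambda u (1/2 + (p $ 2 + p $ 1 / 2))"
    by (simp_all only: Lam_def)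
qed

text \<open>With 1/0 = 0 the reflection formula holds at every point, poles included, and so passes
  directly to classes. The second identity is the reflection formula at - x; it serves the
  half-plane where the variable of the plus solution has positive imaginary part.\<close>

lemma Lambda_jump:
  assumes "Im w < 0"
  shows "abs_mero (Lam 1 w 0) * abs_mero (Lam (- 1) (- w) 0) *
    shift 0 (- w) (abs_mero (\<lambda>p. 1 + exp (2 * of_real pi * \<i> * (p $ 2 + p $ 1 / 2)))) = 1"
    (is "?A * ?B * ?C = 1")
  "abs_mero (Lam 1 (- w) 0) * abs_mero (Lam (- 1) w 0) *
    shift 0 w (abs_mero (\<lambda>p. 1 + exp (- (2 * of_real pi * \<i> * (p $ 2 + p $ 1 / 2))))) = 1"
    (is "?A' * ?B' * ?C' = 1")
proof -
  let ?E = "\<lambda>p :: complex ^ 2. 1 + exp (2 * of_real pi * \<i> * (p $ 2 + p $ 1 / 2))"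
  let ?E' = "\<lambda>p :: complex ^ 2. 1 + exp (- (2 * of_real pi * \<i> * (p $ 2 + p $ 1 / 2)))"
  have m: "mv_meromorphic_on ?E HC" "mv_meromorphic_on ?E' HC"
    by (intro mv_holomorphic_on_imp_meromorphic_on mv_hol_intros mv_holomorphic_on_divide_const open_HC)+
  have nr: "w \<notin> \<real>\<^sub>\<le>\<^sub>0" "- w \<notin> \<real>\<^sub>\<le>\<^sub>0" using assms by (auto simp: complex_nonpos_Reals_iff)
  have mL: "mv_meromorphic_on (Lam 1 w 0) HC" "mv_meromorphic_on (Lam (- 1) (- w) 0) HC"
    "mv_meromorphic_on (Lam 1 (- w) 0) HC" "mv_meromorphic_on (Lam (- 1) w 0) HC"
    using mv_meromorphic_on_Lam nr by auto
  have C: "?C = abs_mero (\<lambda>p. ?E (shear 0 (- w) p))" "?C' = abs_mero (\<lambda>p. ?E' (shear 0 w p))"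
    by (rule abs_mero_shift[OF m(1)], rule abs_mero_shift[OF m(2)])
  have pt: "Lam 1 w 0 p * Lam (- 1) (- w) 0 p = inverse (?E (shear 0 (- w) p))" for p
  proof -
    define x where "x = p $ 2 + p $ 1 / 2"
    have "Lam 1 w 0 p = Lambda w (1/2 - x)" "Lam (- 1) (- w) 0 p = Lambda (- w) (1/2 + x)"
      by (simp_all only: Lam_0 x_def)
    moreover have "shear 0 (- w) p $ 2 + shear 0 (- w) p $ 1 / 2 = x - w" by (simp add: shear_def x_def)
    ultimately show ?thesis using Lambda_reflection[OF assms, of x] by (simp only: inverse_eq_divide)
  qed
  have pt': "Lam 1 (- w) 0 p * Lam (- 1) w 0 p = inverse (?E' (shear 0 w p))" for p
  proof -
    define x where "x = p $ 2 + p $ 1 / 2"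
    have "Lam 1 (- w) 0 p = Lambda (- w) (1/2 + - x)" "Lam (- 1) w 0 p = Lambda w (1/2 - - x)"
      by (simp_all only: Lam_0 x_def diff_conv_add_uminus minus_minus)
    moreover have "shear 0 w p $ 2 + shear 0 w p $ 1 / 2 = x + w" by (simp add: shear_def x_def)
    moreover have "- (2 * of_real pi * \<i> * (x + w)) = 2 * of_real pi * \<i> * (- x - w)"
      by (simp only: mult_minus_right[symmetric] minus_add_distrib diff_conv_add_uminus)
    ultimately show ?thesis
      using Lambda_reflection[OF assms, of "- x"] by (simp only: inverse_eq_divide mult.commute[of "Lambda (- w) _"])
  qed
  have AB: "?A * ?B = inverse ?C"
    unfolding C(1) abs_mero_inverse[OF mv_meromorphic_shear_HC[OF m(1)]] abs_mero_mult[OF mL(1,2)] pt ..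
  have AB': "?A' * ?B' = inverse ?C'"
    unfolding C(2) abs_mero_inverse[OF mv_meromorphic_shear_HC[OF m(2)]] abs_mero_mult[OF mL(3,4)] pt' ..
  have "?A \<noteq> 0" "?B \<noteq> 0" "?A' \<noteq> 0" "?B' \<noteq> 0"
    using fib_mero_abs_mero_neq_0[OF fib_mero_Lam] nr by auto
  hence "?A * ?B \<noteq> 0" "?A' * ?B' \<noteq> 0" by (simp_all only: mult_eq_0_iff simp_thms)
  hence C0: "?C \<noteq> 0" "?C' \<noteq> 0" unfolding AB AB' by (simp_all only: inverse_nonzero_iff_nonzero not_False_eq_True)
  show "?A * ?B * ?C = 1" unfolding AB by (rule left_inverse[OF C0(1)])
  show "?A' * ?B' * ?C' = 1" unfolding AB' by (rule left_inverse[OF C0(2)])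
qed

lemma inverse_mult_eqI: "a * b * c = 1 \<Longrightarrow> inverse c * inverse b = (a :: 'a :: field)"
  using inverse_unique[of "b * c" a] by (simp add: mult_ac)

lemma mult_inverse_eqI: "a * c = e \<Longrightarrow> e \<noteq> 0 \<Longrightarrow> a * inverse e = inverse (c :: 'a :: field)"
  by auto

lemma mult_inverse_eqI': "a = e * c \<Longrightarrow> e \<noteq> 0 \<Longrightarrow> a * inverse e = (c :: 'a :: field)"
  by simp

text \<open>All maps are diagonal up to the common translation, so two cocycles are compared, and
  \<open>cocycle_unique\<close> leaves only degree 1. The Stokes factor acts before the translation
  by - w, which is why its cocycle appears translated.\<close>

lemma qRH1_Phi:
  assumes z: "z \<noteq> 0"
  shows "qRH1 z (Phi z)"
  unfolding qRH1_def
proof (intro allI impI conjI)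
  fix t :: complex assume t: "t \<noteq> 0"
  define w where "w = wz z t"
  define r where "r = t / z"
  define P where "P = 2 * pi * ((Re r)\<^sup>2 + (Im r)\<^sup>2)"
  \<comment> \<open>Since 2 \<pi> \<i> w = z / t is the inverse of r, the sign of Im w is opposite
    to that of Re (t / z).\<close>
  have Im_w: "Im w = - (Re r / P)"
  proof -
    have cancel: "c * (z / (c * t)) = z / t" if "c \<noteq> 0" for c using that by simp
    have "2 * of_real pi * \<i> * w = z / t" unfolding w_def wz_def by (rule cancel) simp
    also have "z / t = inverse r" by (simp only: r_def inverse_divide)
    finally have "Re (2 * of_real pi * \<i> * w) = Re (inverse r)" by (rule arg_cong)
    moreover have "Re (2 * of_real pi * \<i> * w) = - (2 * pi) * Im w" by simp
    ultimately have e: "- (2 * pi) * Im w = Re r / ((Re r)\<^sup>2 + (Im r)\<^sup>2)" by (simp only: inverse_complex.sel)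
    have "Im w = - (1 / (2 * pi)) * (- (2 * pi) * Im w)" by simp
    hence "Im w = - (1 / (2 * pi)) * (Re r / ((Re r)\<^sup>2 + (Im r)\<^sup>2))" by (simp only: e)
    thus ?thesis by (simp add: P_def)
  qed
  have P: "P > 0" if "Re r \<noteq> 0" using that by (simp add: P_def sum_power2_gt_zero_iff)
  define E where "E = (\<lambda>s. abs_mero (DT_fun s))"
  have E0: "E s \<noteq> 0" for s unfolding E_def by (rule DT_fun_neq_0)
  have cE: "cocycle (\<lambda>n. shift 0 d (shift (of_int n) 0 (E s) * inverse (E s)))" for d s
    by (rule cocycle_shift[OF cocycle_coboundary[OF E0]])
  {
    assume "0 < Re (t / z)"
    hence "Re r > 0" by (simp add: r_def)
    hence im: "Im w < 0" unfolding Im_w using P by simp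
    have nr: "of_int 1 * w \<notin> \<real>\<^sub>\<le>\<^sub>0" "of_int (- 1) * w \<notin> \<real>\<^sub>\<le>\<^sub>0" using im by (auto simp: complex_nonpos_Reals_iff)
    have g: "PsiG 1 w \<noteq> 0" "PsiG (- 1) (- w) \<noteq> 0" using PsiG_neq_0[of w 1] PsiG_neq_0[of "- w" "- 1"] nr by auto
    have coc: "cocyc (PsiG 1 w) n = shift 0 (- w) (shift (of_int n) 0 (E 1) * inverse (E 1)) * cocyc (PsiG (- 1) (- w)) n" for n
    proof (rule cocycle_unique[of "cocyc (PsiG 1 w)" "\<lambda>n. shift 0 (- w) (shift (of_int n) 0 (E 1) * inverse (E 1)) * cocyc (PsiG (- 1) (- w)) n"])
      show "cocycle (cocyc (PsiG 1 w))" by (rule cocycle_cocyc[OF g(1)])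
      show "cocycle (\<lambda>n. shift 0 (- w) (shift (of_int n) 0 (E 1) * inverse (E 1)) * cocyc (PsiG (- 1) (- w)) n)"
        by (intro cocycle_mult cE cocycle_cocyc g)
      let ?C = "abs_mero (\<lambda>p :: complex ^ 2. 1 + exp (2 * of_real pi * \<i> * (p $ 2 + p $ 1 / 2)))"
      have s1: "shift 1 0 (E 1) * ?C = E 1" unfolding E_def by (rule stokes_ratio(1))
      have j: "abs_mero (Lam 1 w 0) * abs_mero (Lam (- 1) (- w) 0) * shift 0 (- w) ?C = 1" by (rule Lambda_jump(1)[OF im])
      have "shift 1 0 (E 1) * inverse (E 1) = inverse ?C" by (rule mult_inverse_eqI[OF s1 E0])
      thus "cocyc (PsiG 1 w) 1 = shift 0 (- w) (shift (of_int 1) 0 (E 1) * inverse (E 1)) * cocyc (PsiG (- 1) (- w)) 1"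
        using inverse_mult_eqI[OF j] by (simp add: cocyc_1 PsiG_def power_int_minus shift_inverse)
    qed
    show "Phi z 1 t = Phi z (- 1) t \<circ> S_q 1"
    proof (rule ext, rule qtorus_eqI)
      fix a n
      show "qcoeff (Phi z 1 t a) n = qcoeff ((Phi z (- 1) t \<circ> S_q 1) a) n"
        using qcoeff_Phi[of 1 z t] qcoeff_Phi[of "- 1" z t] nr coc[of n]
        by (simp add: w_def[symmetric] S_q_eq E_def diag_map.rep_eq shift_mult mult_ac)
    qed
  }
  {
    assume "Re (t / z) < 0"
    hence "Re r < 0" by (simp add: r_def)
    hence im: "Im (- w) < 0" using P divide_neg_pos[of "Re r" P] by (simp add: Im_w)
    have nr: "of_int 1 * w \<notin> \<real>\<^sub>\<le>\<^sub>0" "of_int (- 1) * w \<notin> \<real>\<^sub>\<le>\<^sub>0" using im by (auto simp: complex_nonpos_Reals_iff)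
    have g: "PsiG 1 w \<noteq> 0" "PsiG (- 1) (- w) \<noteq> 0" using PsiG_neq_0[of w 1] PsiG_neq_0[of "- w" "- 1"] nr by auto
    have coc: "cocyc (PsiG 1 w) n = shift 0 (- w) (inverse (shift (of_int n) 0 (E (- 1)) * inverse (E (- 1)))) * cocyc (PsiG (- 1) (- w)) n" for n
    proof (rule cocycle_unique[of "cocyc (PsiG 1 w)" "\<lambda>n. shift 0 (- w) (inverse (shift (of_int n) 0 (E (- 1)) * inverse (E (- 1)))) * cocyc (PsiG (- 1) (- w)) n"])
      show "cocycle (cocyc (PsiG 1 w))" by (rule cocycle_cocyc[OF g(1)])
      show "cocycle (\<lambda>n. shift 0 (- w) (inverse (shift (of_int n) 0 (E (- 1)) * inverse (E (- 1)))) * cocyc (PsiG (- 1) (- w)) n)"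
        by (intro cocycle_mult cocycle_shift cocycle_inverse cocycle_coboundary E0 cocycle_cocyc g)
      let ?C = "abs_mero (\<lambda>p :: complex ^ 2. 1 + exp (- (2 * of_real pi * \<i> * (p $ 2 + p $ 1 / 2))))"
      have s1: "shift 1 0 (E (- 1)) = E (- 1) * ?C" unfolding E_def by (rule stokes_ratio(2))
      \<comment> \<open>Here - w lies in the lower half-plane, so \<open>Lambda_jump(2)\<close> is
        applied to - w.\<close>
      have j: "abs_mero (Lam 1 w 0) * abs_mero (Lam (- 1) (- w) 0) * shift 0 (- w) ?C = 1"
        using Lambda_jump(2)[OF im] by simp
      have "shift 1 0 (E (- 1)) * inverse (E (- 1)) = ?C" by (rule mult_inverse_eqI'[OF s1 E0])
      thus "cocyc (PsiG 1 w) 1 = shift 0 (- w) (inverse (shift (of_int 1) 0 (E (- 1)) * inverse (E (- 1)))) * cocyc (PsiG (- 1) (- w)) 1"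
        using inverse_mult_eqI[OF j] by (simp del: inverse_mult_distrib add: cocyc_1 PsiG_def power_int_minus shift_inverse)
    qed
    have S: "inv (S_q (- 1)) = diag_map (\<lambda>n. inverse (shift (of_int n) 0 (E (- 1)) * inverse (E (- 1))))"
      unfolding S_q_eq E_def by (rule bij_diag_map) (simp add: DT_fun_neq_0)
    show "Phi z 1 t = Phi z (- 1) t \<circ> inv (S_q (- 1))"
    proof (rule ext, rule qtorus_eqI)
      fix a n
      show "qcoeff (Phi z 1 t a) n = qcoeff ((Phi z (- 1) t \<circ> inv (S_q (- 1))) a) n"
        using qcoeff_Phi[of 1 z t] qcoeff_Phi[of "- 1" z t] nr coc[of n]
        by (simp del: inverse_mult_distrib add: w_def[symmetric] S diag_map.rep_eq shift_mult mult_ac)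
    qed
  }
qed

section \<open>Limit and growth\<close>

text \<open>Inversion carries a closed subsector of the slit plane to a closed sector away from the
  cut, and compactness makes the latter uniform in the sense of
  \<open>stirling_cone\<close>.\<close>

lemma wz_tends_in_cone:
  assumes z: "z \<noteq> 0" and s: "s \<in> {1, - 1}" and K: "closed_cone K" "K - {0} \<subseteq> slit_plane z s"
  shows "\<exists>c>0. filterlim (\<lambda>t. of_int s * wz z t) (at_inf_in (stirling_cone c)) (at 0 within K)"
proof -
  define b where "b = of_int s * (z / (2 * of_real pi * \<i>))"
  have b0: "b \<noteq> 0" using z s by (auto simp: b_def)
  have wb: "of_int s * wz z t = b / t" for t by (simp add: b_def wz_def)
  have clK: "closed K" and scale: "\<And>r t. t \<in> K \<Longrightarrow> 0 < r \<Longrightarrow> of_real r * t \<in> K"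
    using K(1) unfolding closed_cone_def by simp_all
  have inv: "b * cnj u = of_real (norm u ^ 2) * (b / u)" if "u \<noteq> 0" for u
    using that by (simp add: complex_norm_square del: of_real_power)
  \<comment> \<open>The image cone is described through \<open>b * cnj u\<close>, a positive
    multiple of b / u that is continuous in u also at 0; this makes closedness immediate.\<close>
  define K' where "K' = insert 0 {u. b * cnj u \<in> K}"
  have cone: "closed_cone K'"
    unfolding closed_cone_def
  proof (intro conjI ballI allI impI)
    have "closed ((\<lambda>u. b * cnj u) -` K)" by (intro closed_vimage clK continuous_intros)
    thus "closed K'" unfolding K'_def by (intro closed_insert) (simp add: vimage_def)
    fix u and r :: real assume u: "u \<in> K'" and r: "0 < r"
    have "b * cnj (of_real r * u) = of_real r * (b * cnj u)" by simp
    hence "b * cnj u \<in> K \<Longrightarrow> b * cnj (of_real r * u) \<in> K" using scale[OF _ r, of "b * cnj u"] by metis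
    thus "of_real r * u \<in> K'" using u unfolding K'_def by fastforce
  qed
  have nr: "u \<notin> \<real>\<^sub>\<le>\<^sub>0" if u: "u \<in> K'" "u \<noteq> 0" for u
  proof
    assume "u \<in> \<real>\<^sub>\<le>\<^sub>0"
    then obtain x where x: "u = of_real x" "x \<le> 0" by (auto elim: nonpos_Reals_cases)
    have "b * cnj u \<in> K - {0}" using u b0 by (auto simp: K'_def)
    hence "b * cnj u \<in> slit_plane z s" using K(2) by blast
    hence "b / (b * cnj u) \<notin> \<real>\<^sub>\<le>\<^sub>0" using slit_plane_iff[OF z s] wb by metis
    moreover have "b / (b * cnj u) = of_real (1 / x)" using b0 by (simp add: x(1))
    moreover have "1 / x \<le> 0" using x(2) by simp
    ultimately show False by (metis nonpos_Reals_of_real_iff)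
  qed
  obtain c where c: "c > 0" "K' \<subseteq> stirling_cone c" using closed_cone_subset_stirling_cone[OF cone nr] by blast
  have "filterlim (\<lambda>t. b / t) at_infinity (at 0 within K)"
    by (rule filterlim_divide_at_infinity[OF tendsto_const _ b0])
      (simp add: filterlim_at eventually_at_filter)
  moreover have "\<forall>\<^sub>F t in at 0 within K. b / t \<in> stirling_cone c"
    unfolding eventually_at_filter
  proof (rule always_eventually, intro allI impI)
    fix t assume t: "t \<noteq> 0" "t \<in> K"
    have "b * cnj (b / t) = of_real (norm (b / t) ^ 2) * (b / (b / t))" by (rule inv) (use b0 t in simp)
    also have "b / (b / t) = t" using b0 by simp
    finally have "b * cnj (b / t) \<in> K" using scale[OF t(2), of "norm (b / t) ^ 2"] b0 t(1) by simp
    thus "b / t \<in> stirling_cone c" using c(2) by (auto simp: K'_def)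
  qed
  ultimately have "filterlim (\<lambda>t. b / t) (at_inf_in (stirling_cone c)) (at 0 within K)"
    by (simp add: filterlim_inf filterlim_principal)
  thus ?thesis unfolding wb using c(1) by blast
qed

text \<open>After composition with \<open>eps_Z\<close> the translations cancel: the coefficients of
  a stay fixed and are multiplied by finite products of \<Lambda> factors and their inverses, each
  tending to 1.\<close>

lemma qRH2_Phi:
  assumes z: "z \<noteq> 0"
  shows "qRH2 z (Phi z)"
  unfolding qRH2_def
proof (intro ballI allI impI)
  fix s :: int and K assume s: "s \<in> {1, - 1}" and K: "closed_cone K \<and> K - {0} \<subseteq> slit_plane z s"
  let ?F = "at 0 within K"
  let ?u = "\<lambda>t. of_int s * wz z t"
  obtain c where c: "c > 0" "filterlim ?u (at_inf_in (stirling_cone c)) ?F"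
    using wz_tends_in_cone[OF z s] K by blast
  have slit: "\<forall>\<^sub>F t in ?F. ?u t \<notin> \<real>\<^sub>\<le>\<^sub>0"
    unfolding eventually_at_filter
  proof (rule always_eventually, intro allI impI)
    fix t assume "t \<noteq> 0" "t \<in> K"
    hence "t \<in> slit_plane z s" using K by blast
    thus "?u t \<notin> \<real>\<^sub>\<le>\<^sub>0" using slit_plane_iff[OF z s] by blast
  qed
  have Lam1: "((\<lambda>t. Lam s (?u t) \<kappa> p) \<longlongrightarrow> 1) ?F" for \<kappa> p
    unfolding Lam_def by (rule filterlim_compose[OF Lambda_stirling_cone[OF c(1)] c(2)])
  have Cfun1: "((\<lambda>t. Cfun s (?u t) n p) \<longlongrightarrow> 1) ?F" for n p
  proof -
    have "((\<lambda>t. Cfun s (?u t) n p) \<longlongrightarrow> (\<Prod>k<nat \<bar>n\<bar>. 1 powi cexp s n)) ?F"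
      unfolding Cfun_def by (intro tendsto_prod tendsto_power_int Lam1) simp
    thus ?thesis by simp
  qed
  have val: "\<forall>\<^sub>F t in ?F. mero_value (cocyc (PsiG s (?u t)) n) \<tau> \<theta> (Cfun s (?u t) n (vector [\<tau>, \<theta>])) \<and>
      Cfun s (?u t) n (vector [\<tau>, \<theta>]) \<noteq> 0" if \<tau>: "0 < Im \<tau>" for n \<tau> \<theta>
  proof -
    have "\<forall>\<^sub>F t in ?F. \<forall>k\<in>{..<nat \<bar>n\<bar>}. Lam s (?u t) (cshift n k) (vector [\<tau>, \<theta>]) \<noteq> 0"
      by (intro eventually_ball_finite ballI tendsto_imp_eventually_ne[OF Lam1]) auto
    \<comment> \<open>Factors tending to 1 are eventually nonzero, which is the condition for
      reading off values by \<open>cocyc_value\<close>.\<close>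
    thus ?thesis using slit by eventually_elim (use cocyc_value[OF _ s \<tau>] in auto)
  qed
  have coeff: "\<forall>\<^sub>F t in ?F. qcoeff ((Phi z s t \<circ> eps_Z z t) a) n = qcoeff a n * cocyc (PsiG s (?u t)) n" for a n
    using slit
  proof eventually_elim
    case (elim t)
    have "(Phi z s t \<circ> eps_Z z t) a = Psi z s t a"
      by (simp add: Phi_def inv_f_f bij_is_inj[OF bij_eps_Z])
    thus ?case by (simp add: Psi_eq[OF elim s] diag_map.rep_eq)
  qed
  show "aut_tends ?F (\<lambda>t. Phi z s t \<circ> eps_Z z t) id"
    unfolding aut_tends_def qtorus_tends_def mero_tends_at_def
  proof (intro allI impI conjI)
    fix a n \<tau> \<theta> v assume \<tau>: "0 < Im \<tau>"
    {
      assume "mero_value (qcoeff (id a) n) \<tau> \<theta> v"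
      hence v: "mero_value (qcoeff a n) \<tau> \<theta> v" by simp
      have "\<forall>\<^sub>F t in ?F. mero_value (qcoeff ((Phi z s t \<circ> eps_Z z t) a) n) \<tau> \<theta> (v * Cfun s (?u t) n (vector [\<tau>, \<theta>]))"
        using val[OF \<tau>, of n \<theta>] coeff[of a n]
        by eventually_elim (use mero_value_mult[OF v] in simp)
      moreover have "((\<lambda>t. v * Cfun s (?u t) n (vector [\<tau>, \<theta>])) \<longlongrightarrow> v * 1) ?F" by (intro tendsto_intros Cfun1)
      ultimately show "\<exists>w. (\<forall>\<^sub>F t in ?F. mero_value (qcoeff ((Phi z s t \<circ> eps_Z z t) a) n) \<tau> \<theta> (w t)) \<and> (w \<longlongrightarrow> v) ?F"
        by (intro exI[of _ "\<lambda>t. v * Cfun s (?u t) n (vector [\<tau>, \<theta>])"]) simp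
    }
    {
      assume "mero_value (inverse (qcoeff (id a) n)) \<tau> \<theta> v"
      hence v: "mero_value (inverse (qcoeff a n)) \<tau> \<theta> v" by simp
      have "\<forall>\<^sub>F t in ?F. mero_value (inverse (qcoeff ((Phi z s t \<circ> eps_Z z t) a) n)) \<tau> \<theta>
          (v * inverse (Cfun s (?u t) n (vector [\<tau>, \<theta>])))"
        using val[OF \<tau>, of n \<theta>] coeff[of a n]
      proof eventually_elim
        case (elim t)
        have "mero_value (inverse (cocyc (PsiG s (?u t)) n)) \<tau> \<theta> (inverse (Cfun s (?u t) n (vector [\<tau>, \<theta>])))"
          using elim by (intro mero_value_inverse) auto
        from mero_value_mult[OF v this] show ?case by (simp only: elim(2) inverse_mult_distrib)
      qed
      moreover have "((\<lambda>t. v * inverse (Cfun s (?u t) n (vector [\<tau>, \<theta>]))) \<longlongrightarrow> v * inverse 1) ?F"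
        by (intro tendsto_intros Cfun1) simp
      ultimately show "\<exists>w. (\<forall>\<^sub>F t in ?F. mero_value (inverse (qcoeff ((Phi z s t \<circ> eps_Z z t) a) n)) \<tau> \<theta> (w t)) \<and> (w \<longlongrightarrow> v) ?F"
        by (intro exI[of _ "\<lambda>t. v * inverse (Cfun s (?u t) n (vector [\<tau>, \<theta>]))"]) simp
    }
  qed
qed

section \<open>Growth at infinity\<close>

lemma fib_mero_shear:
  assumes F: "fib_mero 1 T F U" and U: "open U"
  shows "fib_mero 1 T (\<lambda>p. F (shear 0 d p)) (shear 0 d -` U)"
proof (rule fib_mero_compose[OF F _ open_shear[OF U]])
  show "mv_holomorphic_on (\<lambda>x. shear 0 d x $ k) (shear 0 d -` U)" for k
    unfolding shear_def by (intro mv_holomorphic_on_vector_2 mv_hol_intros)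
  fix q assume q: "q \<in> shear 0 d -` U"
  show "\<exists>\<sigma> S. continuous_on UNIV \<sigma> \<and> \<sigma> (shear 0 d q) = q \<and>
      (S = UNIV \<or> shear 0 d q $ 1 \<in> T \<and> S = {y. y $ 1 = shear 0 d q $ 1}) \<and>
      (\<forall>y\<in>U \<inter> S. \<sigma> y \<in> shear 0 d -` U \<and> shear 0 d (\<sigma> y) = y \<and> (q $ 1 \<in> T \<longrightarrow> \<sigma> y $ 1 = q $ 1))"
  proof (intro exI[of _ "shear 0 (- d)"] exI[of _ "if q $ 1 \<in> T then {y. y $ 1 = q $ 1} else UNIV"] conjI ballI)
    show "shear 0 (- d) (shear 0 d q) = q" by (simp add: shear_shear shear_0)
    show "shear 0 d (shear 0 (- d) y) = y" for y by (simp add: shear_shear shear_0)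
    thus "shear 0 (- d) y \<in> shear 0 d -` U" if "y \<in> U \<inter> (if q $ 1 \<in> T then {y. y $ 1 = q $ 1} else UNIV)" for y
      using that by simp
  qed (auto simp: continuous_on_shear, auto simp: shear_def split: if_splits)
qed auto

lemma fibre_ok_shear:
  assumes "fibre_ok c F V" "open V"
  shows "fibre_ok c (\<lambda>p. F (shear 0 d p)) (shear 0 d -` V)"
proof -
  obtain G where G: "agree_on V F G" "fib_mero 1 {c} G V"
    using assms(1) unfolding fibre_ok_def by (elim exE conjE) (rule that; assumption)
  show ?thesis unfolding fibre_ok_def
    by (intro exI[of _ "\<lambda>p. G (shear 0 d p)"] conjI agree_on_shear G(1) fib_mero_shear G(2) assms(2))
qed

lemma fibre_ok_fib_mero: "fib_mero 1 UNIV C U \<Longrightarrow> open V \<Longrightarrow> V \<subseteq> U \<Longrightarrow> fibre_ok c C V"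
proof -
  assume C: "fib_mero 1 UNIV C U" and V: "open V" "V \<subseteq> U"
  have "fib_mero 1 {c} C V"
    by (rule fib_mero_antimono[OF fib_mero_subset[OF C V]]) simp
  thus ?thesis unfolding fibre_ok_def using agree_on_refl[OF V(1)] by (intro exI[of _ C] conjI)
qed

text \<open>The cocycle factor C has order 0 along every fibre over \<tau>, so it may be divided
  out: a regular nonzero value of the product at one \<theta> controls the order of f along the
  whole fibre.\<close>

lemma fibre_ok_coeff:
  assumes f: "mv_meromorphic_on f HC" and C: "fib_mero 1 UNIV C HC" and \<tau>: "0 < Im \<tau>"
    and v: "mero_value (shift 0 d (abs_mero f) * abs_mero C) \<tau> \<theta>\<^sub>1 v" "v \<noteq> 0"
  shows "\<exists>V. open V \<and> vector [\<tau>, \<theta>] \<in> V \<and> V \<subseteq> HC \<and> fibre_ok \<tau> f V"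
proof -
  have f0: "abs_mero f \<noteq> 0"
  proof
    assume "abs_mero f = 0"
    hence "mero_value 0 \<tau> \<theta>\<^sub>1 v" using v(1) by simp
    thus False using mero_value_0 v(2) by blast
  qed
  have vim: "shear 0 e -` HC = HC" for e by (auto simp: shear_HC)
  have ff: "fib_mero 1 {} (\<lambda>p. f (shear 0 d p)) HC"
    using fib_mero_shear[OF abs_mero_fib_mero[OF f f0] open_HC, of d] by (simp add: vim)
  have C': "fib_mero 1 {} C HC"
    by (rule fib_mero_antimono[OF C]) simp
  define H where "H = (\<lambda>p. f (shear 0 d p) * C p)"
  have H: "fib_mero 1 {} H HC" unfolding H_def by (rule fib_mero_mult[OF ff C'])
  have "shift 0 d (abs_mero f) * abs_mero C = abs_mero H"
    unfolding H_def abs_mero_shift[OF f]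
    by (rule abs_mero_mult[OF mv_meromorphic_shear_HC[OF f] fib_mero_imp_meromorphic[OF C]])
  hence rv: "regular_value H (vector [\<tau>, \<theta>\<^sub>1]) v"
    using v(1) by (simp add: mero_value_abs_mero[OF fib_mero_imp_meromorphic[OF H]])
  \<comment> \<open>The translated function near \<theta> - d is f near \<theta>.\<close>
  have "\<exists>V. open V \<and> vector [\<tau>, \<theta> - d] \<in> V \<and> V \<subseteq> HC \<and> fibre_ok ((vector [\<tau>, \<theta>\<^sub>1] :: complex ^ 2) $ 1) H V"
    by (rule fibre_ok_everywhere[OF H _ rv v(2)]) (use \<tau> in \<open>auto simp: HC_def\<close>)
  then obtain V where V: "open V" "vector [\<tau>, \<theta> - d] \<in> V" "V \<subseteq> HC" "fibre_ok \<tau> H V"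
    unfolding vector_2 by (elim exE conjE) (rule that; assumption)
  have okC: "fibre_ok \<tau> (\<lambda>p. inverse (C p)) V" by (rule fibre_ok_inverse[OF fibre_ok_fib_mero[OF C V(1,3)]])
  have "agree_on V (\<lambda>x. C x * inverse (C x)) (\<lambda>x. 1)"
    using agree_on_subset[OF mv_meromorphic_on_inverse(2)[OF fib_mero_imp_meromorphic[OF C] open_HC connected_HC
        fib_mero_not_agree_0[OF C HC_nonempty]] V(1,3)] .
  hence "agree_on V (\<lambda>p. H p * inverse (C p)) (\<lambda>p. f (shear 0 d p))"
    unfolding agree_on_def
  proof (elim exE conjE, intro exI conjI)
    fix W assume "\<forall>x\<in>W. C x * inverse (C x) = 1"
    thus "\<forall>x\<in>W. H x * inverse (C x) = f (shear 0 d x)" by (simp add: H_def mult.assoc)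
  qed
  hence "fibre_ok \<tau> (\<lambda>p. f (shear 0 d p)) V" by (rule fibre_ok_cong[OF _ fibre_ok_mult[OF V(4) okC]])
  hence "fibre_ok \<tau> (\<lambda>p. f (shear 0 d (shear 0 (- d) p))) (shear 0 (- d) -` V)" by (rule fibre_ok_shear[OF _ V(1)])
  hence "fibre_ok \<tau> f (shear 0 (- d) -` V)" by (simp add: shear_shear shear_0)
  moreover have "vector [\<tau>, \<theta>] \<in> shear 0 (- d) -` V" using V(2) by (simp add: shear_def)
  moreover have "shear 0 (- d) -` V \<subseteq> HC" using V(3) shear_HC by auto
  ultimately show ?thesis using open_shear[OF V(1)] by (intro exI[of _ "shear 0 (- d) -` V"]) simp
qed

text \<open>The two bounds are reciprocal to each other, which makes the condition stable under products and inverses.\<close>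

definition pow_bounded :: "real \<Rightarrow> nat \<Rightarrow> complex \<Rightarrow> bool" where
  "pow_bounded x m v \<longleftrightarrow> x ^ m \<le> norm v \<and> norm v \<le> inverse (x ^ m)"

lemma pow_bounded_mult:
  assumes "0 < x" "pow_bounded x m u" "pow_bounded x n v"
  shows "pow_bounded x (m + n) (u * v)"
proof -
  have "x ^ m * x ^ n \<le> norm u * norm v" "norm u * norm v \<le> inverse (x ^ m) * inverse (x ^ n)"
    using assms by (auto simp: pow_bounded_def intro!: mult_mono)
  thus ?thesis by (simp add: pow_bounded_def norm_mult power_add)
qed

lemma pow_bounded_inverse:
  assumes "0 < x" "pow_bounded x m u"
  shows "pow_bounded x m (inverse u)"
proof -
  have p: "0 < x ^ m" using assms(1) by simp
  hence u: "0 < norm u" using assms(2) by (auto simp: pow_bounded_def intro: less_le_trans)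
  have "inverse (norm u) \<le> inverse (x ^ m)" using assms(2) p by (intro le_imp_inverse_le) (auto simp: pow_bounded_def)
  moreover have "inverse (inverse (x ^ m)) \<le> inverse (norm u)"
    using assms(2) u by (intro le_imp_inverse_le) (auto simp: pow_bounded_def)
  ultimately show ?thesis by (simp add: pow_bounded_def norm_inverse)
qed

lemma pow_bounded_powi:
  assumes "0 < x" "pow_bounded x m u" "e \<in> {1, - 1 :: int}"
  shows "pow_bounded x m (u powi e)"
  using assms pow_bounded_inverse by (auto simp: power_int_minus)

lemma pow_bounded_prod:
  assumes "0 < x" "finite K" "\<And>k. k \<in> K \<Longrightarrow> pow_bounded x (m k) (u k)"
  shows "pow_bounded x (\<Sum>k\<in>K. m k) (\<Prod>k\<in>K. u k)"
  using assms(2,3)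
proof (induction K rule: finite_induct)
  case empty
  show ?case by (simp add: pow_bounded_def)
next
  case (insert k K)
  thus ?case using pow_bounded_mult[OF assms(1), of "m k" "u k" "\<Sum>k\<in>K. m k" "\<Prod>k\<in>K. u k"] by simp
qed

lemma qRH3_Phi:
  assumes z: "z \<noteq> 0"
  shows "qRH3 z (Phi z)"
  unfolding qRH3_def aut_bounded_growth_def bounded_growth_def
proof (intro ballI allI impI)
  fix s :: int and a n \<tau> \<theta>
  assume s: "s \<in> {1, - 1}" and \<tau>: "0 < Im \<tau>"
    and ex: "\<exists>t\<in>slit_plane z s. \<exists>v. v \<noteq> 0 \<and> mero_value (qcoeff (Phi z s t a) n) \<tau> \<theta> v"
  let ?D = "slit_plane z s"
  let ?u = "\<lambda>t. of_int s * wz z t"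
  let ?p = "vector [\<tau>, \<theta>] :: complex ^ 2"
  have nu: "norm (?u t) = norm (wz z t)" for t using s by (auto simp: norm_mult)
  obtain f where f: "qcoeff a n = abs_mero f" "mv_meromorphic_on f HC" by (rule abs_mero_cases)
  obtain t1 v1 where t1: "t1 \<in> ?D" "v1 \<noteq> 0" "mero_value (qcoeff (Phi z s t1 a) n) \<tau> \<theta> v1" using ex by blast
  have u1: "?u t1 \<notin> \<real>\<^sub>\<le>\<^sub>0" using t1(1) slit_plane_iff[OF z s] by blast
  have "\<exists>V. open V \<and> ?p \<in> V \<and> V \<subseteq> HC \<and> fibre_ok \<tau> f V"
  proof (rule fibre_ok_coeff[OF f(2) fib_mero_Cfun[OF u1 s] \<tau> _ t1(2)])
    show "mero_value (shift 0 (- wz z t1) (abs_mero f) * abs_mero (Cfun s (?u t1) n)) \<tau> \<theta> v1"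
      using t1(3) by (simp only: qcoeff_Phi[OF u1 s] cocyc_PsiG[OF u1 s] f(1))
  qed
  then obtain V where V: "open V" "?p \<in> V" "V \<subseteq> HC" "fibre_ok \<tau> f V"
    by (elim exE conjE) (rule that; assumption)
  obtain e0 k0 where e0: "e0 > 0" "\<forall>d. 0 < norm d \<and> norm d < e0 \<longrightarrow>
      (\<exists>v. regular_value f (vector [\<tau>, \<theta> + d]) v \<and> norm d ^ k0 \<le> norm v \<and> norm v \<le> inverse (norm d ^ k0))"
    using fibre_ok_bounds[OF V(1,2), of f, unfolded vector_2, OF V(4)] by (elim exE conjE) (rule that; assumption)
  have "\<forall>k. \<exists>\<epsilon> m. \<epsilon> > 0 \<and> (\<forall>u. u \<notin> \<real>\<^sub>\<le>\<^sub>0 \<and> norm u < \<epsilon> \<longrightarrow> pow_bounded (norm u) m (Lam s u (cshift n k) ?p))"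
    unfolding Lam_def pow_bounded_def using Lambda_power_bounds by blast
  then obtain \<epsilon> m where em: "\<And>k. \<epsilon> k > (0::real)"
    "\<And>k u. u \<notin> \<real>\<^sub>\<le>\<^sub>0 \<Longrightarrow> norm u < \<epsilon> k \<Longrightarrow> pow_bounded (norm u) (m k) (Lam s u (cshift n k) ?p)"
    by metis
  define M where "M = k0 + (\<Sum>k<nat \<bar>n\<bar>. m k)"
  define C where "C = norm z / (2 * pi)"
  have C: "C > 0" using z by (simp add: C_def)
  have nw: "norm (wz z t) = C / norm t" for t by (simp add: wz_def C_def norm_divide norm_mult)
  have lim: "((\<lambda>t. norm (wz z t)) \<longlongrightarrow> 0) (at_inf_in ?D)"
    unfolding nw by (rule real_tendsto_divide_at_top[OF tendsto_const])
      (rule filterlim_compose[OF filterlim_norm_at_top filterlim_at_inf_in])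
  have small: "\<forall>\<^sub>F t in at_inf_in ?D. norm (wz z t) < e" if "e > 0" for e
    using order_tendstoD(2)[OF lim that] .
  have inD: "\<forall>\<^sub>F t in at_inf_in ?D. t \<in> ?D" unfolding eventually_at_inf_in by blast
  have big: "\<forall>\<^sub>F t in at_inf_in ?D. b \<le> norm t" for b unfolding eventually_at_inf_in by blast
  have smallL: "\<forall>\<^sub>F t in at_inf_in ?D. \<forall>k\<in>{..<nat \<bar>n\<bar>}. norm (wz z t) < \<epsilon> k"
    by (intro eventually_ball_finite ballI small em) auto
  have "\<forall>\<^sub>F t in at_inf_in ?D. \<exists>v. mero_value (qcoeff (Phi z s t a) n) \<tau> \<theta> v \<and>
      norm t powr - real (Suc M) < norm v \<and> norm v < norm t powr real (Suc M)"
    \<comment> \<open>Since |w| = C / |t|, powers of |w| differ from powers of |t| by the constant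
      C^M; the threshold lets one extra power of |t| absorb this constant or its inverse, whence the
      exponent M + 1 and strict inequalities.\<close>
    using inD smallL small[OF e0(1)] big[of "C ^ M + inverse (C ^ M) + 1"]
  proof eventually_elim
    case (elim t)
    have t0: "t \<noteq> 0" and u: "?u t \<notin> \<real>\<^sub>\<le>\<^sub>0" using elim(1) slit_plane_iff[OF z s] by auto
    define x where "x = norm (wz z t)"
    have x: "0 < x" using z t0 by (simp add: x_def)
    have L: "pow_bounded x (m k) (Lam s (?u t) (cshift n k) ?p)" if "k < nat \<bar>n\<bar>" for k
      using em(2)[OF u, of k] elim(2) that by (simp add: nu x_def)
    have Lnz: "Lam s (?u t) (cshift n k) ?p \<noteq> 0" if "k < nat \<bar>n\<bar>" for k
      using L[OF that] zero_less_power[OF x, of "m k"] unfolding pow_bounded_def by (metis norm_zero not_less)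
    obtain v where v: "regular_value f (vector [\<tau>, \<theta> + (- wz z t)]) v"
      \<comment> \<open>The coefficient is evaluated at \<theta> - w with w small but nonzero, so
        the bounds hold even if f has a zero or a pole at \<theta>.\<close>
      "norm (- wz z t) ^ k0 \<le> norm v" "norm v \<le> inverse (norm (- wz z t) ^ k0)"
      using spec[OF e0(2), of "- wz z t"] elim(3) x by (auto simp: x_def)
    have "mero_value (abs_mero f) \<tau> (\<theta> + 0 * \<tau> + (- wz z t)) v"
      using v(1) \<tau> by (simp add: mero_value_abs_mero[OF f(2)])
    hence fv: "mero_value (shift 0 (- wz z t) (abs_mero f)) \<tau> \<theta> v" by (rule mero_value_shift)
    have val: "mero_value (qcoeff (Phi z s t a) n) \<tau> \<theta> (v * Cfun s (?u t) n ?p)"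
      unfolding qcoeff_Phi[OF u s] f(1) by (rule mero_value_mult[OF fv cocyc_value(1)[OF u s \<tau> Lnz]])
    have "pow_bounded x (\<Sum>k<nat \<bar>n\<bar>. m k) (Cfun s (?u t) n ?p)"
      unfolding Cfun_def by (intro pow_bounded_prod pow_bounded_powi x L cexp_cases[OF s]) auto
    moreover have "pow_bounded x k0 v" using v(2,3) by (simp add: pow_bounded_def x_def)
    ultimately have pb: "pow_bounded x M (v * Cfun s (?u t) n ?p)"
      unfolding M_def by (intro pow_bounded_mult x)
    define r where "r = norm t"
    have r: "0 < r" using t0 by (simp add: r_def)
    have CM: "0 < C ^ M" using C by simp
    have rb: "C ^ M < r" "inverse (C ^ M) < r"
      using elim(4) CM positive_imp_inverse_positive[OF CM] unfolding r_def by linarith+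
    have xM: "x ^ M = C ^ M / r ^ M" by (simp add: x_def nw r_def power_divide)
    have pw: "norm t powr real (Suc M) = r * r ^ M" "norm t powr - real (Suc M) = inverse (r * r ^ M)"
      unfolding powr_minus using powr_realpow[OF r, of "Suc M"] by (simp_all add: r_def)
    have "inverse (r * r ^ M) < x ^ M"
    proof -
      have "inverse r < C ^ M" using rb(2) CM r by (metis inverse_inverse_eq inverse_less_iff_less positive_imp_inverse_positive)
      hence "inverse r * inverse (r ^ M) < C ^ M * inverse (r ^ M)" using r by (intro mult_strict_right_mono) simp_all
      thus ?thesis by (simp add: xM divide_inverse)
    qed
    moreover have "inverse (x ^ M) < r * r ^ M"
    proof -
      have "inverse (x ^ M) = inverse (C ^ M) * r ^ M" by (simp add: xM divide_inverse)
      also have "\<dots> < r * r ^ M" using rb(2) r by (intro mult_strict_right_mono) simp_all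
      finally show ?thesis .
    qed
    ultimately show ?case using val pb unfolding pw pow_bounded_def
      by (intro exI[of _ "v * Cfun s (?u t) n ?p"] conjI) auto
  qed
  thus "\<exists>k::real. 0 < k \<and> (\<forall>\<^sub>F t in inf at_infinity (principal ?D). \<exists>v. mero_value (qcoeff (Phi z s t a) n) \<tau> \<theta> v \<and>
      norm t powr - k < norm v \<and> norm v < norm t powr k)"
    by (intro exI[of _ "real (Suc M)"] conjI) simp_all
qed

theorem theorem1p5:
  fixes z :: complex
  assumes "z \<noteq> 0"
  shows "(\<forall>s\<in>{1, - 1}. \<forall>t\<in>slit_plane z s. \<exists>!\<psi>. is_Psi z s t \<psi>) \<and>
         solves_qRH z (Phi z)"
proof
  show "\<forall>s\<in>{1, - 1}. \<forall>t\<in>slit_plane z s. \<exists>!\<psi>. is_Psi z s t \<psi>"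
  proof (intro ballI)
    fix s :: int and t assume s: "s \<in> {1, - 1}" and t: "t \<in> slit_plane z s"
    have u: "of_int s * wz z t \<notin> \<real>\<^sub>\<le>\<^sub>0" using t slit_plane_iff[OF assms s] by blast
    show "\<exists>!\<psi>. is_Psi z s t \<psi>" unfolding is_Psi_iff[OF u s] by (rule ex1I) (rule refl, assumption)
  qed
  show "solves_qRH z (Phi z)"
    unfolding solves_qRH_def
    using meromorphic_aut_map_Phi[OF assms] qRH1_Phi[OF assms] qRH2_Phi[OF assms] qRH3_Phi[OF assms] by blast
qed

end
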